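(* Let $\mu$ be a full, strictly operator-stable distribution on $\mathbb{R}^m$ with exponent $B$, and let $M$ be the $\mathbb{R}^m$-valued independently scattered random measure generated by $\mu$ and the Lebesgue measure on $(\mathbb{R}^d,\mathcal{B}(\mathbb{R}^d))$. Let $D\in Q(\mathbb{R}^m)$, $E\in Q(\mathbb{R}^d)$, $q:=\mathrm{trace}(E)$, and let $\phi:\mathbb{R}^d\to[0,\infty)$ be a continuous, $E$-homogeneous and $(\beta,E)$-admissible function for some $\beta>0$ such that $\lambda_{D-qB}+\lambda_{qB}>0$ and $\Lambda_{D-qB}+\Lambda_{qB}<\beta$. Let $\mathbb{X}_{\phi,D}=\{X_{\phi,D}(t):t\in\mathbb{R}^d\}$ be the random field $$X_{\phi,D}(t)=\int_{\mathbb{R}^d}\left[\phi(t-s)^{D-qB}-\phi(-s)^{D-qB}\right]M(ds).$$ Then: (a) If $DB=BD$, then $\mathbb{X}_{\phi,D}$ is $(E,D)$-operator-self-similar and strictly operator-stable with exponent $B$. (b) $\mathbb{X}_{\phi,D}$ is stochastically continuous and has stationary increments. (c) If $D-qB$ is invertible, then $\mathbb{X}_{\phi,D}$ is full.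
   Context: Matrices: $\mathrm{L}(\mathbb{R}^m)$ is the set of real $m\times m$ matrices, $\mathrm{GL}(\mathbb{R}^m)$ the invertible ones; $s^A:=\exp((\ln s)A)$ for $s>0$, and $0^A:=0$ by convention. $A^*$ is the adjoint. $\lambda_A$ and $\Lambda_A$ denote the minimum and maximum of the real parts of the complex eigenvalues of $A$. $Q(\mathbb{R}^m):=\{A\in \mathrm{L}(\mathbb{R}^m):\lambda_A>0\}$. Polar coordinates: for $E\in Q(\mathbb{R}^d)$ fix a norm $\|\cdot\|_E$ on $\mathbb{R}^d$ such that, with $S_E:=\{x:\|x\|_E=1\}$, the map $(0,\infty)\times S_E\to\mathbb{R}^d\setminus\{0\}$, $(s,\theta)\mapsto s^E\theta$ is a homeomorphism (such a norm exists); $\tau_E(x)>0$ and $l_E(x)\in S_E$ are defined by $x=\tau_E(x)^El_E(x)$ for $x\ne0$, and $\tau_E(0):=0$. $E$-homogeneous: $\phi(c^Ex)=c\,\phi(x)$ for all $c>0$, $x\neq0$. $(\beta,E)$-admissible: $\phi:\mathbb{R}^d\to[0,\infty)$ is strictly positive outside the origin and for any $0<a<b$ there is a constant $C>0$ such that for all $z$ with $a\le\|z\|\le b$ (Euclidean norm) and all $x$ with $\tau_E(x)\le1$ one has $|\phi(x+z)-\phi(z)|\le C\,\tau_E(x)^\beta$. Distributions: a probability measure on $\mathbb{R}^m$ is full if it is not concentrated on any hyperplane. A random vector $X$ in $\mathbb{R}^k$ (or its law) is operator-stable if, for i.i.d. copies $X_1,X_2,\dots$ of $X$, there are $A_n\in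 \mathrm{GL}(\mathbb{R}^k)$, $a_n\in\mathbb{R}^k$ with $A_n(X_1+\dots+X_n)+a_n\overset{d}{=}X$ for all $n\in\mathbb{N}$; strictly operator-stable if this is possible with $a_n=0$. It is operator-stable with exponent $B$ if one may take $A_n=n^{-B}$; equivalently, it is infinitely divisible and its log-characteristic function $\psi$ (the unique continuous function with $\psi(0)=0$ and $\hat\mu=e^{\psi}$) satisfies $s\,\psi(u)=\psi(s^{B^*}u)+\mathrm{i}\langle a_s,u\rangle$ for all $s>0$ and all $u$, with vectors $a_s$. A distribution is strictly operator-stable with exponent $B$ if this holds with $a_s=0$ for all $s>0$. Random measure: for a $\sigma$-finite measure space $(S,\Sigma,\Theta)$ (here $S=\mathbb{R}^d$ with Lebesgue measure) let $\mathcal{S}=\{A\in\Sigma:\Theta(A)<\infty\}$. The independently scattered random measure $M$ generated by $\mu$ and $\Theta$ is a family $\{M(A):A\in\mathcal{S}\}$ of $\mathbb{R}^m$-valued random vectors on some probability space such that for pairwise disjoint $A_1,A_2,\dots\in\mathcal{S}$ the $M(A_n)$ are independent, $M(\bigcup_nA_n)=\sum_nM(A_n)$ a.s. if $\bigcup_nA_n\in\mathcal{S}$, and $\mathbb{E}e^{\mathrm{i}\langle M(A),u\rangle}=\exp(\Theta(A)\psi(u))$, $\psi$ the log-characteristic function of $\mu$. Integral: for simple $f=\sum_{j=1}^nR_j\mathbf{1}_{A_j}$ ($R_j\in \mathrm{L}(\mathbb{R}^m)$, $A_j\in\mathcal{S}$ disjoint) put $I_M(f)=\sum_jR_jM(A_j)$.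 A measurable $f:S\to \mathrm{L}(\mathbb{R}^m)$ is integrable w.r.t. $M$ if there are simple $f_n\to f$ $\Theta$-a.e. such that $I_M(f_n\mathbf{1}_A)$ converges in probability for every $A\in\Sigma$; then $\int f\,dM=I_M(f)$ is the limit for $A=S$. Under the stated hypotheses the integrals defining $X_{\phi,D}(t)$ exist. Random fields $\mathbb{X}=\{X(t):t\in\mathbb{R}^d\}$ with values in $\mathbb{R}^m$: $\mathbb{X}$ is $(E,D)$-operator-self-similar if $\{X(r^Et):t\in\mathbb{R}^d\}\overset{fdd}{=}\{r^DX(t):t\in\mathbb{R}^d\}$ for every $r>0$ (equality of all finite-dimensional distributions). $\mathbb{X}$ is (strictly) operator-stable if all its finite-dimensional distributions are (strictly) operator-stable; $B$ is an exponent of $\mathbb{X}$ if every linear combination $\sum_{j=1}^kc_jX(t_j)$ ($k\in\mathbb{N}$, $c_j\in\mathbb{R}$, $t_j\in\mathbb{R}^d$) is operator-stable with exponent $B$. $\mathbb{X}$ is full if the law of $X(t)$ is full for each $t\ne0$. Stationary increments: $\{X(t+h)-X(h):t\in\mathbb{R}^d\}\overset{fdd}{=}\{X(t)-X(0):t\in\mathbb{R}^d\}$ for every $h\in\mathbb{R}^d$. Stochastically continuous: $X(t_n)\to X(t)$ in probability whenever $t_n\to t$. *)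

theory Defs
  imports "HOL-Probability.Probability"
begin

section \<open>Matrices\<close>

text \<open>The class operations \<open>*\<close> and \<open>^\<close> on \<^typ>\<open>real^'n^'n\<close> are componentwise, so powers and
  the exponential are taken with respect to \<open>**\<close>.\<close>

definition mat_exp :: "real^'n^'n \<Rightarrow> real^'n^'n" where
  "mat_exp A = (\<Sum>k. (1 / fact k) *\<^sub>R (((**) A ^^ k) (mat 1)))"

text \<open>\<open>s\<^sup>A = exp ((ln s) A)\<close> for \<open>s > 0\<close>, and \<open>0\<^sup>A = 0\<close>; negative \<open>s\<close> is never used.\<close>

definition mat_powr :: "real \<Rightarrow> real^'n^'n \<Rightarrow> real^'n^'n"  (infixr \<open>powm\<close> 80) where
  "s powm A = (if s > 0 then mat_exp (ln s *\<^sub>R A) else 0)"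

definition complex_eigenvalues :: "real^'n^'n \<Rightarrow> complex set" where
  "complex_eigenvalues A =
     {z. \<exists>v::complex^'n. v \<noteq> 0 \<and> (\<chi> i j. complex_of_real (A $ i $ j)) *v v = z *s v}"

definition min_re_eig :: "real^'n^'n \<Rightarrow> real" where
  "min_re_eig A = Min (Re ` complex_eigenvalues A)"

definition max_re_eig :: "real^'n^'n \<Rightarrow> real" where
  "max_re_eig A = Max (Re ` complex_eigenvalues A)"

definition Q_mat :: "(real^'n^'n) set" where
  "Q_mat = {A. min_re_eig A > 0}"


section \<open>Polar coordinates, homogeneous and admissible functions\<close>

definition is_norm :: "('a::real_vector \<Rightarrow> real) \<Rightarrow> bool" where
  "is_norm N \<longleftrightarrow> (\<forall>x. 0 \<le> N x) \<and> (\<forall>x. N x = 0 \<longleftrightarrow> x = 0) \<and>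
     (\<forall>c x. N (c *\<^sub>R x) = \<bar>c\<bar> * N x) \<and> (\<forall>x y. N (x + y) \<le> N x + N y)"

definition polar_norm :: "real^'d^'d \<Rightarrow> (real^'d \<Rightarrow> real) \<Rightarrow> bool" where
  "polar_norm E N \<longleftrightarrow> is_norm N \<and>
     (\<exists>g. homeomorphism ({0<..} \<times> {\<theta>. N \<theta> = 1}) (UNIV - {0}) (\<lambda>(s, \<theta>). (s powm E) *v \<theta>) g)"

definition polar_radius :: "real^'d^'d \<Rightarrow> (real^'d \<Rightarrow> real) \<Rightarrow> real^'d \<Rightarrow> real" where
  "polar_radius E N x =
     (if x = 0 then 0 else (THE s. s > 0 \<and> (\<exists>\<theta>. N \<theta> = 1 \<and> x = (s powm E) *v \<theta>)))"

definition homogeneous_fun :: "real^'d^'d \<Rightarrow> (real^'d \<Rightarrow> real) \<Rightarrow> bool" where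
  "homogeneous_fun E \<phi> \<longleftrightarrow> (\<forall>c>0. \<forall>x. x \<noteq> 0 \<longrightarrow> \<phi> ((c powm E) *v x) = c * \<phi> x)"

definition admissible_fun :: "real \<Rightarrow> real^'d^'d \<Rightarrow> (real^'d \<Rightarrow> real) \<Rightarrow> (real^'d \<Rightarrow> real) \<Rightarrow> bool" where
  "admissible_fun \<beta> E N \<phi> \<longleftrightarrow> (\<forall>x. 0 \<le> \<phi> x) \<and> (\<forall>x. x \<noteq> 0 \<longrightarrow> 0 < \<phi> x) \<and>
     (\<forall>a b. 0 < a \<and> a < b \<longrightarrow>
       (\<exists>C>0. \<forall>z x. a \<le> norm z \<and> norm z \<le> b \<and> polar_radius E N x \<le> 1 \<longrightarrow>
          \<bar>\<phi> (x + z) - \<phi> z\<bar> \<le> C * polar_radius E N x powr \<beta>))"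


section \<open>Distributions\<close>

definition full_distribution :: "'a::euclidean_space measure \<Rightarrow> bool" where
  "full_distribution \<mu> \<longleftrightarrow> (\<forall>a c. a \<noteq> 0 \<longrightarrow> \<not> (AE x in \<mu>. a \<bullet> x = c))"

definition char_fun :: "'a::euclidean_space measure \<Rightarrow> 'a \<Rightarrow> complex" where
  "char_fun \<mu> u = (\<integral>x. iexp (x \<bullet> u) \<partial>\<mu>)"

definition log_char :: "'a::euclidean_space measure \<Rightarrow> 'a \<Rightarrow> complex" where
  "log_char \<mu> = (THE \<psi>. continuous_on UNIV \<psi> \<and> \<psi> 0 = 0 \<and> (\<forall>u. char_fun \<mu> u = exp (\<psi> u)))"

text \<open>The i.i.d. copies are realised as the coordinates of the product space.\<close>

definition iid_sum_law :: "nat \<Rightarrow> 'a::euclidean_space measure \<Rightarrow> 'a measure" where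
  "iid_sum_law n \<nu> = distr (Pi\<^sub>M {..<n} (\<lambda>_. \<nu>)) borel (\<lambda>x. \<Sum>k<n. x k)"

definition infinitely_divisible :: "'a::euclidean_space measure \<Rightarrow> bool" where
  "infinitely_divisible \<mu> \<longleftrightarrow>
     (\<forall>n>0. \<exists>\<nu>. prob_space \<nu> \<and> sets \<nu> = sets borel \<and> iid_sum_law n \<nu> = \<mu>)"

definition operator_stable_exp :: "(real^'m) measure \<Rightarrow> real^'m^'m \<Rightarrow> bool" where
  "operator_stable_exp \<mu> B \<longleftrightarrow> prob_space \<mu> \<and> sets \<mu> = sets borel \<and> infinitely_divisible \<mu> \<and>
     (\<exists>a :: real \<Rightarrow> real^'m. \<forall>s>0. \<forall>u. complex_of_real s * log_char \<mu> u =
        log_char \<mu> ((s powm transpose B) *v u) + \<i> * complex_of_real (a s \<bullet> u))"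

definition strictly_operator_stable_exp :: "(real^'m) measure \<Rightarrow> real^'m^'m \<Rightarrow> bool" where
  "strictly_operator_stable_exp \<mu> B \<longleftrightarrow> prob_space \<mu> \<and> sets \<mu> = sets borel \<and> infinitely_divisible \<mu> \<and>
     (\<forall>s>0. \<forall>u. complex_of_real s * log_char \<mu> u = log_char \<mu> ((s powm transpose B) *v u))"

text \<open>Finite-dimensional distributions live on \<open>\<real>\<^sup>k\<close> with varying \<open>k\<close>. For these, \<open>\<real>\<^sup>k\<close> is the space
  \<open>I \<rightarrow>\<^sub>E UNIV\<close> of real functions on a finite index set \<open>I\<close> of cardinality \<open>k\<close>, and matrices
  are indexed by \<open>I\<close>.\<close>

definition mat_vec_on :: "'i set \<Rightarrow> ('i \<Rightarrow> 'i \<Rightarrow> real) \<Rightarrow> ('i \<Rightarrow> real) \<Rightarrow> 'i \<Rightarrow> real" where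
  "mat_vec_on I A x = (\<lambda>i\<in>I. \<Sum>j\<in>I. A i j * x j)"

definition invertible_on :: "'i set \<Rightarrow> ('i \<Rightarrow> 'i \<Rightarrow> real) \<Rightarrow> bool" where
  "invertible_on I A \<longleftrightarrow> bij_betw (mat_vec_on I A) (I \<rightarrow>\<^sub>E UNIV) (I \<rightarrow>\<^sub>E UNIV)"

definition strictly_operator_stable_on :: "'i set \<Rightarrow> ('i \<Rightarrow> real) measure \<Rightarrow> bool" where
  "strictly_operator_stable_on I \<mu> \<longleftrightarrow>
     prob_space \<mu> \<and> sets \<mu> = sets (Pi\<^sub>M I (\<lambda>_. borel :: real measure)) \<and>
     (\<forall>n::nat. 0 < n \<longrightarrow> (\<exists>A. invertible_on I A \<and>
        distr (Pi\<^sub>M {..<n} (\<lambda>_. \<mu>)) (Pi\<^sub>M I (\<lambda>_. borel))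
          (\<lambda>x. mat_vec_on I A (\<lambda>i. \<Sum>k<n. x k i)) = \<mu>))"


section \<open>Random measures and stochastic integrals\<close>

definition finite_measure_sets :: "'s measure \<Rightarrow> 's set set" where
  "finite_measure_sets \<Theta> = {A \<in> sets \<Theta>. emeasure \<Theta> A < \<infinity>}"

definition indep_scattered_random_measure ::
    "'w measure \<Rightarrow> (real^'m) measure \<Rightarrow> 's measure \<Rightarrow> ('s set \<Rightarrow> 'w \<Rightarrow> real^'m) \<Rightarrow> bool" where
  "indep_scattered_random_measure P \<mu> \<Theta> M \<longleftrightarrow>
     prob_space P \<and>
     (\<forall>A \<in> finite_measure_sets \<Theta>. M A \<in> borel_measurable P) \<and>
     (\<forall>A :: nat \<Rightarrow> 's set. range A \<subseteq> finite_measure_sets \<Theta> \<and> disjoint_family A \<longrightarrow>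
        prob_space.indep_vars P (\<lambda>_. borel) (\<lambda>n. M (A n)) UNIV \<and>
        ((\<Union>n. A n) \<in> finite_measure_sets \<Theta> \<longrightarrow>
           (AE \<omega> in P. (\<lambda>n. M (A n) \<omega>) sums M (\<Union>n. A n) \<omega>))) \<and>
     (\<forall>A \<in> finite_measure_sets \<Theta>. \<forall>u.
        char_fun (distr P borel (M A)) u = exp (complex_of_real (measure \<Theta> A) * log_char \<mu> u))"

definition conv_in_prob :: "'w measure \<Rightarrow> (nat \<Rightarrow> 'w \<Rightarrow> 'a::metric_space) \<Rightarrow> ('w \<Rightarrow> 'a) \<Rightarrow> bool" where
  "conv_in_prob P Y Z \<longleftrightarrow>
     (\<forall>\<epsilon>>0. (\<lambda>n. measure P {\<omega> \<in> space P. dist (Y n \<omega>) (Z \<omega>) > \<epsilon>}) \<longlonglongrightarrow> 0)"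

text \<open>A simple function \<open>f = \<Sum>j<n. R\<^sub>j 1\<^bsub>A\<^sub>j\<^esub>\<close> is represented by its data \<open>n, R, A\<close>; note that
  \<open>f 1\<^sub>C\<close> is then represented by \<open>n, R, (\<lambda>j. A j \<inter> C)\<close>.\<close>

definition simple_data :: "'s measure \<Rightarrow> nat \<Rightarrow> (nat \<Rightarrow> 's set) \<Rightarrow> bool" where
  "simple_data \<Theta> n A \<longleftrightarrow> (\<forall>j<n. A j \<in> finite_measure_sets \<Theta>) \<and> disjoint_family_on A {..<n}"

definition simple_mat_fun :: "nat \<Rightarrow> (nat \<Rightarrow> real^'m^'m) \<Rightarrow> (nat \<Rightarrow> 's set) \<Rightarrow> 's \<Rightarrow> real^'m^'m" where
  "simple_mat_fun n R A s = (\<Sum>j<n. indicat_real (A j) s *\<^sub>R R j)"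

definition simple_stoch_integral ::
    "('s set \<Rightarrow> 'w \<Rightarrow> real^'m) \<Rightarrow> nat \<Rightarrow> (nat \<Rightarrow> real^'m^'m) \<Rightarrow> (nat \<Rightarrow> 's set) \<Rightarrow> 'w \<Rightarrow> real^'m" where
  "simple_stoch_integral M n R A \<omega> = (\<Sum>j<n. R j *v M (A j) \<omega>)"

definition has_stoch_integral ::
    "'w measure \<Rightarrow> 's measure \<Rightarrow> ('s set \<Rightarrow> 'w \<Rightarrow> real^'m) \<Rightarrow> ('s \<Rightarrow> real^'m^'m) \<Rightarrow> ('w \<Rightarrow> real^'m) \<Rightarrow> bool" where
  "has_stoch_integral P \<Theta> M f Y \<longleftrightarrow>
     f \<in> borel_measurable \<Theta> \<and> Y \<in> borel_measurable P \<and>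
     (\<exists>n R A. (\<forall>k. simple_data \<Theta> (n k) (A k)) \<and>
        (AE s in \<Theta>. (\<lambda>k. simple_mat_fun (n k) (R k) (A k) s) \<longlonglongrightarrow> f s) \<and>
        (\<forall>C \<in> sets \<Theta>. \<exists>Z \<in> borel_measurable P.
           conv_in_prob P (\<lambda>k. simple_stoch_integral M (n k) (R k) (\<lambda>j. A k j \<inter> C)) Z) \<and>
        conv_in_prob P (\<lambda>k. simple_stoch_integral M (n k) (R k) (A k)) Y)"

text \<open>The integral is determined only up to almost sure equality; this picks one version.\<close>

definition stoch_integral ::
    "'w measure \<Rightarrow> 's measure \<Rightarrow> ('s set \<Rightarrow> 'w \<Rightarrow> real^'m) \<Rightarrow> ('s \<Rightarrow> real^'m^'m) \<Rightarrow> 'w \<Rightarrow> real^'m" where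
  "stoch_integral P \<Theta> M f = (SOME Y. has_stoch_integral P \<Theta> M f Y)"


section \<open>Random fields\<close>

definition fdd_eq ::
    "'w measure \<Rightarrow> ('t \<Rightarrow> 'w \<Rightarrow> 'a::euclidean_space) \<Rightarrow> ('t \<Rightarrow> 'w \<Rightarrow> 'a) \<Rightarrow> bool" where
  "fdd_eq P X Y \<longleftrightarrow> (\<forall>J. finite J \<longrightarrow>
     distr P (Pi\<^sub>M J (\<lambda>_. borel)) (\<lambda>\<omega>. \<lambda>t\<in>J. X t \<omega>) =
     distr P (Pi\<^sub>M J (\<lambda>_. borel)) (\<lambda>\<omega>. \<lambda>t\<in>J. Y t \<omega>))"

definition operator_self_similar ::
    "'w measure \<Rightarrow> real^'d^'d \<Rightarrow> real^'m^'m \<Rightarrow> (real^'d \<Rightarrow> 'w \<Rightarrow> real^'m) \<Rightarrow> bool" where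
  "operator_self_similar P E D X \<longleftrightarrow>
     (\<forall>r>0. fdd_eq P (\<lambda>t. X ((r powm E) *v t)) (\<lambda>t \<omega>. (r powm D) *v X t \<omega>))"

definition strictly_operator_stable_field :: "'w measure \<Rightarrow> ('t \<Rightarrow> 'w \<Rightarrow> real^'m) \<Rightarrow> bool" where
  "strictly_operator_stable_field P X \<longleftrightarrow>
     (\<forall>n>0. \<forall>t :: nat \<Rightarrow> 't.
        strictly_operator_stable_on ({..<n} \<times> UNIV)
          (distr P (Pi\<^sub>M ({..<n} \<times> UNIV) (\<lambda>_. borel))
            (\<lambda>\<omega>. \<lambda>p \<in> {..<n} \<times> UNIV. X (t (fst p)) \<omega> $ snd p)))"

definition field_exponent :: "'w measure \<Rightarrow> ('t \<Rightarrow> 'w \<Rightarrow> real^'m) \<Rightarrow> real^'m^'m \<Rightarrow> bool" where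
  "field_exponent P X B \<longleftrightarrow>
     (\<forall>k (c :: nat \<Rightarrow> real) (t :: nat \<Rightarrow> 't).
        operator_stable_exp (distr P borel (\<lambda>\<omega>. \<Sum>j<k. c j *\<^sub>R X (t j) \<omega>)) B)"

definition full_field :: "'w measure \<Rightarrow> (real^'d \<Rightarrow> 'w \<Rightarrow> real^'m) \<Rightarrow> bool" where
  "full_field P X \<longleftrightarrow> (\<forall>t. t \<noteq> 0 \<longrightarrow> full_distribution (distr P borel (X t)))"

definition stationary_increments :: "'w measure \<Rightarrow> (real^'d \<Rightarrow> 'w \<Rightarrow> real^'m) \<Rightarrow> bool" where
  "stationary_increments P X \<longleftrightarrow>
     (\<forall>h. fdd_eq P (\<lambda>t \<omega>. X (t + h) \<omega> - X h \<omega>) (\<lambda>t \<omega>. X t \<omega> - X 0 \<omega>))"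

definition stochastically_continuous :: "'w measure \<Rightarrow> (real^'d \<Rightarrow> 'w \<Rightarrow> real^'m) \<Rightarrow> bool" where
  "stochastically_continuous P X \<longleftrightarrow>
     (\<forall>t T. T \<longlonglongrightarrow> t \<longrightarrow> conv_in_prob P (\<lambda>n. X (T n)) (X t))"

end

theory Submission imports Defs "HOL-Computational_Algebra.Fundamental_Theorem_Algebra" begin

text \<open>Write \<open>k t s = \<phi>(t - s)\<^sup>A - \<phi>(- s)\<^sup>A\<close> with \<open>A = D - qB\<close>. The integrals of \<open>k t\<close> have joint
  characteristic function \<open>exp (\<integral>s. \<psi> (\<Sum>j. (k (t\<^sub>j) s)\<^sup>* u\<^sub>j))\<close>, and each part of the theorem is read off
  from this formula: self-similarity and the exponent from the scaling of \<open>\<psi>\<close> and the substitution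
  \<open>s \<mapsto> r\<^sup>E s\<close>, which has Jacobian \<open>r\<^sup>q\<close>; stationarity from translation invariance; continuity from
  dominated convergence; fullness because \<open>Re \<psi> < 0\<close> away from the origin.

  Scaling bounds \<open>\<psi>\<close> by \<open>\<bar>v\<bar>\<^sup>a + \<bar>v\<bar>\<^sup>b\<close> with \<open>q/a\<close> above and \<open>q/b\<close> below the real parts of the
  eigenvalues of \<open>qB\<close>, and the two spectral hypotheses make \<open>\<bar>k t\<bar>\<^sup>a\<close> and \<open>\<bar>k t\<bar>\<^sup>b\<close> integrable: the first
  one near the singularities, the second one, by admissibility, at infinity. The stochastic integral
  is only specified through some approximating sequence, so its uniqueness must hold without any
  domination; a gliding hump argument supplies it.\<close>

section \<open>Uniqueness of characteristic functions\<close>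

text \<open>Convergence in probability is visible only through characteristic functions, that is,
  through exponentials of integrals, and these do not determine the integrals. For this reason the
  gliding hump argument is carried out for the exponentials themselves.

  The exponents come from two thresholds: \<open>\<phi> powr p\<close> is integrable near the origin
  for \<open>p > - q\<close> and at infinity for \<open>p < - q\<close>. The kernel has size
  \<open>\<phi> powr \<alpha>\<close> near its singularities and, through admissibility,
  \<open>\<phi> powr (\<gamma> - \<beta>)\<close> at infinity. For the power
  \<open>q / \<omega>\<close> of its norm the thresholds read \<open>\<alpha> > - \<omega>\<close>
  and \<open>\<gamma> + \<omega> < \<beta>\<close>, and the strict spectral inequalities leave room
  for both.

  That the spectrum of \<open>q B\<close> lies in the open right half plane is not assumed; it is
  deduced from the scaling and the strict negativity of \<open>Re \<psi>\<close>. That negativity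
  comes from an inequality for \<open>1 - cos\<close> which passes to the limit, in place of a
  Levy-Khintchine representation. Likewise, growth of matrix powers is obtained from annihilating
  products of linear factors, in place of a Jordan form.\<close>

lemma finite_measure_eqI_char:
  fixes \<mu> \<nu> :: "real measure"
  assumes "finite_measure \<mu>" "finite_measure \<nu>" "sets \<mu> = sets borel" "sets \<nu> = sets borel"
    and ch: "\<And>t. (\<integral>x. iexp (t * x) \<partial>\<mu>) = (\<integral>x. iexp (t * x) \<partial>\<nu>)"
  shows "\<mu> = \<nu>"
proof -
  interpret m: finite_measure \<mu> by fact
  interpret n: finite_measure \<nu> by fact
  note [measurable_cong] = assms(3,4)
  have sp: "space \<mu> = UNIV" "space \<nu> = UNIV" using assms(3,4) by (metis sets_eq_imp_space_eq space_borel)+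
  define c where "c = measure \<mu> UNIV"
  have cn: "c = measure \<nu> UNIV" using ch[of 0] by (simp add: sp c_def)
  show ?thesis
  proof (cases "c = 0")
    case True
    have "emeasure \<mu> A = 0" "emeasure \<nu> A = 0" for A
      using True cn emeasure_space[of \<mu> A] emeasure_space[of \<nu> A]
      by (simp_all add: c_def m.emeasure_eq_measure n.emeasure_eq_measure sp)
    then show ?thesis using assms(3,4) by (intro measure_eqI) auto
  next
    case False
    then have c: "c > 0" by (simp add: c_def order_less_le)
    define \<mu>' where "\<mu>' = density \<mu> (\<lambda>_. ennreal (1 / c))"
    define \<nu>' where "\<nu>' = density \<nu> (\<lambda>_. ennreal (1 / c))"
    have em: "emeasure \<mu>' A = ennreal (1 / c) * emeasure \<mu> A" if "A \<in> sets borel" for A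
      using that assms(3) by (simp add: \<mu>'_def emeasure_density_const)
    have en: "emeasure \<nu>' A = ennreal (1 / c) * emeasure \<nu> A" if "A \<in> sets borel" for A
      using that assms(4) by (simp add: \<nu>'_def emeasure_density_const)
    have "real_distribution \<mu>'"
      unfolding real_distribution_def real_distribution_axioms_def
    proof (intro conjI prob_spaceI)
      show "emeasure \<mu>' (space \<mu>') = 1"
        using em[of UNIV] c by (simp add: \<mu>'_def sp m.emeasure_eq_measure c_def[symmetric] ennreal_mult'[symmetric])
    qed (auto simp: \<mu>'_def assms(3))
    moreover have "real_distribution \<nu>'"
      unfolding real_distribution_def real_distribution_axioms_def
    proof (intro conjI prob_spaceI)
      show "emeasure \<nu>' (space \<nu>') = 1"
        using en[of UNIV] c by (simp add: \<nu>'_def sp n.emeasure_eq_measure cn[symmetric] ennreal_mult'[symmetric])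
    qed (auto simp: \<nu>'_def assms(4))
    moreover have "char \<mu>' = char \<nu>'"
      unfolding char_def \<mu>'_def \<nu>'_def using c ch
      by (intro ext) (subst integral_density; auto simp: integral_density)
    ultimately have eq: "\<mu>' = \<nu>'" by (rule Levy_uniqueness)
    show ?thesis
    proof (rule measure_eqI)
      fix A assume "A \<in> sets \<mu>"
      then have "ennreal (1 / c) * emeasure \<mu> A = ennreal (1 / c) * emeasure \<nu> A"
        using em[of A] en[of A] eq assms(3) by simp
      then have "ennreal c * (ennreal (1 / c) * emeasure \<mu> A) = ennreal c * (ennreal (1 / c) * emeasure \<nu> A)" by simp
      moreover have "ennreal c * ennreal (1 / c) = 1" using c by (simp add: ennreal_mult'[symmetric])
      ultimately show "emeasure \<mu> A = emeasure \<nu> A" by (simp add: mult.assoc[symmetric])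
    qed (simp add: assms)
  qed
qed

text \<open>The images of the weighted measures under \<open>Z\<close> and \<open>W\<close> are
  finite measures on the line, which is why the preceding uniqueness statement is not confined to
  probability measures. The weights will carry the coordinates already treated in the induction
  below.\<close>

lemma weighted_char_unique:
  fixes Z :: "'w \<Rightarrow> real" and W :: "'v \<Rightarrow> real"
  assumes "prob_space P" "prob_space Q"
    and [measurable]: "f \<in> borel_measurable P" "g \<in> borel_measurable Q" "Z \<in> borel_measurable P" "W \<in> borel_measurable Q"
    and f: "\<And>x. 0 \<le> f x" "\<And>x. f x \<le> c" and g: "\<And>x. 0 \<le> g x" "\<And>x. g x \<le> c"
    and ch: "\<And>t. (\<integral>x. f x *\<^sub>R iexp (t * Z x) \<partial>P) = (\<integral>x. g x *\<^sub>R iexp (t * W x) \<partial>Q)"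
    and [measurable]: "A \<in> sets borel"
  shows "(\<integral>x. f x * indicator A (Z x) \<partial>P) = (\<integral>x. g x * indicator A (W x) \<partial>Q)"
proof -
  interpret P: prob_space P by fact
  interpret Q: prob_space Q by fact
  define \<mu> where "\<mu> = distr (density P (\<lambda>x. ennreal (f x))) borel Z"
  define \<nu> where "\<nu> = distr (density Q (\<lambda>x. ennreal (g x))) borel W"
  have intf: "integrable P f" using f by (intro P.integrable_const_bound[of _ c]) auto
  have intg: "integrable Q g" using g by (intro Q.integrable_const_bound[of _ c]) auto
  have m: "measure \<mu> A = (\<integral>x. f x * indicator A (Z x) \<partial>P)" if [measurable]: "A \<in> sets borel" for A
  proof -
    have "emeasure \<mu> A = (\<integral>\<^sup>+x. ennreal (f x * indicator A (Z x)) \<partial>P)"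
      unfolding \<mu>_def by (simp add: emeasure_distr emeasure_density ennreal_mult f, intro nn_integral_cong) (auto split: split_indicator)
    also have "\<dots> = ennreal (\<integral>x. f x * indicator A (Z x) \<partial>P)"
      using f by (intro nn_integral_eq_integral P.integrable_const_bound[of _ "\<bar>c\<bar>"]) (auto split: split_indicator intro: order_trans[OF _ abs_ge_self])
    finally show ?thesis using f by (simp add: measure_def integral_nonneg_AE)
  qed
  have n: "measure \<nu> A = (\<integral>x. g x * indicator A (W x) \<partial>Q)" if [measurable]: "A \<in> sets borel" for A
  proof -
    have "emeasure \<nu> A = (\<integral>\<^sup>+x. ennreal (g x * indicator A (W x)) \<partial>Q)"
      unfolding \<nu>_def by (simp add: emeasure_distr emeasure_density ennreal_mult g, intro nn_integral_cong) (auto split: split_indicator)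
    also have "\<dots> = ennreal (\<integral>x. g x * indicator A (W x) \<partial>Q)"
      using g by (intro nn_integral_eq_integral Q.integrable_const_bound[of _ "\<bar>c\<bar>"]) (auto split: split_indicator intro: order_trans[OF _ abs_ge_self])
    finally show ?thesis using g by (simp add: measure_def integral_nonneg_AE)
  qed
  have "\<mu> = \<nu>"
  proof (rule finite_measure_eqI_char)
    have "(\<integral>\<^sup>+x. ennreal (f x) \<partial>P) < \<infinity>" using intf f by (simp add: nn_integral_eq_integral)
    then show "finite_measure \<mu>" unfolding \<mu>_def
      by (intro finite_measure.finite_measure_distr finite_measureI) (auto simp: emeasure_density cong: nn_integral_cong)
    have "(\<integral>\<^sup>+x. ennreal (g x) \<partial>Q) < \<infinity>" using intg g by (simp add: nn_integral_eq_integral)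
    then show "finite_measure \<nu>" unfolding \<nu>_def
      by (intro finite_measure.finite_measure_distr finite_measureI) (auto simp: emeasure_density cong: nn_integral_cong)
    show "(\<integral>x. iexp (t * x) \<partial>\<mu>) = (\<integral>x. iexp (t * x) \<partial>\<nu>)" for t
      unfolding \<mu>_def \<nu>_def using ch[of t] f g by (simp add: integral_distr integral_density)
  qed (auto simp: \<mu>_def \<nu>_def)
  then show ?thesis using m[of A] n[of A] by simp
qed

lemma integral_iexp_combination:
  fixes f :: "'w \<Rightarrow> real"
  assumes "prob_space P" and [measurable]: "f \<in> borel_measurable P" "h1 \<in> borel_measurable P"
      "h2 \<in> borel_measurable P" "h3 \<in> borel_measurable P"
    and f: "\<And>x. 0 \<le> f x" "\<And>x. f x \<le> 1"
  shows "(\<integral>x. f x *\<^sub>R (c1 * iexp (h1 x)) + f x *\<^sub>R (c2 * iexp (h2 x)) + f x *\<^sub>R (c3 * iexp (h3 x)) \<partial>P)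
    = c1 * (\<integral>x. f x *\<^sub>R iexp (h1 x) \<partial>P) + c2 * (\<integral>x. f x *\<^sub>R iexp (h2 x) \<partial>P) + c3 * (\<integral>x. f x *\<^sub>R iexp (h3 x) \<partial>P)"
proof -
  interpret prob_space P by fact
  have int: "integrable P (\<lambda>x. f x *\<^sub>R (c * iexp (h x)))" if [measurable]: "h \<in> borel_measurable P" for h c
    by (intro integrable_const_bound[of _ "cmod c"]) (use f in \<open>auto simp: norm_mult mult_left_le_one_le\<close>)
  have mul: "(\<integral>x. f x *\<^sub>R (c * iexp (h x)) \<partial>P) = c * (\<integral>x. f x *\<^sub>R iexp (h x) \<partial>P)" for h c
    by (subst integral_mult_right_zero[symmetric]) simp
  show ?thesis by (simp add: int mul del: mult_scaleR_right)
qed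

text \<open>Uniqueness in several dimensions is reached one coordinate at a time. The coordinates in
  \<open>K\<close> have been exchanged from exponentials to indicators; each step applies
  one-dimensional uniqueness to one more coordinate, with everything else absorbed into the
  weight.\<close>

lemma indicator_char_unique:
  fixes X :: "'i \<Rightarrow> 'w \<Rightarrow> real" and Y :: "'i \<Rightarrow> 'v \<Rightarrow> real"
  assumes P: "prob_space P" and Q: "prob_space Q" and J: "finite J" "K \<subseteq> J"
    and X: "\<And>i. i \<in> J \<Longrightarrow> X i \<in> borel_measurable P" and Y: "\<And>i. i \<in> J \<Longrightarrow> Y i \<in> borel_measurable Q"
    and ch: "\<And>u. (\<integral>x. iexp (\<Sum>i\<in>J. u i * X i x) \<partial>P) = (\<integral>x. iexp (\<Sum>i\<in>J. u i * Y i x) \<partial>Q)"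
    and A: "\<And>i. i \<in> K \<Longrightarrow> A i \<in> sets borel"
  shows "(\<integral>x. (\<Prod>i\<in>K. indicat_real (A i) (X i x)) *\<^sub>R iexp (\<Sum>i\<in>J - K. u i * X i x) \<partial>P)
       = (\<integral>x. (\<Prod>i\<in>K. indicat_real (A i) (Y i x)) *\<^sub>R iexp (\<Sum>i\<in>J - K. u i * Y i x) \<partial>Q)"
proof -
  interpret P: prob_space P by fact
  interpret Q: prob_space Q by fact
  have "finite K" using J finite_subset by blast
  then show ?thesis using \<open>K \<subseteq> J\<close> A
  proof (induction K arbitrary: u rule: finite_induct)
    case empty
    then show ?case using ch[of u] by simp
  next
    case (insert k K)
    have kJ: "k \<in> J" "K \<subseteq> J" "k \<notin> K" using insert by auto
    have A: "A i \<in> sets borel" if "i \<in> insert k K" for i using insert.prems(2) that by blast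
    define f where "f x = (\<Prod>i\<in>K. indicat_real (A i) (X i x))" for x
    define g where "g x = (\<Prod>i\<in>K. indicat_real (A i) (Y i x))" for x
    define \<theta> where "\<theta> x = (\<Sum>i\<in>J - insert k K. u i * X i x)" for x
    define \<eta> where "\<eta> x = (\<Sum>i\<in>J - insert k K. u i * Y i x)" for x
    have [measurable]: "X i \<in> borel_measurable P" "Y i \<in> borel_measurable Q" "A i \<in> sets borel" if "i \<in> K" for i
      using X Y A kJ that by auto
    have [measurable]: "X i \<in> borel_measurable P" "Y i \<in> borel_measurable Q" if "i \<in> J - insert k K" for i
      using X Y that by auto
    have [measurable]: "X k \<in> borel_measurable P" "Y k \<in> borel_measurable Q" "A k \<in> sets borel" using X Y A kJ by auto
    have [measurable]: "f \<in> borel_measurable P" "g \<in> borel_measurable Q" unfolding f_def g_def by measurable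
    have [measurable]: "\<theta> \<in> borel_measurable P" "\<eta> \<in> borel_measurable Q" unfolding \<theta>_def \<eta>_def by measurable
    have f01: "0 \<le> f x" "f x \<le> 1" and g01: "0 \<le> g y" "g y \<le> 1" for x y
      unfolding f_def g_def by (auto intro!: prod_nonneg prod_le_1)
    have premsP: "prob_space P" "f \<in> borel_measurable P" "\<And>x. 0 \<le> f x" "\<And>x. f x \<le> 1"
        "(\<lambda>x. t * X k x + s * \<theta> x) \<in> borel_measurable P" "(\<lambda>x. t * X k x) \<in> borel_measurable P" for s t
      using P f01 by auto
    have premsQ: "prob_space Q" "g \<in> borel_measurable Q" "\<And>x. 0 \<le> g x" "\<And>x. g x \<le> 1"
        "(\<lambda>x. t * Y k x + s * \<eta> x) \<in> borel_measurable Q" "(\<lambda>x. t * Y k x) \<in> borel_measurable Q" for s t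
      using Q g01 by auto
    have IH: "(\<integral>x. f x *\<^sub>R iexp (t * X k x + s * \<theta> x) \<partial>P) = (\<integral>x. g x *\<^sub>R iexp (t * Y k x + s * \<eta> x) \<partial>Q)" for s t
    proof -
      have JK: "J - K = insert k (J - insert k K)" using kJ by auto
      have sX: "(\<Sum>i\<in>J - K. (if i = k then t else s * u i) * Z i) = t * Z k + s * (\<Sum>i\<in>J - insert k K. u i * Z i)" for Z
        unfolding JK using J(1) by (subst sum.insert) (auto simp: sum_distrib_left mult.assoc intro!: sum.cong)
      show ?thesis
        using insert.IH[of "\<lambda>i. if i = k then t else s * u i"] kJ A by (simp add: sX f_def g_def \<theta>_def \<eta>_def)
    qed
    \<comment> \<open>Resolves the real weight into exponentials, so that the induction hypothesis
      with \<open>s\<close> equal to 0, 1 and -1 evaluates it.\<close>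
    have w_eq: "complex_of_real (1 + Re (c * iexp r)) * iexp s = 1 * iexp s + c / 2 * iexp (s + 1 * r) + cnj c / 2 * iexp (s + (-1) * r)" for c r s
    proof -
      have "complex_of_real (Re z) = (z + cnj z) / 2" for z by (simp add: complex_add_cnj)
      from this[of "c * iexp r"] have d: "complex_of_real (Re (c * iexp r)) = (c * iexp r + cnj c * iexp (- r)) / 2"
      proof -
        have "cnj (c * iexp r) = cnj c * iexp (- r)" by (simp add: exp_cnj)
        with \<open>complex_of_real (Re (c * iexp r)) = _\<close> show ?thesis by (simp only:)
      qed
      show ?thesis unfolding of_real_add d
        by (simp add: exp_add exp_diff exp_minus field_simps)
    qed
    \<comment> \<open>A weight has to be nonnegative, whereas the remaining factor
      \<open>iexp (\<theta> x)\<close> is complex. Its rotated real part plus 1 lies between 0 and 2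
      as long as \<open>cmod c \<le> 1\<close>.\<close>
    have step: "(\<integral>x. f x * (1 + Re (c * iexp (\<theta> x))) * indicator (A k) (X k x) \<partial>P)
        = (\<integral>x. g x * (1 + Re (c * iexp (\<eta> x))) * indicator (A k) (Y k x) \<partial>Q)" if c: "cmod c \<le> 1" for c
    proof (rule weighted_char_unique[OF P Q, where c=2])
      have b: "-1 \<le> Re (c * iexp r)" "Re (c * iexp r) \<le> 1" for r
        using abs_Re_le_cmod[of "c * iexp r"] c by (auto simp: norm_mult)
      show "0 \<le> f x * (1 + Re (c * iexp (\<theta> x)))" "0 \<le> g y * (1 + Re (c * iexp (\<eta> y)))" for x y
        using f01 g01 b[of "\<theta> x"] b[of "\<eta> y"] by (auto intro!: mult_nonneg_nonneg simp del: times_complex.sel)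
      show "f x * (1 + Re (c * iexp (\<theta> x))) \<le> 2" "g y * (1 + Re (c * iexp (\<eta> y))) \<le> 2" for x y
        using f01[of x] g01[of y] b[of "\<theta> x"] b[of "\<eta> y"]
          mult_mono[of "f x" 1 "1 + Re (c * iexp (\<theta> x))" 2] mult_mono[of "g y" 1 "1 + Re (c * iexp (\<eta> y))" 2]
        by (auto simp del: times_complex.sel)
      show "(\<integral>x. (f x * (1 + Re (c * iexp (\<theta> x)))) *\<^sub>R iexp (t * X k x) \<partial>P)
          = (\<integral>x. (g x * (1 + Re (c * iexp (\<eta> x)))) *\<^sub>R iexp (t * Y k x) \<partial>Q)" for t
      proof -
        have "(\<integral>x. (f x * (1 + Re (c * iexp (\<theta> x)))) *\<^sub>R iexp (t * X k x) \<partial>P)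
            = (\<integral>x. f x *\<^sub>R (1 * iexp (t * X k x)) + f x *\<^sub>R (c / 2 * iexp (t * X k x + 1 * \<theta> x))
               + f x *\<^sub>R (cnj c / 2 * iexp (t * X k x + (-1) * \<theta> x)) \<partial>P)"
          by (intro Bochner_Integration.integral_cong refl)
            (simp only: scaleR_scaleR[symmetric] scaleR_conv_of_real[where r="1 + Re z" for z] w_eq scaleR_right_distrib)
        also have "\<dots> = (\<integral>x. f x *\<^sub>R iexp (t * X k x + 0 * \<theta> x) \<partial>P) + c / 2 * (\<integral>x. f x *\<^sub>R iexp (t * X k x + 1 * \<theta> x) \<partial>P)
               + cnj c / 2 * (\<integral>x. f x *\<^sub>R iexp (t * X k x + (-1) * \<theta> x) \<partial>P)"
          by (subst integral_iexp_combination) (use premsP in \<open>auto simp del: mult_1\<close>)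
        also have "\<dots> = (\<integral>x. g x *\<^sub>R iexp (t * Y k x + 0 * \<eta> x) \<partial>Q) + c / 2 * (\<integral>x. g x *\<^sub>R iexp (t * Y k x + 1 * \<eta> x) \<partial>Q)
               + cnj c / 2 * (\<integral>x. g x *\<^sub>R iexp (t * Y k x + (-1) * \<eta> x) \<partial>Q)"
          by (simp only: IH)
        also have "\<dots> = (\<integral>x. g x *\<^sub>R (1 * iexp (t * Y k x)) + g x *\<^sub>R (c / 2 * iexp (t * Y k x + 1 * \<eta> x))
               + g x *\<^sub>R (cnj c / 2 * iexp (t * Y k x + (-1) * \<eta> x)) \<partial>Q)"
          by (subst integral_iexp_combination) (use premsQ in \<open>auto simp del: mult_1\<close>)
        also have "\<dots> = (\<integral>x. (g x * (1 + Re (c * iexp (\<eta> x)))) *\<^sub>R iexp (t * Y k x) \<partial>Q)"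
          by (intro Bochner_Integration.integral_cong refl)
            (simp only: scaleR_scaleR[symmetric] scaleR_conv_of_real[where r="1 + Re z" for z] w_eq scaleR_right_distrib)
        finally show ?thesis .
      qed
    qed measurable
    have iP: "integrable P (\<lambda>x. f x * indicator (A k) (X k x) * h x)" if "h \<in> borel_measurable P" "\<And>x. \<bar>h x\<bar> \<le> 1" for h :: "'w \<Rightarrow> real"
    proof -
      have [measurable]: "h \<in> borel_measurable P" by fact
      show ?thesis using f01 that(2)
        by (intro P.integrable_const_bound[of _ 1]) (auto simp: abs_mult split: split_indicator intro!: mult_le_one)
    qed
    have iQ: "integrable Q (\<lambda>x. g x * indicator (A k) (Y k x) * h x)" if "h \<in> borel_measurable Q" "\<And>x. \<bar>h x\<bar> \<le> 1" for h :: "'v \<Rightarrow> real"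
    proof -
      have [measurable]: "h \<in> borel_measurable Q" by fact
      show ?thesis using g01 that(2)
        by (intro Q.integrable_const_bound[of _ 1]) (auto simp: abs_mult split: split_indicator intro!: mult_le_one)
    qed
    \<comment> \<open>Subtracting the case \<open>c = 0\<close> leaves the real part alone. Below,
      \<open>c = 1\<close> and \<open>c = -\<i>\<close> recover the real and the imaginary part of
      the exponential.\<close>
    have reim: "(\<integral>x. f x * indicator (A k) (X k x) * Re (c * iexp (\<theta> x)) \<partial>P)
        = (\<integral>x. g x * indicator (A k) (Y k x) * Re (c * iexp (\<eta> x)) \<partial>Q)" if c: "cmod c = 1" for c
    proof -
      have b: "\<bar>Re (c * iexp r)\<bar> \<le> 1" for r
        using abs_Re_le_cmod[of "c * iexp r"] c by (auto simp: norm_mult)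
      have "(\<integral>x. f x * indicator (A k) (X k x) * 1 \<partial>P) = (\<integral>x. g x * indicator (A k) (Y k x) * 1 \<partial>Q)"
        using step[of 0] by simp
      moreover have "(\<integral>x. f x * indicator (A k) (X k x) * 1 + f x * indicator (A k) (X k x) * Re (c * iexp (\<theta> x)) \<partial>P)
        = (\<integral>x. g x * indicator (A k) (Y k x) * 1 + g x * indicator (A k) (Y k x) * Re (c * iexp (\<eta> x)) \<partial>Q)"
        using step[of c] c by (simp add: distrib_left mult_ac del: times_complex.sel)
      moreover have "(\<integral>x. f x * indicator (A k) (X k x) * 1 + f x * indicator (A k) (X k x) * Re (c * iexp (\<theta> x)) \<partial>P)
        = (\<integral>x. f x * indicator (A k) (X k x) * 1 \<partial>P) + (\<integral>x. f x * indicator (A k) (X k x) * Re (c * iexp (\<theta> x)) \<partial>P)"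
        by (intro Bochner_Integration.integral_add iP b) auto
      moreover have "(\<integral>x. g x * indicator (A k) (Y k x) * 1 + g x * indicator (A k) (Y k x) * Re (c * iexp (\<eta> x)) \<partial>Q)
        = (\<integral>x. g x * indicator (A k) (Y k x) * 1 \<partial>Q) + (\<integral>x. g x * indicator (A k) (Y k x) * Re (c * iexp (\<eta> x)) \<partial>Q)"
        by (intro Bochner_Integration.integral_add iQ b) auto
      ultimately show ?thesis by linarith
    qed
    have "(\<integral>x. (f x * indicator (A k) (X k x)) *\<^sub>R iexp (\<theta> x) \<partial>P) = (\<integral>x. (g x * indicator (A k) (Y k x)) *\<^sub>R iexp (\<eta> x) \<partial>Q)"
    proof (rule complex_eqI)
      have i1: "integrable P (\<lambda>x. (f x * indicator (A k) (X k x)) *\<^sub>R iexp (\<theta> x))"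
        using f01 by (intro P.integrable_const_bound[of _ 1]) (auto split: split_indicator)
      have i2: "integrable Q (\<lambda>x. (g x * indicator (A k) (Y k x)) *\<^sub>R iexp (\<eta> x))"
        using g01 by (intro Q.integrable_const_bound[of _ 1]) (auto split: split_indicator)
      show "Re (\<integral>x. (f x * indicator (A k) (X k x)) *\<^sub>R iexp (\<theta> x) \<partial>P) = Re (\<integral>x. (g x * indicator (A k) (Y k x)) *\<^sub>R iexp (\<eta> x) \<partial>Q)"
        using reim[of 1] integral_Re[OF i1] integral_Re[OF i2] by simp
      show "Im (\<integral>x. (f x * indicator (A k) (X k x)) *\<^sub>R iexp (\<theta> x) \<partial>P) = Im (\<integral>x. (g x * indicator (A k) (Y k x)) *\<^sub>R iexp (\<eta> x) \<partial>Q)"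
        using reim[of "-\<i>"] integral_Im[OF i1] integral_Im[OF i2] by simp
    qed
    then show ?case
      using insert.hyps by (simp add: f_def g_def \<theta>_def \<eta>_def mult.commute)
  qed
qed

text \<open>For \<open>K = J\<close> no exponential is left and the product of indicators is the
  indicator of a box; boxes determine a finite measure on the product.\<close>

lemma PiM_distr_eqI_char:
  fixes X :: "'i \<Rightarrow> 'w \<Rightarrow> real" and Y :: "'i \<Rightarrow> 'v \<Rightarrow> real"
  assumes P: "prob_space P" and Q: "prob_space Q" and J: "finite J"
    and X: "\<And>i. i \<in> J \<Longrightarrow> X i \<in> borel_measurable P" and Y: "\<And>i. i \<in> J \<Longrightarrow> Y i \<in> borel_measurable Q"
    and ch: "\<And>u. (\<integral>x. iexp (\<Sum>i\<in>J. u i * X i x) \<partial>P) = (\<integral>x. iexp (\<Sum>i\<in>J. u i * Y i x) \<partial>Q)"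
  shows "distr P (Pi\<^sub>M J (\<lambda>_. borel)) (\<lambda>x. \<lambda>i\<in>J. X i x) = distr Q (Pi\<^sub>M J (\<lambda>_. borel)) (\<lambda>x. \<lambda>i\<in>J. Y i x)"
    (is "?L = ?R")
proof -
  interpret P: prob_space P by fact
  interpret Q: prob_space Q by fact
  have mX: "(\<lambda>x. \<lambda>i\<in>J. X i x) \<in> measurable P (Pi\<^sub>M J (\<lambda>_. borel))" using X by (intro measurable_restrict) auto
  have mY: "(\<lambda>x. \<lambda>i\<in>J. Y i x) \<in> measurable Q (Pi\<^sub>M J (\<lambda>_. borel))" using Y by (intro measurable_restrict) auto
  interpret L: prob_space ?L by (rule P.prob_space_distr[OF mX])
  interpret R: prob_space ?R by (rule Q.prob_space_distr[OF mY])
  show ?thesis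
  proof (rule measure_eqI_PiM_finite[OF J])
    fix A assume A: "\<And>i. i \<in> J \<Longrightarrow> A i \<in> sets (borel :: real measure)"
    have box: "Pi\<^sub>E J A \<in> sets (Pi\<^sub>M J (\<lambda>_. borel))" using J A by (intro sets_PiM_I_finite) auto
    have ind: "indicat_real (Pi\<^sub>E J A) (\<lambda>i\<in>J. Z i) = (\<Prod>i\<in>J. indicat_real (A i) (Z i))" for Z
      using J by (auto simp: PiE_iff indicator_def prod_zero_iff)
    have "measure ?L (Pi\<^sub>E J A) = (\<integral>x. indicator (Pi\<^sub>E J A) (\<lambda>i\<in>J. X i x) \<partial>P)"
      using box mX by (subst integral_distr[symmetric, where N="Pi\<^sub>M J (\<lambda>_. borel)"]) auto
    moreover have "measure ?R (Pi\<^sub>E J A) = (\<integral>x. indicator (Pi\<^sub>E J A) (\<lambda>i\<in>J. Y i x) \<partial>Q)"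
      using box mY by (subst integral_distr[symmetric, where N="Pi\<^sub>M J (\<lambda>_. borel)"]) auto
    moreover have "(\<integral>x. (\<Prod>i\<in>J. indicat_real (A i) (X i x)) \<partial>P) = (\<integral>x. (\<Prod>i\<in>J. indicat_real (A i) (Y i x)) \<partial>Q)"
    proof -
      have "(\<integral>x. complex_of_real (\<Prod>i\<in>J. indicat_real (A i) (X i x)) \<partial>P) = (\<integral>x. complex_of_real (\<Prod>i\<in>J. indicat_real (A i) (Y i x)) \<partial>Q)"
        using indicator_char_unique[OF P Q J subset_refl X Y ch A, where u="\<lambda>_. 0"]
        by (simp add: scaleR_conv_of_real del: of_real_prod integral_complex_of_real)
      then show ?thesis unfolding integral_complex_of_real by (simp only: of_real_eq_iff)
    qed
    ultimately show "emeasure ?L (Pi\<^sub>E J A) = emeasure ?R (Pi\<^sub>E J A)"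
      unfolding ind by (simp add: L.emeasure_eq_measure R.emeasure_eq_measure)
  next
    show "range (\<lambda>_. space (Pi\<^sub>M J (\<lambda>_. borel :: real measure))) \<subseteq> prod_algebra J (\<lambda>_. borel)"
      using space_in_prod_algebra[of J "\<lambda>_. borel :: real measure"] by (simp add: space_PiM)
    show "(\<Union>i. space (Pi\<^sub>M J (\<lambda>_. borel :: real measure))) = space (Pi\<^sub>M J (\<lambda>_. borel))" by simp
    show "emeasure ?L (space (Pi\<^sub>M J (\<lambda>_. borel))) \<noteq> \<infinity>" by simp
  qed simp_all
qed

lemma PiM_measure_eqI_char:
  fixes \<mu> \<nu> :: "('i \<Rightarrow> real) measure"
  assumes "prob_space \<mu>" "prob_space \<nu>" "finite J"
    and [measurable_cong]: "sets \<mu> = sets (Pi\<^sub>M J (\<lambda>_. borel))" "sets \<nu> = sets (Pi\<^sub>M J (\<lambda>_. borel))"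
    and ch: "\<And>u. (\<integral>x. iexp (\<Sum>i\<in>J. u i * x i) \<partial>\<mu>) = (\<integral>x. iexp (\<Sum>i\<in>J. u i * x i) \<partial>\<nu>)"
  shows "\<mu> = \<nu>"
proof -
  have "distr \<mu> (Pi\<^sub>M J (\<lambda>_. borel)) (\<lambda>x. \<lambda>i\<in>J. x i) = distr \<nu> (Pi\<^sub>M J (\<lambda>_. borel)) (\<lambda>x. \<lambda>i\<in>J. x i)"
    by (rule PiM_distr_eqI_char) (use assms in measurable)
  moreover have "distr M (Pi\<^sub>M J (\<lambda>_. borel)) (\<lambda>x. \<lambda>i\<in>J. x i) = M" if "sets M = sets (Pi\<^sub>M J (\<lambda>_. borel))" for M :: "('i \<Rightarrow> real) measure"
  proof -
    have "distr M (Pi\<^sub>M J (\<lambda>_. borel)) (\<lambda>x. \<lambda>i\<in>J. x i) = distr M M (\<lambda>x. x)"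
      using sets_eq_imp_space_eq[OF that]
      by (intro distr_cong) (auto simp: that space_PiM PiE_def extensional_restrict)
    then show ?thesis by simp
  qed
  ultimately show ?thesis using assms by metis
qed

text \<open>Vectors are flattened into their coordinates, indexed by
  \<open>J \<times> Basis\<close>, and the measurable map \<open>h\<close> reassembles them
  afterwards.\<close>

lemma fdd_eqI_char:
  fixes X :: "'t \<Rightarrow> 'w \<Rightarrow> 'a::euclidean_space" and Y :: "'t \<Rightarrow> 'v \<Rightarrow> 'a"
  assumes P: "prob_space P" and Q: "prob_space Q" and J: "finite J"
    and X: "\<And>i. i \<in> J \<Longrightarrow> X i \<in> borel_measurable P" and Y: "\<And>i. i \<in> J \<Longrightarrow> Y i \<in> borel_measurable Q"
    and ch: "\<And>u. (\<integral>x. iexp (\<Sum>i\<in>J. X i x \<bullet> u i) \<partial>P) = (\<integral>x. iexp (\<Sum>i\<in>J. Y i x \<bullet> u i) \<partial>Q)"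
  shows "distr P (Pi\<^sub>M J (\<lambda>_. borel)) (\<lambda>x. \<lambda>i\<in>J. X i x) = distr Q (Pi\<^sub>M J (\<lambda>_. borel)) (\<lambda>x. \<lambda>i\<in>J. Y i x)"
proof -
  let ?K = "J \<times> (Basis :: 'a set)"
  define h :: "('t \<times> 'a \<Rightarrow> real) \<Rightarrow> 't \<Rightarrow> 'a" where "h x = (\<lambda>i\<in>J. \<Sum>b\<in>Basis. x (i, b) *\<^sub>R b)" for x
  have sum_u: "(\<Sum>p\<in>?K. u p * (Z (fst p) \<bullet> snd p)) = (\<Sum>i\<in>J. Z i \<bullet> (\<Sum>b\<in>Basis. u (i, b) *\<^sub>R b))" for u and Z :: "'t \<Rightarrow> 'a"
    using sum.cartesian_product[of "\<lambda>i b. u (i, b) * (Z i \<bullet> b)" Basis J]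
    by (simp add: inner_sum_right split_beta)
  have eq: "distr P (Pi\<^sub>M ?K (\<lambda>_. borel)) (\<lambda>x. \<lambda>p\<in>?K. X (fst p) x \<bullet> snd p)
      = distr Q (Pi\<^sub>M ?K (\<lambda>_. borel)) (\<lambda>x. \<lambda>p\<in>?K. Y (fst p) x \<bullet> snd p)"
  proof (rule PiM_distr_eqI_char[OF P Q])
    show "(\<integral>x. iexp (\<Sum>p\<in>?K. u p * (X (fst p) x \<bullet> snd p)) \<partial>P) = (\<integral>x. iexp (\<Sum>p\<in>?K. u p * (Y (fst p) x \<bullet> snd p)) \<partial>Q)" for u
      unfolding sum_u[where Z="\<lambda>i. X i x" for x] sum_u[where Z="\<lambda>i. Y i x" for x] by (rule ch)
  qed (use X Y J in auto)
  have h: "h \<in> measurable (Pi\<^sub>M ?K (\<lambda>_. borel)) (Pi\<^sub>M J (\<lambda>_. borel))"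
    unfolding h_def
    by (intro measurable_restrict borel_measurable_sum borel_measurable_scaleR measurable_component_singleton) auto
  have "(\<lambda>x. \<lambda>p\<in>?K. X (fst p) x \<bullet> snd p) \<in> measurable P (Pi\<^sub>M ?K (\<lambda>_. borel))"
    using X by (intro measurable_restrict) auto
  from distr_distr[OF h this] have 1: "distr (distr P (Pi\<^sub>M ?K (\<lambda>_. borel)) (\<lambda>x. \<lambda>p\<in>?K. X (fst p) x \<bullet> snd p)) (Pi\<^sub>M J (\<lambda>_. borel)) h
      = distr P (Pi\<^sub>M J (\<lambda>_. borel)) (\<lambda>x. \<lambda>i\<in>J. X i x)"
    by (simp add: o_def h_def euclidean_representation cong: restrict_cong)
  have "(\<lambda>x. \<lambda>p\<in>?K. Y (fst p) x \<bullet> snd p) \<in> measurable Q (Pi\<^sub>M ?K (\<lambda>_. borel))"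
    using Y by (intro measurable_restrict) auto
  from distr_distr[OF h this] have 2: "distr (distr Q (Pi\<^sub>M ?K (\<lambda>_. borel)) (\<lambda>x. \<lambda>p\<in>?K. Y (fst p) x \<bullet> snd p)) (Pi\<^sub>M J (\<lambda>_. borel)) h
      = distr Q (Pi\<^sub>M J (\<lambda>_. borel)) (\<lambda>x. \<lambda>i\<in>J. Y i x)"
    by (simp add: o_def h_def euclidean_representation cong: restrict_cong)
  show ?thesis using 1 2 eq by metis
qed

lemma distr_eqI_char:
  fixes X :: "'w \<Rightarrow> 'a::euclidean_space" and Y :: "'v \<Rightarrow> 'a"
  assumes P: "prob_space P" and Q: "prob_space Q"
    and [measurable]: "X \<in> borel_measurable P" "Y \<in> borel_measurable Q"
    and ch: "\<And>u. (\<integral>x. iexp (X x \<bullet> u) \<partial>P) = (\<integral>x. iexp (Y x \<bullet> u) \<partial>Q)"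
  shows "distr P borel X = distr Q borel Y"
proof -
  let ?K = "{()} :: unit set"
  have "distr P (Pi\<^sub>M ?K (\<lambda>_. borel)) (\<lambda>x. \<lambda>i\<in>?K. X x) = distr Q (Pi\<^sub>M ?K (\<lambda>_. borel)) (\<lambda>x. \<lambda>i\<in>?K. Y x)"
    by (rule fdd_eqI_char[OF P Q]) (use ch in auto)
  then have "distr (distr P (Pi\<^sub>M ?K (\<lambda>_. borel)) (\<lambda>x. \<lambda>i\<in>?K. X x)) borel (\<lambda>f. f ()) = distr (distr Q (Pi\<^sub>M ?K (\<lambda>_. borel)) (\<lambda>x. \<lambda>i\<in>?K. Y x)) borel (\<lambda>f. f ())"
    by simp
  then show ?thesis
    by (subst (asm) (1 2) distr_distr) (auto simp: o_def intro!: measurable_component_singleton measurable_restrict)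
qed


section \<open>Convergence in probability\<close>

lemma measurable_dist_gt [measurable]:
  fixes Y Z :: "'w \<Rightarrow> 'a::{second_countable_topology, metric_space}"
  assumes "Y \<in> borel_measurable P" "Z \<in> borel_measurable P"
  shows "{\<omega> \<in> space P. dist (Y \<omega>) (Z \<omega>) > \<epsilon>} \<in> sets P"
  using borel_measurable_dist[OF assms] by measurable

lemma conv_in_prob_dominated:
  fixes Y :: "nat \<Rightarrow> 'w \<Rightarrow> 'a::metric_space" and Y' :: "nat \<Rightarrow> 'w \<Rightarrow> 'b::metric_space"
  assumes "\<And>\<epsilon>. \<epsilon> > 0 \<Longrightarrow> \<exists>r. r \<longlonglongrightarrow> 0 \<and> (\<forall>n. measure P {\<omega> \<in> space P. dist (Y n \<omega>) (Z \<omega>) > \<epsilon>} \<le> r n)"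
  shows "conv_in_prob P Y Z"
  unfolding conv_in_prob_def
proof (intro allI impI)
  fix \<epsilon> :: real assume "\<epsilon> > 0"
  then obtain r where r: "r \<longlonglongrightarrow> 0" "\<And>n. measure P {\<omega> \<in> space P. dist (Y n \<omega>) (Z \<omega>) > \<epsilon>} \<le> r n"
    using assms by blast
  show "(\<lambda>n. measure P {\<omega> \<in> space P. dist (Y n \<omega>) (Z \<omega>) > \<epsilon>}) \<longlonglongrightarrow> 0"
    by (rule tendsto_sandwich[OF _ _ tendsto_const r(1)]) (use r in auto)
qed

lemma conv_in_probD:
  "conv_in_prob P Y Z \<Longrightarrow> \<epsilon> > 0 \<Longrightarrow> (\<lambda>n. measure P {\<omega> \<in> space P. dist (Y n \<omega>) (Z \<omega>) > \<epsilon>}) \<longlonglongrightarrow> 0"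
  by (simp add: conv_in_prob_def)

context prob_space begin

lemma conv_in_prob_lipschitz:
  fixes Y :: "nat \<Rightarrow> 'a \<Rightarrow> 'b::{second_countable_topology, metric_space}" and g :: "'b \<Rightarrow> 'c::metric_space"
  assumes conv: "conv_in_prob M Y Z" and L: "\<And>x y. dist (g x) (g y) \<le> L * dist x y"
    and [measurable]: "\<And>n. Y n \<in> borel_measurable M" "Z \<in> borel_measurable M"
  shows "conv_in_prob M (\<lambda>n \<omega>. g (Y n \<omega>)) (\<lambda>\<omega>. g (Z \<omega>))"
proof (rule conv_in_prob_dominated)
  fix \<epsilon> :: real assume "\<epsilon> > 0"
  define \<delta> where "\<delta> = \<epsilon> / (\<bar>L\<bar> + 1)"
  have \<delta>: "\<delta> > 0" using \<open>\<epsilon> > 0\<close> by (simp add: \<delta>_def)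
  have "dist x y > \<delta>" if "dist (g x) (g y) > \<epsilon>" for x y
  proof -
    have "\<epsilon> < (\<bar>L\<bar> + 1) * dist x y"
    proof -
      have "L * dist x y \<le> (\<bar>L\<bar> + 1) * dist x y" by (rule mult_right_mono) auto
      then show ?thesis using that L[of x y] by linarith
    qed
    then show ?thesis by (simp add: \<delta>_def field_simps)
  qed
  then have "measure M {\<omega> \<in> space M. dist (g (Y n \<omega>)) (g (Z \<omega>)) > \<epsilon>} \<le> measure M {\<omega> \<in> space M. dist (Y n \<omega>) (Z \<omega>) > \<delta>}" for n
    by (intro finite_measure_mono) auto
  then show "\<exists>r. r \<longlonglongrightarrow> 0 \<and> (\<forall>n. measure M {\<omega> \<in> space M. dist (g (Y n \<omega>)) (g (Z \<omega>)) > \<epsilon>} \<le> r n)"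
    using conv \<delta> unfolding conv_in_prob_def by blast
qed

lemma conv_in_prob_add:
  fixes Y Y' :: "nat \<Rightarrow> 'a \<Rightarrow> 'b::{second_countable_topology, real_normed_vector}"
  assumes conv: "conv_in_prob M Y Z" "conv_in_prob M Y' Z'"
    and [measurable]: "\<And>n. Y n \<in> borel_measurable M" "Z \<in> borel_measurable M" "\<And>n. Y' n \<in> borel_measurable M" "Z' \<in> borel_measurable M"
  shows "conv_in_prob M (\<lambda>n \<omega>. Y n \<omega> + Y' n \<omega>) (\<lambda>\<omega>. Z \<omega> + Z' \<omega>)"
proof (rule conv_in_prob_dominated)
  fix \<epsilon> :: real assume "\<epsilon> > 0"
  let ?r = "\<lambda>n. measure M {\<omega> \<in> space M. dist (Y n \<omega>) (Z \<omega>) > \<epsilon> / 2} + measure M {\<omega> \<in> space M. dist (Y' n \<omega>) (Z' \<omega>) > \<epsilon> / 2}"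
  have "?r \<longlonglongrightarrow> 0 + 0" using \<open>\<epsilon> > 0\<close> by (intro tendsto_add conv_in_probD conv) auto
  moreover have "measure M {\<omega> \<in> space M. dist (Y n \<omega> + Y' n \<omega>) (Z \<omega> + Z' \<omega>) > \<epsilon>} \<le> ?r n" for n
  proof -
    have "measure M {\<omega> \<in> space M. dist (Y n \<omega> + Y' n \<omega>) (Z \<omega> + Z' \<omega>) > \<epsilon>}
      \<le> measure M ({\<omega> \<in> space M. dist (Y n \<omega>) (Z \<omega>) > \<epsilon> / 2} \<union> {\<omega> \<in> space M. dist (Y' n \<omega>) (Z' \<omega>) > \<epsilon> / 2})"
    proof (intro finite_measure_mono subsetI)
      fix \<omega> assume "\<omega> \<in> {\<omega> \<in> space M. dist (Y n \<omega> + Y' n \<omega>) (Z \<omega> + Z' \<omega>) > \<epsilon>}"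
      moreover have "dist (Y n \<omega> + Y' n \<omega>) (Z \<omega> + Z' \<omega>) \<le> dist (Y n \<omega>) (Z \<omega>) + dist (Y' n \<omega>) (Z' \<omega>)"
        by (rule dist_triangle_add)
      ultimately show "\<omega> \<in> {\<omega> \<in> space M. dist (Y n \<omega>) (Z \<omega>) > \<epsilon> / 2} \<union> {\<omega> \<in> space M. dist (Y' n \<omega>) (Z' \<omega>) > \<epsilon> / 2}"
        by auto
    qed auto
    also have "\<dots> \<le> ?r n" by (rule measure_Un_le) auto
    finally show ?thesis .
  qed
  ultimately show "\<exists>r. r \<longlonglongrightarrow> 0 \<and> (\<forall>n. measure M {\<omega> \<in> space M. dist (Y n \<omega> + Y' n \<omega>) (Z \<omega> + Z' \<omega>) > \<epsilon>} \<le> r n)"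
    by (intro exI[of _ ?r]) auto
qed

lemma conv_in_prob_const: "conv_in_prob M (\<lambda>n. Z) Z"
  by (simp add: conv_in_prob_def)

lemma conv_in_prob_sum:
  fixes Y :: "'i \<Rightarrow> nat \<Rightarrow> 'a \<Rightarrow> 'b::{second_countable_topology, real_normed_vector}"
  assumes "\<And>i. i \<in> I \<Longrightarrow> conv_in_prob M (Y i) (Z i)"
    and "\<And>i n. i \<in> I \<Longrightarrow> Y i n \<in> borel_measurable M" "\<And>i. i \<in> I \<Longrightarrow> Z i \<in> borel_measurable M"
  shows "conv_in_prob M (\<lambda>n \<omega>. \<Sum>i\<in>I. Y i n \<omega>) (\<lambda>\<omega>. \<Sum>i\<in>I. Z i \<omega>)"
  using assms
proof (induction I rule: infinite_finite_induct)
  case (insert i I)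
  have "conv_in_prob M (\<lambda>n \<omega>. Y i n \<omega> + (\<Sum>i\<in>I. Y i n \<omega>)) (\<lambda>\<omega>. Z i \<omega> + (\<Sum>i\<in>I. Z i \<omega>))"
    by (intro conv_in_prob_add insert.IH) (auto intro!: insert.prems borel_measurable_sum)
  then show ?case using insert.hyps by simp
qed (auto intro: conv_in_prob_const)

text \<open>The distance of \<open>iexp y\<close> and \<open>iexp z\<close> is at most 2 and at most
  \<open>dist y z\<close>: the first bound serves on the exceptional set, the second one off
  it.\<close>

lemma conv_in_prob_char:
  fixes Y :: "nat \<Rightarrow> 'a \<Rightarrow> real"
  assumes conv: "conv_in_prob M Y Z"
    and [measurable]: "\<And>n. Y n \<in> borel_measurable M" "Z \<in> borel_measurable M"
  shows "(\<lambda>n. \<integral>\<omega>. iexp (Y n \<omega>) \<partial>M) \<longlonglongrightarrow> (\<integral>\<omega>. iexp (Z \<omega>) \<partial>M)"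
proof (rule LIMSEQ_I)
  fix \<epsilon> :: real assume "\<epsilon> > 0"
  let ?A = "\<lambda>n. {\<omega> \<in> space M. dist (Y n \<omega>) (Z \<omega>) > \<epsilon> / 2}"
  have "(\<lambda>n. measure M (?A n)) \<longlonglongrightarrow> 0"
    using \<open>\<epsilon> > 0\<close> by (intro conv_in_probD[OF conv]) auto
  then have "\<forall>\<^sub>F n in sequentially. measure M (?A n) < \<epsilon> / 4"
    using \<open>\<epsilon> > 0\<close> by (intro order_tendstoD) auto
  then obtain N where N: "\<And>n. n \<ge> N \<Longrightarrow> measure M (?A n) < \<epsilon> / 4"
    unfolding eventually_sequentially by blast
  show "\<exists>N. \<forall>n\<ge>N. norm ((\<integral>\<omega>. iexp (Y n \<omega>) \<partial>M) - (\<integral>\<omega>. iexp (Z \<omega>) \<partial>M)) < \<epsilon>"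
  proof (intro exI[of _ N] allI impI)
    fix n assume "n \<ge> N"
    have "norm ((\<integral>\<omega>. iexp (Y n \<omega>) \<partial>M) - (\<integral>\<omega>. iexp (Z \<omega>) \<partial>M)) = norm (\<integral>\<omega>. iexp (Y n \<omega>) - iexp (Z \<omega>) \<partial>M)"
      by (subst Bochner_Integration.integral_diff) (auto intro!: integrable_const_bound[of _ 1])
    also have "\<dots> \<le> (\<integral>\<omega>. norm (iexp (Y n \<omega>) - iexp (Z \<omega>)) \<partial>M)"
      by (rule integral_norm_bound)
    also have "\<dots> \<le> (\<integral>\<omega>. \<epsilon> / 2 + 2 * indicator (?A n) \<omega> \<partial>M)"
    proof (rule integral_mono)
      show "integrable M (\<lambda>\<omega>. norm (iexp (Y n \<omega>) - iexp (Z \<omega>)))"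
        by (intro integrable_const_bound[of _ 2]) (auto intro!: order_trans[OF norm_triangle_ineq4])
      show "integrable M (\<lambda>\<omega>. \<epsilon> / 2 + 2 * indicat_real (?A n) \<omega>)"
        by (intro integrable_const_bound[of _ "\<epsilon> / 2 + 2"]) (use \<open>\<epsilon> > 0\<close> in \<open>auto split: split_indicator\<close>)
      fix \<omega> assume "\<omega> \<in> space M"
      have "norm (iexp (Y n \<omega>) - iexp (Z \<omega>)) \<le> 2" by (rule order_trans[OF norm_triangle_ineq4]) simp
      moreover have "norm (iexp (Y n \<omega>) - iexp (Z \<omega>)) \<le> dist (Y n \<omega>) (Z \<omega>)"
      proof -
        have "iexp (Y n \<omega>) - iexp (Z \<omega>) = iexp (Z \<omega>) * (iexp (Y n \<omega> - Z \<omega>) - 1)"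
          by (simp add: exp_add[symmetric] algebra_simps)
        then have "norm (iexp (Y n \<omega>) - iexp (Z \<omega>)) = norm (iexp (Y n \<omega> - Z \<omega>) - 1)"
          by (simp add: norm_mult)
        then show ?thesis using iexp_approx1[of "Y n \<omega> - Z \<omega>" 0] by (simp add: dist_real_def)
      qed
      ultimately show "norm (iexp (Y n \<omega>) - iexp (Z \<omega>)) \<le> \<epsilon> / 2 + 2 * indicator (?A n) \<omega>"
        using \<open>\<epsilon> > 0\<close> \<open>\<omega> \<in> space M\<close> by (auto split: split_indicator)
    qed
    also have "\<dots> = \<epsilon> / 2 + 2 * measure M (?A n)"
    proof -
      have "?A n \<in> sets M" by (intro measurable_dist_gt) auto
      then show ?thesis
        by (subst Bochner_Integration.integral_add) (simp_all add: prob_space emeasure_eq_measure)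
    qed
    also have "\<dots> < \<epsilon>" using N[OF \<open>n \<ge> N\<close>] by simp
    finally show "norm ((\<integral>\<omega>. iexp (Y n \<omega>) \<partial>M) - (\<integral>\<omega>. iexp (Z \<omega>) \<partial>M)) < \<epsilon>" .
  qed
qed

text \<open>Levy's continuity theorem yields weak convergence to the point mass at 0, whose
  distribution function jumps only at 0. The distribution functions therefore converge at
  \<open>- \<epsilon>\<close> and \<open>\<epsilon>\<close>, and these two values bound the
  tail.\<close>

lemma conv_in_prob_0_if_char_real:
  fixes W :: "nat \<Rightarrow> 'a \<Rightarrow> real"
  assumes ch: "\<And>t. (\<lambda>n. \<integral>\<omega>. iexp (t * W n \<omega>) \<partial>M) \<longlonglongrightarrow> 1"
    and [measurable]: "\<And>n. W n \<in> borel_measurable M" and "\<epsilon> > 0"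
  shows "(\<lambda>n. measure M {\<omega> \<in> space M. \<bar>W n \<omega>\<bar> > \<epsilon>}) \<longlonglongrightarrow> 0"
proof -
  let ?R = "return borel (0::real)"
  interpret R: prob_space ?R by (rule prob_space_return) simp
  have R: "real_distribution ?R" by unfold_locales simp
  have D: "real_distribution (distr M borel (W n))" for n by (intro real_distribution_distr) simp
  have "(\<lambda>n. char (distr M borel (W n)) t) \<longlonglongrightarrow> char ?R t" for t
    using ch[of t] by (simp add: char_def integral_distr integral_return)
  from levy_continuity[OF D R this] have wc: "weak_conv_m (\<lambda>n. distr M borel (W n)) ?R" .
  have cdfR: "cdf ?R x = (if x \<ge> 0 then 1 else 0)" for x
    by (simp add: cdf_def measure_return)
  have cont: "isCont (cdf ?R) x" if "x \<noteq> 0" for x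
  proof (cases "x > 0")
    case True
    then have "eventually (\<lambda>y. cdf ?R y = 1) (nhds x)"
      by (intro eventually_mono[OF eventually_nhds_in_open[of "{0<..}"]]) (auto simp: cdfR)
    then show ?thesis by (subst isCont_cong) auto
  next
    case False
    with that have "eventually (\<lambda>y. cdf ?R y = 0) (nhds x)"
      by (intro eventually_mono[OF eventually_nhds_in_open[of "{..<0}"]]) (auto simp: cdfR)
    then show ?thesis by (subst isCont_cong) auto
  qed
  have lim: "(\<lambda>n. cdf (distr M borel (W n)) x) \<longlonglongrightarrow> (if x \<ge> 0 then 1 else 0)" if "x \<noteq> 0" for x
    using wc cont[OF that] by (auto simp: weak_conv_m_def weak_conv_def cdfR)
  have cdfW: "cdf (distr M borel (W n)) x = measure M {\<omega> \<in> space M. W n \<omega> \<le> x}" for n x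
    unfolding cdf_def by (subst measure_distr) (auto intro!: arg_cong[where f="measure M"])
  let ?r = "\<lambda>n. cdf (distr M borel (W n)) (- \<epsilon>) + (1 - cdf (distr M borel (W n)) \<epsilon>)"
  have "?r \<longlonglongrightarrow> 0 + (1 - 1)"
    using lim[of "-\<epsilon>"] lim[of \<epsilon>] \<open>\<epsilon> > 0\<close> by (intro tendsto_intros) auto
  then have r0: "?r \<longlonglongrightarrow> 0" by simp
  have le: "measure M {\<omega> \<in> space M. \<bar>W n \<omega>\<bar> > \<epsilon>} \<le> ?r n" for n
  proof -
    have "measure M {\<omega> \<in> space M. \<bar>W n \<omega>\<bar> > \<epsilon>} \<le> measure M ({\<omega> \<in> space M. W n \<omega> \<le> - \<epsilon>} \<union> (space M - {\<omega> \<in> space M. W n \<omega> \<le> \<epsilon>}))"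
    proof (rule finite_measure_mono)
      show "{\<omega> \<in> space M. \<bar>W n \<omega>\<bar> > \<epsilon>} \<subseteq> {\<omega> \<in> space M. W n \<omega> \<le> - \<epsilon>} \<union> (space M - {\<omega> \<in> space M. W n \<omega> \<le> \<epsilon>})"
      proof
        fix \<omega> assume "\<omega> \<in> {\<omega> \<in> space M. \<bar>W n \<omega>\<bar> > \<epsilon>}"
        then show "\<omega> \<in> {\<omega> \<in> space M. W n \<omega> \<le> - \<epsilon>} \<union> (space M - {\<omega> \<in> space M. W n \<omega> \<le> \<epsilon>})"
          by (cases "W n \<omega> \<ge> 0") simp_all
      qed
    qed measurable
    also have "\<dots> \<le> measure M {\<omega> \<in> space M. W n \<omega> \<le> - \<epsilon>} + measure M (space M - {\<omega> \<in> space M. W n \<omega> \<le> \<epsilon>})"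
      by (rule measure_Un_le) auto
    also have "\<dots> = ?r n" unfolding cdfW by (subst prob_compl) auto
    finally show ?thesis .
  qed
  show ?thesis
    by (rule tendsto_sandwich[OF _ _ tendsto_const r0]) (intro always_eventually allI measure_nonneg le)+
qed

lemma conv_in_prob_0_if_char:
  fixes Y :: "nat \<Rightarrow> 'a \<Rightarrow> 'b::euclidean_space"
  assumes ch: "\<And>u. (\<lambda>n. \<integral>\<omega>. iexp (Y n \<omega> \<bullet> u) \<partial>M) \<longlonglongrightarrow> 1"
    and [measurable]: "\<And>n. Y n \<in> borel_measurable M"
  shows "conv_in_prob M Y (\<lambda>_. 0)"
proof (rule conv_in_prob_dominated)
  fix \<epsilon> :: real assume "\<epsilon> > 0"
  define \<delta> where "\<delta> = \<epsilon> / real DIM('b)"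
  have \<delta>: "\<delta> > 0" using \<open>\<epsilon> > 0\<close> by (simp add: \<delta>_def)
  let ?r = "\<lambda>n. \<Sum>b\<in>Basis. measure M {\<omega> \<in> space M. \<bar>Y n \<omega> \<bullet> b\<bar> > \<delta>}"
  have "?r \<longlonglongrightarrow> (\<Sum>b\<in>(Basis :: 'b set). 0)"
  proof (intro tendsto_sum conv_in_prob_0_if_char_real)
    show "(\<lambda>n. \<integral>\<omega>. iexp (t * (Y n \<omega> \<bullet> b)) \<partial>M) \<longlonglongrightarrow> 1" for t b
      using ch[of "t *\<^sub>R b"] by simp
  qed (use \<delta> in auto)
  moreover have "measure M {\<omega> \<in> space M. dist (Y n \<omega>) 0 > \<epsilon>} \<le> ?r n" for n
  proof -
    have "measure M {\<omega> \<in> space M. dist (Y n \<omega>) 0 > \<epsilon>} \<le> measure M (\<Union>b\<in>Basis. {\<omega> \<in> space M. \<bar>Y n \<omega> \<bullet> b\<bar> > \<delta>})"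
    proof (intro finite_measure_mono subsetI)
      fix \<omega> assume w: "\<omega> \<in> {\<omega> \<in> space M. dist (Y n \<omega>) 0 > \<epsilon>}"
      have "\<exists>b\<in>Basis. \<bar>Y n \<omega> \<bullet> b\<bar> > \<delta>"
      proof (rule ccontr)
        assume "\<not> ?thesis"
        then have "(\<Sum>b\<in>Basis. \<bar>Y n \<omega> \<bullet> b\<bar>) \<le> (\<Sum>b\<in>(Basis::'b set). \<delta>)" by (intro sum_mono) force
        then show False using w norm_le_l1[of "Y n \<omega>"] by (simp add: \<delta>_def)
      qed
      with w show "\<omega> \<in> (\<Union>b\<in>Basis. {\<omega> \<in> space M. \<bar>Y n \<omega> \<bullet> b\<bar> > \<delta>})" by auto
    qed auto
    also have "\<dots> \<le> ?r n" by (rule measure_UNION_le) auto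
    finally show ?thesis .
  qed
  ultimately show "\<exists>r. r \<longlonglongrightarrow> 0 \<and> (\<forall>n. measure M {\<omega> \<in> space M. dist (Y n \<omega>) 0 > \<epsilon>} \<le> r n)"
    by (intro exI[of _ ?r]) auto
qed

lemma AE_zero_if_char:
  fixes Z :: "'a \<Rightarrow> 'b::euclidean_space"
  assumes [measurable]: "Z \<in> borel_measurable M" and "\<And>u. (\<integral>\<omega>. iexp (Z \<omega> \<bullet> u) \<partial>M) = 1"
  shows "AE \<omega> in M. Z \<omega> = 0"
proof -
  have "distr M borel Z = distr M borel (\<lambda>_. 0)"
    by (rule distr_eqI_char) (use assms prob_space prob_space_axioms in auto)
  moreover have "AE x in distr M borel (\<lambda>_. 0 :: 'b). x = 0" by (subst AE_distr_iff) auto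
  ultimately have "AE x in distr M borel Z. x = 0" by metis
  then show ?thesis by (subst (asm) AE_distr_iff) auto
qed

text \<open>Along a suitable subsequence the increments exceed \<open>(1/2)^k\<close> only with
  probability at most \<open>(1/2)^k\<close>; by Borel-Cantelli it converges almost surely. The
  Cauchy property carries its limit over to the whole sequence.\<close>

lemma conv_in_prob_if_Cauchy:
  fixes Y :: "nat \<Rightarrow> 'a \<Rightarrow> 'b::{banach, second_countable_topology}"
  assumes C: "\<And>\<epsilon>. \<epsilon> > 0 \<Longrightarrow> \<exists>N. \<forall>m\<ge>N. \<forall>n\<ge>N. measure M {\<omega> \<in> space M. dist (Y m \<omega>) (Y n \<omega>) > \<epsilon>} \<le> \<epsilon>"
    and [measurable]: "\<And>n. Y n \<in> borel_measurable M"
  shows "\<exists>Z\<in>borel_measurable M. conv_in_prob M Y Z"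
proof -
  obtain N where N: "\<And>k m n. m \<ge> N k \<Longrightarrow> n \<ge> N k \<Longrightarrow> measure M {\<omega> \<in> space M. dist (Y m \<omega>) (Y n \<omega>) > (1/2)^k} \<le> (1/2)^k"
  proof -
    have "\<exists>N. \<forall>k. \<forall>m\<ge>N k. \<forall>n\<ge>N k. measure M {\<omega> \<in> space M. dist (Y m \<omega>) (Y n \<omega>) > (1/2)^k} \<le> (1/2)^k"
      by (intro choice allI C) simp
    then show ?thesis using that by blast
  qed
  define s where "s = rec_nat (N 0) (\<lambda>k x. max (Suc x) (N (Suc k)))"
  have s_Suc: "s (Suc k) > s k" for k by (simp add: s_def)
  have s_N: "s k \<ge> N k" for k by (cases k) (auto simp: s_def)
  have s_mono: "strict_mono s" using s_Suc by (simp add: strict_mono_Suc_iff)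
  define A where "A k = {\<omega> \<in> space M. dist (Y (s k) \<omega>) (Y (s (Suc k)) \<omega>) > (1/2)^k}" for k
  have [measurable]: "A k \<in> sets M" for k unfolding A_def by measurable
  have A_le: "measure M (A k) \<le> (1/2)^k" for k
    unfolding A_def using s_N[of k] s_Suc[of k] by (intro N) auto
  have "summable (\<lambda>k. measure M (A k))"
    by (rule summable_comparison_test[OF _ summable_geometric[of "1/2"]]) (use A_le in auto)
  then have "AE \<omega> in M. eventually (\<lambda>k. \<omega> \<in> space M - A k) sequentially"
    by (intro borel_cantelli_AE1) (auto simp: emeasure_eq_measure)
  moreover have "convergent (\<lambda>k. Y (s k) \<omega>)" if "eventually (\<lambda>k. \<omega> \<in> space M - A k) sequentially" for \<omega>
  proof -
    have "eventually (\<lambda>k. norm (Y (s (Suc k)) \<omega> - Y (s k) \<omega>) \<le> (1/2)^k) sequentially"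
      using that by eventually_elim (auto simp: A_def dist_norm norm_minus_commute)
    then obtain K where K: "\<And>k. k \<ge> K \<Longrightarrow> norm (Y (s (Suc k)) \<omega> - Y (s k) \<omega>) \<le> (1/2)^k"
      unfolding eventually_sequentially by blast
    have "summable (\<lambda>k. Y (s (Suc k)) \<omega> - Y (s k) \<omega>)"
      by (rule summable_comparison_test[OF _ summable_geometric[of "1/2::real"]]) (use K in auto)
    moreover have "(\<Sum>i<n. Y (s (Suc i)) \<omega> - Y (s i) \<omega>) = Y (s n) \<omega> - Y (s 0) \<omega>" for n
      by (rule sum_lessThan_telescope)
    ultimately have "convergent (\<lambda>n. Y (s n) \<omega> - Y (s 0) \<omega>)"
      by (simp add: summable_iff_convergent)
    then show ?thesis by (simp add: convergent_diff_const_right_iff)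
  qed
  ultimately have ae: "AE \<omega> in M. convergent (\<lambda>k. Y (s k) \<omega>)" by (rule AE_mp[OF _ AE_I2[OF impI]])
  define Z where "Z \<omega> = lim (\<lambda>k. Y (s k) \<omega>)" for \<omega>
  have [measurable]: "Z \<in> borel_measurable M" unfolding Z_def by measurable
  have ae_lim: "AE \<omega> in M. (\<lambda>k. Y (s k) \<omega>) \<longlonglongrightarrow> Z \<omega>"
    using ae by eventually_elim (simp add: Z_def convergent_LIMSEQ_iff)
  have sub: "(\<lambda>k. measure M {\<omega> \<in> space M. dist (Y (s k) \<omega>) (Z \<omega>) > \<epsilon>}) \<longlonglongrightarrow> 0" if "\<epsilon> > 0" for \<epsilon>
  proof -
    have "(\<lambda>k. \<integral>\<omega>. indicat_real {\<omega> \<in> space M. dist (Y (s k) \<omega>) (Z \<omega>) > \<epsilon>} \<omega> \<partial>M) \<longlonglongrightarrow> (\<integral>\<omega>. 0 \<partial>M)"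
    proof (rule integral_dominated_convergence[where w="\<lambda>_. 1"])
      show "AE \<omega> in M. (\<lambda>k. indicat_real {\<omega> \<in> space M. dist (Y (s k) \<omega>) (Z \<omega>) > \<epsilon>} \<omega>) \<longlonglongrightarrow> 0"
        using ae_lim
      proof eventually_elim
        case (elim \<omega>)
        then have "eventually (\<lambda>k. dist (Y (s k) \<omega>) (Z \<omega>) < \<epsilon>) sequentially"
          using that by (rule tendstoD)
        then have "eventually (\<lambda>k. indicat_real {\<omega> \<in> space M. dist (Y (s k) \<omega>) (Z \<omega>) > \<epsilon>} \<omega> = 0) sequentially"
          by eventually_elim auto
        then show ?case by (rule tendsto_eventually)
      qed
    qed (auto split: split_indicator)
    then show ?thesis by simp
  qed
  have "conv_in_prob M Y Z"
    unfolding conv_in_prob_def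
  proof (intro allI impI LIMSEQ_I)
    fix \<epsilon> r :: real assume "\<epsilon> > 0" "r > 0"
    define \<eta> where "\<eta> = min (\<epsilon> / 2) (r / 3)"
    have "\<eta> > 0" using \<open>\<epsilon> > 0\<close> \<open>r > 0\<close> by (simp add: \<eta>_def)
    then obtain N1 where N1: "\<And>m n. m \<ge> N1 \<Longrightarrow> n \<ge> N1 \<Longrightarrow> measure M {\<omega> \<in> space M. dist (Y m \<omega>) (Y n \<omega>) > \<eta>} \<le> \<eta>"
      using C by blast
    have "eventually (\<lambda>k. measure M {\<omega> \<in> space M. dist (Y (s k) \<omega>) (Z \<omega>) > \<eta>} < \<eta>) sequentially"
      using sub[OF \<open>\<eta> > 0\<close>] \<open>\<eta> > 0\<close> by (intro order_tendstoD) auto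
    moreover have "eventually (\<lambda>k. k \<ge> N1) sequentially" by (rule eventually_ge_at_top)
    ultimately have "eventually (\<lambda>k. measure M {\<omega> \<in> space M. dist (Y (s k) \<omega>) (Z \<omega>) > \<eta>} < \<eta> \<and> k \<ge> N1) sequentially"
      by eventually_elim auto
    then obtain k where k: "measure M {\<omega> \<in> space M. dist (Y (s k) \<omega>) (Z \<omega>) > \<eta>} < \<eta>" "k \<ge> N1"
      by (auto dest!: eventually_happens)
    have "s k \<ge> N1" using k(2) seq_suble[OF s_mono, of k] by simp
    show "\<exists>N. \<forall>n\<ge>N. norm (measure M {\<omega> \<in> space M. dist (Y n \<omega>) (Z \<omega>) > \<epsilon>} - 0) < r"
    proof (intro exI[of _ N1] allI impI)
      fix n assume "n \<ge> N1"
      have "measure M {\<omega> \<in> space M. dist (Y n \<omega>) (Z \<omega>) > \<epsilon>}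
          \<le> measure M ({\<omega> \<in> space M. dist (Y n \<omega>) (Y (s k) \<omega>) > \<eta>} \<union> {\<omega> \<in> space M. dist (Y (s k) \<omega>) (Z \<omega>) > \<eta>})"
      proof (intro finite_measure_mono subsetI)
        fix \<omega> assume "\<omega> \<in> {\<omega> \<in> space M. dist (Y n \<omega>) (Z \<omega>) > \<epsilon>}"
        moreover have "dist (Y n \<omega>) (Z \<omega>) \<le> dist (Y n \<omega>) (Y (s k) \<omega>) + dist (Y (s k) \<omega>) (Z \<omega>)" by (rule dist_triangle)
        moreover have "\<eta> \<le> \<epsilon> / 2" by (simp add: \<eta>_def)
        ultimately show "\<omega> \<in> {\<omega> \<in> space M. dist (Y n \<omega>) (Y (s k) \<omega>) > \<eta>} \<union> {\<omega> \<in> space M. dist (Y (s k) \<omega>) (Z \<omega>) > \<eta>}"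
          by auto
      qed auto
      also have "\<dots> \<le> measure M {\<omega> \<in> space M. dist (Y n \<omega>) (Y (s k) \<omega>) > \<eta>} + measure M {\<omega> \<in> space M. dist (Y (s k) \<omega>) (Z \<omega>) > \<eta>}"
        by (rule measure_Un_le) auto
      also have "\<dots> < \<eta> + \<eta>" using N1[OF \<open>n \<ge> N1\<close> \<open>s k \<ge> N1\<close>] k(1) by linarith
      also have "\<dots> \<le> r" using \<open>r > 0\<close> by (auto simp: \<eta>_def)
      finally show "norm (measure M {\<omega> \<in> space M. dist (Y n \<omega>) (Z \<omega>) > \<epsilon>} - 0) < r" by simp
    qed
  qed
  from bexI[of "conv_in_prob M Y", OF this \<open>Z \<in> borel_measurable M\<close>] show ?thesis .
qed

text \<open>A failure of the Cauchy property selects two index sequences along which the differences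
  stay large. It therefore suffices to test differences along arbitrary pairs of index sequences
  that tend to infinity.\<close>

lemma conv_in_prob_if_char_Cauchy:
  fixes Y :: "nat \<Rightarrow> 'a \<Rightarrow> 'b::euclidean_space"
  assumes ch: "\<And>k l u. (\<And>j. k j \<ge> j) \<Longrightarrow> (\<And>j. l j \<ge> j) \<Longrightarrow>
      (\<lambda>j. \<integral>\<omega>. iexp ((Y (k j) \<omega> - Y (l j) \<omega>) \<bullet> u) \<partial>M) \<longlonglongrightarrow> 1"
    and [measurable]: "\<And>n. Y n \<in> borel_measurable M"
  shows "\<exists>Z\<in>borel_measurable M. conv_in_prob M Y Z"
proof (rule conv_in_prob_if_Cauchy)
  fix \<epsilon> :: real assume "\<epsilon> > 0"
  show "\<exists>N. \<forall>m\<ge>N. \<forall>n\<ge>N. measure M {\<omega> \<in> space M. dist (Y m \<omega>) (Y n \<omega>) > \<epsilon>} \<le> \<epsilon>"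
  proof (rule ccontr)
    assume "\<not> ?thesis"
    then have "\<forall>N. \<exists>m n. m \<ge> N \<and> n \<ge> N \<and> \<not> measure M {\<omega> \<in> space M. dist (Y m \<omega>) (Y n \<omega>) > \<epsilon>} \<le> \<epsilon>"
      by (simp only: not_ex not_all not_imp) metis
    then obtain k l where kl: "\<And>N. k N \<ge> N" "\<And>N. l N \<ge> N"
      "\<And>N. \<not> measure M {\<omega> \<in> space M. dist (Y (k N) \<omega>) (Y (l N) \<omega>) > \<epsilon>} \<le> \<epsilon>" by metis
    have "conv_in_prob M (\<lambda>j \<omega>. Y (k j) \<omega> - Y (l j) \<omega>) (\<lambda>_. 0)"
      by (rule conv_in_prob_0_if_char) (use ch[OF kl(1,2)] in auto)
    then have "(\<lambda>j. measure M {\<omega> \<in> space M. dist (Y (k j) \<omega>) (Y (l j) \<omega>) > \<epsilon>}) \<longlonglongrightarrow> 0"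
      using \<open>\<epsilon> > 0\<close> unfolding conv_in_prob_def by (simp add: dist_norm)
    then have "eventually (\<lambda>j. measure M {\<omega> \<in> space M. dist (Y (k j) \<omega>) (Y (l j) \<omega>) > \<epsilon>} < \<epsilon>) sequentially"
      using \<open>\<epsilon> > 0\<close> by (intro order_tendstoD) auto
    then obtain j where "measure M {\<omega> \<in> space M. dist (Y (k j) \<omega>) (Y (l j) \<omega>) > \<epsilon>} < \<epsilon>"
      by (auto dest!: eventually_happens)
    with kl(3)[of j] show False by simp
  qed
qed simp

end


section \<open>Random measures\<close>

text \<open>Along a subsequence, \<open>g\<close> concentrates on pairwise disjoint sets \<open>H\<^sub>j\<close>. If \<open>A\<close> is the union of those
  with even \<open>j\<close>, then the integrals over \<open>A\<close> vanish along the odd indices and those over its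
  complement along the even ones.\<close>

lemma gliding_hump_exp:
  fixes g :: "nat \<Rightarrow> 's \<Rightarrow> complex"
  assumes "sigma_finite_measure \<Theta>" and int: "\<And>n. integrable \<Theta> (g n)"
    and ae: "AE s in \<Theta>. (\<lambda>n. g n s) \<longlonglongrightarrow> 0"
    and conv: "\<And>A. A \<in> sets \<Theta> \<Longrightarrow> convergent (\<lambda>n. exp (\<integral>s. indicator A s *\<^sub>R g n s \<partial>\<Theta>))"
  shows "(\<lambda>n. exp (\<integral>s. g n s \<partial>\<Theta>)) \<longlonglongrightarrow> 1"
proof -
  interpret sigma_finite_measure \<Theta> by fact
  note [measurable] = borel_measurable_integrable[OF int]
  obtain F :: "nat \<Rightarrow> 's set" where F: "range F \<subseteq> sets \<Theta>" "(\<Union>i. F i) = space \<Theta>" "\<And>i. emeasure \<Theta> (F i) \<noteq> \<infinity>" "incseq F"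
    using sigma_finite_incseq by metis
  have [measurable]: "F i \<in> sets \<Theta>" for i using F by auto
  \<comment> \<open>On \<open>B N\<close> dominated convergence is available, since the set has
    finite measure and \<open>g k\<close> is bounded by 1 there for \<open>k \<ge> N\<close>. Almost
    every point lies in all later \<open>B N\<close>, so the mass of \<open>g n\<close> can only sit
    outside every fixed level.\<close>
  define B where "B N = F N \<inter> {s \<in> space \<Theta>. \<forall>k\<ge>N. cmod (g k s) \<le> 1}" for N
  have [measurable]: "B N \<in> sets \<Theta>" for N unfolding B_def by measurable
  have B_mono: "B N \<subseteq> B N'" if "N \<le> N'" for N N'
    using that F(4) by (auto simp: B_def dest: monoD)
  define I where "I A n = (\<integral>s. indicator A s *\<^sub>R cmod (g n s) \<partial>\<Theta>)" for A n
  have intI: "integrable \<Theta> (\<lambda>s. indicator A s *\<^sub>R cmod (g n s))" if "A \<in> sets \<Theta>" for A n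
    using that int by (intro integrable_mult_indicator integrable_norm)
  have lim_in: "(\<lambda>k. I (B N) k) \<longlonglongrightarrow> 0" for N
  proof (rule LIMSEQ_offset[of _ N])
    have "(\<lambda>k. I (B N) (k + N)) \<longlonglongrightarrow> (\<integral>s. 0 \<partial>\<Theta>)"
      unfolding I_def
    proof (rule integral_dominated_convergence[where w="\<lambda>s. indicator (F N) s"])
      show "integrable \<Theta> (indicat_real (F N))" using F(3)[of N] by (simp add: less_top)
      show "AE s in \<Theta>. (\<lambda>k. indicator (B N) s *\<^sub>R cmod (g (k + N) s)) \<longlonglongrightarrow> 0"
        using ae
      proof eventually_elim
        case (elim s)
        then have "(\<lambda>k. cmod (g (k + N) s)) \<longlonglongrightarrow> 0"
          using LIMSEQ_ignore_initial_segment tendsto_norm_zero by blast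
        then have "(\<lambda>k. indicator (B N) s *\<^sub>R cmod (g (k + N) s)) \<longlonglongrightarrow> indicator (B N) s *\<^sub>R 0"
          by (intro tendsto_scaleR tendsto_const)
        then show ?case by simp
      qed
    qed (auto simp: B_def split: split_indicator)
    then show "(\<lambda>k. I (B N) (k + N)) \<longlonglongrightarrow> 0" by simp
  qed
  have lim_out: "(\<lambda>N. I (space \<Theta> - B N) n) \<longlonglongrightarrow> 0" for n
  proof -
    have "(\<lambda>N. I (space \<Theta> - B N) n) \<longlonglongrightarrow> (\<integral>s. 0 \<partial>\<Theta>)"
      unfolding I_def
    proof (rule integral_dominated_convergence[where w="\<lambda>s. cmod (g n s)"])
      show "integrable \<Theta> (\<lambda>s. cmod (g n s))" by (intro integrable_norm int)
      show "AE s in \<Theta>. (\<lambda>N. indicator (space \<Theta> - B N) s *\<^sub>R cmod (g n s)) \<longlonglongrightarrow> 0"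
        using ae
      proof (rule AE_mp, intro AE_I2 impI)
        fix s assume s: "s \<in> space \<Theta>" "(\<lambda>n. g n s) \<longlonglongrightarrow> 0"
        have "eventually (\<lambda>k. cmod (g k s) < 1) sequentially"
          using tendsto_norm_zero[OF s(2)] by (intro order_tendstoD) auto
        then obtain K where K: "\<And>k. k \<ge> K \<Longrightarrow> cmod (g k s) \<le> 1"
          unfolding eventually_sequentially using less_imp_le by blast
        obtain i where i: "s \<in> F i" using s(1) F(2) by blast
        have "s \<in> B N" if "N \<ge> max K i" for N
          using that K i s(1) F(4) by (auto simp: B_def dest: monoD)
        then have "eventually (\<lambda>N. indicator (space \<Theta> - B N) s *\<^sub>R cmod (g n s) = 0) sequentially"
          unfolding eventually_sequentially by (intro exI[of _ "max K i"]) auto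
        then show "(\<lambda>N. indicator (space \<Theta> - B N) s *\<^sub>R cmod (g n s)) \<longlonglongrightarrow> 0"
          by (rule tendsto_eventually)
      qed
    qed (auto split: split_indicator)
    then show ?thesis by simp
  qed
  \<comment> \<open>A state is an index together with a level. The new index is taken so late that
    its mass on the old level is small, then the new level so large that little of this mass lies
    beyond it; the hump sits in the difference of the two levels.\<close>
  have "\<exists>p. \<forall>j. True \<and> (fst (p (Suc j)) > fst (p j) \<and> snd (p (Suc j)) \<ge> (snd (p j) :: nat) \<and>
      I (B (snd (p j))) (fst (p (Suc j))) < (1/2)^j \<and> I (space \<Theta> - B (snd (p (Suc j)))) (fst (p (Suc j))) < (1/2)^j)"
  proof (rule dependent_nat_choice)
    fix x :: "nat \<times> nat" and j :: nat
    have "eventually (\<lambda>k. I (B (snd x)) k < (1/2)^j) sequentially"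
      using lim_in by (rule order_tendstoD) simp
    from eventually_conj[OF this eventually_gt_at_top[of "fst x"]]
    obtain n' where n': "I (B (snd x)) n' < (1/2)^j" "n' > fst x" by (auto dest!: eventually_happens)
    have "eventually (\<lambda>N. I (space \<Theta> - B N) n' < (1/2)^j) sequentially"
      using lim_out by (rule order_tendstoD) simp
    from eventually_conj[OF this eventually_ge_at_top[of "snd x"]]
    obtain N' where N': "I (space \<Theta> - B N') n' < (1/2)^j" "N' \<ge> snd x" by (auto dest!: eventually_happens)
    show "\<exists>y. True \<and> (fst y > fst x \<and> snd y \<ge> snd x \<and> I (B (snd x)) (fst y) < (1/2)^j \<and> I (space \<Theta> - B (snd y)) (fst y) < (1/2)^j)"
      by (rule exI[of _ "(n', N')"]) (use n' N' in auto)
  qed auto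
  then obtain p where p: "\<And>j. fst (p (Suc j)) > fst (p j)" "\<And>j. snd (p (Suc j)) \<ge> snd (p j)"
      "\<And>j. I (B (snd (p j))) (fst (p (Suc j))) < (1/2)^j"
      "\<And>j. I (space \<Theta> - B (snd (p (Suc j)))) (fst (p (Suc j))) < (1/2)^j"
    by blast
  define m where "m j = fst (p (Suc j))" for j
  define H where "H j = B (snd (p (Suc j))) - B (snd (p j))" for j
  have m: "strict_mono m" using p(1) by (simp add: m_def strict_mono_Suc_iff)
  have [measurable]: "H j \<in> sets \<Theta>" for j unfolding H_def by measurable
  have pmono: "snd (p i) \<le> snd (p j)" if "i \<le> j" for i j
    using lift_Suc_mono_le[of "\<lambda>j. snd (p j)"] p(2) that by blast
  have H_disj: "H i \<inter> H j = {}" if "i < j" for i j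
    using B_mono[OF pmono[of "Suc i" j]] that unfolding H_def by auto
  have H_disj': "H i \<inter> H j = {}" if "i \<noteq> j" for i j
    using H_disj[of i j] H_disj[of j i] that by (metis Int_commute nat_neq_iff)
  have small: "cmod (\<integral>s. indicator A s *\<^sub>R g (m j) s \<partial>\<Theta>) \<le> 2 * (1/2)^j" if [measurable]: "A \<in> sets \<Theta>" and disj: "A \<inter> H j = {}" for A j
  proof -
    have "cmod (\<integral>s. indicator A s *\<^sub>R g (m j) s \<partial>\<Theta>) \<le> (\<integral>s. cmod (indicator A s *\<^sub>R g (m j) s) \<partial>\<Theta>)"
      by (rule integral_norm_bound)
    also have "\<dots> \<le> (\<integral>s. indicator (B (snd (p j))) s *\<^sub>R cmod (g (m j) s) + indicator (space \<Theta> - B (snd (p (Suc j)))) s *\<^sub>R cmod (g (m j) s) \<partial>\<Theta>)"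
    proof (rule integral_mono)
      show "integrable \<Theta> (\<lambda>s. cmod (indicator A s *\<^sub>R g (m j) s))"
        by (intro integrable_norm integrable_mult_indicator int) measurable
      show "integrable \<Theta> (\<lambda>s. indicator (B (snd (p j))) s *\<^sub>R cmod (g (m j) s) + indicator (space \<Theta> - B (snd (p (Suc j)))) s *\<^sub>R cmod (g (m j) s))"
        by (intro Bochner_Integration.integrable_add intI) measurable
      fix s assume "s \<in> space \<Theta>"
      then show "cmod (indicator A s *\<^sub>R g (m j) s) \<le> indicator (B (snd (p j))) s *\<^sub>R cmod (g (m j) s) + indicator (space \<Theta> - B (snd (p (Suc j)))) s *\<^sub>R cmod (g (m j) s)"
        using disj by (auto simp: H_def split: split_indicator)
    qed
    also have "\<dots> = I (B (snd (p j))) (m j) + I (space \<Theta> - B (snd (p (Suc j)))) (m j)"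
      unfolding I_def by (intro Bochner_Integration.integral_add intI) measurable
    also have "\<dots> \<le> (1/2)^j + (1/2)^j"
      using p(3)[of j] p(4)[of j] by (simp add: m_def)
    finally show ?thesis by simp
  qed
  define A where "A = (\<Union>j. H (2 * j))"
  have [measurable]: "A \<in> sets \<Theta>" unfolding A_def by measurable
  have disj_odd: "A \<inter> H (2 * j + 1) = {}" for j
    unfolding A_def using H_disj'[of "2 * i" "2 * j + 1" for i] by auto (metis IntI empty_iff double_not_eq_Suc_double)
  have disj_even: "(space \<Theta> - A) \<inter> H (2 * j) = {}" for j
    unfolding A_def by auto
  have pow0: "(\<lambda>j. 2 * (1/2::real)^j) \<longlonglongrightarrow> 0"
    using tendsto_mult_right_zero[OF LIMSEQ_power_zero[of "1/2::real"], of 2] by simp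
  have mo: "strict_mono (\<lambda>j. 2 * j + 1 :: nat)" "strict_mono (\<lambda>j. 2 * j :: nat)" by (auto intro: strict_monoI)
  have odd0: "(\<lambda>j. \<integral>s. indicator A s *\<^sub>R g (m (2 * j + 1)) s \<partial>\<Theta>) \<longlonglongrightarrow> 0"
    by (rule Lim_null_comparison[OF always_eventually LIMSEQ_subseq_LIMSEQ[OF pow0 mo(1), unfolded o_def]])
      (use small[OF _ disj_odd] in auto)
  have even0: "(\<lambda>j. \<integral>s. indicator (space \<Theta> - A) s *\<^sub>R g (m (2 * j)) s \<partial>\<Theta>) \<longlonglongrightarrow> 0"
    by (rule Lim_null_comparison[OF always_eventually LIMSEQ_subseq_LIMSEQ[OF pow0 mo(2), unfolded o_def]])
      (use small[OF _ disj_even] in auto)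
  \<comment> \<open>The convergence hypothesis is used only for \<open>A\<close> and for the whole
    space. As the full sequences converge, their limits can be read off along the odd and the even
    indices.\<close>
  obtain L where L: "(\<lambda>n. exp (\<integral>s. indicator A s *\<^sub>R g n s \<partial>\<Theta>)) \<longlonglongrightarrow> L"
    using conv[of A] by (auto simp: convergent_def)
  have split: "(\<integral>s. g n s \<partial>\<Theta>) = (\<integral>s. indicator A s *\<^sub>R g n s \<partial>\<Theta>) + (\<integral>s. indicator (space \<Theta> - A) s *\<^sub>R g n s \<partial>\<Theta>)" for n
  proof -
    have "(\<integral>s. g n s \<partial>\<Theta>) = (\<integral>s. indicator A s *\<^sub>R g n s + indicator (space \<Theta> - A) s *\<^sub>R g n s \<partial>\<Theta>)"
      by (intro Bochner_Integration.integral_cong) (auto split: split_indicator)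
    also have "\<dots> = (\<integral>s. indicator A s *\<^sub>R g n s \<partial>\<Theta>) + (\<integral>s. indicator (space \<Theta> - A) s *\<^sub>R g n s \<partial>\<Theta>)"
      by (intro Bochner_Integration.integral_add integrable_mult_indicator int) measurable
    finally show ?thesis .
  qed
  have "(\<lambda>j. exp (\<integral>s. indicator A s *\<^sub>R g (m (2 * j + 1)) s \<partial>\<Theta>)) \<longlonglongrightarrow> L"
    using LIMSEQ_subseq_LIMSEQ[OF L strict_mono_o[OF m mo(1)]] by (simp add: o_def)
  moreover have "(\<lambda>j. exp (\<integral>s. indicator A s *\<^sub>R g (m (2 * j + 1)) s \<partial>\<Theta>)) \<longlonglongrightarrow> exp 0"
    by (intro tendsto_intros odd0)
  ultimately have "L = 1" using LIMSEQ_unique by fastforce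
  have "convergent (\<lambda>n. exp (\<integral>s. g n s \<partial>\<Theta>))"
    using conv[OF sets.top] by (simp cong: Bochner_Integration.integral_cong)
  then obtain L' where L': "(\<lambda>n. exp (\<integral>s. g n s \<partial>\<Theta>)) \<longlonglongrightarrow> L'" by (auto simp: convergent_def)
  have "(\<lambda>j. exp (\<integral>s. g (m (2 * j)) s \<partial>\<Theta>)) \<longlonglongrightarrow> L'"
    using LIMSEQ_subseq_LIMSEQ[OF L' strict_mono_o[OF m mo(2)]] by (simp add: o_def)
  moreover have "(\<lambda>j. exp (\<integral>s. indicator A s *\<^sub>R g (m (2 * j)) s \<partial>\<Theta>)) \<longlonglongrightarrow> L"
    using LIMSEQ_subseq_LIMSEQ[OF L strict_mono_o[OF m mo(2)]] by (simp add: o_def)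
  then have "(\<lambda>j. exp (\<integral>s. g (m (2 * j)) s \<partial>\<Theta>)) \<longlonglongrightarrow> L * exp 0"
    unfolding split exp_add by (intro tendsto_intros even0)
  ultimately have "L' = 1" using LIMSEQ_unique \<open>L = 1\<close> by fastforce
  with L' show ?thesis by simp
qed

lemma inner_matrix_vector: "(A *v x) \<bullet> y = x \<bullet> (transpose A *v y)" for A :: "real^'n^'m"
  by (metis dot_lmul_matrix vector_transpose_matrix)

lemma (in prob_space) conv_in_prob_joint_char:
  fixes Y :: "'i \<Rightarrow> nat \<Rightarrow> 'a \<Rightarrow> 'b::euclidean_space"
  assumes conv: "\<And>i. i \<in> I \<Longrightarrow> conv_in_prob M (Y i) (Z i)"
    and Y: "\<And>i n. i \<in> I \<Longrightarrow> Y i n \<in> borel_measurable M" and Z: "\<And>i. i \<in> I \<Longrightarrow> Z i \<in> borel_measurable M"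
  shows "(\<lambda>n. \<integral>\<omega>. iexp (\<Sum>i\<in>I. Y i n \<omega> \<bullet> u i) \<partial>M) \<longlonglongrightarrow> (\<integral>\<omega>. iexp (\<Sum>i\<in>I. Z i \<omega> \<bullet> u i) \<partial>M)"
proof (rule conv_in_prob_char)
  show "conv_in_prob M (\<lambda>n \<omega>. \<Sum>i\<in>I. Y i n \<omega> \<bullet> u i) (\<lambda>\<omega>. \<Sum>i\<in>I. Z i \<omega> \<bullet> u i)"
  proof (rule conv_in_prob_sum)
    fix i assume i: "i \<in> I"
    show "conv_in_prob M (\<lambda>n \<omega>. Y i n \<omega> \<bullet> u i) (\<lambda>\<omega>. Z i \<omega> \<bullet> u i)"
    proof (rule conv_in_prob_lipschitz[OF conv[OF i], of "\<lambda>x. x \<bullet> u i" "norm (u i)"])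
      show "dist (x \<bullet> u i) (y \<bullet> u i) \<le> norm (u i) * dist x y" for x y
        using Cauchy_Schwarz_ineq2[of "x - y" "u i"] by (simp add: dist_norm inner_diff_left mult.commute)
    qed (use Y Z i in auto)
  qed (use Y Z in auto)
qed (use Y Z in \<open>auto intro!: borel_measurable_sum\<close>)

text \<open>The exponent \<open>\<psi>\<close> is kept abstract: its continuity and its value at 0
  are what the integral is built on. Infinite divisibility, from which these properties are derived,
  is treated separately.\<close>

locale random_measure = prob_space P for P :: "'w measure" +
  fixes \<Theta> :: "'s measure" and M :: "'s set \<Rightarrow> 'w \<Rightarrow> real^'m" and \<psi> :: "real^'m \<Rightarrow> complex"
  assumes sigma_finite: "sigma_finite_measure \<Theta>"
    and M_measurable: "\<And>A. A \<in> finite_measure_sets \<Theta> \<Longrightarrow> M A \<in> borel_measurable P"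
    and M_indep: "\<And>A :: nat \<Rightarrow> 's set. range A \<subseteq> finite_measure_sets \<Theta> \<Longrightarrow> disjoint_family A \<Longrightarrow>
        indep_vars (\<lambda>_. borel) (\<lambda>n. M (A n)) UNIV"
    and M_sums: "\<And>A :: nat \<Rightarrow> 's set. range A \<subseteq> finite_measure_sets \<Theta> \<Longrightarrow> disjoint_family A \<Longrightarrow>
        (\<Union>n. A n) \<in> finite_measure_sets \<Theta> \<Longrightarrow> AE \<omega> in P. (\<lambda>n. M (A n) \<omega>) sums M (\<Union>n. A n) \<omega>"
    and M_char: "\<And>A u. A \<in> finite_measure_sets \<Theta> \<Longrightarrow>
        (\<integral>\<omega>. iexp (M A \<omega> \<bullet> u) \<partial>P) = exp (complex_of_real (measure \<Theta> A) * \<psi> u)"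
    and \<psi>_cont: "continuous_on UNIV \<psi>" and \<psi>_0 [simp]: "\<psi> 0 = 0"
begin

lemma \<psi>_measurable [measurable]: "\<psi> \<in> borel_measurable borel"
  using \<psi>_cont by (rule borel_measurable_continuous_onI)

lemma fms_sets: "A \<in> finite_measure_sets \<Theta> \<Longrightarrow> A \<in> sets \<Theta>"
  by (simp add: finite_measure_sets_def)

lemma fms_subset: "A \<in> finite_measure_sets \<Theta> \<Longrightarrow> B \<in> sets \<Theta> \<Longrightarrow> B \<subseteq> A \<Longrightarrow> B \<in> finite_measure_sets \<Theta>"
  using emeasure_mono[of B A \<Theta>] by (auto simp: finite_measure_sets_def intro: le_less_trans)

lemma fms_empty [simp]: "{} \<in> finite_measure_sets \<Theta>"
  by (simp add: finite_measure_sets_def)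

lemma M_empty: "AE \<omega> in P. M {} \<omega> = 0"
  by (rule AE_zero_if_char) (simp_all add: M_measurable M_char)

text \<open>Independence and additivity are given for sequences. A finite family is enumerated and
  padded with empty sets, on which the random measure vanishes almost surely.\<close>

lemma extend_family:
  assumes "finite I" "\<And>i. i \<in> I \<Longrightarrow> A i \<in> finite_measure_sets \<Theta>" "disjoint_family_on A I"
  obtains h :: "nat \<Rightarrow> 'i" and B where "bij_betw h {..<card I} I" "range B \<subseteq> finite_measure_sets \<Theta>" "disjoint_family B"
    "\<And>k. k < card I \<Longrightarrow> B k = A (h k)" "\<And>k. k \<ge> card I \<Longrightarrow> B k = {}"
proof -
  obtain h where h: "bij_betw h {..<card I} I"
    using ex_bij_betw_nat_finite[OF assms(1)] by (auto simp: atLeast0LessThan)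
  define B where "B k = (if k < card I then A (h k) else {})" for k
  have hI: "h k \<in> I" if "k < card I" for k using h that by (auto simp: bij_betw_def)
  have "range B \<subseteq> finite_measure_sets \<Theta>" using assms(2) hI by (auto simp: B_def)
  moreover have "disjoint_family B"
    unfolding disjoint_family_on_def
  proof (intro ballI impI)
    fix k l :: nat assume "k \<noteq> l"
    then have "h k \<noteq> h l" if "k < card I" "l < card I"
      using h that by (auto simp: bij_betw_def inj_on_def)
    then show "B k \<inter> B l = {}" using assms(3) hI by (auto simp: B_def disjoint_family_on_def)
  qed
  ultimately show ?thesis by (rule that[OF h]) (simp_all add: B_def)
qed

lemma M_finite_union:
  assumes "finite I" "\<And>i. i \<in> I \<Longrightarrow> A i \<in> finite_measure_sets \<Theta>" "disjoint_family_on A I"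
    "(\<Union>i\<in>I. A i) \<in> finite_measure_sets \<Theta>"
  shows "AE \<omega> in P. M (\<Union>i\<in>I. A i) \<omega> = (\<Sum>i\<in>I. M (A i) \<omega>)"
proof -
  obtain h :: "nat \<Rightarrow> 'a" and B where h: "bij_betw h {..<card I} I" and B: "range B \<subseteq> finite_measure_sets \<Theta>" "disjoint_family B"
    "\<And>k. k < card I \<Longrightarrow> B k = A (h k)" "\<And>k. k \<ge> card I \<Longrightarrow> B k = {}"
    using extend_family[OF assms(1-3)] by blast
  have "(\<Union>k. B k) = (\<Union>k<card I. A (h k))"
  proof -
    have "B k = (if k < card I then A (h k) else {})" for k using B(3,4)[of k] by auto
    then show ?thesis by (auto split: if_splits)
  qed
  also have "\<dots> = (\<Union>i\<in>I. A i)"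
  proof -
    have "(\<Union>i\<in>h ` {..<card I}. A i) = (\<Union>k<card I. A (h k))" by simp
    then show ?thesis unfolding bij_betw_imp_surj_on[OF h] by (rule sym)
  qed
  finally have U: "(\<Union>k. B k) = (\<Union>i\<in>I. A i)" .
  have "AE \<omega> in P. (\<lambda>n. M (B n) \<omega>) sums M (\<Union>n. B n) \<omega>"
    using B(1,2) assms(4) by (intro M_sums) (auto simp: U)
  with M_empty show ?thesis
  proof eventually_elim
    case (elim \<omega>)
    have "(\<lambda>n. M (B n) \<omega>) sums (\<Sum>k<card I. M (B k) \<omega>)"
      by (rule sums_finite) (auto simp: B(4) elim not_less)
    then have "M (\<Union>i\<in>I. A i) \<omega> = (\<Sum>k<card I. M (B k) \<omega>)"
      using elim(2) unfolding U by (rule sums_unique2[THEN sym])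
    also have "\<dots> = (\<Sum>k<card I. M (A (h k)) \<omega>)" by (intro sum.cong) (auto simp: B(3))
    also have "\<dots> = (\<Sum>i\<in>I. M (A i) \<omega>)" by (rule sum.reindex_bij_betw[OF h])
    finally show ?case .
  qed
qed

lemma disjoint_char:
  assumes "finite I" "\<And>i. i \<in> I \<Longrightarrow> A i \<in> finite_measure_sets \<Theta>" "disjoint_family_on A I"
  shows "(\<integral>\<omega>. iexp (\<Sum>i\<in>I. M (A i) \<omega> \<bullet> v i) \<partial>P) = exp (\<Sum>i\<in>I. complex_of_real (measure \<Theta> (A i)) * \<psi> (v i))"
proof -
  obtain h :: "nat \<Rightarrow> 'a" and B where h: "bij_betw h {..<card I} I" and B: "range B \<subseteq> finite_measure_sets \<Theta>" "disjoint_family B"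
    "\<And>k. k < card I \<Longrightarrow> B k = A (h k)" "\<And>k. k \<ge> card I \<Longrightarrow> B k = {}"
    using extend_family[OF assms(1-3)] by blast
  have Bm [measurable]: "M (B k) \<in> borel_measurable P" for k using B(1) by (intro M_measurable) auto
  have "indep_vars (\<lambda>_. borel) (\<lambda>n. M (B n)) {..<card I}"
    by (rule indep_vars_subset[OF M_indep[OF B(1,2)]]) auto
  then have ind: "indep_vars (\<lambda>_. borel) (\<lambda>n \<omega>. iexp (M (B n) \<omega> \<bullet> v (h n))) {..<card I}"
    by (rule indep_vars_compose2) measurable
  have "(\<integral>\<omega>. iexp (\<Sum>i\<in>I. M (A i) \<omega> \<bullet> v i) \<partial>P) = (\<integral>\<omega>. (\<Prod>k<card I. iexp (M (B k) \<omega> \<bullet> v (h k))) \<partial>P)"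
  proof (intro Bochner_Integration.integral_cong refl)
    fix \<omega>
    have "(\<Sum>i\<in>I. M (A i) \<omega> \<bullet> v i) = (\<Sum>k<card I. M (A (h k)) \<omega> \<bullet> v (h k))"
      by (rule sum.reindex_bij_betw[OF h, symmetric])
    also have "\<dots> = (\<Sum>k<card I. M (B k) \<omega> \<bullet> v (h k))" by (intro sum.cong) (auto simp: B(3))
    finally show "iexp (\<Sum>i\<in>I. M (A i) \<omega> \<bullet> v i) = (\<Prod>k<card I. iexp (M (B k) \<omega> \<bullet> v (h k)))"
      by (simp add: sum_distrib_left exp_sum)
  qed
  also have "\<dots> = (\<Prod>k<card I. \<integral>\<omega>. iexp (M (B k) \<omega> \<bullet> v (h k)) \<partial>P)"
    by (rule indep_vars_lebesgue_integral[OF _ ind]) (auto intro!: integrable_const_bound[of _ 1])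
  also have "\<dots> = (\<Prod>k<card I. exp (complex_of_real (measure \<Theta> (A (h k))) * \<psi> (v (h k))))"
  proof (intro prod.cong refl)
    fix k assume "k \<in> {..<card I}"
    then have "A (h k) \<in> finite_measure_sets \<Theta>" "B k = A (h k)"
      using B(1) B(3)[of k] by (metis lessThan_iff rangeI subsetD)+
    then show "(\<integral>\<omega>. iexp (M (B k) \<omega> \<bullet> v (h k)) \<partial>P) = exp (complex_of_real (measure \<Theta> (A (h k))) * \<psi> (v (h k)))"
      by (simp only: M_char)
  qed
  also have "\<dots> = (\<Prod>i\<in>I. exp (complex_of_real (measure \<Theta> (A i)) * \<psi> (v i)))"
    by (rule prod.reindex_bij_betw[OF h])
  finally show ?thesis using assms(1) by (simp add: exp_sum)
qed

text \<open>Overlapping sets are cut into the atoms of the algebra they generate. On an atom the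
  argument of \<open>\<psi>\<close> is constant, so the disjoint case applies and the resulting sum
  over atoms is an integral.\<close>

lemma joint_char:
  assumes I: "finite I" and A: "\<And>i. i \<in> I \<Longrightarrow> A i \<in> finite_measure_sets \<Theta>"
  shows "integrable \<Theta> (\<lambda>s. \<psi> (\<Sum>i\<in>I. indicat_real (A i) s *\<^sub>R v i))"
    and "(\<integral>\<omega>. iexp (\<Sum>i\<in>I. M (A i) \<omega> \<bullet> v i) \<partial>P) = exp (\<integral>s. \<psi> (\<Sum>i\<in>I. indicat_real (A i) s *\<^sub>R v i) \<partial>\<Theta>)"
proof -
  \<comment> \<open>The atom that belongs to the empty index set is left out: it may have infinite
    measure, and by \<open>\<psi> 0 = 0\<close> it contributes nothing.\<close>
  define S where "S = Pow I - {{}}"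
  define atm where "atm \<sigma> = {s \<in> space \<Theta>. \<forall>i\<in>I. s \<in> A i \<longleftrightarrow> i \<in> \<sigma>}" for \<sigma>
  define w where "w \<sigma> = (\<Sum>i\<in>\<sigma>. v i)" for \<sigma>
  have S: "finite S" using I by (simp add: S_def)
  have As: "A i \<in> sets \<Theta>" if "i \<in> I" for i using A that fms_sets by blast
  have atm_sets [measurable]: "atm \<sigma> \<in> sets \<Theta>" for \<sigma>
    unfolding atm_def
  proof (rule sets.sets_Collect_finite_All[OF _ I])
    fix i assume "i \<in> I"
    show "{s \<in> space \<Theta>. (s \<in> A i) = (i \<in> \<sigma>)} \<in> sets \<Theta>"
      using As[OF \<open>i \<in> I\<close>] by measurable
  qed
  have atm_fms: "atm \<sigma> \<in> finite_measure_sets \<Theta>" if \<sigma>: "\<sigma> \<in> S" for \<sigma>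
  proof -
    obtain i where i: "i \<in> \<sigma>" "i \<in> I" using \<sigma> by (auto simp: S_def)
    then have "atm \<sigma> \<subseteq> A i" by (auto simp: atm_def)
    then show ?thesis by (rule fms_subset[OF A[OF i(2)] atm_sets])
  qed
  have disj: "disjoint_family_on atm S'" if "S' \<subseteq> S" for S'
  proof -
    have "\<sigma> = \<tau>" if "\<sigma> \<in> S" "\<tau> \<in> S" "s \<in> atm \<sigma>" "s \<in> atm \<tau>" for \<sigma> \<tau> s
      using that by (auto simp: S_def atm_def)
    then show ?thesis using that unfolding disjoint_family_on_def by blast
  qed
  have A_eq: "A i = (\<Union>\<sigma>\<in>{\<sigma>. \<sigma> \<in> S \<and> i \<in> \<sigma>}. atm \<sigma>)" if "i \<in> I" for i
  proof
    show "A i \<subseteq> (\<Union>\<sigma>\<in>{\<sigma>. \<sigma> \<in> S \<and> i \<in> \<sigma>}. atm \<sigma>)"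
    proof
      fix s assume "s \<in> A i"
      with that As[OF that] have "s \<in> atm {j \<in> I. s \<in> A j}" "{j \<in> I. s \<in> A j} \<in> S" "i \<in> {j \<in> I. s \<in> A j}"
        using sets.sets_into_space[of "A i" \<Theta>] by (auto simp: atm_def S_def)
      then show "s \<in> (\<Union>\<sigma>\<in>{\<sigma>. \<sigma> \<in> S \<and> i \<in> \<sigma>}. atm \<sigma>)" by blast
    qed
    show "(\<Union>\<sigma>\<in>{\<sigma>. \<sigma> \<in> S \<and> i \<in> \<sigma>}. atm \<sigma>) \<subseteq> A i" using that by (auto simp: atm_def)
  qed
  have "AE \<omega> in P. M (A i) \<omega> = (\<Sum>\<sigma> | \<sigma> \<in> S \<and> i \<in> \<sigma>. M (atm \<sigma>) \<omega>)" if "i \<in> I" for i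
    unfolding A_eq[OF that]
  proof (rule M_finite_union)
    show "(\<Union>\<sigma>\<in>{\<sigma>. \<sigma> \<in> S \<and> i \<in> \<sigma>}. atm \<sigma>) \<in> finite_measure_sets \<Theta>" using A[OF that] A_eq[OF that] by simp
  qed (use S atm_fms disj in auto)
  then have "AE \<omega> in P. \<forall>i\<in>I. M (A i) \<omega> = (\<Sum>\<sigma> | \<sigma> \<in> S \<and> i \<in> \<sigma>. M (atm \<sigma>) \<omega>)"
    using I by (simp add: AE_finite_all)
  then have ae: "AE \<omega> in P. (\<Sum>i\<in>I. M (A i) \<omega> \<bullet> v i) = (\<Sum>\<sigma>\<in>S. M (atm \<sigma>) \<omega> \<bullet> w \<sigma>)"
  proof eventually_elim
    case (elim \<omega>)
    have "(\<Sum>i\<in>I. M (A i) \<omega> \<bullet> v i) = (\<Sum>i\<in>I. \<Sum>\<sigma> | \<sigma> \<in> S \<and> i \<in> \<sigma>. M (atm \<sigma>) \<omega> \<bullet> v i)"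
      using elim by (intro sum.cong) (auto simp: inner_sum_left)
    also have "\<dots> = (\<Sum>\<sigma>\<in>S. \<Sum>i | i \<in> I \<and> i \<in> \<sigma>. M (atm \<sigma>) \<omega> \<bullet> v i)"
      by (rule sum.swap_restrict[OF I S])
    also have "\<dots> = (\<Sum>\<sigma>\<in>S. M (atm \<sigma>) \<omega> \<bullet> w \<sigma>)"
    proof (rule sum.cong[OF refl])
      fix \<sigma> assume "\<sigma> \<in> S"
      then have "{i. i \<in> I \<and> i \<in> \<sigma>} = \<sigma>" by (auto simp: S_def)
      then show "(\<Sum>i | i \<in> I \<and> i \<in> \<sigma>. M (atm \<sigma>) \<omega> \<bullet> v i) = M (atm \<sigma>) \<omega> \<bullet> w \<sigma>"
        by (simp add: w_def inner_sum_right)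
    qed
    finally show ?case .
  qed
  have point: "\<psi> (\<Sum>i\<in>I. indicat_real (A i) s *\<^sub>R v i) = (\<Sum>\<sigma>\<in>S. indicat_real (atm \<sigma>) s *\<^sub>R \<psi> (w \<sigma>))" if s: "s \<in> space \<Theta>" for s
  proof -
    define \<tau> where "\<tau> = {i \<in> I. s \<in> A i}"
    have 1: "(\<Sum>i\<in>I. indicat_real (A i) s *\<^sub>R v i) = w \<tau>"
      unfolding w_def \<tau>_def using I by (auto simp: sum.inter_filter intro!: sum.cong)
    have 2: "indicat_real (atm \<sigma>) s = (if \<sigma> = \<tau> then 1 else 0)" if "\<sigma> \<in> S" for \<sigma>
      using that s by (auto simp: atm_def \<tau>_def S_def indicator_def)
    have "(\<Sum>\<sigma>\<in>S. indicat_real (atm \<sigma>) s *\<^sub>R \<psi> (w \<sigma>)) = (\<Sum>\<sigma>\<in>S. if \<sigma> = \<tau> then \<psi> (w \<sigma>) else 0)"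
      by (intro sum.cong) (auto simp: 2)
    also have "\<dots> = \<psi> (w \<tau>)"
    proof (cases "\<tau> = {}")
      case True
      then have "\<tau> \<notin> S" by (simp add: S_def)
      with True show ?thesis using S by (simp add: w_def)
    next
      case False
      then have "\<tau> \<in> S" by (auto simp: S_def \<tau>_def)
      then show ?thesis using S by simp
    qed
    finally show ?thesis using 1 by simp
  qed
  have atm_int: "integrable \<Theta> (\<lambda>s. indicat_real (atm \<sigma>) s *\<^sub>R \<psi> (w \<sigma>))" if "\<sigma> \<in> S" for \<sigma>
    using atm_fms[OF that] by (intro integrable_scaleR_left) (simp add: finite_measure_sets_def)
  have "integrable \<Theta> (\<lambda>s. \<Sum>\<sigma>\<in>S. indicat_real (atm \<sigma>) s *\<^sub>R \<psi> (w \<sigma>))"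
    using atm_int by (rule Bochner_Integration.integrable_sum)
  then show "integrable \<Theta> (\<lambda>s. \<psi> (\<Sum>i\<in>I. indicat_real (A i) s *\<^sub>R v i))"
    by (rule Bochner_Integration.integrable_cong[THEN iffD1, rotated 2]) (simp_all add: point)
  have "(\<integral>\<omega>. iexp (\<Sum>i\<in>I. M (A i) \<omega> \<bullet> v i) \<partial>P) = (\<integral>\<omega>. iexp (\<Sum>\<sigma>\<in>S. M (atm \<sigma>) \<omega> \<bullet> w \<sigma>) \<partial>P)"
  proof (rule integral_cong_AE)
    have [measurable]: "M (A i) \<in> borel_measurable P" if "i \<in> I" for i by (rule M_measurable[OF A[OF that]])
    have [measurable]: "M (atm \<sigma>) \<in> borel_measurable P" if "\<sigma> \<in> S" for \<sigma> by (rule M_measurable[OF atm_fms[OF that]])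
    show "(\<lambda>\<omega>. iexp (\<Sum>i\<in>I. M (A i) \<omega> \<bullet> v i)) \<in> borel_measurable P" by measurable
    show "(\<lambda>\<omega>. iexp (\<Sum>\<sigma>\<in>S. M (atm \<sigma>) \<omega> \<bullet> w \<sigma>)) \<in> borel_measurable P" by measurable
    show "AE \<omega> in P. iexp (\<Sum>i\<in>I. M (A i) \<omega> \<bullet> v i) = iexp (\<Sum>\<sigma>\<in>S. M (atm \<sigma>) \<omega> \<bullet> w \<sigma>)"
      using ae by eventually_elim simp
  qed
  also have "\<dots> = exp (\<Sum>\<sigma>\<in>S. complex_of_real (measure \<Theta> (atm \<sigma>)) * \<psi> (w \<sigma>))"
    by (rule disjoint_char[OF S atm_fms disj]) auto
  also have "(\<Sum>\<sigma>\<in>S. complex_of_real (measure \<Theta> (atm \<sigma>)) * \<psi> (w \<sigma>)) = (\<integral>s. (\<Sum>\<sigma>\<in>S. indicat_real (atm \<sigma>) s *\<^sub>R \<psi> (w \<sigma>)) \<partial>\<Theta>)"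
    using atm_fms atm_int by (subst Bochner_Integration.integral_sum)
      (auto simp: finite_measure_sets_def scaleR_conv_of_real intro!: sum.cong)
  also have "\<dots> = (\<integral>s. \<psi> (\<Sum>i\<in>I. indicat_real (A i) s *\<^sub>R v i) \<partial>\<Theta>)"
    by (intro Bochner_Integration.integral_cong) (simp_all add: point)
  finally show "(\<integral>\<omega>. iexp (\<Sum>i\<in>I. M (A i) \<omega> \<bullet> v i) \<partial>P) = exp (\<integral>s. \<psi> (\<Sum>i\<in>I. indicat_real (A i) s *\<^sub>R v i) \<partial>\<Theta>)" .
qed

end


section \<open>Powers of matrices and their growth\<close>

text \<open>Multiplication of matrices in the class sense is componentwise; the exponential of the library
  applies only after passing to a type whose multiplication is composition.\<close>

typedef (overloaded) ('a::euclidean_space) endo = "UNIV :: ('a \<Rightarrow>\<^sub>L 'a) set"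
  morphisms run_endo Endo by simp

setup_lifting type_definition_endo

instantiation endo :: (euclidean_space) real_normed_algebra_1
begin

lift_definition zero_endo :: "'a endo" is 0 .
lift_definition one_endo :: "'a endo" is id_blinfun .
lift_definition plus_endo :: "'a endo \<Rightarrow> 'a endo \<Rightarrow> 'a endo" is "(+)" .
lift_definition minus_endo :: "'a endo \<Rightarrow> 'a endo \<Rightarrow> 'a endo" is "(-)" .
lift_definition uminus_endo :: "'a endo \<Rightarrow> 'a endo" is uminus .
lift_definition times_endo :: "'a endo \<Rightarrow> 'a endo \<Rightarrow> 'a endo" is "(o\<^sub>L)" .
lift_definition scaleR_endo :: "real \<Rightarrow> 'a endo \<Rightarrow> 'a endo" is "(*\<^sub>R)" .
lift_definition norm_endo :: "'a endo \<Rightarrow> real" is norm .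

definition dist_endo :: "'a endo \<Rightarrow> 'a endo \<Rightarrow> real" where "dist_endo S T = norm (S - T)"
definition sgn_endo :: "'a endo \<Rightarrow> 'a endo" where "sgn_endo T = scaleR (inverse (norm T)) T"
definition uniformity_endo :: "('a endo \<times> 'a endo) filter" where
  "uniformity_endo = (INF e\<in>{0<..}. principal {(x, y). dist x y < e})"
definition open_endo :: "'a endo set \<Rightarrow> bool" where
  "open_endo U \<longleftrightarrow> (\<forall>x\<in>U. \<forall>\<^sub>F (x', y) in uniformity. x' = x \<longrightarrow> y \<in> U)"

instance
proof
  fix x y z :: "'a endo" and a b :: real
  show "dist x y = norm (x - y)" by (simp add: dist_endo_def)
  show "sgn x = scaleR (inverse (norm x)) x" by (simp add: sgn_endo_def)
  show "(uniformity :: ('a endo \<times> 'a endo) filter) = (INF e\<in>{0<..}. principal {(x, y). dist x y < e})"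
    by (simp add: uniformity_endo_def)
  show "open U \<longleftrightarrow> (\<forall>x\<in>U. \<forall>\<^sub>F (x', y) in uniformity. x' = x \<longrightarrow> y \<in> U)" for U :: "'a endo set"
    by (simp add: open_endo_def)
  show "(0 :: 'a endo) \<noteq> 1"
    by transfer (metis norm_blinfun_id norm_zero zero_neq_one)
  show "norm (1 :: 'a endo) = 1" by transfer (rule norm_blinfun_id)
  show "norm (x * y) \<le> norm x * norm y" by transfer (rule norm_blinfun_compose)
  show "norm (x + y) \<le> norm x + norm y" by transfer (rule norm_triangle_ineq)
  show "norm x = 0 \<longleftrightarrow> x = 0" by transfer simp
  show "norm (scaleR a x) = \<bar>a\<bar> * norm x" by transfer simp
qed (transfer, auto intro!: blinfun_eqI simp: blinfun.bilinear_simps algebra_simps)+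

end

instance endo :: (euclidean_space) banach
proof
  fix X :: "nat \<Rightarrow> 'a endo" assume "Cauchy X"
  then have "Cauchy (\<lambda>n. run_endo (X n))"
    unfolding Cauchy_def dist_norm by transfer simp
  then obtain L where "(\<lambda>n. run_endo (X n)) \<longlonglongrightarrow> L"
    using Cauchy_convergent_iff convergent_def by blast
  then have "X \<longlonglongrightarrow> Endo L"
    unfolding lim_sequentially dist_norm
    by (simp add: norm_endo.rep_eq minus_endo.rep_eq Endo_inverse)
  then show "convergent X" by (auto simp: convergent_def)
qed

section \<open>The matrix exponential as an exponential in a Banach algebra\<close>

definition mat_of_endo :: "(real^'n) endo \<Rightarrow> real^'n^'n" where
  "mat_of_endo T = matrix (blinfun_apply (run_endo T))"

definition endo_of_mat :: "real^'n^'n \<Rightarrow> (real^'n) endo" where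
  "endo_of_mat A = Endo (Blinfun ((*v) A))"

lemma run_endo_of_mat: "blinfun_apply (run_endo (endo_of_mat A)) = (*v) A"
  by (simp add: endo_of_mat_def Endo_inverse bounded_linear_Blinfun_apply matrix_vector_mul_bounded_linear)

lemma mat_of_endo_of_mat [simp]: "mat_of_endo (endo_of_mat A) = A"
  by (simp add: mat_of_endo_def run_endo_of_mat)

lemma mat_of_endo_component: "mat_of_endo T $ i $ j = blinfun_apply (run_endo T) (axis j 1) $ i"
  by (simp add: mat_of_endo_def matrix_def)

lemma endo_of_mat_of_endo [simp]: "endo_of_mat (mat_of_endo T) = T"
  by (simp add: endo_of_mat_def mat_of_endo_def run_endo_inverse blinfun_apply_inverse
      matrix_works bounded_linear.linear blinfun.bounded_linear_right)

lemma mat_of_endo_mult: "mat_of_endo (S * T) = mat_of_endo S ** mat_of_endo T"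
  unfolding mat_of_endo_def times_endo.rep_eq
  by (subst matrix_compose[symmetric])
    (auto simp: o_def fun_eq_iff bounded_linear.linear blinfun.bounded_linear_right intro!: arg_cong[where f=matrix])

lemma endo_of_mat_mult: "endo_of_mat (A ** B) = endo_of_mat A * endo_of_mat B"
  by (metis endo_of_mat_of_endo mat_of_endo_mult mat_of_endo_of_mat)

lemma mat_of_endo_1 [simp]: "mat_of_endo 1 = mat 1"
  by (simp add: mat_of_endo_def one_endo.rep_eq matrix_id_mat_1[symmetric] id_def)

lemma bounded_linear_mat_of_endo: "bounded_linear mat_of_endo"
proof (rule bounded_linear_intro)
  show "mat_of_endo (S + T) = mat_of_endo S + mat_of_endo T" for S T :: "(real^'a) endo"
    by (simp add: vec_eq_iff mat_of_endo_component plus_endo.rep_eq blinfun.bilinear_simps)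
  show "mat_of_endo (c *\<^sub>R T) = c *\<^sub>R mat_of_endo T" for c and T :: "(real^'a) endo"
    by (simp add: vec_eq_iff mat_of_endo_component scaleR_endo.rep_eq blinfun.bilinear_simps)
  show "norm (mat_of_endo T) \<le> norm T * (real CARD('a) * real CARD('a))" for T :: "(real^'a) endo"
  proof -
    have c: "\<bar>mat_of_endo T $ i $ j\<bar> \<le> norm T" for i j
    proof -
      have "\<bar>mat_of_endo T $ i $ j\<bar> \<le> norm (blinfun_apply (run_endo T) (axis j 1))"
        unfolding mat_of_endo_component by (rule component_le_norm_cart)
      also have "\<dots> \<le> norm (run_endo T) * norm (axis j 1 :: real^'a)" by (rule norm_blinfun)
      finally show ?thesis by (simp add: norm_endo.rep_eq)
    qed
    have "norm (mat_of_endo T $ i) \<le> real CARD('a) * norm T" for i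
      using norm_le_l1_cart[of "mat_of_endo T $ i"] sum_bounded_above[of UNIV "\<lambda>j. \<bar>mat_of_endo T $ i $ j\<bar>" "norm T"] c
      by (auto intro: order_trans)
    then have "(\<Sum>i\<in>UNIV. norm (mat_of_endo T $ i)) \<le> real CARD('a) * (real CARD('a) * norm T)"
      using sum_bounded_above[of UNIV "\<lambda>i. norm (mat_of_endo T $ i)" "real CARD('a) * norm T"] by auto
    moreover have "norm (mat_of_endo T) \<le> (\<Sum>i\<in>UNIV. norm (mat_of_endo T $ i))"
      unfolding norm_vec_def by (rule L2_set_le_sum) simp
    ultimately show ?thesis by (simp add: algebra_simps)
  qed
qed

lemma endo_of_mat_scaleR: "endo_of_mat (c *\<^sub>R A) = c *\<^sub>R endo_of_mat A"
  using endo_of_mat_of_endo[of "c *\<^sub>R endo_of_mat A"]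
  by (simp add: linear_simps[OF bounded_linear_mat_of_endo] del: endo_of_mat_of_endo)

lemma endo_of_mat_add: "endo_of_mat (A + B) = endo_of_mat A + endo_of_mat B"
  using endo_of_mat_of_endo[of "endo_of_mat A + endo_of_mat B"]
  by (simp add: linear_simps[OF bounded_linear_mat_of_endo] del: endo_of_mat_of_endo)

lemma mat_of_endo_power: "mat_of_endo (T ^ k) = ((**) (mat_of_endo T) ^^ k) (mat 1)"
  by (induction k) (auto simp: mat_of_endo_mult)

lemma mat_exp_sums: "(\<lambda>k. (1 / fact k) *\<^sub>R (((**) A ^^ k) (mat 1))) sums mat_of_endo (exp (endo_of_mat A))"
  using bounded_linear.sums[OF bounded_linear_mat_of_endo exp_converges[of "endo_of_mat A"]]
  by (simp add: linear_simps[OF bounded_linear_mat_of_endo] mat_of_endo_power divide_inverse)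

lemma mat_exp_eq: "mat_exp A = mat_of_endo (exp (endo_of_mat A))"
  unfolding mat_exp_def using mat_exp_sums by (rule sums_unique[symmetric])

lemma mat_exp_sums': "(\<lambda>k. (1 / fact k) *\<^sub>R (((**) A ^^ k) (mat 1))) sums mat_exp A"
  using mat_exp_sums by (simp add: mat_exp_eq)

lemma mat_exp_0 [simp]: "mat_exp 0 = mat 1"
proof -
  have "endo_of_mat (0::real^'a^'a) = 0"
    using endo_of_mat_of_endo[of "0 :: (real^'a) endo"]
    by (simp add: linear_simps[OF bounded_linear_mat_of_endo] del: endo_of_mat_of_endo)
  then show ?thesis by (simp add: mat_exp_eq)
qed

lemma mat_exp_add:
  assumes "A ** B = B ** A"
  shows "mat_exp (A + B) = mat_exp A ** mat_exp B"
  using assms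
  by (simp add: mat_exp_eq endo_of_mat_add exp_add_commuting mat_of_endo_mult endo_of_mat_mult[symmetric])

lemma mat_exp_has_vector_derivative:
  "((\<lambda>t. mat_exp (t *\<^sub>R A)) has_vector_derivative (mat_exp (t *\<^sub>R A) ** A)) (at t within S)"
  unfolding mat_exp_eq endo_of_mat_scaleR
  using bounded_linear.has_vector_derivative[OF bounded_linear_mat_of_endo
      exp_scaleR_has_vector_derivative_right[of "endo_of_mat A" t S]]
  by (simp add: mat_of_endo_mult)


lemma bounded_linear_matrix_mult_right: "bounded_linear (\<lambda>A::real^'n^'m. B ** A)"
  unfolding linear_conv_bounded_linear[symmetric]
  by (auto intro!: linearI simp: matrix_add_ldistrib matrix_scalar_ac scalar_matrix_assoc)

lemma bounded_linear_matrix_mult_left: "bounded_linear (\<lambda>A::real^'n^'m. A ** B)"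
  unfolding linear_conv_bounded_linear[symmetric]
  by (auto intro!: linearI simp: scalar_matrix_assoc)
    (simp add: matrix_matrix_mult_def vec_eq_iff algebra_simps sum.distrib)

lemma bounded_linear_transpose: "bounded_linear (transpose :: real^'n^'m \<Rightarrow> real^'m^'n)"
  unfolding linear_conv_bounded_linear[symmetric]
  by (auto intro!: linearI simp: transpose_scalar) (simp add: transpose_def vec_eq_iff)

text \<open>Bounded linear maps act on the exponential series term by term, so an identity between
  powers passes to the exponentials. Commutation, transposition and change of the index type are all
  instances.\<close>

lemma matrix_mul_cong_sums:
  assumes "\<And>k. L ((1 / fact k) *\<^sub>R (((**) A ^^ k) (mat 1))) = (1 / fact k) *\<^sub>R R (((**) C ^^ k) (mat 1))"
    and "bounded_linear L" "bounded_linear R"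
  shows "L (mat_exp A) = R (mat_exp C)"
proof (rule sums_unique2)
  show "(\<lambda>k. L ((1 / fact k) *\<^sub>R (((**) A ^^ k) (mat 1)))) sums L (mat_exp A)"
    by (rule bounded_linear.sums[OF assms(2) mat_exp_sums'])
  show "(\<lambda>k. L ((1 / fact k) *\<^sub>R (((**) A ^^ k) (mat 1)))) sums R (mat_exp C)"
    using bounded_linear.sums[OF assms(3) mat_exp_sums'[of C]]
    by (simp add: assms(1) linear_simps[OF assms(3)])
qed

lemma mat_power_commute:
  assumes "A ** C = C ** A"
  shows "((**) A ^^ k) (mat 1) ** C = C ** ((**) A ^^ k) (mat 1)"
proof (induction k)
  case (Suc k)
  have "((**) A ^^ Suc k) (mat 1) ** C = A ** (C ** ((**) A ^^ k) (mat 1))"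
    by (simp add: matrix_mul_assoc[symmetric] Suc)
  also have "\<dots> = C ** ((**) A ^^ Suc k) (mat 1)"
    by (simp add: matrix_mul_assoc assms)
  finally show ?case .
qed simp

lemma mat_exp_commute:
  assumes "A ** C = C ** A"
  shows "mat_exp A ** C = C ** mat_exp A"
  by (rule matrix_mul_cong_sums[OF _ bounded_linear_matrix_mult_left bounded_linear_matrix_mult_right])
    (simp add: mat_power_commute[OF assms] scalar_matrix_assoc[symmetric])

lemma transpose_mat_power:
  fixes A :: "real^'n^'n"
  shows "transpose (((**) A ^^ k) (mat 1)) = ((**) (transpose A) ^^ k) (mat 1)"
proof (induction k)
  case (Suc k)
  have "transpose (((**) A ^^ Suc k) (mat 1)) = ((**) (transpose A) ^^ k) (mat 1) ** transpose A"
    by (simp add: matrix_transpose_mul Suc)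
  then show ?case by (simp add: mat_power_commute)
qed simp

lemma transpose_mat_exp: "transpose (mat_exp A) = mat_exp (transpose A)"
  by (rule matrix_mul_cong_sums[OF _ bounded_linear_transpose bounded_linear_ident])
    (simp add: transpose_scalar transpose_mat_power)

lemma mat_exp_minus: "mat_exp A ** mat_exp (- A) = mat 1" "mat_exp (- A) ** mat_exp A = mat 1"
proof -
  have "A ** (- A) = (- A) ** A"
    by (simp add: linear_simps(4)[OF bounded_linear_matrix_mult_left] linear_simps(4)[OF bounded_linear_matrix_mult_right])
  then show "mat_exp A ** mat_exp (- A) = mat 1" "mat_exp (- A) ** mat_exp A = mat 1"
    using mat_exp_add[of A "-A"] mat_exp_add[of "-A" A] by auto
qed

declare transpose_matrix_vector [simp del]

lemma norm_matrix_vector_mult: "norm (A *v x) \<le> norm A * norm x" for A :: "real^'n^'m"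
proof -
  have "norm (A *v x) \<le> L2_set (\<lambda>i. norm (A $ i) * norm x) UNIV"
    unfolding norm_vec_def[of "A *v x"]
    by (rule L2_set_mono) (auto simp: matrix_vector_mul_component Cauchy_Schwarz_ineq2)
  also have "\<dots> = norm A * norm x"
    by (simp add: norm_vec_def[of A] L2_set_left_distrib)
  finally show ?thesis .
qed

lemma norm_transpose: "norm (transpose A) = norm A" for A :: "real^'n^'m"
  unfolding norm_vec_def L2_set_def transpose_def
  by (simp add: sum_nonneg) (rule sum.swap)

lemma norm_matrix_matrix_mult: "norm (A ** B) \<le> norm A * norm B" for A :: "real^'n^'m" and B :: "real^'k^'n"
proof -
  have row: "(A ** B) $ i = transpose B *v (A $ i)" for i
    by (simp add: vec_eq_iff matrix_matrix_mult_def matrix_vector_mult_def transpose_def mult.commute)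
  have "norm (A ** B) \<le> L2_set (\<lambda>i. norm (A $ i) * norm B) UNIV"
    unfolding norm_vec_def[of "A ** B"]
    by (rule L2_set_mono) (auto simp: row mult.commute norm_matrix_vector_mult[of "transpose B", unfolded norm_transpose])
  also have "\<dots> = norm A * norm B"
    by (simp add: norm_vec_def[of A] L2_set_left_distrib)
  finally show ?thesis .
qed

section \<open>Powers of positive numbers with matrix exponents\<close>

lemma powm_pos: "0 < s \<Longrightarrow> s powm A = mat_exp (ln s *\<^sub>R A)"
  by (simp add: mat_powr_def)

lemma powm_nonpos [simp]: "s \<le> 0 \<Longrightarrow> s powm A = 0"
  by (simp add: mat_powr_def)

lemma powm_one [simp]: "1 powm A = mat 1"
  by (simp add: mat_powr_def)

lemma scaleR_matrix_commute: "A ** C = C ** A \<Longrightarrow> (r *\<^sub>R A) ** C = C ** (r *\<^sub>R A)" for A :: "real^'n^'n"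
  by (simp add: matrix_scalar_ac scalar_matrix_assoc[symmetric])

lemma powm_mult:
  assumes "0 < s" "0 < t"
  shows "(s * t) powm A = s powm A ** t powm A"
  using mat_exp_add[of "ln s *\<^sub>R A" "ln t *\<^sub>R A"] assms
  by (simp add: powm_pos ln_mult algebra_simps matrix_scalar_ac scalar_matrix_assoc[symmetric])

lemma powm_inverse: "0 < s \<Longrightarrow> s powm A ** (1 / s) powm A = mat 1"
  "0 < s \<Longrightarrow> (1 / s) powm A ** s powm A = mat 1"
  using powm_mult[of s "1/s" A] powm_mult[of "1/s" s A] by auto

lemma powm_add:
  assumes "0 < s" "A ** C = C ** A"
  shows "s powm (A + C) = s powm A ** s powm C"
  using mat_exp_add[of "ln s *\<^sub>R A" "ln s *\<^sub>R C"] assms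
  by (simp add: powm_pos algebra_simps matrix_scalar_ac scalar_matrix_assoc[symmetric])

lemma powm_scaleR: "0 < s \<Longrightarrow> s powm (q *\<^sub>R A) = (s powr q) powm A"
  by (simp add: powm_pos mult.commute)

lemma transpose_powm: "transpose (s powm A) = s powm (transpose A)"
  by (simp add: mat_powr_def transpose_mat_exp transpose_scalar) (simp add: transpose_def vec_eq_iff)

lemma powm_commute:
  assumes "A ** C = C ** A"
  shows "s powm A ** C = C ** s powm A"
  using mat_exp_commute[OF scaleR_matrix_commute[OF assms, of "ln s"]]
  by (auto simp: mat_powr_def linear_simps(3)[OF bounded_linear_matrix_mult_left] linear_simps(3)[OF bounded_linear_matrix_mult_right])

lemma powm_has_vector_derivative:
  assumes "0 < s"
  shows "((\<lambda>s. s powm A) has_vector_derivative (1 / s) *\<^sub>R (s powm A ** A)) (at s)"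
proof -
  have "((\<lambda>t. mat_exp (t *\<^sub>R A)) \<circ> ln has_vector_derivative (1 / s) *\<^sub>R (mat_exp (ln s *\<^sub>R A) ** A)) (at s)"
    using assms
    by (intro vector_diff_chain_at mat_exp_has_vector_derivative)
       (auto simp: has_real_derivative_iff_has_vector_derivative[symmetric] intro!: derivative_eq_intros)
  then have "((\<lambda>s. mat_exp (ln s *\<^sub>R A)) has_vector_derivative (1 / s) *\<^sub>R (s powm A ** A)) (at s)"
    using assms by (simp add: o_def powm_pos)
  then show ?thesis
    by (rule has_vector_derivative_transform_within_open[where S="{0<..}"]) (use assms in \<open>auto simp: powm_pos\<close>)
qed

lemma isCont_powm: "0 < s \<Longrightarrow> isCont (\<lambda>s. s powm A) s"
  by (rule has_vector_derivative_continuous[OF powm_has_vector_derivative])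

lemma continuous_on_powm: "continuous_on {0<..} (\<lambda>s. s powm A)"
  by (intro continuous_at_imp_continuous_on ballI isCont_powm) auto

lemma borel_measurable_powm [measurable]: "(\<lambda>s. s powm A) \<in> borel_measurable borel"
proof -
  have "(\<lambda>s. if s \<in> {0<..} then s powm A else 0) \<in> borel_measurable borel"
    by (intro borel_measurable_continuous_on_if continuous_on_powm) auto
  also have "(\<lambda>s. if s \<in> {0<..} then s powm A else 0) = (\<lambda>s. s powm A)"
    by (auto simp: fun_eq_iff)
  finally show ?thesis .
qed

section \<open>The determinant of a matrix exponential\<close>

lemma permutes_no_single_move:
  assumes "p permutes UNIV" "p \<noteq> id"
  shows "\<exists>j. j \<noteq> i \<and> p j \<noteq> j"
proof (rule ccontr)
  assume "\<not> ?thesis"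
  then have fixed: "p j = j" if "j \<noteq> i" for j using that by auto
  then have "p i = i"
    by (metis assms(1) permutes_inj injD)
  with fixed have "p = id" by (metis eq_id_iff)
  with assms show False by simp
qed

text \<open>Jacobi's formula at the identity. Differentiating the Leibniz expansion removes one
  factor from each product. A permutation other than the identity moves at least two indices, so an
  off-diagonal zero is still left in its product.\<close>

lemma det_has_derivative_at_identity:
  fixes C :: "real \<Rightarrow> real^'n^'n"
  assumes "(C has_vector_derivative E) (at t)" "C t = mat 1"
  shows "((\<lambda>t. det (C t)) has_real_derivative trace E) (at t)"
proof -
  have entry: "((\<lambda>t. C t $ i $ j) has_real_derivative E $ i $ j) (at t)" for i j
    unfolding has_real_derivative_iff_has_vector_derivative
    by (intro bounded_linear.has_vector_derivative[OF bounded_linear_vec_nth] assms)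
  define d where "d p = (\<Sum>i\<in>UNIV. E $ i $ p i * (\<Prod>j\<in>UNIV - {i}. C t $ j $ p j))" for p
  have prod: "((\<lambda>t. \<Prod>i\<in>UNIV. C t $ i $ p i) has_real_derivative d p) (at t)" for p
    unfolding d_def by (intro has_field_derivative_prod entry)
  have "((\<lambda>t. det (C t)) has_real_derivative (\<Sum>p | p permutes UNIV. of_int (sign p) * d p)) (at t)"
    unfolding det_def by (intro DERIV_sum DERIV_cmult prod)
  moreover have "(\<Sum>p | p permutes UNIV. of_int (sign p) * d p) = (\<Sum>p\<in>{id::'n\<Rightarrow>'n}. of_int (sign p) * d p)"
  proof (intro sum.mono_neutral_right ballI)
    fix p :: "'n \<Rightarrow> 'n" assume "p \<in> {p. p permutes UNIV} - {id}"
    then have "(\<Prod>j\<in>UNIV - {i}. C t $ j $ p j) = 0" for i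
      using permutes_no_single_move[of p i] by (auto simp: assms(2) mat_def)
    then show "of_int (sign p) * d p = 0" unfolding d_def by (simp del: prod_zero_iff)
  qed (auto simp: permutes_id finite_permutations)
  moreover have "d id = trace E"
    by (simp add: d_def trace_def assms(2) mat_def)
  ultimately show ?thesis by (simp add: sign_id)
qed

text \<open>The function \<open>h\<close> turns sums into products, so its derivative at 0
  determines it through the equation \<open>h' = h * trace E\<close>.\<close>

lemma det_mat_exp: "det (mat_exp (t *\<^sub>R E)) = exp (t * trace E)"
proof -
  define h where "h t = det (mat_exp (t *\<^sub>R E))" for t
  have h_add: "h (s + t) = h s * h t" for s t
    unfolding h_def using mat_exp_add[of "s *\<^sub>R E" "t *\<^sub>R E"]
    by (simp add: det_mul scaleR_left_distrib matrix_scalar_ac scalar_matrix_assoc[symmetric])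
  have h0: "(h has_real_derivative trace E) (at 0)"
    unfolding h_def
    by (rule det_has_derivative_at_identity) (use mat_exp_has_vector_derivative[of E 0 UNIV] in auto)
  have h': "(h has_real_derivative h t * trace E) (at t)" for t
  proof -
    have "((\<lambda>s. h t * h (s - t)) has_real_derivative h t * trace E) (at t)"
      using DERIV_shift[of h "trace E" t "-t"] h0 by (intro DERIV_cmult) simp
    also have "(\<lambda>s. h t * h (s - t)) = h" by (simp add: h_add[symmetric] fun_eq_iff)
    finally show ?thesis .
  qed
  have "((\<lambda>t. h t * exp (- t * trace E)) has_real_derivative 0) (at t)" for t
    by (rule DERIV_cong) (rule h' derivative_eq_intros refl | simp)+
  then have "h t * exp (- t * trace E) = h 0 * exp (- 0 * trace E)"
    by (intro DERIV_isconst_all) auto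
  then show ?thesis
    by (simp add: h_def exp_minus field_simps)
qed

lemma det_powm: "0 < s \<Longrightarrow> det (s powm E) = s powr trace E"
  by (simp add: powm_pos det_mat_exp powr_def mult.commute)

section \<open>Complexification and annihilating products of linear factors\<close>

definition cmat :: "real^'n^'m \<Rightarrow> complex^'n^'m" where
  "cmat A = (\<chi> i j. complex_of_real (A $ i $ j))"

definition cvec :: "real^'n \<Rightarrow> complex^'n" where
  "cvec x = (\<chi> i. complex_of_real (x $ i))"

lemma complex_eigenvalues_iff:
  "z \<in> complex_eigenvalues A \<longleftrightarrow> (\<exists>v. v \<noteq> 0 \<and> cmat A *v v = z *s v)"
  by (simp add: complex_eigenvalues_def cmat_def)

lemma cmat_mult: "cmat (A ** B) = cmat A ** cmat B"
  by (simp add: cmat_def matrix_matrix_mult_def vec_eq_iff)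

lemma cmat_mult_cvec: "cmat A *v cvec x = cvec (A *v x)"
  by (simp add: cmat_def cvec_def matrix_vector_mult_def vec_eq_iff)

lemma norm_cvec: "norm (cvec x) = norm x"
  by (simp add: norm_vec_def cvec_def L2_set_def)

lemma bounded_linear_cmat_mult: "bounded_linear (\<lambda>M. cmat M *v v)"
  unfolding linear_conv_bounded_linear[symmetric]
  by (intro linearI) (simp_all add: cmat_def matrix_vector_mult_def vec_eq_iff algebra_simps sum.distrib sum_distrib_left scaleR_conv_of_real[where 'a=complex])

lemma norm_smult_vec: "norm (c *s v) = cmod c * norm v" for v :: "complex^'n"
  by (simp add: norm_vec_def L2_set_right_distrib norm_mult)

lemma bounded_bilinear_smult: "bounded_bilinear (\<lambda>(c::complex) (v::complex^'n). c *s v)"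
proof
  show "\<exists>K. \<forall>c v. norm (c *s v :: complex^'n) \<le> norm c * norm v * K"
    by (rule exI[of _ 1]) (simp add: norm_smult_vec)
qed (simp_all add: vec_eq_iff algebra_simps)

text \<open>This is the product \<open>(T - z_1) ... (T - z_k)\<close> applied to \<open>v\<close>.
  Such products take the place of the Jordan normal form in the growth estimates.\<close>

fun annihil :: "complex^'n^'n \<Rightarrow> complex list \<Rightarrow> complex^'n \<Rightarrow> complex^'n" where
  "annihil T [] v = v"
| "annihil T (z # zs) v = T *v annihil T zs v - z *s annihil T zs v"

lemma annihil_append: "annihil T (xs @ ys) v = annihil T xs (annihil T ys v)"
  by (induction xs) auto

lemma annihil_add: "annihil T xs (v + w) = annihil T xs v + annihil T xs w"
  by (induction xs) (auto simp: matrix_vector_right_distrib vector_add_ldistrib)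

lemma annihil_smult: "annihil T xs (c *s v) = c *s annihil T xs v"
  by (induction xs) (auto simp: vector_scalar_commute vector_ssub_ldistrib vector_smult_assoc mult.commute)

lemma annihil_0: "annihil T xs 0 = 0"
  using annihil_smult[of T xs 0 0] by simp

lemma annihil_diff: "annihil T xs (v - w) = annihil T xs v - annihil T xs w"
  using annihil_add[of T xs v "(-1) *s w"] annihil_smult[of T xs "-1" w]
  by (simp add: vector_smult_lneg)

lemma annihil_commute1: "annihil T xs (T *v v) = T *v annihil T xs v"
  by (induction xs) (auto simp: matrix_vector_mult_diff_distrib vector_scalar_commute)

lemma annihil_commute: "annihil T xs (annihil T ys v) = annihil T ys (annihil T xs v)"
  by (induction ys) (auto simp: annihil_diff annihil_commute1 annihil_smult)

lemma annihil_sum: "annihil T xs (\<Sum>i\<in>I. f i) = (\<Sum>i\<in>I. annihil T xs (f i))"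
  by (induction I rule: infinite_finite_induct) (auto simp: annihil_0 annihil_add)

text \<open>The polynomial is split over the complex numbers one root at a time: passing from
  \<open>v\<close> to \<open>w = (T - z) v\<close> leaves the quotient polynomial as the one that
  kills \<open>w\<close>.\<close>

lemma annihil_of_poly:
  fixes T :: "complex^'n^'n"
  assumes "p \<noteq> 0" "degree p = n" "(\<Sum>i\<le>n. coeff p i *s (((*v) T ^^ i) v)) = 0"
  shows "\<exists>xs. annihil T xs v = 0"
  using assms
proof (induction n arbitrary: p v)
  case 0
  then have "coeff p 0 \<noteq> 0" using leading_coeff_neq_0 by fastforce
  with 0 have "annihil T [] v = 0" by (simp add: vector_mul_eq_0)
  then show ?case by blast
next
  case (Suc n)
  then obtain z where z: "poly p z = 0"
    using fundamental_theorem_of_algebra[of p] by (metis constant_degree nat.distinct(1))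
  then obtain r where r: "p = [:-z, 1:] * r" by (metis dvdE poly_eq_0_iff_dvd)
  have r0: "r \<noteq> 0" using Suc.prems r by auto
  have deg: "degree r = n"
    using Suc.prems(2) r0 by (simp add: r degree_mult_eq del: mult_pCons_left)
  define w where "w = T *v v - z *s v"
  have pow: "((*v) T ^^ i) w = ((*v) T ^^ Suc i) v - z *s ((*v) T ^^ i) v" for i
    by (induction i) (auto simp: w_def matrix_vector_mult_diff_distrib vector_scalar_commute)
  have cp: "coeff p i = (case i of 0 \<Rightarrow> 0 | Suc j \<Rightarrow> coeff r j) - z * coeff r i" for i
    by (simp add: r coeff_pCons split: nat.splits)
  have "(\<Sum>i\<le>Suc n. coeff p i *s (((*v) T ^^ i) v))
      = (\<Sum>i\<le>Suc n. (case i of 0 \<Rightarrow> 0 | Suc j \<Rightarrow> coeff r j) *s (((*v) T ^^ i) v))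
        - (\<Sum>i\<le>Suc n. (z * coeff r i) *s (((*v) T ^^ i) v))"
    by (simp add: cp vector_sub_rdistrib sum_subtractf)
  also have "(\<Sum>i\<le>Suc n. (case i of 0 \<Rightarrow> 0 | Suc j \<Rightarrow> coeff r j) *s (((*v) T ^^ i) v))
      = (\<Sum>i\<le>n. coeff r i *s (((*v) T ^^ Suc i) v))"
    by (subst sum.atMost_Suc_shift) simp
  also have "(\<Sum>i\<le>Suc n. (z * coeff r i) *s (((*v) T ^^ i) v)) = (\<Sum>i\<le>n. (z * coeff r i) *s (((*v) T ^^ i) v))"
    using deg by (simp add: coeff_eq_0)
  also have "(\<Sum>i\<le>n. coeff r i *s (((*v) T ^^ Suc i) v)) - (\<Sum>i\<le>n. (z * coeff r i) *s (((*v) T ^^ i) v))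
      = (\<Sum>i\<le>n. coeff r i *s (((*v) T ^^ i) w))"
    unfolding pow by (simp add: sum_subtractf vec_eq_iff algebra_simps)
  finally have "(\<Sum>i\<le>n. coeff r i *s (((*v) T ^^ i) w)) = 0" using Suc.prems by simp
  from Suc.IH[OF r0 deg this] obtain xs where "annihil T xs w = 0" by blast
  then have "annihil T (xs @ [z]) v = 0" by (simp add: annihil_append w_def)
  then show ?case by blast
qed

text \<open>Otherwise every initial segment of the sequence would be linearly independent, against
  the dimension.\<close>

lemma linear_recurrence_exists:
  fixes f :: "nat \<Rightarrow> 'a::euclidean_space"
  shows "\<exists>k c. f k = (\<Sum>i<k. c i *\<^sub>R f i)"
proof -
  have "\<exists>k. f k \<in> span (f ` {..<k})"
  proof (rule ccontr)
    assume none: "\<not> ?thesis"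
    have ind: "independent (f ` {..<k}) \<and> card (f ` {..<k}) = k" for k
    proof (induction k)
      case (Suc k)
      have nsp: "f k \<notin> span (f ` {..<k})" using none by blast
      then have nin: "f k \<notin> f ` {..<k}" using span_base[of "f k" "f ` {..<k}"] by metis
      have eq: "f ` {..<Suc k} = insert (f k) (f ` {..<k})" by (simp add: lessThan_Suc)
      show ?case
        unfolding eq using Suc nsp nin by (simp add: independent_insertI)
    qed (simp add: independent_empty)
    have "card (f ` {..<Suc DIM('a)}) \<le> DIM('a)"
      using ind[of "Suc DIM('a)"] independent_bound[of "f ` {..<Suc DIM('a)}"] by blast
    with ind[of "Suc DIM('a)"] show False by simp
  qed
  then obtain k where k: "f k \<in> span (f ` {..<k})" by blast
  have "x \<in> span (f ` {..<k}) \<Longrightarrow> \<exists>c. x = (\<Sum>i<k. c i *\<^sub>R f i)" for x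
  proof (induction rule: span_induct_alt)
    case base
    show ?case by (rule exI[of _ "\<lambda>_. 0"]) simp
  next
    case (step a x y)
    then obtain j c where j: "j < k" "x = f j" and c: "y = (\<Sum>i<k. c i *\<^sub>R f i)" by auto
    have "(c i + (if i = j then a else 0)) *\<^sub>R f i = c i *\<^sub>R f i + (if i = j then a *\<^sub>R f i else 0)" for i
      by (simp add: scaleR_left_distrib)
    then have "a *\<^sub>R x + y = (\<Sum>i<k. (c i + (if i = j then a else 0)) *\<^sub>R f i)"
      using j by (simp add: c sum.distrib)
    then show ?case by (intro exI[of _ "\<lambda>i. c i + (if i = j then a else 0)"])
  qed
  with k show ?thesis by blast
qed

text \<open>The Krylov sequence of \<open>v\<close> satisfies a linear recurrence, which is to say
  that a monic polynomial in \<open>T\<close> kills \<open>v\<close>. The coefficients come out real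
  because the complex vectors are regarded as a real Euclidean space.\<close>

lemma annihil_exists: "\<exists>xs. annihil T xs v = 0" for T :: "complex^'n^'n"
proof -
  obtain k c where kc: "((*v) T ^^ k) v = (\<Sum>i<k. c i *\<^sub>R ((*v) T ^^ i) v)"
    using linear_recurrence_exists[of "\<lambda>k. ((*v) T ^^ k) v"] by blast
  define p :: "complex poly" where "p = monom 1 k - (\<Sum>i<k. monom (of_real (c i)) i)"
  have cp: "coeff p i = (if i = k then 1 else if i < k then - of_real (c i) else 0)" for i
    by (auto simp: p_def coeff_sum sum.delta')
  have "degree p = k"
    by (rule antisym) (auto intro!: degree_le le_degree simp: cp)
  moreover have "p \<noteq> 0" using cp[of k] by auto
  moreover have "(\<Sum>i\<le>k. coeff p i *s (((*v) T ^^ i) v)) = 0"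
  proof -
    have "(\<Sum>i<k. coeff p i *s (((*v) T ^^ i) v)) = (\<Sum>i<k. - (c i *\<^sub>R ((*v) T ^^ i) v))"
      by (intro sum.cong) (auto simp: cp vec_eq_iff scaleR_conv_of_real[where 'a=complex])
    then show ?thesis
      by (simp add: lessThan_Suc_atMost[symmetric] cp kc sum_negf)
  qed
  ultimately show ?thesis using annihil_of_poly by blast
qed

lemma annihil_eigenvalues:
  assumes "annihil T xs v = 0"
  shows "\<exists>ys. set ys \<subseteq> {z. \<exists>v. v \<noteq> 0 \<and> T *v v = z *s v} \<and> annihil T ys v = 0"
  using assms
proof (induction xs arbitrary: v rule: rev_induct)
  case Nil
  then show ?case by (intro exI[of _ "[]"]) auto
next
  case (snoc z xs)
  then have "annihil T xs (annihil T [z] v) = 0" by (simp add: annihil_append)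
  then obtain ys where ys: "set ys \<subseteq> {z. \<exists>v. v \<noteq> 0 \<and> T *v v = z *s v}" "annihil T ys (annihil T [z] v) = 0"
    using snoc.IH by blast
  have eq: "T *v annihil T ys v = z *s annihil T ys v"
    using ys(2) annihil_commute[of T ys "[z]" v] by simp
  show ?case
  proof (cases "annihil T ys v = 0")
    case True
    with ys show ?thesis by blast
  next
    case False
    with eq ys have "set (ys @ [z]) \<subseteq> {z. \<exists>v. v \<noteq> 0 \<and> T *v v = z *s v}" by auto
    moreover have "annihil T (ys @ [z]) v = 0" using ys(2) by (simp add: annihil_append)
    ultimately show ?thesis by blast
  qed
qed

lemma annihil_eigenvalues_exists:
  "\<exists>ys. set ys \<subseteq> complex_eigenvalues A \<and> annihil (cmat A) ys v = 0"
proof -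
  obtain xs where "annihil (cmat A) xs v = 0" using annihil_exists by blast
  from annihil_eigenvalues[OF this] show ?thesis by (simp add: complex_eigenvalues_iff[abs_def] subset_iff)
qed

lemma complex_eigenvalues_nonempty: "complex_eigenvalues A \<noteq> {}" for A :: "real^'n^'n"
proof
  assume "complex_eigenvalues A = {}"
  then have "annihil (cmat A) [] (axis undefined 1) = 0"
    using annihil_eigenvalues_exists[of A "axis undefined 1"] by simp
  then show False by (simp add: axis_eq_0_iff)
qed

text \<open>The factors found for the basis vectors are concatenated into one product that kills the
  whole space. On an eigenvector for \<open>z\<close> this product acts as the number obtained by
  multiplying all \<open>z - x\<close>, so \<open>z\<close> occurs among the factors. Finiteness
  gives \<open>Min\<close> and \<open>Max\<close> in the spectral bounds their meaning.\<close>

lemma finite_complex_eigenvalues: "finite (complex_eigenvalues A)" for A :: "real^'n^'n"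
proof -
  have "\<exists>ys. \<forall>j\<in>S. annihil (cmat A) ys (axis j 1) = 0" if "finite S" for S
    using that
  proof induction
    case (insert j S)
    then obtain ys where ys: "\<forall>j\<in>S. annihil (cmat A) ys (axis j 1) = 0" by blast
    obtain xs where xs: "annihil (cmat A) xs (axis j 1) = 0" using annihil_exists by blast
    have "\<forall>i\<in>insert j S. annihil (cmat A) (xs @ ys) (axis i 1) = 0"
      using xs ys annihil_commute[of "cmat A" xs ys "axis j 1"] by (auto simp: annihil_append annihil_0)
    then show ?case by blast
  qed auto
  then obtain ys where ys: "annihil (cmat A) ys (axis j 1) = 0" for j
    by (metis UNIV_I finite)
  have all: "annihil (cmat A) ys v = 0" for v
    by (subst basis_expansion[of v, symmetric]) (simp only: annihil_sum annihil_smult ys, simp)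
  have eig: "annihil (cmat A) zs v = (\<Prod>x\<leftarrow>zs. z - x) *s v" if "cmat A *v v = z *s v" for z v zs
  proof (induction zs)
    case (Cons x zs)
    then show ?case by (simp add: that vector_scalar_commute) (simp add: vec_eq_iff algebra_simps)
  qed simp
  have "z \<in> set ys" if z: "z \<in> complex_eigenvalues A" for z
  proof -
    obtain v where v: "v \<noteq> 0" "cmat A *v v = z *s v"
      using z[unfolded complex_eigenvalues_iff] by blast
    have "(\<Prod>x\<leftarrow>ys. z - x) = 0" using eig[OF v(2), of ys] v(1) unfolding all by (metis vector_mul_eq_0)
    then show ?thesis by (auto simp: prod_list_zero_iff)
  qed
  then show ?thesis by (metis finite_set rev_finite_subset subsetI)
qed

section \<open>Growth bounds from the real parts of the eigenvalues\<close>

lemma norm_le_sum_columns: "norm M \<le> (\<Sum>j\<in>UNIV. norm (M *v axis j 1))" for M :: "real^'n^'m"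
proof -
  have "norm (transpose M) \<le> (\<Sum>j\<in>UNIV. norm (transpose M $ j))"
    unfolding norm_vec_def[of "transpose M"] by (rule L2_set_le_sum) simp
  moreover have "transpose M $ j = M *v axis j 1" for j
    by (simp add: matrix_vector_mul_component vec_eq_iff inner_axis transpose_def)
  moreover have "norm (transpose M) = norm M"
    unfolding norm_vec_def L2_set_def transpose_def by (simp add: sum_nonneg) (rule sum.swap)
  ultimately show ?thesis by simp
qed

text \<open>With \<open>w = (A - z) v\<close>, the function \<open>exp (- z t) exp (t A) v\<close>
  has the derivative \<open>exp (- z t) exp (t A) w\<close>. The vector \<open>w\<close> needs one
  factor less, and its bound is integrated. Because of the strict inequality
  \<open>Re z < \<omega>\<close> the integral of \<open>exp ((\<omega> - Re z) t)\<close> has the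
  same order as its integrand, so that no polynomial factors in \<open>t\<close> accumulate.\<close>

lemma annihil_growth:
  fixes A :: "real^'n^'n"
  assumes "annihil (cmat A) xs v = 0" "\<And>z. z \<in> set xs \<Longrightarrow> Re z < \<omega>"
  shows "\<exists>C\<ge>0. \<forall>t\<ge>0. norm (cmat (mat_exp (t *\<^sub>R A)) *v v) \<le> C * exp (\<omega> * t)"
  using assms
proof (induction xs arbitrary: v rule: rev_induct)
  case Nil
  then show ?case by (intro exI[of _ 0]) auto
next
  case (snoc z xs)
  define w where "w = cmat A *v v - z *s v"
  have "annihil (cmat A) xs w = 0" using snoc.prems by (simp add: annihil_append w_def)
  then obtain C where C: "C \<ge> 0" "norm (cmat (mat_exp (t *\<^sub>R A)) *v w) \<le> C * exp (\<omega> * t)" if "t \<ge> 0" for t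
    using snoc.IH[of w] snoc.prems by auto
  define \<delta> where "\<delta> = \<omega> - Re z"
  have \<delta>: "\<delta> > 0" using snoc.prems by (simp add: \<delta>_def)
  define g where "g t = exp (- z * of_real t) *s (cmat (mat_exp (t *\<^sub>R A)) *v v)" for t :: real
  define g' where "g' t = exp (- z * of_real t) *s (cmat (mat_exp (t *\<^sub>R A)) *v w)" for t :: real
  have deriv: "(g has_vector_derivative g' t) (at t)" for t
  proof -
    have 1: "((\<lambda>t. exp (- z * of_real t)) has_vector_derivative - z * exp (- z * of_real t)) (at t)"
    proof -
      have "((\<lambda>t. exp (- z * t)) has_field_derivative - z * exp (- z * of_real t)) (at (of_real t))"
        by (auto intro!: derivative_eq_intros)
      then show ?thesis by (rule has_vector_derivative_real_field)
    qed
    have 2: "((\<lambda>t. cmat (mat_exp (t *\<^sub>R A)) *v v) has_vector_derivative cmat (mat_exp (t *\<^sub>R A) ** A) *v v) (at t)"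
      by (rule bounded_linear.has_vector_derivative[OF bounded_linear_cmat_mult mat_exp_has_vector_derivative])
    have "(g has_vector_derivative (exp (- z * of_real t) *s (cmat (mat_exp (t *\<^sub>R A) ** A) *v v)
        + (- z * exp (- z * of_real t)) *s (cmat (mat_exp (t *\<^sub>R A)) *v v))) (at t)"
      unfolding g_def by (rule bounded_bilinear.has_vector_derivative[OF bounded_bilinear_smult 1 2])
    moreover have "exp (- z * of_real t) *s (cmat (mat_exp (t *\<^sub>R A) ** A) *v v)
        + (- z * exp (- z * of_real t)) *s (cmat (mat_exp (t *\<^sub>R A)) *v v) = g' t"
      by (simp add: g'_def w_def cmat_mult matrix_vector_mul_assoc[symmetric] matrix_vector_mult_diff_distrib
          vector_scalar_commute vector_smult_assoc vector_ssub_ldistrib mult.commute)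
    ultimately show ?thesis by simp
  qed
  have g'_le: "norm (g' t) \<le> C * exp (\<delta> * t)" if "t \<ge> 0" for t
  proof -
    have "norm (g' t) = exp (- Re z * t) * norm (cmat (mat_exp (t *\<^sub>R A)) *v w)"
      by (simp add: g'_def norm_smult_vec)
    also have "\<dots> \<le> exp (- Re z * t) * (C * exp (\<omega> * t))"
      using C that by (intro mult_left_mono) auto
    finally show ?thesis by (simp add: \<delta>_def algebra_simps exp_add[symmetric] exp_diff exp_minus field_simps)
  qed
  have g0: "norm (g 0) = norm v"
  proof -
    have "cmat (mat 1) *v v = v"
      by (simp add: cmat_def mat_def matrix_vector_mult_def vec_eq_iff if_distrib if_distribR cong: if_cong)
    then show ?thesis by (simp add: g_def norm_smult_vec)
  qed
  have g_le: "norm (g t) \<le> (norm v + C / \<delta>) * exp (\<delta> * t)" if "t \<ge> 0" for t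
  proof (cases "t = 0")
    case True
    then show ?thesis using C(1)[of 0] \<delta> by (simp add: g0)
  next
    case False
    have "norm (g t - g 0) \<le> C / \<delta> * exp (\<delta> * t) - C / \<delta> * exp (\<delta> * 0)"
    proof (rule differentiable_bound_general)
      show "continuous_on {0..t} g"
        by (intro continuous_at_imp_continuous_on ballI has_vector_derivative_continuous[OF deriv])
      show "continuous_on {0..t} (\<lambda>t. C / \<delta> * exp (\<delta> * t))" by (intro continuous_intros)
      show "(g has_vector_derivative g' x) (at x)" for x by (rule deriv)
      show "((\<lambda>t. C / \<delta> * exp (\<delta> * t)) has_vector_derivative C * exp (\<delta> * x)) (at x)" for x
        unfolding has_real_derivative_iff_has_vector_derivative[symmetric]
        using \<delta> by (auto intro!: derivative_eq_intros)
    qed (use False that g'_le in auto)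
    moreover have "norm (g t) \<le> norm (g t - g 0) + norm (g 0)" by (metis diff_add_cancel norm_triangle_ineq)
    moreover have "norm v \<le> norm v * exp (\<delta> * t)" using \<delta> that by (intro mult_le_cancel_left1[THEN iffD2]) auto
    moreover have "0 \<le> C / \<delta>" using C(1)[of 0] \<delta> by auto
    ultimately show ?thesis using g0 by (simp add: algebra_simps)
  qed
  have "norm (cmat (mat_exp (t *\<^sub>R A)) *v v) \<le> (norm v + C / \<delta>) * exp (\<omega> * t)" if "t \<ge> 0" for t
  proof -
    have "norm (cmat (mat_exp (t *\<^sub>R A)) *v v) = exp (Re z * t) * norm (g t)"
      by (simp add: g_def norm_smult_vec exp_add[symmetric] mult.assoc[symmetric])
    also have "\<dots> \<le> exp (Re z * t) * ((norm v + C / \<delta>) * exp (\<delta> * t))"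
      using g_le that by (intro mult_left_mono) auto
    also have "\<dots> = (norm v + C / \<delta>) * exp (\<omega> * t)"
      by (simp add: \<delta>_def exp_add[symmetric] algebra_simps)
    finally show ?thesis .
  qed
  moreover have "norm v + C / \<delta> \<ge> 0" using C(1)[of 0] \<delta> by auto
  ultimately show ?case by blast
qed

lemma mat_exp_growth:
  fixes A :: "real^'n^'n"
  assumes "\<And>z. z \<in> complex_eigenvalues A \<Longrightarrow> Re z < \<omega>"
  shows "\<exists>C>0. \<forall>t\<ge>0. norm (mat_exp (t *\<^sub>R A)) \<le> C * exp (\<omega> * t)"
proof -
  have "\<exists>C\<ge>0. \<forall>t\<ge>0. norm (mat_exp (t *\<^sub>R A) *v axis j 1) \<le> C * exp (\<omega> * t)" for j
  proof -
    obtain ys where "set ys \<subseteq> complex_eigenvalues A" "annihil (cmat A) ys (cvec (axis j 1)) = 0"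
      using annihil_eigenvalues_exists by blast
    from annihil_growth[OF this(2), of \<omega>] this(1) assms show ?thesis
      by (auto simp: cmat_mult_cvec norm_cvec)
  qed
  then obtain C where C: "\<And>j. C j \<ge> 0" "\<And>j t. t \<ge> 0 \<Longrightarrow> norm (mat_exp (t *\<^sub>R A) *v axis j 1) \<le> C j * exp (\<omega> * t)"
    by metis
  have "norm (mat_exp (t *\<^sub>R A)) \<le> (1 + (\<Sum>j\<in>UNIV. C j)) * exp (\<omega> * t)" if "t \<ge> 0" for t
  proof -
    have "norm (mat_exp (t *\<^sub>R A)) \<le> (\<Sum>j\<in>UNIV. C j * exp (\<omega> * t))"
      by (rule order_trans[OF norm_le_sum_columns sum_mono]) (use C that in auto)
    then show ?thesis by (simp add: sum_distrib_right[symmetric] distrib_right add_increasing)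
  qed
  moreover have "1 + (\<Sum>j\<in>UNIV. C j) > 0" using C(1) by (simp add: add_pos_nonneg sum_nonneg)
  ultimately show ?thesis by blast
qed

lemma bounded_linear_mult_vec: "bounded_linear (\<lambda>T::real^'n^'m. T *v w)"
  unfolding linear_conv_bounded_linear[symmetric]
  by (intro linearI) (simp_all add: matrix_vector_mult_add_rdistrib scaleR_matrix_vector_assoc)

lemma bounded_linear_transpose_mult: "bounded_linear (\<lambda>T::real^'n^'m. transpose T *v w)"
  using bounded_linear_compose[OF bounded_linear_mult_vec bounded_linear_transpose] .

lemma min_re_eig_le: "z \<in> complex_eigenvalues A \<Longrightarrow> min_re_eig A \<le> Re z"
  and max_re_eig_ge: "z \<in> complex_eigenvalues A \<Longrightarrow> Re z \<le> max_re_eig A"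
  unfolding min_re_eig_def max_re_eig_def by (simp_all add: finite_complex_eigenvalues)

lemma min_re_eig_attained: "\<exists>z\<in>complex_eigenvalues A. min_re_eig A = Re z" for A :: "real^'n^'n"
proof -
  have "min_re_eig A \<in> Re ` complex_eigenvalues A"
    unfolding min_re_eig_def
    by (intro Min_in) (simp_all add: finite_complex_eigenvalues complex_eigenvalues_nonempty)
  then show ?thesis by auto
qed

lemma min_re_eig_le_max: "min_re_eig A \<le> max_re_eig A" for A :: "real^'n^'n"
  using min_re_eig_attained[of A] max_re_eig_ge[of _ A] by auto

lemma cmat_uminus: "cmat (- A) *v v = - (cmat A *v v)"
  by (simp add: cmat_def matrix_vector_mult_def vec_eq_iff sum_negf)

lemma complex_eigenvalues_uminus: "z \<in> complex_eigenvalues (- A) \<longleftrightarrow> - z \<in> complex_eigenvalues A"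
proof -
  have "(- (cmat A *v v) = z *s v) = (cmat A *v v = (- z) *s v)" for v
    by (simp add: vec_eq_iff) (metis minus_equation_iff)
  then show ?thesis by (simp add: complex_eigenvalues_iff cmat_uminus)
qed

lemma powm_growth_ge_1:
  assumes "max_re_eig A < \<omega>"
  shows "\<exists>C>0. \<forall>s\<ge>1. norm (s powm A) \<le> C * s powr \<omega>"
proof -
  obtain C where C: "C > 0" "\<And>t. t \<ge> 0 \<Longrightarrow> norm (mat_exp (t *\<^sub>R A)) \<le> C * exp (\<omega> * t)"
    using mat_exp_growth[of A \<omega>] max_re_eig_ge[of _ A] assms by (meson order_le_less_trans)
  have "norm (s powm A) \<le> C * s powr \<omega>" if "s \<ge> 1" for s
    using C(2)[of "ln s"] that by (simp add: powm_pos powr_def mult.commute)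
  with C show ?thesis by blast
qed

text \<open>Small \<open>s\<close> corresponds to large \<open>t = - ln s\<close> for the matrix
  \<open>- A\<close>, and the negation exchanges the smallest real part with the largest.\<close>

lemma powm_growth_le_1:
  assumes "\<omega> < min_re_eig A"
  shows "\<exists>C>0. \<forall>s. 0 < s \<and> s \<le> 1 \<longrightarrow> norm (s powm A) \<le> C * s powr \<omega>"
proof -
  have "Re z < - \<omega>" if "z \<in> complex_eigenvalues (- A)" for z
    using that min_re_eig_le[of "-z" A] assms by (simp add: complex_eigenvalues_uminus)
  then obtain C where C: "C > 0" "\<And>t. t \<ge> 0 \<Longrightarrow> norm (mat_exp (t *\<^sub>R - A)) \<le> C * exp (- \<omega> * t)"
    using mat_exp_growth[of "-A" "- \<omega>"] by blast
  have "norm (s powm A) \<le> C * s powr \<omega>" if "0 < s" "s \<le> 1" for s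
    using C(2)[of "- ln s"] that by (simp add: powm_pos powr_def mult.commute)
  with C show ?thesis by blast
qed

lemma powm_tendsto_0:
  assumes "min_re_eig A > 0"
  shows "((\<lambda>s. norm (s powm A)) \<longlongrightarrow> 0) (at_right 0)"
proof -
  obtain C where C: "C > 0" "\<And>s. 0 < s \<and> s \<le> 1 \<Longrightarrow> norm (s powm A) \<le> C * s powr (min_re_eig A / 2)"
    using powm_growth_le_1[of "min_re_eig A / 2" A] assms by auto
  show ?thesis
  proof (rule tendsto_sandwich[OF _ _ tendsto_const])
    show "eventually (\<lambda>s. norm (s powm A) \<le> C * s powr (min_re_eig A / 2)) (at_right 0)"
      by (rule eventually_at_rightI[of 0 1]) (use C in auto)
    have "((\<lambda>s. C * s powr (min_re_eig A / 2)) \<longlongrightarrow> C * 0 powr (min_re_eig A / 2)) (at_right 0)"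
      using assms by (intro tendsto_intros) (auto intro!: eventually_at_rightI[of 0 1])
    then show "((\<lambda>s. C * s powr (min_re_eig A / 2)) \<longlongrightarrow> 0) (at_right 0)" by simp
  qed auto
qed

text \<open>As \<open>s\<close> decreases to 0, \<open>det (s powm E) = s powr trace E\<close> tends
  to \<open>det 0 = 0\<close>. For a nonpositive trace it would stay at least 1.\<close>

lemma trace_pos:
  assumes "min_re_eig E > 0"
  shows "trace E > 0"
proof (rule ccontr)
  assume neg: "\<not> trace E > 0"
  have "((\<lambda>s. s powm E) \<longlongrightarrow> 0) (at_right 0)"
    using powm_tendsto_0[OF assms] by (rule tendsto_norm_zero_cancel)
  moreover have "isCont (\<lambda>M::real^'a^'a. det M) 0"
    unfolding det_def by (intro continuous_intros)
  ultimately have "((\<lambda>s. det (s powm E)) \<longlongrightarrow> det (0::real^'a^'a)) (at_right 0)"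
    by (rule isCont_tendsto_compose[rotated])
  moreover have "det (0::real^'a^'a) = 0"
    by (rule det_zero_row(1)[of undefined]) (simp add: row_def vec_eq_iff)
  moreover have "eventually (\<lambda>s. 1 \<le> det (s powm E)) (at_right 0)"
  proof (rule eventually_at_rightI[of 0 1])
    fix s :: real assume "s \<in> {0<..<1}"
    then show "1 \<le> det (s powm E)"
      using neg powr_mono'[of "trace E" 0 s] by (simp add: det_powm)
  qed simp
  ultimately have "(1::real) \<le> 0"
    using tendsto_lowerbound[of "\<lambda>s. det (s powm E)" 0 "at_right 0" 1] by simp
  then show False by simp
qed

section \<open>Functions that scale along the group \<open>s powm transpose G\<close>\<close>

lemma mat_exp_solves_unique:
  assumes "\<And>t. (x has_vector_derivative H *v x t) (at t)"
  shows "x t = mat_exp (t *\<^sub>R H) *v x 0"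
proof -
  define y where "y t = mat_exp (t *\<^sub>R - H) *v x t" for t
  have "(y has_vector_derivative 0) (at t)" for t
  proof -
    have bl: "bounded_bilinear (\<lambda>(A::real^'a^'a) x. A *v x)"
    proof
      show "\<exists>K. \<forall>(A::real^'a^'a) x. norm (A *v x) \<le> norm A * norm x * K"
        by (rule exI[of _ 1]) (simp add: norm_matrix_vector_mult)
    qed (simp_all add: algebra_simps matrix_vector_mult_add_rdistrib matrix_vector_right_distrib scaleR_matrix_vector_assoc[symmetric] matrix_vector_mult_scaleR)
    have "(y has_vector_derivative (mat_exp (t *\<^sub>R - H) *v (H *v x t) + (mat_exp (t *\<^sub>R - H) ** - H) *v x t)) (at t)"
      unfolding y_def
      by (rule bounded_bilinear.has_vector_derivative[OF bl mat_exp_has_vector_derivative assms])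
    moreover have "mat_exp (t *\<^sub>R - H) *v (H *v x t) + (mat_exp (t *\<^sub>R - H) ** - H) *v x t = 0"
      by (simp add: matrix_vector_mul_assoc linear_simps(4)[OF bounded_linear_matrix_mult_right]
          bounded_bilinear.minus_left[OF bl])
    ultimately show ?thesis by simp
  qed
  then obtain c where "\<And>t. y t = c"
    using has_vector_derivative_zero_constant[of UNIV y] by auto
  then have "y t = y 0" by simp
  then have "mat_exp (t *\<^sub>R H) *v (mat_exp (- (t *\<^sub>R H)) *v x t) = mat_exp (t *\<^sub>R H) *v x 0"
    by (simp add: y_def)
  then show ?thesis by (simp add: matrix_vector_mul_assoc mat_exp_minus)
qed

text \<open>Being an eigenvalue is the vanishing of a determinant, which transposition
  preserves.\<close>

lemma eigenvalue_transpose: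
  assumes "z \<in> complex_eigenvalues A"
  shows "z \<in> complex_eigenvalues (transpose A)"
proof -
  obtain v where v: "v \<noteq> 0" "cmat A *v v = z *s v" using assms unfolding complex_eigenvalues_iff by blast
  have lin: "(cmat A - mat z) *v w = cmat A *v w - z *s w" for A :: "real^'a^'a" and w
  proof -
    have "mat z *v w = z *s w"
      by (simp add: vec_eq_iff matrix_vector_mult_def mat_def if_distrib if_distribR cong: if_cong)
    then show ?thesis by (simp add: matrix_vector_mult_diff_rdistrib)
  qed
  have "det (cmat A - mat z) = 0"
  proof (rule ccontr)
    assume "det (cmat A - mat z) \<noteq> 0"
    then obtain M where "M ** (cmat A - mat z) = mat 1"
      by (metis invertible_det_nz invertible_def)
    then have "v = 0" using lin[of A v] v
      by (metis cancel_comm_monoid_add_class.diff_cancel matrix_left_invertible_ker)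
    with v show False by simp
  qed
  moreover have "transpose (cmat A - mat z) = cmat (transpose A) - mat z"
    by (simp add: vec_eq_iff transpose_def cmat_def mat_def)
  ultimately have "det (cmat (transpose A) - mat z) = 0" by (metis det_transpose)
  then have "\<not> (\<exists>M. M ** (cmat (transpose A) - mat z) = mat 1)"
    by (metis invertible_det_nz invertible_left_inverse)
  then obtain w where "w \<noteq> 0" "(cmat (transpose A) - mat z) *v w = 0"
    by (metis matrix_left_invertible_ker)
  then show ?thesis unfolding complex_eigenvalues_iff lin by auto
qed

text \<open>An eigenvalue of the transpose with real part at most 0 yields a nonzero real orbit
  \<open>s powm transpose G *v x 0\<close> that stays bounded for \<open>s \<ge> 1\<close>. A
  continuous \<open>F\<close> is bounded along it, whereas the scaling makes \<open>F\<close> grow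
  like \<open>s powr q\<close>. With \<open>F = - Re \<psi>\<close> this gives the positivity of the
  spectrum of \<open>q B\<close>.\<close>

lemma min_re_eig_pos_of_scaling:
  fixes G :: "real^'n^'n" and F :: "real^'n \<Rightarrow> real"
  assumes "continuous_on UNIV F" "\<And>v. v \<noteq> 0 \<Longrightarrow> F v > 0" "q > 0"
    and scal: "\<And>s v. s > 0 \<Longrightarrow> F (s powm transpose G *v v) = s powr q * F v"
  shows "min_re_eig G > 0"
proof (rule ccontr)
  assume neg: "\<not> min_re_eig G > 0"
  obtain z where z: "z \<in> complex_eigenvalues (transpose G)" "Re z \<le> 0"
    using min_re_eig_attained[of G] neg eigenvalue_transpose by force
  then obtain w where w: "w \<noteq> 0" "cmat (transpose G) *v w = z *s w"
    unfolding complex_eigenvalues_iff by blast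
  define re :: "complex^'n \<Rightarrow> real^'n" where "re v = (\<chi> i. Re (v $ i))" for v
  have re_bl: "bounded_linear re"
    unfolding linear_conv_bounded_linear[symmetric] re_def by (intro linearI) (simp_all add: vec_eq_iff)
  have re_cmat: "re (cmat H *v v) = H *v re v" for H :: "real^'n^'n" and v
    by (simp add: re_def cmat_def matrix_vector_mult_def vec_eq_iff)
  have norm_re: "norm (re v) \<le> norm v" for v
    unfolding norm_vec_def re_def by (rule L2_set_mono) (simp_all add: abs_Re_le_cmod)
  \<comment> \<open>The real part of a complex eigenvector may vanish. Multiplying by the conjugate
    of a nonzero entry makes this entry real and positive.\<close>
  obtain c where c: "re (c *s w) \<noteq> 0"
  proof -
    obtain i where i: "w $ i \<noteq> 0" using w(1) by (auto simp: vec_eq_iff)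
    have "re (cnj (w $ i) *s w) $ i = (cmod (w $ i))\<^sup>2"
      unfolding cmod_power2 by (simp add: re_def power2_eq_square)
    with i have "re (cnj (w $ i) *s w) $ i \<noteq> 0" by simp
    then have "re (cnj (w $ i) *s w) \<noteq> 0" by (metis zero_index)
    then show ?thesis by (rule that)
  qed
  define x where "x t = re ((exp (z * of_real t) * c) *s w)" for t
  have dx: "(x has_vector_derivative transpose G *v x t) (at t)" for t
  proof -
    have "((\<lambda>t. exp (z * of_real t)) has_vector_derivative z * exp (z * of_real t)) (at t)"
    proof -
      have "((\<lambda>t. exp (z * t)) has_field_derivative z * exp (z * of_real t)) (at (of_real t))"
        by (auto intro!: derivative_eq_intros)
      then show ?thesis by (rule has_vector_derivative_real_field)
    qed
    from bounded_linear.has_vector_derivative[OF re_bl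
        bounded_bilinear.has_vector_derivative[OF bounded_bilinear_smult this has_vector_derivative_const[of "c *s w"]]]
    have "(x has_vector_derivative re ((z * exp (z * of_real t)) *s (c *s w))) (at t)"
      by (simp add: x_def[abs_def] vector_smult_assoc)
    moreover have "re ((z * exp (z * of_real t)) *s (c *s w)) = transpose G *v x t"
      by (simp add: x_def re_cmat[symmetric] vector_scalar_commute w vector_smult_assoc mult_ac)
    ultimately show ?thesis by simp
  qed
  have x0: "x 0 \<noteq> 0" using c by (simp add: x_def)
  define R where "R = cmod c * norm w"
  have xR: "x t \<in> cball 0 R" if "t \<ge> 0" for t
  proof -
    have "norm (x t) \<le> exp (Re z * t) * R"
      unfolding x_def R_def by (rule order_trans[OF norm_re]) (simp add: norm_smult_vec norm_mult)
    also have "\<dots> \<le> 1 * R"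
      using z(2) that by (intro mult_right_mono) (auto simp: R_def mult_nonpos_nonneg)
    finally show ?thesis by simp
  qed
  have "bounded (F ` cball 0 R)"
    by (intro compact_imp_bounded compact_continuous_image continuous_on_subset[OF assms(1)]) auto
  then obtain K where "\<forall>y\<in>F ` cball 0 R. norm y \<le> K"
    unfolding bounded_iff by blast
  then have K: "\<bar>F v\<bar> \<le> K" if "v \<in> cball 0 R" for v
    using that by simp
  have le: "s powr q * F (x 0) \<le> K" if "s \<ge> 1" for s
  proof -
    have "x (ln s) = s powm transpose G *v x 0"
      using mat_exp_solves_unique[OF dx, of "ln s"] that by (simp add: powm_pos)
    then have "s powr q * F (x 0) = F (x (ln s))" using scal[of s "x 0"] that by simp
    also have "\<dots> \<le> K" using K[OF xR[of "ln s"]] that by simp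
    finally show ?thesis .
  qed
  have "F (x 0) > 0" using assms(2) x0 by blast
  \<comment> \<open>Large enough for \<open>s powr q * F (x 0)\<close> to reach
    \<open>K + 1\<close>, and at least 1 so that the bound along the orbit applies.\<close>
  define s where "s = (max 1 ((K + 1) / F (x 0))) powr (1 / q)"
  have "s \<ge> 1" unfolding s_def using assms(3) by (intro ge_one_powr_ge_zero) auto
  moreover have "s powr q = max 1 ((K + 1) / F (x 0))" using assms(3) by (simp add: s_def powr_powr)
  moreover have "(K + 1) / F (x 0) * F (x 0) \<le> max 1 ((K + 1) / F (x 0)) * F (x 0)"
    using \<open>F (x 0) > 0\<close> by (intro mult_right_mono) auto
  ultimately show False using le[of s] \<open>F (x 0) > 0\<close> by simp
qed

text \<open>Every \<open>v \<noteq> 0\<close> has the form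
  \<open>s powm transpose G *v \<theta>\<close> with \<open>\<theta>\<close> on the unit sphere, so
  \<open>cmod (\<psi> v)\<close> is at most a constant times \<open>s powr q\<close>. The growth of
  \<open>(1 / s) powm G\<close> bounds \<open>s\<close> by a power of \<open>norm v\<close>; which
  of the two powers appears depends on whether \<open>s \<le> 1\<close>.\<close>

lemma scaling_power_bound:
  fixes G :: "real^'n^'n" and \<psi> :: "real^'n \<Rightarrow> complex"
  assumes "continuous_on UNIV \<psi>" "q > 0" "0 < \<omega>1" "\<omega>1 < min_re_eig G" "max_re_eig G < \<omega>2" "\<psi> 0 = 0"
    and scal: "\<And>s v. s > 0 \<Longrightarrow> \<psi> (s powm transpose G *v v) = of_real (s powr q) * \<psi> v"
  shows "\<exists>K>0. \<forall>v. cmod (\<psi> v) \<le> K * (norm v powr (q / \<omega>2) + norm v powr (q / \<omega>1))"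
proof -
  obtain C1 where C1: "C1 > 0" "\<And>s. 0 < s \<and> s \<le> 1 \<Longrightarrow> norm (s powm G) \<le> C1 * s powr \<omega>1"
    using powm_growth_le_1[OF assms(4)] by auto
  obtain C2 where C2: "C2 > 0" "\<And>s. s \<ge> 1 \<Longrightarrow> norm (s powm G) \<le> C2 * s powr \<omega>2"
    using powm_growth_ge_1[OF assms(5)] by auto
  have \<omega>2: "\<omega>2 > 0" using assms(3-5) min_re_eig_le_max[of G] by linarith
  have "bounded (\<psi> ` sphere 0 1)"
    by (intro compact_imp_bounded compact_continuous_image continuous_on_subset[OF assms(1)]) auto
  then obtain K where K: "\<And>v. norm v = 1 \<Longrightarrow> cmod (\<psi> v) \<le> K" and "K > 0"
    unfolding bounded_pos by (auto simp: sphere_def)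
  define Kf where "Kf = K * (C2 powr (q / \<omega>2) + C1 powr (q / \<omega>1))"
  have bound: "cmod (\<psi> v) \<le> Kf * (norm v powr (q / \<omega>2) + norm v powr (q / \<omega>1))" if v: "v \<noteq> 0" for v
  proof -
    define h where "h s = norm ((1 / s) powm transpose G *v v)" for s
    have normT: "norm (s powm transpose G) = norm (s powm G)" for s
      by (simp add: transpose_powm[symmetric] norm_transpose)
    have h1: "h s \<le> norm ((1 / s) powm G) * norm v" for s
      unfolding h_def by (rule order_trans[OF norm_matrix_vector_mult]) (simp add: normT)
    have h2: "norm v \<le> norm (s powm G) * h s" if "s > 0" for s
    proof -
      have "v = s powm transpose G *v ((1 / s) powm transpose G *v v)"
        using that by (simp add: matrix_vector_mul_assoc powm_inverse)
      then show ?thesis unfolding h_def by (metis norm_matrix_vector_mult normT)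
    qed
    \<comment> \<open>Both ends for the intermediate value theorem come from \<open>s powm G\<close>
      tending to 0: \<open>h\<close> is at most 1 at \<open>1 / s1\<close> and at least 1 at
      \<open>s2\<close>.\<close>
    have "\<exists>s>0. norm (s powm G) * norm v < 1 \<and> s \<le> 1" and small: "\<exists>s>0. s \<le> 1 \<and> norm (s powm G) < norm v"
    proof -
      have lim: "((\<lambda>s. norm (s powm G)) \<longlongrightarrow> 0) (at_right 0)"
        using assms(3,4) by (intro powm_tendsto_0) simp
      have ev: "eventually (\<lambda>s::real. 0 < s \<and> s \<le> 1) (at_right 0)"
        by (rule eventually_at_rightI[of 0 1]) auto
      have "eventually (\<lambda>s. norm (s powm G) < 1 / norm v) (at_right 0)"
        using lim v by (intro order_tendstoD) auto
      from eventually_conj[OF this ev] have "\<exists>s. norm (s powm G) < 1 / norm v \<and> 0 < s \<and> s \<le> 1"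
        by (auto dest!: eventually_happens)
      then show "\<exists>s>0. norm (s powm G) * norm v < 1 \<and> s \<le> 1"
        using v by (auto simp: field_simps)
      have "eventually (\<lambda>s. norm (s powm G) < norm v) (at_right 0)"
        using lim v by (intro order_tendstoD) auto
      from eventually_conj[OF this ev] show "\<exists>s>0. s \<le> 1 \<and> norm (s powm G) < norm v"
        by (auto dest!: eventually_happens)
    qed
    then obtain s1 s2 where s1: "s1 > 0" "norm (s1 powm G) * norm v < 1" "s1 \<le> 1"
      and s2: "s2 > 0" "s2 \<le> 1" "norm (s2 powm G) < norm v" by blast
    have "h (1 / s1) \<le> 1" using h1[of "1 / s1"] s1 by simp
    moreover have "1 \<le> h s2"
    proof (rule ccontr)
      assume "\<not> 1 \<le> h s2"
      then have "norm (s2 powm G) * h s2 \<le> norm (s2 powm G) * 1" by (intro mult_left_mono) auto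
      with h2[OF s2(1)] s2 show False by simp
    qed
    moreover have "continuous_on {s2..1 / s1} h"
      unfolding h_def
    proof (intro continuous_at_imp_continuous_on ballI)
      fix s assume "s \<in> {s2..1 / s1}"
      then have "s > 0" using s2 by simp
      have "isCont (\<lambda>s. (1 / s) powm transpose G) s"
        using \<open>s > 0\<close> by (intro isCont_o2[where f="\<lambda>s. 1 / s" and g="\<lambda>s. s powm transpose G"] isCont_powm isCont_divide continuous_const continuous_ident) simp_all
      moreover have "bounded_linear (\<lambda>M::real^'n^'n. M *v v)"
        unfolding linear_conv_bounded_linear[symmetric]
        by (intro linearI) (simp_all add: matrix_vector_mult_add_rdistrib scaleR_matrix_vector_assoc)
      ultimately show "isCont (\<lambda>s. norm ((1 / s) powm transpose G *v v)) s"
        by (intro continuous_norm) (rule bounded_linear.isCont)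
    qed
    moreover have "s2 \<le> 1 / s1" using s1 s2 by (simp add: field_simps) (metis mult_le_one less_imp_le)
    ultimately obtain s where s: "s2 \<le> s" "h s = 1"
      using IVT2'[of h "1 / s1" 1 s2] by blast
    have "s > 0" using s s2 by simp
    define \<theta> where "\<theta> = (1 / s) powm transpose G *v v"
    have \<theta>: "norm \<theta> = 1" using s by (simp add: \<theta>_def h_def)
    have "v = s powm transpose G *v \<theta>"
      using \<open>s > 0\<close> by (simp add: \<theta>_def matrix_vector_mul_assoc powm_inverse)
    then have psi: "cmod (\<psi> v) \<le> s powr q * K"
      using scal[of s \<theta>] \<open>s > 0\<close> K[OF \<theta>] by (simp add: norm_mult mult_left_mono)
    have one: "1 \<le> norm ((1 / s) powm G) * norm v" using h1[of s] s by simp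
    have "s powr q \<le> C2 powr (q / \<omega>2) * norm v powr (q / \<omega>2) + C1 powr (q / \<omega>1) * norm v powr (q / \<omega>1)"
    proof (cases "s \<le> 1")
      case True
      have "1 \<le> C2 * (1 / s) powr \<omega>2 * norm v"
        using one C2(2)[of "1/s"] True \<open>s > 0\<close> by (meson divide_le_eq_1_pos le_divide_eq_1_pos mult_right_mono norm_ge_zero order_trans)
      then have "s powr \<omega>2 \<le> C2 * norm v" using \<open>s > 0\<close> by (simp add: powr_divide field_simps)
      then have "(s powr \<omega>2) powr (q / \<omega>2) \<le> (C2 * norm v) powr (q / \<omega>2)"
        using assms(2) \<omega>2 by (intro powr_mono2) auto
      then show ?thesis using \<omega>2 C1 C2 by (simp add: powr_powr powr_mult add_increasing2)
    next
      case False
      have "1 \<le> C1 * (1 / s) powr \<omega>1 * norm v"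
        using one C1(2)[of "1/s"] False \<open>s > 0\<close> mult_right_mono[of "norm ((1 / s) powm G)" "C1 * (1 / s) powr \<omega>1" "norm v"] by auto
      then have "s powr \<omega>1 \<le> C1 * norm v" using \<open>s > 0\<close> by (simp add: powr_divide field_simps)
      then have "(s powr \<omega>1) powr (q / \<omega>1) \<le> (C1 * norm v) powr (q / \<omega>1)"
        using assms(2,3) by (intro powr_mono2) auto
      then show ?thesis using assms(3) C1 C2 by (simp add: powr_powr powr_mult add_increasing)
    qed
    also have "\<dots> \<le> (C2 powr (q / \<omega>2) + C1 powr (q / \<omega>1)) * (norm v powr (q / \<omega>2) + norm v powr (q / \<omega>1))"
      by (simp add: algebra_simps)
    finally have "s powr q * K \<le> Kf * (norm v powr (q / \<omega>2) + norm v powr (q / \<omega>1))"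
      using \<open>K > 0\<close> by (simp add: Kf_def mult_ac mult_right_mono)
    with psi show ?thesis by simp
  qed
  have "Kf > 0" using \<open>K > 0\<close> C1 C2 by (auto simp: Kf_def intro!: mult_pos_pos add_pos_pos)
  moreover have "cmod (\<psi> v) \<le> Kf * (norm v powr (q / \<omega>2) + norm v powr (q / \<omega>1))" for v
    using bound[of v] assms(6) by (cases "v = 0") auto
  ultimately show ?thesis by blast
qed


section \<open>Stochastic integrals\<close>

lemma transpose_simple_mat_fun:
  "transpose (simple_mat_fun n R A s) *v v = (\<Sum>i<n. indicat_real (A i) s *\<^sub>R (transpose (R i) *v v))"
proof -
  have "transpose (simple_mat_fun n R A s) = (\<Sum>i<n. indicat_real (A i) s *\<^sub>R transpose (R i))"
    unfolding simple_mat_fun_def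
    by (simp add: linear_sum[OF bounded_linear.linear[OF bounded_linear_transpose]] transpose_scalar)
  then show ?thesis
    by (simp only: linear_sum[OF bounded_linear.linear[OF bounded_linear_mult_vec]] scaleR_matrix_vector_assoc)
qed

text \<open>Comparing the sum with \<open>card J\<close> times its largest term works for exponents
  on either side of 1, where neither convexity nor concavity would cover both.\<close>

lemma powr_sum_le:
  fixes r :: "'i \<Rightarrow> real"
  assumes "finite J" "\<And>j. j \<in> J \<Longrightarrow> 0 \<le> r j" "0 < a"
  shows "(\<Sum>j\<in>J. r j) powr a \<le> (\<Sum>j\<in>J. (real (card J) * r j) powr a)"
proof (cases "J = {}")
  case False
  then have "Max (r ` J) \<in> r ` J" using assms(1) by (intro Max_in) auto
  then obtain k where k: "k \<in> J" "r k = Max (r ` J)" by auto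
  have "(\<Sum>j\<in>J. r j) \<le> (\<Sum>j\<in>J. r k)" using assms(1) k by (intro sum_mono) simp
  then have "(\<Sum>j\<in>J. r j) powr a \<le> (real (card J) * r k) powr a"
    using assms by (intro powr_mono2) (auto intro: sum_nonneg)
  also have "\<dots> \<le> (\<Sum>j\<in>J. (real (card J) * r j) powr a)"
    using assms(1) k(1) by (intro member_le_sum) auto
  finally show ?thesis .
qed simp

lemma simple_function_data:
  fixes g :: "'s \<Rightarrow> real^'m^'m"
  assumes g: "simple_function \<Theta> g" and S: "S \<in> finite_measure_sets \<Theta>"
  shows "\<exists>n R A. simple_data \<Theta> n A \<and> (\<forall>s\<in>space \<Theta>. simple_mat_fun n R A s = indicator S s *\<^sub>R g s)"
proof -
  define V where "V = g ` space \<Theta>"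
  have V: "finite V" using simple_functionD(1)[OF g] by (simp add: V_def)
  obtain h where h: "bij_betw h {..<card V} V"
    using ex_bij_betw_nat_finite[OF V] by (auto simp: atLeast0LessThan)
  define A where "A j = g -` {h j} \<inter> space \<Theta> \<inter> S" for j
  have "A j \<in> finite_measure_sets \<Theta>" for j
  proof -
    have "A j \<in> sets \<Theta>" using simple_functionD(2)[OF g, of "{h j}"] S by (auto simp: A_def finite_measure_sets_def)
    moreover have "emeasure \<Theta> (A j) \<le> emeasure \<Theta> S" using S by (intro emeasure_mono) (auto simp: A_def finite_measure_sets_def)
    ultimately show ?thesis using S by (auto simp: finite_measure_sets_def intro: le_less_trans)
  qed
  moreover have "disjoint_family_on A {..<card V}"
    using h by (auto simp: disjoint_family_on_def A_def bij_betw_def inj_on_def)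
  moreover have "simple_mat_fun (card V) h A s = indicator S s *\<^sub>R g s" if s: "s \<in> space \<Theta>" for s
  proof -
    have "simple_mat_fun (card V) h A s = (\<Sum>j<card V. if h j = g s then indicator S s *\<^sub>R h j else 0)"
      unfolding simple_mat_fun_def using s by (intro sum.cong) (auto simp: A_def indicator_def)
    also have "\<dots> = (\<Sum>v\<in>V. if v = g s then indicator S s *\<^sub>R v else 0)"
      by (rule sum.reindex_bij_betw[OF h])
    also have "\<dots> = indicator S s *\<^sub>R g s" using V s by (simp add: V_def)
    finally show ?thesis .
  qed
  ultimately show ?thesis unfolding simple_data_def by blast
qed

text \<open>Restricting the \<open>k\<close>-th simple function to the \<open>k\<close>-th set of an
  exhaustion by sets of finite measure keeps its level sets inside the domain of the random measure.
  The factor 2 in the bound supplies the domination used for existence of the integral.\<close>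

lemma simple_data_approximation:
  fixes f :: "'s \<Rightarrow> real^'m^'m"
  assumes "sigma_finite_measure \<Theta>" and f: "f \<in> borel_measurable \<Theta>"
  shows "\<exists>n R A. (\<forall>k. simple_data \<Theta> (n k) (A k)) \<and>
    (\<forall>s\<in>space \<Theta>. (\<lambda>k. simple_mat_fun (n k) (R k) (A k) s) \<longlonglongrightarrow> f s) \<and>
    (\<forall>k. \<forall>s\<in>space \<Theta>. norm (simple_mat_fun (n k) (R k) (A k) s) \<le> 2 * norm (f s))"
proof -
  interpret sigma_finite_measure \<Theta> by fact
  obtain S :: "nat \<Rightarrow> 's set" where S: "range S \<subseteq> sets \<Theta>" "(\<Union>i. S i) = space \<Theta>" "\<And>i. emeasure \<Theta> (S i) \<noteq> \<infinity>" "incseq S"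
    using sigma_finite_incseq by metis
  have S_fms: "S k \<in> finite_measure_sets \<Theta>" for k using S by (auto simp: finite_measure_sets_def less_top)
  obtain F where F: "\<And>i. simple_function \<Theta> (F i)" "\<And>x. x \<in> space \<Theta> \<Longrightarrow> (\<lambda>i. F i x) \<longlonglongrightarrow> f x"
    "\<And>i x. x \<in> space \<Theta> \<Longrightarrow> dist (F i x) 0 \<le> 2 * dist (f x) 0"
    using borel_measurable_implies_sequence_metric[OF f, of 0] by blast
  have "\<forall>k. \<exists>n R A. simple_data \<Theta> n A \<and> (\<forall>s\<in>space \<Theta>. simple_mat_fun n R A s = indicator (S k) s *\<^sub>R F k s)"
    using simple_function_data[OF F(1) S_fms] by blast
  then obtain n R A where d: "\<And>k. simple_data \<Theta> (n k) (A k)"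
    "\<And>k s. s \<in> space \<Theta> \<Longrightarrow> simple_mat_fun (n k) (R k) (A k) s = indicator (S k) s *\<^sub>R F k s"
    by metis
  have "(\<lambda>k. simple_mat_fun (n k) (R k) (A k) s) \<longlonglongrightarrow> f s" if s: "s \<in> space \<Theta>" for s
  proof -
    obtain i where i: "s \<in> S i" using s S(2) by blast
    have "simple_mat_fun (n k) (R k) (A k) s = F k s" if "k \<ge> i" for k
      using d(2)[OF s, of k] i incseqD[OF S(4) that] by auto
    then have "eventually (\<lambda>k. F k s = simple_mat_fun (n k) (R k) (A k) s) sequentially"
      unfolding eventually_sequentially by (intro exI[of _ i]) auto
    from Lim_transform_eventually[OF F(2)[OF s] this] show ?thesis .
  qed
  moreover have "norm (simple_mat_fun (n k) (R k) (A k) s) \<le> 2 * norm (f s)" if s: "s \<in> space \<Theta>" for k s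
    using F(3)[OF s, of k] by (auto simp: d(2)[OF s] split: split_indicator)
  ultimately show ?thesis using d(1) by blast
qed

context random_measure begin

text \<open>Several simple functions, each with its own partition, form one finite family of sets
  indexed by pairs of function and piece. Pieces of different functions may overlap, which
  \<open>joint_char\<close> allows, so no common refinement is formed. The set \<open>C\<close> is
  the test set of the definition of integrability.\<close>

lemma simple_joint_char:
  fixes A :: "'j \<Rightarrow> nat \<Rightarrow> 's set"
  assumes J: "finite J" and data: "\<And>j. j \<in> J \<Longrightarrow> simple_data \<Theta> (n j) (A j)" and C: "C \<in> sets \<Theta>"
  shows "integrable \<Theta> (\<lambda>s. \<psi> (\<Sum>j\<in>J. transpose (simple_mat_fun (n j) (R j) (A j) s) *v u j))" (is ?int)
    and "(\<integral>\<omega>. iexp (\<Sum>j\<in>J. simple_stoch_integral M (n j) (R j) (\<lambda>i. A j i \<inter> C) \<omega> \<bullet> u j) \<partial>P)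
      = exp (\<integral>s. indicator C s *\<^sub>R \<psi> (\<Sum>j\<in>J. transpose (simple_mat_fun (n j) (R j) (A j) s) *v u j) \<partial>\<Theta>)" (is "?L = ?R")
proof -
  let ?I = "Sigma J (\<lambda>j. {..<n j})"
  have I: "finite ?I" using J by auto
  have A0: "A j i \<in> finite_measure_sets \<Theta>" if "j \<in> J" "i < n j" for i j
    using data[OF that(1)] that(2) by (simp add: simple_data_def)
  have AC: "A j i \<inter> C \<in> finite_measure_sets \<Theta>" if "j \<in> J" "i < n j" for i j
    using A0[OF that] C fms_sets by (intro fms_subset[OF A0[OF that]]) auto
  define v where "v p = transpose (R (fst p) (snd p)) *v u (fst p)" for p
  have sum1: "(\<Sum>p\<in>?I. indicat_real (A (fst p) (snd p)) s *\<^sub>R v p)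
      = (\<Sum>j\<in>J. transpose (simple_mat_fun (n j) (R j) (A j) s) *v u j)" for s
    using J by (subst sum.Sigma[symmetric, of J "\<lambda>j. {..<n j}" "\<lambda>j i. indicat_real (A j i) s *\<^sub>R v (j, i)", unfolded split_def prod.collapse])
      (auto simp: transpose_simple_mat_fun v_def)
  have sum2: "(\<Sum>p\<in>?I. indicat_real (A (fst p) (snd p) \<inter> C) s *\<^sub>R v p)
      = indicator C s *\<^sub>R (\<Sum>j\<in>J. transpose (simple_mat_fun (n j) (R j) (A j) s) *v u j)" for s
    unfolding sum1[symmetric] by (simp add: scaleR_sum_right indicator_inter_arith mult.commute)
  show ?int
    using joint_char(1)[OF I, of "\<lambda>p. A (fst p) (snd p)" v] A0 by (auto simp: sum1)
  have "(\<Sum>j\<in>J. simple_stoch_integral M (n j) (R j) (\<lambda>i. A j i \<inter> C) \<omega> \<bullet> u j)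
      = (\<Sum>p\<in>?I. M (A (fst p) (snd p) \<inter> C) \<omega> \<bullet> v p)" for \<omega>
    using J by (subst sum.Sigma[symmetric, of J "\<lambda>j. {..<n j}" "\<lambda>j i. M (A j i \<inter> C) \<omega> \<bullet> v (j, i)", unfolded split_def prod.collapse])
      (auto simp: simple_stoch_integral_def inner_sum_left inner_matrix_vector v_def)
  then have "?L = exp (\<integral>s. \<psi> (indicator C s *\<^sub>R (\<Sum>j\<in>J. transpose (simple_mat_fun (n j) (R j) (A j) s) *v u j)) \<partial>\<Theta>)"
    using joint_char(2)[OF I, of "\<lambda>p. A (fst p) (snd p) \<inter> C" v] AC by (auto simp: sum2)
  also have "\<dots> = ?R"
    by (intro arg_cong[where f=exp] Bochner_Integration.integral_cong) (auto split: split_indicator)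
  finally show "?L = ?R" .
qed

lemma simple_stoch_integral_measurable:
  assumes "simple_data \<Theta> n A" "C \<in> sets \<Theta>"
  shows "simple_stoch_integral M n R (\<lambda>i. A i \<inter> C) \<in> borel_measurable P"
proof -
  have "M (A i \<inter> C) \<in> borel_measurable P" if "i < n" for i
  proof (rule M_measurable)
    have "A i \<in> finite_measure_sets \<Theta>" using assms that by (simp add: simple_data_def)
    with fms_sets[OF this] show "A i \<inter> C \<in> finite_measure_sets \<Theta>" using assms(2) by (auto intro: fms_subset)
  qed
  moreover have "(\<lambda>x. Rj *v x) \<in> borel_measurable borel" for Rj :: "real^'m^'m"
    by (intro borel_measurable_continuous_onI linear_continuous_on matrix_vector_mul_bounded_linear)
  ultimately have "(\<lambda>\<omega>. R i *v M (A i \<inter> C) \<omega>) \<in> borel_measurable P" if "i < n" for i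
    using measurable_compose that by blast
  then show ?thesis
    unfolding simple_stoch_integral_def[abs_def] by (intro borel_measurable_sum) simp
qed

lemma simple_data_Int_space: "simple_data \<Theta> n A \<Longrightarrow> simple_stoch_integral M n R (\<lambda>i. A i \<inter> space \<Theta>) = simple_stoch_integral M n R A"
  unfolding simple_stoch_integral_def[abs_def] simple_data_def
  by (intro ext sum.cong arg_cong[where f="\<lambda>A. R i *v M A \<omega>" for i \<omega>] refl)
    (auto dest!: fms_sets sets.sets_into_space)

text \<open>The difference of two approximating sequences tends to 0 almost everywhere, with no
  majorant in sight. Its integrals over every measurable set converge in probability, hence so do
  their characteristic functions, and this is exactly the hypothesis of
  \<open>gliding_hump_exp\<close>.\<close>

lemma has_stoch_integral_unique:
  assumes "has_stoch_integral P \<Theta> M f Y" "has_stoch_integral P \<Theta> M f Y'"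
  shows "AE \<omega> in P. Y \<omega> = Y' \<omega>"
proof -
  have Ym [measurable]: "Y \<in> borel_measurable P" "Y' \<in> borel_measurable P" using assms by (auto simp: has_stoch_integral_def)
  obtain n1 R1 A1 where 1: "\<And>k. simple_data \<Theta> (n1 k) (A1 k)"
      "AE s in \<Theta>. (\<lambda>k. simple_mat_fun (n1 k) (R1 k) (A1 k) s) \<longlonglongrightarrow> f s"
      "\<And>C. C \<in> sets \<Theta> \<Longrightarrow> \<exists>Z \<in> borel_measurable P. conv_in_prob P (\<lambda>k. simple_stoch_integral M (n1 k) (R1 k) (\<lambda>j. A1 k j \<inter> C)) Z"
      "conv_in_prob P (\<lambda>k. simple_stoch_integral M (n1 k) (R1 k) (A1 k)) Y"
    using assms(1) unfolding has_stoch_integral_def by blast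
  obtain n2 R2 A2 where 2: "\<And>k. simple_data \<Theta> (n2 k) (A2 k)"
      "AE s in \<Theta>. (\<lambda>k. simple_mat_fun (n2 k) (R2 k) (A2 k) s) \<longlonglongrightarrow> f s"
      "\<And>C. C \<in> sets \<Theta> \<Longrightarrow> \<exists>Z \<in> borel_measurable P. conv_in_prob P (\<lambda>k. simple_stoch_integral M (n2 k) (R2 k) (\<lambda>j. A2 k j \<inter> C)) Z"
      "conv_in_prob P (\<lambda>k. simple_stoch_integral M (n2 k) (R2 k) (A2 k)) Y'"
    using assms(2) unfolding has_stoch_integral_def by blast
  \<comment> \<open>A Boolean index distinguishes the two sequences. Testing them with
    \<open>u\<close> and \<open>- u\<close> turns the joint characteristic function into that of the
    difference.\<close>
  define n where "n b = (if b then n1 else n2)" for b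
  define R where "R b = (if b then R1 else R2)" for b
  define A where "A b = (if b then A1 else A2)" for b
  have data: "simple_data \<Theta> (n b k) (A b k)" for b k using 1(1) 2(1) by (simp add: n_def A_def)
  let ?I = "\<lambda>b k C. simple_stoch_integral M (n b k) (R b k) (\<lambda>i. A b k i \<inter> C)"
  have Im: "?I b k C \<in> borel_measurable P" if "C \<in> sets \<Theta>" for b k C
    by (rule simple_stoch_integral_measurable[OF data that])
  have lim: "\<exists>Z \<in> borel_measurable P. conv_in_prob P (\<lambda>k. ?I b k C) Z" if "C \<in> sets \<Theta>" for b C
    using 1(3)[OF that] 2(3)[OF that] by (cases b) (simp_all add: n_def R_def A_def)
  have limS: "conv_in_prob P (\<lambda>k. ?I b k (space \<Theta>)) (if b then Y else Y')" for b
    using 1(4) 2(4) by (simp add: simple_data_Int_space[OF data]) (simp add: n_def R_def A_def)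
  have "(\<integral>\<omega>. iexp ((Y \<omega> - Y' \<omega>) \<bullet> u) \<partial>P) = 1" for u
  proof -
    define w where "w b = (if b then u else - u)" for b
    define g where "g k s = \<psi> (\<Sum>b\<in>UNIV. transpose (simple_mat_fun (n b k) (R b k) (A b k) s) *v w b)" for k s
    have ch: "(\<integral>\<omega>. iexp (\<Sum>b\<in>UNIV. ?I b k C \<omega> \<bullet> w b) \<partial>P) = exp (\<integral>s. indicator C s *\<^sub>R g k s \<partial>\<Theta>)"
      if "C \<in> sets \<Theta>" for k C
      unfolding g_def by (rule simple_joint_char(2)[OF _ data that]) simp
    have lim1: "(\<lambda>k. exp (\<integral>s. g k s \<partial>\<Theta>)) \<longlonglongrightarrow> 1"
    proof (rule gliding_hump_exp[OF sigma_finite])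
      show "integrable \<Theta> (g k)" for k
        unfolding g_def by (rule simple_joint_char(1)[OF _ data sets.top]) simp
      show "AE s in \<Theta>. (\<lambda>k. g k s) \<longlonglongrightarrow> 0"
        using 1(2) 2(2)
      proof eventually_elim
        case (elim s)
        have "(\<lambda>k. simple_mat_fun (n b k) (R b k) (A b k) s) \<longlonglongrightarrow> f s" for b
          using elim by (simp add: n_def R_def A_def)
        then have "(\<lambda>k. \<Sum>b\<in>UNIV. transpose (simple_mat_fun (n b k) (R b k) (A b k) s) *v w b) \<longlonglongrightarrow> (\<Sum>b\<in>UNIV. transpose (f s) *v w b)"
          by (intro tendsto_sum bounded_linear.tendsto[OF bounded_linear_transpose_mult])
        also have "(\<Sum>b\<in>UNIV. transpose (f s) *v w b) = 0"
          by (simp add: UNIV_bool w_def linear_simps(4)[OF matrix_vector_mul_bounded_linear])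
        finally have "(\<lambda>k. \<psi> (\<Sum>b\<in>UNIV. transpose (simple_mat_fun (n b k) (R b k) (A b k) s) *v w b)) \<longlonglongrightarrow> \<psi> 0"
          using \<psi>_cont by (intro isCont_tendsto_compose[of 0 \<psi>]) (auto simp: continuous_on_eq_continuous_at)
        then show ?case by (simp add: g_def)
      qed
      show "convergent (\<lambda>k. exp (\<integral>s. indicator C s *\<^sub>R g k s \<partial>\<Theta>))" if C: "C \<in> sets \<Theta>" for C
      proof -
        have "\<forall>b. \<exists>Z. Z \<in> borel_measurable P \<and> conv_in_prob P (\<lambda>k. ?I b k C) Z"
          using lim[OF C] by (simp add: Bex_def)
        from choice[OF this] obtain Z where Z: "\<And>b. Z b \<in> borel_measurable P" "\<And>b. conv_in_prob P (\<lambda>k. ?I b k C) (Z b)"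
          by auto
        have "(\<lambda>k. \<integral>\<omega>. iexp (\<Sum>b\<in>UNIV. ?I b k C \<omega> \<bullet> w b) \<partial>P) \<longlonglongrightarrow> (\<integral>\<omega>. iexp (\<Sum>b\<in>UNIV. Z b \<omega> \<bullet> w b) \<partial>P)"
          by (rule conv_in_prob_joint_char) (use Z Im[OF C] in auto)
        then show ?thesis unfolding ch[OF C] by (auto simp: convergent_def)
      qed
    qed
    have eqS: "(\<integral>\<omega>. iexp (\<Sum>b\<in>UNIV. ?I b k (space \<Theta>) \<omega> \<bullet> w b) \<partial>P) = exp (\<integral>s. g k s \<partial>\<Theta>)" for k
      unfolding ch[OF sets.top] by (intro arg_cong[where f=exp] Bochner_Integration.integral_cong) auto
    have "(\<lambda>k. \<integral>\<omega>. iexp (\<Sum>b\<in>UNIV. ?I b k (space \<Theta>) \<omega> \<bullet> w b) \<partial>P) \<longlonglongrightarrow> (\<integral>\<omega>. iexp (\<Sum>b\<in>UNIV. (if b then Y else Y') \<omega> \<bullet> w b) \<partial>P)"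
      by (rule conv_in_prob_joint_char) (use limS Im in auto)
    from LIMSEQ_unique[OF this[unfolded eqS] lim1]
    have "(\<integral>\<omega>. iexp (\<Sum>b\<in>UNIV. (if b then Y else Y') \<omega> \<bullet> w b) \<partial>P) = 1" .
    then show ?thesis by (simp add: UNIV_bool w_def inner_diff_left add.commute)
  qed
  then have "AE \<omega> in P. Y \<omega> - Y' \<omega> = 0" by (intro AE_zero_if_char) auto
  then show ?thesis by eventually_elim simp
qed

end

section \<open>Integration under a two-power bound on the exponent\<close>

locale random_measure_bounded = random_measure P \<Theta> M \<psi>
  for P :: "'w measure" and \<Theta> :: "'s measure" and M :: "'s set \<Rightarrow> 'w \<Rightarrow> real^'m" and \<psi> +
  fixes K a b :: real
  assumes ab: "0 < a" "0 < b" and K: "0 \<le> K"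
    and \<psi>_le: "\<And>v. cmod (\<psi> v) \<le> K * (norm v powr a + norm v powr b)"
begin

text \<open>A sufficient condition for integrability with respect to \<open>M\<close>: both powers
  from the bound on \<open>\<psi>\<close> must be integrable.\<close>

definition good :: "('s \<Rightarrow> real^'m^'m) \<Rightarrow> bool" where
  "good f \<longleftrightarrow> f \<in> borel_measurable \<Theta> \<and> integrable \<Theta> (\<lambda>s. norm (f s) powr a) \<and> integrable \<Theta> (\<lambda>s. norm (f s) powr b)"

text \<open>A bound for the norm of the sum of the \<open>transpose (T j) *v u j\<close> when each
  \<open>T j\<close> is at most \<open>c\<close> times as large as \<open>f j s\<close>. The
  constant is 1 for the integrands themselves and 2 for their simple approximations.\<close>

definition envelope :: "real \<Rightarrow> ('j \<Rightarrow> 's \<Rightarrow> real^'m^'m) \<Rightarrow> ('j \<Rightarrow> real^'m) \<Rightarrow> 'j set \<Rightarrow> 's \<Rightarrow> real" where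
  "envelope c f u J s = (\<Sum>j\<in>J. c * norm (f j s) * norm (u j))"

lemma integrable_envelope:
  assumes "finite J" "\<And>j. j \<in> J \<Longrightarrow> good (f j)" "0 \<le> c"
  shows "integrable \<Theta> (\<lambda>s. K * (envelope c f u J s powr a + envelope c f u J s powr b))"
proof -
  have e: "integrable \<Theta> (\<lambda>s. envelope c f u J s powr p)" if p: "0 < p" and int: "\<And>j. j \<in> J \<Longrightarrow> integrable \<Theta> (\<lambda>s. norm (f j s) powr p)" for p
  proof (rule Bochner_Integration.integrable_bound)
    show "integrable \<Theta> (\<lambda>s. \<Sum>j\<in>J. (real (card J) * c * norm (u j)) powr p * norm (f j s) powr p)"
      by (intro Bochner_Integration.integrable_sum integrable_mult_right int)
    have [measurable]: "f j \<in> borel_measurable \<Theta>" if "j \<in> J" for j using assms(2)[OF that] by (simp add: good_def)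
    show "(\<lambda>s. envelope c f u J s powr p) \<in> borel_measurable \<Theta>" unfolding envelope_def by measurable
    show "AE s in \<Theta>. norm (envelope c f u J s powr p) \<le> norm (\<Sum>j\<in>J. (real (card J) * c * norm (u j)) powr p * norm (f j s) powr p)"
    proof (rule AE_I2)
      fix s
      have "envelope c f u J s powr p \<le> (\<Sum>j\<in>J. (real (card J) * (c * norm (f j s) * norm (u j))) powr p)"
        unfolding envelope_def using assms p by (intro powr_sum_le) auto
      also have "\<dots> = (\<Sum>j\<in>J. (real (card J) * c * norm (u j)) powr p * norm (f j s) powr p)"
        using assms(3) by (intro sum.cong refl) (simp add: powr_mult[symmetric] mult_ac)
      finally show "norm (envelope c f u J s powr p) \<le> norm (\<Sum>j\<in>J. (real (card J) * c * norm (u j)) powr p * norm (f j s) powr p)"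
        by simp
    qed
  qed
  show ?thesis
    using assms(2) by (intro integrable_mult_right Bochner_Integration.integrable_add e ab) (auto simp: good_def)
qed

lemma \<psi>_le_envelope:
  fixes T :: "'j \<Rightarrow> real^'m^'m"
  assumes "\<And>j. j \<in> J \<Longrightarrow> norm (T j) \<le> c * norm (f j s)"
  shows "cmod (\<psi> (\<Sum>j\<in>J. transpose (T j) *v u j)) \<le> K * (envelope c f u J s powr a + envelope c f u J s powr b)"
proof -
  have "norm (\<Sum>j\<in>J. transpose (T j) *v u j) \<le> envelope c f u J s"
    unfolding envelope_def
  proof (rule sum_norm_le)
    fix j assume "j \<in> J"
    then show "norm (transpose (T j) *v u j) \<le> c * norm (f j s) * norm (u j)"
      using norm_matrix_vector_mult[of "transpose (T j)" "u j"] mult_right_mono[OF assms, of j "norm (u j)"]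
      by (simp add: norm_transpose)
  qed
  then have "norm (\<Sum>j\<in>J. transpose (T j) *v u j) powr p \<le> envelope c f u J s powr p" if "0 < p" for p
    using that by (intro powr_mono2) auto
  from add_mono[OF this[OF ab(1)] this[OF ab(2)]] show ?thesis
    using \<psi>_le[of "\<Sum>j\<in>J. transpose (T j) *v u j"] K by (meson mult_left_mono order_trans)
qed

lemma measurable_transpose_mult:
  "T \<in> borel_measurable \<Theta> \<Longrightarrow> (\<lambda>s. transpose (T s) *v (w :: real^'m)) \<in> borel_measurable \<Theta>"
  by (rule measurable_compose[OF _ borel_measurable_continuous_onI[OF linear_continuous_on[OF bounded_linear_transpose_mult]]])

lemma measurable_\<psi>_sum:
  fixes T :: "'j \<Rightarrow> 's \<Rightarrow> real^'m^'m"
  shows "(\<And>j. j \<in> J \<Longrightarrow> T j \<in> borel_measurable \<Theta>) \<Longrightarrow>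
    (\<lambda>s. \<psi> (\<Sum>j\<in>J. transpose (T j s) *v u j)) \<in> borel_measurable \<Theta>"
  by (intro measurable_compose[OF _ \<psi>_measurable] borel_measurable_sum measurable_transpose_mult)

lemma integrable_\<psi>:
  assumes "finite J" "\<And>j. j \<in> J \<Longrightarrow> good (f j)"
  shows "integrable \<Theta> (\<lambda>s. \<psi> (\<Sum>j\<in>J. transpose (f j s) *v u j))"
proof (rule Bochner_Integration.integrable_bound[OF integrable_envelope[where c=1 and u=u, OF assms]])
  have [measurable]: "f j \<in> borel_measurable \<Theta>" if "j \<in> J" for j using assms(2)[OF that] by (simp add: good_def)
  show "(\<lambda>s. \<psi> (\<Sum>j\<in>J. transpose (f j s) *v u j)) \<in> borel_measurable \<Theta>"
    by (intro measurable_\<psi>_sum) simp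
  show "AE s in \<Theta>. cmod (\<psi> (\<Sum>j\<in>J. transpose (f j s) *v u j)) \<le> norm (K * (envelope 1 f u J s powr a + envelope 1 f u J s powr b))"
  proof (rule AE_I2)
    fix s
    have "cmod (\<psi> (\<Sum>j\<in>J. transpose (f j s) *v u j)) \<le> K * (envelope 1 f u J s powr a + envelope 1 f u J s powr b)"
      by (rule \<psi>_le_envelope) simp
    then show "cmod (\<psi> (\<Sum>j\<in>J. transpose (f j s) *v u j)) \<le> norm (K * (envelope 1 f u J s powr a + envelope 1 f u J s powr b))"
      by simp
  qed
qed simp_all

lemma good_joint_approximation:
  fixes J :: "'j set" and f g :: "'j \<Rightarrow> 's \<Rightarrow> real^'m^'m" and F :: "'j \<Rightarrow> nat \<Rightarrow> 's \<Rightarrow> real^'m^'m"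
  assumes "finite J" "\<And>j. j \<in> J \<Longrightarrow> good (f j)" "C \<in> sets \<Theta>"
    and F: "\<And>j k s. j \<in> J \<Longrightarrow> s \<in> space \<Theta> \<Longrightarrow> norm (F j k s) \<le> c * norm (f j s)" "0 \<le> c"
    and lim: "\<And>j s. j \<in> J \<Longrightarrow> s \<in> space \<Theta> \<Longrightarrow> (\<lambda>k. F j k s) \<longlonglongrightarrow> g j s"
    and meas: "\<And>j k. j \<in> J \<Longrightarrow> F j k \<in> borel_measurable \<Theta>"
  shows "(\<lambda>k. \<integral>s. indicator C s *\<^sub>R \<psi> (\<Sum>j\<in>J. transpose (F j k s) *v u j) \<partial>\<Theta>)
    \<longlonglongrightarrow> (\<integral>s. indicator C s *\<^sub>R \<psi> (\<Sum>j\<in>J. transpose (g j s) *v u j) \<partial>\<Theta>)"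
proof (rule integral_dominated_convergence[OF _ _ integrable_envelope[OF assms(1,2) F(2)]])
  have [measurable]: "C \<in> sets \<Theta>" by fact
  have [measurable]: "F j k \<in> borel_measurable \<Theta>" if "j \<in> J" for j k by (rule meas[OF that])
  have [measurable]: "g j \<in> borel_measurable \<Theta>" if "j \<in> J" for j
    by (rule borel_measurable_LIMSEQ_metric[OF meas lim]) (use that in auto)
  show "(\<lambda>s. indicator C s *\<^sub>R \<psi> (\<Sum>j\<in>J. transpose (F j k s) *v u j)) \<in> borel_measurable \<Theta>" for k
    by (intro borel_measurable_scaleR borel_measurable_indicator measurable_\<psi>_sum meas) auto
  show "(\<lambda>s. indicator C s *\<^sub>R \<psi> (\<Sum>j\<in>J. transpose (g j s) *v u j)) \<in> borel_measurable \<Theta>"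
    by (intro borel_measurable_scaleR borel_measurable_indicator measurable_\<psi>_sum) auto
  show "AE s in \<Theta>. (\<lambda>k. indicator C s *\<^sub>R \<psi> (\<Sum>j\<in>J. transpose (F j k s) *v u j)) \<longlonglongrightarrow> indicator C s *\<^sub>R \<psi> (\<Sum>j\<in>J. transpose (g j s) *v u j)"
  proof (rule AE_I2)
    fix s assume "s \<in> space \<Theta>"
    then have "(\<lambda>k. \<Sum>j\<in>J. transpose (F j k s) *v u j) \<longlonglongrightarrow> (\<Sum>j\<in>J. transpose (g j s) *v u j)"
      using lim by (intro tendsto_sum bounded_linear.tendsto[OF bounded_linear_transpose_mult])
    then show "(\<lambda>k. indicator C s *\<^sub>R \<psi> (\<Sum>j\<in>J. transpose (F j k s) *v u j)) \<longlonglongrightarrow> indicator C s *\<^sub>R \<psi> (\<Sum>j\<in>J. transpose (g j s) *v u j)"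
      using \<psi>_cont by (intro tendsto_scaleR tendsto_const isCont_tendsto_compose[of _ \<psi>]) (auto simp: continuous_on_eq_continuous_at)
  qed
  show "AE s in \<Theta>. norm (indicator C s *\<^sub>R \<psi> (\<Sum>j\<in>J. transpose (F j k s) *v u j)) \<le> K * (envelope c f u J s powr a + envelope c f u J s powr b)" for k
  proof (rule AE_I2)
    fix s assume "s \<in> space \<Theta>"
    then have "cmod (\<psi> (\<Sum>j\<in>J. transpose (F j k s) *v u j)) \<le> K * (envelope c f u J s powr a + envelope c f u J s powr b)"
      using F(1) by (intro \<psi>_le_envelope) auto
    then show "norm (indicator C s *\<^sub>R \<psi> (\<Sum>j\<in>J. transpose (F j k s) *v u j)) \<le> K * (envelope c f u J s powr a + envelope c f u J s powr b)"
      using K by (auto split: split_indicator)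
  qed
qed

lemma simple_mat_fun_measurable:
  assumes "simple_data \<Theta> n A"
  shows "simple_mat_fun n R A \<in> borel_measurable \<Theta>"
  unfolding simple_mat_fun_def[abs_def] using assms
  by (intro borel_measurable_sum borel_measurable_scaleR borel_measurable_indicator borel_measurable_const)
    (auto simp: simple_data_def dest: fms_sets)

text \<open>Bundled into a single predicate so that integrals and approximating data can be chosen
  for a whole family of integrands at once.\<close>

definition dominated_approximation ::
    "('s \<Rightarrow> real^'m^'m) \<Rightarrow> ('w \<Rightarrow> real^'m) \<Rightarrow> (nat \<Rightarrow> nat) \<Rightarrow> (nat \<Rightarrow> nat \<Rightarrow> real^'m^'m) \<Rightarrow> (nat \<Rightarrow> nat \<Rightarrow> 's set) \<Rightarrow> bool" where
  "dominated_approximation f Y n R A \<longleftrightarrow> has_stoch_integral P \<Theta> M f Y \<and> (\<forall>k. simple_data \<Theta> (n k) (A k)) \<and>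
    (\<forall>s\<in>space \<Theta>. (\<lambda>k. simple_mat_fun (n k) (R k) (A k) s) \<longlonglongrightarrow> f s) \<and>
    (\<forall>k. \<forall>s\<in>space \<Theta>. norm (simple_mat_fun (n k) (R k) (A k) s) \<le> 2 * norm (f s)) \<and>
    conv_in_prob P (\<lambda>k. simple_stoch_integral M (n k) (R k) (A k)) Y \<and> Y \<in> borel_measurable P"

text \<open>The majorant \<open>2 * norm (f s)\<close> lets the exponents of differences tend to 0
  along any two index sequences and over any set \<open>C\<close>. The approximating integrals are
  therefore Cauchy in probability over every \<open>C\<close>.\<close>

lemma good_dominated_approximation:
  assumes f: "good f"
  shows "\<exists>Y n R A. dominated_approximation f Y n R A"
proof -
  have fm: "f \<in> borel_measurable \<Theta>" using f by (simp add: good_def)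
  obtain n R A where d: "\<And>k. simple_data \<Theta> (n k) (A k)"
    "\<And>s. s \<in> space \<Theta> \<Longrightarrow> (\<lambda>k. simple_mat_fun (n k) (R k) (A k) s) \<longlonglongrightarrow> f s"
    "\<And>k s. s \<in> space \<Theta> \<Longrightarrow> norm (simple_mat_fun (n k) (R k) (A k) s) \<le> 2 * norm (f s)"
    using simple_data_approximation[OF sigma_finite fm] by blast
  let ?I = "\<lambda>k C. simple_stoch_integral M (n k) (R k) (\<lambda>i. A k i \<inter> C)"
  let ?F = "\<lambda>k. simple_mat_fun (n k) (R k) (A k)"
  have lim: "\<exists>Z\<in>borel_measurable P. conv_in_prob P (\<lambda>k. ?I k C) Z" if C: "C \<in> sets \<Theta>" for C
  proof (rule conv_in_prob_if_char_Cauchy)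
    show "?I k C \<in> borel_measurable P" for k by (rule simple_stoch_integral_measurable[OF d(1) C])
    fix k l :: "nat \<Rightarrow> nat" and u :: "real^'m" assume kl: "\<And>j. k j \<ge> j" "\<And>j. l j \<ge> j"
    define m where "m b = (if b then k else l)" for b
    define w where "w b = (if b then u else - u)" for b
    have m: "filterlim (m b) sequentially sequentially" for b
      using kl by (cases b) (auto simp: m_def intro!: filterlim_at_top_mono[OF filterlim_ident])
    have ch: "(\<integral>\<omega>. iexp ((?I (k j) C \<omega> - ?I (l j) C \<omega>) \<bullet> u) \<partial>P)
        = exp (\<integral>s. indicator C s *\<^sub>R \<psi> (\<Sum>b\<in>UNIV. transpose (?F (m b j) s) *v w b) \<partial>\<Theta>)" for j
      using simple_joint_char(2)[of "UNIV :: bool set" "\<lambda>b. n (m b j)" "\<lambda>b. A (m b j)" C "\<lambda>b. R (m b j)" w] d(1) C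
      by (simp add: UNIV_bool m_def w_def inner_diff_left add.commute)
    have "(\<lambda>j. \<integral>s. indicator C s *\<^sub>R \<psi> (\<Sum>b\<in>UNIV. transpose (?F (m b j) s) *v w b) \<partial>\<Theta>)
        \<longlonglongrightarrow> (\<integral>s. indicator C s *\<^sub>R \<psi> (\<Sum>b\<in>(UNIV :: bool set). transpose (f s) *v w b) \<partial>\<Theta>)"
    proof (rule good_joint_approximation[of UNIV "\<lambda>_. f" C _ 2])
      show "(\<lambda>j. ?F (m b j) s) \<longlonglongrightarrow> f s" if "s \<in> space \<Theta>" for b s
        using filterlim_compose[OF d(2)[OF that] m] .
    qed (use f C d(1,3) in \<open>auto intro: simple_mat_fun_measurable\<close>)
    also have "(\<integral>s. indicator C s *\<^sub>R \<psi> (\<Sum>b\<in>(UNIV :: bool set). transpose (f s) *v w b) \<partial>\<Theta>) = 0"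
      by (simp add: UNIV_bool w_def linear_simps(4)[OF matrix_vector_mul_bounded_linear])
    finally show "(\<lambda>j. \<integral>\<omega>. iexp ((?I (k j) C \<omega> - ?I (l j) C \<omega>) \<bullet> u) \<partial>P) \<longlonglongrightarrow> 1"
      unfolding ch by (rule tendsto_exp[of _ 0, simplified])
  qed
  obtain Y where Y: "Y \<in> borel_measurable P" "conv_in_prob P (\<lambda>k. simple_stoch_integral M (n k) (R k) (A k)) Y"
    using lim[OF sets.top] unfolding simple_data_Int_space[OF d(1)] by blast
  have "has_stoch_integral P \<Theta> M f Y"
    unfolding has_stoch_integral_def
  proof (intro conjI exI[of _ n] exI[of _ R] exI[of _ A] allI ballI)
    show "AE s in \<Theta>. (\<lambda>k. ?F k s) \<longlonglongrightarrow> f s" using d(2) by (rule AE_I2)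
  qed (use fm Y d(1) lim in auto)
  then have "dominated_approximation f Y n R A"
    unfolding dominated_approximation_def using d Y by (intro conjI allI ballI)
  then show ?thesis by (intro exI)
qed

text \<open>The given integral comes from an unknown approximating sequence. By uniqueness it agrees
  almost surely with the one from a dominated sequence, for which the limit can be taken under the
  integral.\<close>

lemma has_stoch_integral_joint_char:
  fixes J :: "'j set" and f :: "'j \<Rightarrow> 's \<Rightarrow> real^'m^'m"
  assumes J: "finite J" and f: "\<And>j. j \<in> J \<Longrightarrow> good (f j)"
    and Y: "\<And>j. j \<in> J \<Longrightarrow> has_stoch_integral P \<Theta> M (f j) (Y j)"
  shows "(\<integral>\<omega>. iexp (\<Sum>j\<in>J. Y j \<omega> \<bullet> u j) \<partial>P) = exp (\<integral>s. \<psi> (\<Sum>j\<in>J. transpose (f j s) *v u j) \<partial>\<Theta>)"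
proof -
  have "\<exists>Z n R A. \<forall>j\<in>J. dominated_approximation (f j) (Z j) (n j) (R j) (A j)"
    using good_dominated_approximation[OF f] by metis
  then obtain Z n R A where dom: "\<And>j. j \<in> J \<Longrightarrow> dominated_approximation (f j) (Z j) (n j) (R j) (A j)"
    by blast
  have Z: "has_stoch_integral P \<Theta> M (f j) (Z j)" if "j \<in> J" for j
    using dom[OF that] by (simp add: dominated_approximation_def)
  have d: "simple_data \<Theta> (n j k) (A j k)"
      "s \<in> space \<Theta> \<Longrightarrow> (\<lambda>k. simple_mat_fun (n j k) (R j k) (A j k) s) \<longlonglongrightarrow> f j s"
      "s \<in> space \<Theta> \<Longrightarrow> norm (simple_mat_fun (n j k) (R j k) (A j k) s) \<le> 2 * norm (f j s)" if "j \<in> J" for j k s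
    using dom[OF that] by (simp_all add: dominated_approximation_def)
  have conv: "conv_in_prob P (\<lambda>k. simple_stoch_integral M (n j k) (R j k) (A j k)) (Z j)" if "j \<in> J" for j
    using dom[OF that] by (simp add: dominated_approximation_def)
  have Zm: "Z j \<in> borel_measurable P" if "j \<in> J" for j
    using dom[OF that] by (simp add: dominated_approximation_def)
  have "AE \<omega> in P. \<forall>j\<in>J. Y j \<omega> = Z j \<omega>"
    using J has_stoch_integral_unique[OF Y Z] by (simp add: AE_finite_all)
  then have "(\<integral>\<omega>. iexp (\<Sum>j\<in>J. Y j \<omega> \<bullet> u j) \<partial>P) = (\<integral>\<omega>. iexp (\<Sum>j\<in>J. Z j \<omega> \<bullet> u j) \<partial>P)"
  proof (intro integral_cong_AE)
    have [measurable]: "Y j \<in> borel_measurable P" "Z j \<in> borel_measurable P" if "j \<in> J" for j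
      using Y[OF that] Zm[OF that] by (auto simp: has_stoch_integral_def)
    show "(\<lambda>\<omega>. iexp (\<Sum>j\<in>J. Y j \<omega> \<bullet> u j)) \<in> borel_measurable P" by measurable
    show "(\<lambda>\<omega>. iexp (\<Sum>j\<in>J. Z j \<omega> \<bullet> u j)) \<in> borel_measurable P" by measurable
  qed (auto elim!: eventually_mono)
  moreover have lim1: "(\<lambda>k. \<integral>\<omega>. iexp (\<Sum>j\<in>J. simple_stoch_integral M (n j k) (R j k) (\<lambda>i. A j k i \<inter> space \<Theta>) \<omega> \<bullet> u j) \<partial>P)
      \<longlonglongrightarrow> (\<integral>\<omega>. iexp (\<Sum>j\<in>J. Z j \<omega> \<bullet> u j) \<partial>P)"
  proof (rule conv_in_prob_joint_char)
    fix j assume j: "j \<in> J"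
    show "conv_in_prob P (\<lambda>k. simple_stoch_integral M (n j k) (R j k) (\<lambda>i. A j k i \<inter> space \<Theta>)) (Z j)"
      unfolding simple_data_Int_space[OF d(1)[OF j]] by (rule conv[OF j])
    show "simple_stoch_integral M (n j k) (R j k) (\<lambda>i. A j k i \<inter> space \<Theta>) \<in> borel_measurable P" for k
      by (rule simple_stoch_integral_measurable[OF d(1)[OF j]]) simp
  qed (rule Zm)
  moreover have eqk: "(\<integral>\<omega>. iexp (\<Sum>j\<in>J. simple_stoch_integral M (n j k) (R j k) (\<lambda>i. A j k i \<inter> space \<Theta>) \<omega> \<bullet> u j) \<partial>P)
      = exp (\<integral>s. indicator (space \<Theta>) s *\<^sub>R \<psi> (\<Sum>j\<in>J. transpose (simple_mat_fun (n j k) (R j k) (A j k) s) *v u j) \<partial>\<Theta>)" for k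
    by (rule simple_joint_char(2)[OF J d(1)]) auto
  moreover have lim2: "(\<lambda>k. exp (\<integral>s. indicator (space \<Theta>) s *\<^sub>R \<psi> (\<Sum>j\<in>J. transpose (simple_mat_fun (n j k) (R j k) (A j k) s) *v u j) \<partial>\<Theta>))
      \<longlonglongrightarrow> exp (\<integral>s. indicator (space \<Theta>) s *\<^sub>R \<psi> (\<Sum>j\<in>J. transpose (f j s) *v u j) \<partial>\<Theta>)"
    by (intro tendsto_exp good_joint_approximation[OF J f sets.top d(3) _ d(2)] simple_mat_fun_measurable d(1)) auto
  moreover have "(\<integral>s. indicator (space \<Theta>) s *\<^sub>R \<psi> (\<Sum>j\<in>J. transpose (f j s) *v u j) \<partial>\<Theta>) = (\<integral>s. \<psi> (\<Sum>j\<in>J. transpose (f j s) *v u j) \<partial>\<Theta>)"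
    by (intro Bochner_Integration.integral_cong) auto
  ultimately show ?thesis
    using LIMSEQ_unique[OF lim1[unfolded eqk] lim2] by (simp only:)
qed

lemma good_has_stoch_integral: "good f \<Longrightarrow> has_stoch_integral P \<Theta> M f (stoch_integral P \<Theta> M f)"
  unfolding stoch_integral_def
  by (rule someI_ex[of "has_stoch_integral P \<Theta> M f"]) (use good_dominated_approximation[of f] in \<open>unfold dominated_approximation_def, blast\<close>)

end


section \<open>Operator-stable distributions\<close>

text \<open>The double-angle formula makes \<open>1 - cos\<close> twice a squared sine, and sine is
  subadditive in absolute value. Integrated, the inequality holds for \<open>1 - Re\<close> of a
  characteristic function, and in the limit for \<open>- Re \<psi>\<close>.\<close>

lemma one_minus_cos_add: "1 - cos (a + b) \<le> 2 * (1 - cos a) + 2 * (1 - cos b :: real)"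
proof -
  have dbl: "1 - cos t = 2 * (sin (t / 2))\<^sup>2" for t :: real
    using cos_double_sin[of "t / 2"] by simp
  have "\<bar>sin (a / 2 + b / 2)\<bar> \<le> \<bar>sin (a / 2)\<bar> * \<bar>cos (b / 2)\<bar> + \<bar>cos (a / 2)\<bar> * \<bar>sin (b / 2)\<bar>"
    unfolding sin_add abs_mult[symmetric] by (rule abs_triangle_ineq)
  also have "\<dots> \<le> \<bar>sin (a / 2)\<bar> * 1 + 1 * \<bar>sin (b / 2)\<bar>"
    by (intro add_mono mult_mono) auto
  finally have "(sin (a / 2 + b / 2))\<^sup>2 \<le> (\<bar>sin (a / 2)\<bar> + \<bar>sin (b / 2)\<bar>)\<^sup>2"
    using power_mono[of "\<bar>sin (a / 2 + b / 2)\<bar>" "\<bar>sin (a / 2)\<bar> + \<bar>sin (b / 2)\<bar>" 2] by simp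
  also have "\<dots> \<le> 2 * (sin (a / 2))\<^sup>2 + 2 * (sin (b / 2))\<^sup>2"
    using sum_squares_bound[of "\<bar>sin (a / 2)\<bar>" "\<bar>sin (b / 2)\<bar>"] by (simp add: power2_sum)
  finally show ?thesis unfolding dbl by (simp add: add_divide_distrib)
qed

lemma char_fun_0: "prob_space \<mu> \<Longrightarrow> char_fun \<mu> 0 = 1"
  by (simp add: char_fun_def prob_space.prob_space)

lemma integrable_iexp_inner:
  fixes \<mu> :: "'a::euclidean_space measure"
  assumes "prob_space \<mu>" "sets \<mu> = sets borel"
  shows "integrable \<mu> (\<lambda>x. iexp ((x - y) \<bullet> u))"
proof -
  interpret prob_space \<mu> by fact
  note [measurable_cong] = assms(2)
  show ?thesis by (rule integrable_const_bound[of _ 1]) auto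
qed

lemma integrable_cos_inner:
  fixes \<mu> :: "'a::euclidean_space measure"
  assumes "prob_space \<mu>" "sets \<mu> = sets borel"
  shows "integrable \<mu> (\<lambda>x. 1 - cos ((x - y) \<bullet> u))"
proof -
  interpret prob_space \<mu> by fact
  note [measurable_cong] = assms(2)
  show ?thesis by (rule integrable_const_bound[of _ 2]) (auto intro: order_trans[OF abs_triangle_ineq4])
qed

lemma char_fun_uminus: "char_fun \<mu> (- u) = cnj (char_fun \<mu> u)"
proof -
  have "char_fun \<mu> (- u) = (\<integral>x. cnj (iexp (x \<bullet> u)) \<partial>\<mu>)"
    unfolding char_fun_def by (intro Bochner_Integration.integral_cong) (auto simp: exp_cnj)
  also have "\<dots> = cnj (char_fun \<mu> u)" unfolding char_fun_def by (rule Bochner_Integration.integral_cnj)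
  finally show ?thesis .
qed

lemma norm_char_fun_le: "prob_space \<mu> \<Longrightarrow> cmod (char_fun \<mu> u) \<le> 1"
  unfolding char_fun_def
  using integral_norm_bound[of \<mu> "\<lambda>x. iexp (x \<bullet> u)"] by (simp add: prob_space.prob_space)

lemma Re_char_fun_shift:
  assumes "prob_space \<mu>" "sets \<mu> = sets borel"
  shows "1 - Re (char_fun \<mu> u * iexp (- (y \<bullet> u))) = (\<integral>x. 1 - cos ((x - y) \<bullet> u) \<partial>\<mu>)"
proof -
  interpret prob_space \<mu> by fact
  have "char_fun \<mu> u * iexp (- (y \<bullet> u)) = (\<integral>x. iexp ((x - y) \<bullet> u) \<partial>\<mu>)"
    unfolding char_fun_def
    by (subst integral_mult_left_zero[symmetric]) (simp add: exp_add[symmetric] inner_diff_left algebra_simps)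
  then have "Re (char_fun \<mu> u * iexp (- (y \<bullet> u))) = (\<integral>x. cos ((x - y) \<bullet> u) \<partial>\<mu>)"
    using integral_Re[OF integrable_iexp_inner[OF assms, of y u]] by (simp add: Re_exp)
  moreover have "integrable \<mu> (\<lambda>x. cos ((x - y) \<bullet> u))"
    using Bochner_Integration.integrable_diff[OF integrable_const[of 1] integrable_cos_inner[OF assms, of y u]] by simp
  ultimately show ?thesis by (simp add: prob_space)
qed

lemma one_minus_Re_char_fun_add:
  assumes "prob_space \<mu>" "sets \<mu> = sets borel"
  shows "1 - Re (char_fun \<mu> (u + v) * iexp (- (y \<bullet> (u + v)))) \<le>
    2 * (1 - Re (char_fun \<mu> u * iexp (- (y \<bullet> u)))) + 2 * (1 - Re (char_fun \<mu> v * iexp (- (y \<bullet> v))))"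
proof -
  have int: "integrable \<mu> (\<lambda>x. 2 * (1 - cos ((x - y) \<bullet> w)))" for w
    by (intro integrable_mult_right integrable_cos_inner assms)
  have "(\<integral>x. 1 - cos ((x - y) \<bullet> (u + v)) \<partial>\<mu>) \<le> (\<integral>x. 2 * (1 - cos ((x - y) \<bullet> u)) + 2 * (1 - cos ((x - y) \<bullet> v)) \<partial>\<mu>)"
  proof (rule integral_mono)
    show "1 - cos ((x - y) \<bullet> (u + v)) \<le> 2 * (1 - cos ((x - y) \<bullet> u)) + 2 * (1 - cos ((x - y) \<bullet> v))" for x
      unfolding inner_add_right by (rule one_minus_cos_add)
  qed (intro Bochner_Integration.integrable_add int integrable_cos_inner assms)+
  also have "\<dots> = 2 * (\<integral>x. 1 - cos ((x - y) \<bullet> u) \<partial>\<mu>) + 2 * (\<integral>x. 1 - cos ((x - y) \<bullet> v) \<partial>\<mu>)"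
    unfolding Bochner_Integration.integral_add[OF int int] integral_mult_right_zero ..
  finally show ?thesis unfolding Re_char_fun_shift[OF assms] .
qed

text \<open>Averaging the shift \<open>y\<close> over \<open>\<mu>\<close> itself produces the
  characteristic function of the difference of two independent copies, without constructing the law
  of that difference.\<close>

lemma char_fun_symmetrised:
  assumes "prob_space \<mu>" "sets \<mu> = sets borel"
  shows "integrable \<mu> (\<lambda>y. 1 - Re (char_fun \<mu> u * iexp (- (y \<bullet> u))))"
    and "(\<integral>y. 1 - Re (char_fun \<mu> u * iexp (- (y \<bullet> u))) \<partial>\<mu>) = 1 - (cmod (char_fun \<mu> u))\<^sup>2"
proof -
  interpret prob_space \<mu> by fact
  have int0: "integrable \<mu> (\<lambda>y. iexp (y \<bullet> (- u)))"
    using integrable_iexp_inner[OF assms, of 0 "-u"] by simp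
  then have int: "integrable \<mu> (\<lambda>y. char_fun \<mu> u * iexp (- (y \<bullet> u)))"
    by (intro integrable_mult_right) simp
  have int': "integrable \<mu> (\<lambda>y. Re (char_fun \<mu> u * iexp (- (y \<bullet> u))))"
    using int by (rule integrable_Re)
  show "integrable \<mu> (\<lambda>y. 1 - Re (char_fun \<mu> u * iexp (- (y \<bullet> u))))"
    by (intro Bochner_Integration.integrable_diff int') simp
  have "(\<integral>y. iexp (- (y \<bullet> u)) \<partial>\<mu>) = cnj (char_fun \<mu> u)"
    using char_fun_uminus[of \<mu> u] by (simp add: char_fun_def)
  then have "(\<integral>y. char_fun \<mu> u * iexp (- (y \<bullet> u)) \<partial>\<mu>) = of_real ((cmod (char_fun \<mu> u))\<^sup>2)"
    by (simp only: integral_mult_right_zero complex_norm_square)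
  then have "(\<integral>y. Re (char_fun \<mu> u * iexp (- (y \<bullet> u))) \<partial>\<mu>) = (cmod (char_fun \<mu> u))\<^sup>2"
    using integral_Re[OF int] by simp
  then show "(\<integral>y. 1 - Re (char_fun \<mu> u * iexp (- (y \<bullet> u))) \<partial>\<mu>) = 1 - (cmod (char_fun \<mu> u))\<^sup>2"
    by (subst Bochner_Integration.integral_diff[OF _ int']) (auto simp: prob_space)
qed

text \<open>The case \<open>u = v\<close> of the preceding inequality, averaged over the shift. It
  propagates non-vanishing from a point to its double.\<close>

lemma char_fun_double:
  assumes "prob_space \<mu>" "sets \<mu> = sets borel"
  shows "1 - (cmod (char_fun \<mu> (2 *\<^sub>R u)))\<^sup>2 \<le> 4 * (1 - (cmod (char_fun \<mu> u))\<^sup>2)"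
proof -
  have "(\<integral>y. 1 - Re (char_fun \<mu> (u + u) * iexp (- (y \<bullet> (u + u)))) \<partial>\<mu>) \<le> (\<integral>y. 4 * (1 - Re (char_fun \<mu> u * iexp (- (y \<bullet> u)))) \<partial>\<mu>)"
  proof (rule integral_mono)
    show "1 - Re (char_fun \<mu> (u + u) * iexp (- (y \<bullet> (u + u)))) \<le> 4 * (1 - Re (char_fun \<mu> u * iexp (- (y \<bullet> u))))" for y
      using one_minus_Re_char_fun_add[OF assms, of u u y] by linarith
  qed (intro integrable_mult_right char_fun_symmetrised(1) assms)+
  then show ?thesis
    unfolding integral_mult_right_zero char_fun_symmetrised(2)[OF assms] by (simp add: scaleR_2)
qed

lemma continuous_char_fun:
  fixes \<mu> :: "'a::euclidean_space measure"
  assumes "prob_space \<mu>" "sets \<mu> = sets borel"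
  shows "continuous_on UNIV (char_fun \<mu>)"
proof -
  interpret prob_space \<mu> by fact
  note [measurable_cong] = assms(2)
  have "isCont (char_fun \<mu>) u" for u
    unfolding continuous_at_sequentially
  proof (intro allI impI)
    fix v :: "nat \<Rightarrow> 'a" assume v: "v \<longlonglongrightarrow> u"
    have "(\<lambda>n. \<integral>x. iexp (x \<bullet> v n) \<partial>\<mu>) \<longlonglongrightarrow> (\<integral>x. iexp (x \<bullet> u) \<partial>\<mu>)"
      by (rule integral_dominated_convergence[where w="\<lambda>_. 1"]) (auto intro!: tendsto_intros v)
    then show "(char_fun \<mu> \<circ> v) \<longlonglongrightarrow> char_fun \<mu> u" by (simp add: char_fun_def o_def)
  qed
  then show ?thesis by (simp add: continuous_on_eq_continuous_at)
qed

lemma char_fun_iid_sum: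
  fixes \<nu> :: "'a::euclidean_space measure"
  assumes "prob_space \<nu>" "sets \<nu> = sets borel"
  shows "char_fun (iid_sum_law n \<nu>) u = char_fun \<nu> u ^ n"
proof -
  interpret nu: prob_space \<nu> by fact
  interpret pp: product_prob_space "\<lambda>_::nat. \<nu>" "{..<n}" by unfold_locales
  note [measurable_cong] = assms(2)
  have [measurable]: "(\<lambda>x. x k) \<in> measurable (Pi\<^sub>M {..<n} (\<lambda>_. \<nu>)) borel" if "k \<in> {..<n}" for k
    using measurable_component_singleton[OF that, of "\<lambda>_. \<nu>"] assms(2) by (simp cong: measurable_cong_sets)
  have m: "(\<lambda>x. \<Sum>k<n. x k) \<in> measurable (Pi\<^sub>M {..<n} (\<lambda>_. \<nu>)) borel" by (intro borel_measurable_sum) simp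
  have "char_fun (iid_sum_law n \<nu>) u = (\<integral>x. iexp ((\<Sum>k<n. x k) \<bullet> u) \<partial>Pi\<^sub>M {..<n} (\<lambda>_. \<nu>))"
    unfolding char_fun_def iid_sum_law_def by (rule integral_distr[OF m]) measurable
  also have "\<dots> = (\<integral>x. (\<Prod>k<n. iexp (x k \<bullet> u)) \<partial>Pi\<^sub>M {..<n} (\<lambda>_. \<nu>))"
    by (simp add: inner_sum_left sum_distrib_left exp_sum)
  also have "\<dots> = (\<Prod>k<n. \<integral>x. iexp (x \<bullet> u) \<partial>\<nu>)"
    using integrable_iexp_inner[OF assms, of 0 u] by (intro pp.product_integral_prod) auto
  finally show ?thesis by (simp add: char_fun_def)
qed

text \<open>For a convolution root of high order the squared modulus at \<open>u\<close> is close to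
  1, and then the doubling inequality keeps it positive at \<open>2 *\<^sub>R u\<close>. Continuity
  gives non-vanishing near 0, and repeated doubling reaches every point from there.\<close>

lemma infinitely_divisible_char_fun_nonzero:
  fixes \<mu> :: "'a::euclidean_space measure"
  assumes \<mu>: "prob_space \<mu>" "sets \<mu> = sets borel" and id: "infinitely_divisible \<mu>"
  shows "char_fun \<mu> u \<noteq> 0"
proof -
  have dbl: "char_fun \<mu> (2 *\<^sub>R u) \<noteq> 0" if nz: "char_fun \<mu> u \<noteq> 0" for u
  proof -
    define r where "r = (cmod (char_fun \<mu> u))\<^sup>2"
    have "r > 0" using nz by (simp add: r_def)
    \<comment> \<open>The threshold 3/4 is where \<open>1 - 4 * (1 - Y)\<close> becomes positive.
      The order \<open>n\<close> depends on the value at \<open>u\<close>, so a new root is taken at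
      each doubling.\<close>
    then obtain n where n: "(3/4) ^ n < r" using real_arch_pow_inv[of r "3/4"] by auto
    have "r \<le> 1" using norm_char_fun_le[OF \<mu>(1), of u] by (simp add: r_def power_le_one)
    with n have "n > 0" by (cases n) auto
    then obtain \<nu> where \<nu>: "prob_space \<nu>" "sets \<nu> = sets borel" "iid_sum_law n \<nu> = \<mu>"
      using id unfolding infinitely_divisible_def by blast
    have pw: "char_fun \<mu> w = char_fun \<nu> w ^ n" for w
      using char_fun_iid_sum[OF \<nu>(1,2)] \<nu>(3) by metis
    have "(cmod (char_fun \<nu> u))\<^sup>2 > 3/4"
    proof (rule ccontr)
      assume "\<not> ?thesis"
      then have "((cmod (char_fun \<nu> u))\<^sup>2) ^ n \<le> (3/4) ^ n" by (intro power_mono) auto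
      moreover have "((cmod (char_fun \<nu> u))\<^sup>2) ^ n = r"
        by (simp add: r_def pw norm_power power_mult[symmetric] mult.commute)
      ultimately show False using n by simp
    qed
    moreover have "0 < X" if "1 - X \<le> 4 * (1 - Y)" "3 / 4 < Y" for X Y :: real
      using that by (simp add: field_simps)
    ultimately have "(cmod (char_fun \<nu> (2 *\<^sub>R u)))\<^sup>2 > 0"
      using char_fun_double[OF \<nu>(1,2), of u] by blast
    then show ?thesis by (simp add: pw)
  qed
  have up: "char_fun \<mu> (2 ^ k *\<^sub>R v) \<noteq> 0" if "char_fun \<mu> v \<noteq> 0" for k v
  proof (induction k)
    case (Suc k)
    then show ?case using dbl[of "2 ^ k *\<^sub>R v"] by simp
  qed (use that in simp)
  have "(\<lambda>k. (1/2) ^ k *\<^sub>R u) \<longlonglongrightarrow> 0 *\<^sub>R u"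
    by (intro tendsto_intros LIMSEQ_power_zero) simp
  then have "(\<lambda>k. char_fun \<mu> ((1/2) ^ k *\<^sub>R u)) \<longlonglongrightarrow> char_fun \<mu> (0 *\<^sub>R u)"
    using continuous_char_fun[OF \<mu>] by (intro isCont_tendsto_compose[of _ "char_fun \<mu>"]) (auto simp: continuous_on_eq_continuous_at)
  then have "eventually (\<lambda>k. char_fun \<mu> ((1/2) ^ k *\<^sub>R u) \<noteq> 0) sequentially"
    by (rule tendsto_imp_eventually_ne) (simp add: char_fun_0[OF \<mu>(1)])
  then obtain k where "char_fun \<mu> ((1/2) ^ k *\<^sub>R u) \<noteq> 0" by (auto dest!: eventually_happens)
  from up[OF this, of k] show ?thesis by (simp add: power_divide)
qed

text \<open>Two logarithms differ by a continuous function with values in the integer multiples of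
  \<open>2 * pi * \<i>\<close>, a discrete set, and such a function is constant on a connected
  space. This justifies the definite description in \<open>log_char\<close>.\<close>

lemma continuous_log_unique:
  fixes \<psi> \<psi>' :: "'a::real_normed_vector \<Rightarrow> complex"
  assumes "continuous_on UNIV \<psi>" "continuous_on UNIV \<psi>'" "\<psi> 0 = \<psi>' 0" "\<And>u. exp (\<psi> u) = exp (\<psi>' u)"
  shows "\<psi> = \<psi>'"
proof -
  define d where "d u = \<psi> u - \<psi>' u" for u
  have one: "exp (d u) = 1" for u using assms(4)[of u] by (simp add: d_def exp_diff)
  have "d constant_on UNIV"
  proof (rule continuous_discrete_range_constant)
    show "continuous_on UNIV d" unfolding d_def by (intro continuous_intros assms)
    fix x :: 'a
    show "\<exists>e>0. \<forall>y. y \<in> UNIV \<and> d y \<noteq> d x \<longrightarrow> e \<le> norm (d y - d x)"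
    proof (intro exI[of _ "2 * pi"] conjI allI impI)
      fix y assume y: "y \<in> UNIV \<and> d y \<noteq> d x"
      have "exp (d y - d x) = 1" by (simp add: exp_diff one)
      then obtain n :: int where n: "Re (d y - d x) = 0" "Im (d y - d x) = of_int (2 * n) * pi"
        unfolding exp_eq_1 by blast
      have "n \<noteq> 0"
      proof
        assume "n = 0"
        with n have "d y - d x = 0" by (simp only: complex_eq_iff) simp
        with y show False by simp
      qed
      then have "1 \<le> \<bar>real_of_int n\<bar>" by linarith
      then have "2 * pi \<le> \<bar>Im (d y - d x)\<bar>"
        unfolding n(2) by (simp add: abs_mult)
      also have "\<dots> \<le> norm (d y - d x)" by (rule abs_Im_le_cmod)
      finally show "2 * pi \<le> norm (d y - d x)" .
    qed simp
  qed (rule connected_UNIV)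
  then have "d u = d 0" for u unfolding constant_on_def by auto
  then show ?thesis using assms(3) by (auto simp: d_def fun_eq_iff)
qed

lemma log_char_eqI:
  assumes "continuous_on UNIV \<psi>" "\<psi> 0 = 0" "\<And>u. char_fun \<mu> u = exp (\<psi> u)"
  shows "log_char \<mu> = \<psi>"
  unfolding log_char_def
proof (rule the_equality)
  show "continuous_on UNIV \<psi> \<and> \<psi> 0 = 0 \<and> (\<forall>u. char_fun \<mu> u = exp (\<psi> u))" using assms by simp
  fix \<psi>' assume "continuous_on UNIV \<psi>' \<and> \<psi>' 0 = 0 \<and> (\<forall>u. char_fun \<mu> u = exp (\<psi>' u))"
  then show "\<psi>' = \<psi>" using assms by (intro continuous_log_unique) auto
qed

text \<open>A continuous function without zeros on a contractible space has a continuous logarithm;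
  subtracting its value at 0 normalises it.\<close>

lemma infinitely_divisible_log_char:
  fixes \<mu> :: "'a::euclidean_space measure"
  assumes \<mu>: "prob_space \<mu>" "sets \<mu> = sets borel" "infinitely_divisible \<mu>"
  shows "continuous_on UNIV (log_char \<mu>)" "log_char \<mu> 0 = 0" "char_fun \<mu> u = exp (log_char \<mu> u)"
proof -
  obtain g where g: "continuous_on UNIV g" "\<And>x. char_fun \<mu> x = exp (g x)"
    using continuous_logarithm_on_contractible[OF continuous_char_fun[OF \<mu>(1,2)] contractible_UNIV]
      infinitely_divisible_char_fun_nonzero[OF \<mu>] by auto
  have "exp (g 0) = 1" using g(2)[of 0] char_fun_0[OF \<mu>(1)] by simp
  then have "log_char \<mu> = (\<lambda>u. g u - g 0)"
    using g by (intro log_char_eqI) (auto intro!: continuous_intros simp: exp_diff)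
  then show "continuous_on UNIV (log_char \<mu>)" "log_char \<mu> 0 = 0" "char_fun \<mu> u = exp (log_char \<mu> u)"
    using g \<open>exp (g 0) = 1\<close> by (auto intro!: continuous_intros simp: exp_diff)
qed

text \<open>Modulus 1 makes the symmetrised integral of \<open>1 - cos\<close> vanish, so
  \<open>(x - y) \<bullet> w / (n + 1)\<close> is almost surely a multiple of \<open>2 * pi\<close>
  for every \<open>n\<close>. Only the value 0 satisfies this for all \<open>n\<close> at
  once.\<close>

lemma norm_char_fun_1_degenerate:
  fixes \<mu> :: "'a::euclidean_space measure"
  assumes \<mu>: "prob_space \<mu>" "sets \<mu> = sets borel" and one: "\<And>r. cmod (char_fun \<mu> (r *\<^sub>R w)) = 1"
  shows "\<exists>c. AE x in \<mu>. w \<bullet> x = c"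
proof -
  interpret prob_space \<mu> by fact
  note [measurable_cong] = \<mu>(2)
  have "AE y in \<mu>. AE x in \<mu>. cos ((x - y) \<bullet> (r *\<^sub>R w)) = 1" for r
  proof -
    have nn: "0 \<le> 1 - Re (char_fun \<mu> (r *\<^sub>R w) * iexp (- (y \<bullet> (r *\<^sub>R w))))" for y
      unfolding Re_char_fun_shift[OF \<mu>] by (intro integral_nonneg_AE AE_I2) simp
    have "(\<integral>y. 1 - Re (char_fun \<mu> (r *\<^sub>R w) * iexp (- (y \<bullet> (r *\<^sub>R w)))) \<partial>\<mu>) = 0"
      unfolding char_fun_symmetrised(2)[OF \<mu>] by (simp add: one)
    then have "AE y in \<mu>. 1 - Re (char_fun \<mu> (r *\<^sub>R w) * iexp (- (y \<bullet> (r *\<^sub>R w)))) = 0"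
      using integral_nonneg_eq_0_iff_AE[OF char_fun_symmetrised(1)[OF \<mu>, of "r *\<^sub>R w"]] nn by simp
    then show ?thesis
    proof eventually_elim
      case (elim y)
      then have "(\<integral>x. 1 - cos ((x - y) \<bullet> (r *\<^sub>R w)) \<partial>\<mu>) = 0"
        using Re_char_fun_shift[OF \<mu>] by metis
      then have "AE x in \<mu>. 1 - cos ((x - y) \<bullet> (r *\<^sub>R w)) = 0"
        using integral_nonneg_eq_0_iff_AE[OF integrable_cos_inner[OF \<mu>, of y "r *\<^sub>R w"]] by simp
      then show ?case by eventually_elim simp
    qed
  qed
  then have "AE y in \<mu>. \<forall>n::nat. AE x in \<mu>. cos ((x - y) \<bullet> ((1 / real (Suc n)) *\<^sub>R w)) = 1"
    unfolding AE_all_countable by blast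
  then obtain y where "\<forall>n::nat. AE x in \<mu>. cos ((x - y) \<bullet> ((1 / real (Suc n)) *\<^sub>R w)) = 1"
    using eventually_happens[of _ "ae_filter \<mu>"] ae_filter_eq_bot_iff[of \<mu>] emeasure_space_1 by auto
  then have "AE x in \<mu>. \<forall>n::nat. cos ((x - y) \<bullet> ((1 / real (Suc n)) *\<^sub>R w)) = 1"
    unfolding AE_all_countable .
  then have "AE x in \<mu>. w \<bullet> x = w \<bullet> y"
  proof eventually_elim
    case (elim x)
    define d where "d = (x - y) \<bullet> w"
    \<comment> \<open>For this \<open>n\<close> the quotient has absolute value below 1, so 0 is the
      only multiple of \<open>2 * pi\<close> available to it.\<close>
    obtain n :: nat where n: "\<bar>d\<bar> < real n" using reals_Archimedean2 by blast
    have d1: "\<bar>d / real (Suc n)\<bar> < 1" using n by (simp add: abs_divide)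
    have "cos (d / real (Suc n)) = 1" using elim[rule_format, of n] by (simp add: d_def)
    then obtain k :: int where k: "d / real (Suc n) = of_int k * 2 * pi"
      unfolding cos_one_2pi_int by blast
    have "\<bar>real_of_int k\<bar> * (2 * pi) < 1"
      using d1 unfolding k by (simp add: abs_mult mult.assoc)
    then have k1: "\<bar>real_of_int k\<bar> * (2 * pi) < 1" .
    have "k = 0"
    proof (rule ccontr)
      assume "k \<noteq> 0"
      then have "1 \<le> \<bar>real_of_int k\<bar>" by linarith
      then have "1 * 1 \<le> \<bar>real_of_int k\<bar> * (2 * pi)" using pi_gt3 by (intro mult_mono) auto
      with k1 show False by simp
    qed
    with k have "d = 0" by simp
    then show ?case by (simp add: d_def inner_diff_left inner_diff_right inner_commute)
  qed
  then show ?thesis by blast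
qed

lemma has_vector_derivative_at_0_quotient:
  assumes "(f has_vector_derivative f') (at 0)"
  shows "((\<lambda>h. (f h - f 0) /\<^sub>R h) \<longlongrightarrow> f') (at 0)"
proof -
  have "((\<lambda>h. norm (f h - f 0 - h *\<^sub>R f') / norm h) \<longlongrightarrow> 0) (at 0)"
    using assms by (simp add: has_vector_derivative_def has_derivative_at)
  moreover have "norm (f h - f 0 - h *\<^sub>R f') / norm h = norm ((f h - f 0) /\<^sub>R h - f')" if "h \<noteq> 0" for h
  proof -
    have "(f h - f 0) /\<^sub>R h - f' = (f h - f 0 - h *\<^sub>R f') /\<^sub>R h"
      using that by (simp add: scaleR_diff_right)
    then show ?thesis by (simp add: divide_inverse)
  qed
  then have "eventually (\<lambda>h. norm (f h - f 0 - h *\<^sub>R f') / norm h = norm ((f h - f 0) /\<^sub>R h - f')) (at 0)"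
    unfolding eventually_at by (intro exI[of _ 1]) auto
  ultimately have "((\<lambda>h. norm ((f h - f 0) /\<^sub>R h - f')) \<longlongrightarrow> 0) (at 0)"
    by (rule Lim_transform_eventually)
  then show ?thesis by (rule LIM_zero_cancel[OF tendsto_norm_zero_cancel])
qed

section \<open>The exponent of a full strictly operator-stable law\<close>

locale full_strictly_operator_stable =
  fixes \<mu> :: "(real^'m) measure" and B :: "real^'m^'m"
  assumes full: "full_distribution \<mu>" and stable: "strictly_operator_stable_exp \<mu> B"
begin

abbreviation \<psi> :: "real^'m \<Rightarrow> complex" where "\<psi> \<equiv> log_char \<mu>"

lemma prob: "prob_space \<mu>" and sets_\<mu>: "sets \<mu> = sets borel" and inf_div: "infinitely_divisible \<mu>"
  and \<psi>_scale: "s > 0 \<Longrightarrow> \<psi> ((s powm transpose B) *v u) = complex_of_real s * \<psi> u"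
  using stable by (auto simp: strictly_operator_stable_exp_def)

lemmas \<psi>_props = infinitely_divisible_log_char[OF prob sets_\<mu> inf_div]

lemma norm_char_fun_\<psi>: "cmod (char_fun \<mu> u) = exp (Re (\<psi> u))"
  by (simp add: \<psi>_props(3))

lemma Re_\<psi>_le_0: "Re (\<psi> u) \<le> 0"
  using norm_char_fun_le[OF prob, of u] unfolding norm_char_fun_\<psi> by simp

text \<open>At the point \<open>(1 / n) powm transpose B *v u\<close> the characteristic function
  equals \<open>exp (\<psi> u / n)\<close>. Hence \<open>n\<close> times the distance of its real
  part from 1 tends to \<open>- Re (\<psi> u)\<close>, and the inequality for characteristic
  functions survives the limit.\<close>

lemma Re_\<psi>_add: "- Re (\<psi> (u + v)) \<le> 2 * (- Re (\<psi> u)) + 2 * (- Re (\<psi> v))"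
proof -
  let ?T = "\<lambda>n u. ((1 / real (Suc n)) powm transpose B) *v u"
  have ch: "char_fun \<mu> (?T n w) = exp (\<psi> w / of_nat (Suc n))" for n w
    unfolding \<psi>_props(3) by (subst \<psi>_scale) auto
  have lim: "(\<lambda>n. real (Suc n) * (1 - Re (char_fun \<mu> (?T n w)))) \<longlonglongrightarrow> - Re (\<psi> w)" for w
  proof -
    have "((\<lambda>h. (exp (\<psi> w * (0 + h)) - exp (\<psi> w * 0)) / h) \<longlongrightarrow> \<psi> w) (at 0)"
    proof (rule DERIV_D)
      show "((\<lambda>t. exp (\<psi> w * t)) has_field_derivative \<psi> w) (at 0)" by (auto intro!: derivative_eq_intros)
    qed
    moreover have "filterlim (\<lambda>n. 1 / of_nat (Suc n) :: complex) (at 0) sequentially"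
      unfolding filterlim_at
    proof
      show "eventually (\<lambda>n. 1 / of_nat (Suc n) \<in> UNIV \<and> 1 / of_nat (Suc n) \<noteq> (0::complex)) sequentially"
        by (simp del: of_nat_Suc)
      show "(\<lambda>n. 1 / of_nat (Suc n) :: complex) \<longlonglongrightarrow> 0"
        using tendsto_of_real[OF LIMSEQ_inverse_real_of_nat, where 'a=complex] by (simp add: divide_inverse)
    qed
    ultimately have "(\<lambda>n. (exp (\<psi> w * (0 + 1 / of_nat (Suc n))) - exp (\<psi> w * 0)) / (1 / of_nat (Suc n))) \<longlonglongrightarrow> \<psi> w"
      by (rule filterlim_compose)
    from tendsto_minus[OF tendsto_Re[OF this]]
    have "(\<lambda>n. - Re ((exp (\<psi> w / of_nat (Suc n)) - 1) * of_nat (Suc n))) \<longlonglongrightarrow> - Re (\<psi> w)" by simp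
    moreover have "- Re ((exp (\<psi> w / of_nat (Suc n)) - 1) * of_nat (Suc n)) = real (Suc n) * (1 - Re (char_fun \<mu> (?T n w)))" for n
      unfolding ch by (simp add: algebra_simps del: of_nat_Suc)
    ultimately show ?thesis by simp
  qed
  have "(\<lambda>n. 2 * (real (Suc n) * (1 - Re (char_fun \<mu> (?T n u)))) + 2 * (real (Suc n) * (1 - Re (char_fun \<mu> (?T n v)))))
      \<longlonglongrightarrow> 2 * (- Re (\<psi> u)) + 2 * (- Re (\<psi> v))"
    by (intro tendsto_intros lim)
  with lim[of "u + v"] show ?thesis
  proof (rule LIMSEQ_le)
    have "real (Suc n) * (1 - Re (char_fun \<mu> (?T n (u + v)))) \<le>
        2 * (real (Suc n) * (1 - Re (char_fun \<mu> (?T n u)))) + 2 * (real (Suc n) * (1 - Re (char_fun \<mu> (?T n v))))" for n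
      using mult_left_mono[OF one_minus_Re_char_fun_add[OF prob sets_\<mu>, of "?T n u" "?T n v" 0], of "real (Suc n)"]
      by (simp add: matrix_vector_right_distrib algebra_simps del: of_nat_Suc)
    then show "\<exists>N. \<forall>n\<ge>N. real (Suc n) * (1 - Re (char_fun \<mu> (?T n (u + v)))) \<le>
        2 * (real (Suc n) * (1 - Re (char_fun \<mu> (?T n u)))) + 2 * (real (Suc n) * (1 - Re (char_fun \<mu> (?T n v))))" by blast
  qed
qed

lemma Re_\<psi>_uminus: "Re (\<psi> (- u)) = Re (\<psi> u)"
proof -
  have "cmod (char_fun \<mu> (- u)) = cmod (char_fun \<mu> u)" by (simp add: char_fun_uminus)
  then show ?thesis unfolding norm_char_fun_\<psi> by simp
qed

text \<open>By \<open>Re_\<psi>_add\<close>, symmetry and continuity the zeros of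
  \<open>Re \<psi>\<close> form a closed additive group, and the scalings map it to itself. A
  nonzero zero \<open>u\<close> produces a whole line of zeros, obtained in general by
  differentiating the orbit of \<open>u\<close> under the scalings. Along such a line the law is
  degenerate, against fullness.\<close>

lemma Re_\<psi>_neg:
  assumes "u \<noteq> 0"
  shows "Re (\<psi> u) < 0"
proof (rule ccontr)
  assume "\<not> Re (\<psi> u) < 0"
  then have u0: "Re (\<psi> u) = 0" using Re_\<psi>_le_0[of u] by simp
  have add0: "Re (\<psi> (v + w)) = 0" if "Re (\<psi> v) = 0" "Re (\<psi> w) = 0" for v w
    using Re_\<psi>_add[of v w] Re_\<psi>_le_0[of "v + w"] that by simp
  have mult0: "Re (\<psi> (real k *\<^sub>R v)) = 0" if "Re (\<psi> v) = 0" for k v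
    by (induction k) (auto simp: \<psi>_props(2) scaleR_left_distrib add0 that)
  have scale: "\<psi> (mat_exp (t *\<^sub>R transpose B) *v w) = of_real (exp t) * \<psi> w" for t w
    using \<psi>_scale[of "exp t" w] by (simp add: powm_pos)
  have "\<exists>w. w \<noteq> 0 \<and> (\<forall>r. Re (\<psi> (r *\<^sub>R w)) = 0)"
  proof (cases "transpose B *v u = 0")
    \<comment> \<open>Here all multiples of \<open>u\<close> are fixed by the scalings, and
      \<open>\<psi> (r *\<^sub>R u) = 2 * \<psi> (r *\<^sub>R u)\<close> already makes them
      zeros.\<close>
    case True
    have "Re (\<psi> (r *\<^sub>R u)) = 0" for r
    proof -
      have "r *\<^sub>R u = mat_exp (ln 2 *\<^sub>R transpose B) *v (r *\<^sub>R u)"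
        by (rule mat_exp_solves_unique[where x="\<lambda>_. r *\<^sub>R u"]) (simp add: matrix_vector_mult_scaleR True)
      then have "\<psi> (r *\<^sub>R u) = 2 * \<psi> (r *\<^sub>R u)" using scale[of "ln 2" "r *\<^sub>R u"] by simp
      then show ?thesis by simp
    qed
    then show ?thesis using assms by blast
  next
    case False
    have "Re (\<psi> (r *\<^sub>R (transpose B *v u))) = 0" for r
    proof -
      \<comment> \<open>A natural multiple of a difference of two zeros, hence a zero. The step size
        \<open>r / (n + 1)\<close> makes these points converge to \<open>r\<close> times the
        derivative of the orbit, for any real \<open>r\<close>.\<close>
      define x where "x n = real (Suc n) *\<^sub>R (mat_exp ((r / real (Suc n)) *\<^sub>R transpose B) *v u - u)" for n
      have "Re (\<psi> (x n)) = 0" for n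
      proof -
        have "Re (\<psi> (mat_exp ((r / real (Suc n)) *\<^sub>R transpose B) *v u + - u)) = 0"
          using u0 by (intro add0) (simp_all add: scale Re_\<psi>_uminus)
        then show ?thesis unfolding x_def by (intro mult0) simp
      qed
      moreover have "x \<longlonglongrightarrow> r *\<^sub>R (transpose B *v u)"
      proof -
        have "((\<lambda>t. mat_exp (t *\<^sub>R (r *\<^sub>R transpose B)) *v u) has_vector_derivative (mat_exp (0 *\<^sub>R (r *\<^sub>R transpose B)) ** (r *\<^sub>R transpose B)) *v u) (at 0)"
          by (rule bounded_linear.has_vector_derivative[OF bounded_linear_mult_vec mat_exp_has_vector_derivative])
        then have "((\<lambda>t. mat_exp (t *\<^sub>R (r *\<^sub>R transpose B)) *v u) has_vector_derivative r *\<^sub>R (transpose B *v u)) (at 0)"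
          by (simp add: scaleR_matrix_vector_assoc)
        then have "((\<lambda>h. (mat_exp (h *\<^sub>R (r *\<^sub>R transpose B)) *v u - u) /\<^sub>R h) \<longlongrightarrow> r *\<^sub>R (transpose B *v u)) (at 0)"
          by (auto dest!: has_vector_derivative_at_0_quotient)
        moreover have "filterlim (\<lambda>n. 1 / real (Suc n)) (at 0) sequentially"
          unfolding filterlim_at using LIMSEQ_inverse_real_of_nat by (auto simp: divide_inverse)
        ultimately have "(\<lambda>n. (mat_exp ((1 / real (Suc n)) *\<^sub>R (r *\<^sub>R transpose B)) *v u - u) /\<^sub>R (1 / real (Suc n))) \<longlonglongrightarrow> r *\<^sub>R (transpose B *v u)"
          by (rule filterlim_compose)
        then show ?thesis by (simp add: x_def[abs_def] del: of_nat_Suc)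
      qed
      then have "(\<lambda>n. Re (\<psi> (x n))) \<longlonglongrightarrow> Re (\<psi> (r *\<^sub>R (transpose B *v u)))"
        using \<psi>_props(1) by (intro tendsto_Re isCont_tendsto_compose[of _ \<psi>]) (auto simp: continuous_on_eq_continuous_at)
      ultimately show ?thesis by (simp add: LIMSEQ_const_iff)
    qed
    with False show ?thesis by blast
  qed
  then obtain w where w: "w \<noteq> 0" "\<And>r. Re (\<psi> (r *\<^sub>R w)) = 0" by blast
  have "\<exists>c. AE x in \<mu>. w \<bullet> x = c"
    by (rule norm_char_fun_1_degenerate[OF prob sets_\<mu>]) (simp add: norm_char_fun_\<psi> w(2))
  with full w(1) show False unfolding full_distribution_def by blast
qed

lemma scale_q:
  assumes "s > 0"
  shows "\<psi> (s powm transpose (q *\<^sub>R B) *v v) = of_real (s powr q) * \<psi> v"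
  using \<psi>_scale[of "s powr q" v] assms by (simp add: transpose_scalar powm_scaleR)

lemma min_re_eig_pos:
  assumes "q > 0"
  shows "min_re_eig (q *\<^sub>R B) > 0"
proof (rule min_re_eig_pos_of_scaling[where F="\<lambda>v. - Re (\<psi> v)"])
  show "continuous_on UNIV (\<lambda>v. - Re (\<psi> v))" by (intro continuous_intros \<psi>_props(1))
  show "- Re (\<psi> (s powm transpose (q *\<^sub>R B) *v v)) = s powr q * (- Re (\<psi> v))" if "s > 0" for s v
    unfolding scale_q[OF that] by simp
qed (use Re_\<psi>_neg assms in auto)

end


section \<open>Lebesgue measure and homogeneous functions\<close>

text \<open>The library computes the Lebesgue measure of linear images only over well-ordered index types.\<close>

typedef ('a::finite) wo = "UNIV :: 'a set"
  morphisms un_wo mk_wo by simp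

lemma bij_un_wo: "bij un_wo"
  by (metis bijI' un_wo_inject mk_wo_inverse UNIV_I)

instance wo :: (finite) finite
proof
  show "finite (UNIV :: 'a wo set)"
    using bij_un_wo by (metis bij_betw_finite finite)
qed

definition wo_nat :: "'a::finite wo \<Rightarrow> nat" where "wo_nat = (SOME f. inj f)"

lemma inj_wo_nat: "inj wo_nat"
proof -
  have "\<exists>f :: 'a wo \<Rightarrow> nat. inj f"
    using finite_imp_inj_to_nat_seg[of "UNIV :: 'a wo set"] by blast
  then show ?thesis unfolding wo_nat_def by (rule someI_ex)
qed

instantiation wo :: (finite) wellorder
begin
definition less_eq_wo :: "'a wo \<Rightarrow> 'a wo \<Rightarrow> bool" where "x \<le> y \<longleftrightarrow> wo_nat x \<le> wo_nat y"
definition less_wo :: "'a wo \<Rightarrow> 'a wo \<Rightarrow> bool" where "x < y \<longleftrightarrow> wo_nat x < wo_nat y"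
instance
proof
  fix P :: "'a wo \<Rightarrow> bool" and a :: "'a wo"
  assume step: "\<And>x. (\<And>y. y < x \<Longrightarrow> P y) \<Longrightarrow> P x"
  show "P a"
    by (induction a rule: measure_induct_rule[of wo_nat]) (auto intro: step simp: less_wo_def)
qed (auto simp: less_eq_wo_def less_wo_def dest: injD[OF inj_wo_nat])
end

definition vec_wo :: "real^'n \<Rightarrow> real^('n wo)" where "vec_wo x = (\<chi> i. x $ un_wo i)"
definition vec_un_wo :: "real^('n wo) \<Rightarrow> real^'n" where "vec_un_wo x = (\<chi> i. x $ mk_wo i)"
definition mat_wo :: "real^'n^'n \<Rightarrow> real^('n wo)^('n wo)" where "mat_wo A = (\<chi> i j. A $ un_wo i $ un_wo j)"

lemma vec_wo_inverse [simp]: "vec_un_wo (vec_wo x) = x" "vec_wo (vec_un_wo y) = y"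
  by (simp_all add: vec_wo_def vec_un_wo_def vec_eq_iff mk_wo_inverse un_wo_inverse)

lemma mat_wo_mult_vec: "mat_wo A *v vec_wo x = vec_wo (A *v x)"
  using sum.reindex_bij_betw[OF bij_un_wo, of "\<lambda>j. A $ un_wo i $ j * x $ j" for i]
  by (simp add: mat_wo_def vec_wo_def matrix_vector_mult_def vec_eq_iff)

lemma mat_wo_mult: "mat_wo (A ** B) = mat_wo A ** mat_wo B"
proof -
  have "(\<Sum>k\<in>UNIV. A $ un_wo i $ k * B $ k $ un_wo j) = (\<Sum>k\<in>UNIV. A $ un_wo i $ un_wo k * B $ un_wo k $ un_wo j)" for i j
    by (rule sum.reindex_bij_betw[OF bij_un_wo, symmetric])
  then show ?thesis by (simp add: mat_wo_def matrix_matrix_mult_def vec_eq_iff)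
qed

lemma bounded_linear_mat_wo: "bounded_linear mat_wo"
  unfolding linear_conv_bounded_linear[symmetric]
  by (intro linearI) (simp_all add: mat_wo_def vec_eq_iff)

lemma mat_wo_power: "mat_wo (((**) A ^^ k) (mat 1)) = ((**) (mat_wo A) ^^ k) (mat 1)"
  by (induction k) (auto simp: mat_wo_mult, simp add: mat_wo_def mat_def vec_eq_iff un_wo_inject)

lemma mat_wo_exp: "mat_wo (mat_exp A) = mat_exp (mat_wo A)"
  by (rule matrix_mul_cong_sums[OF _ bounded_linear_mat_wo bounded_linear_ident])
    (simp add: linear_simps[OF bounded_linear_mat_wo] mat_wo_power)

lemma trace_mat_wo: "trace (mat_wo A) = trace A"
  unfolding trace_def mat_wo_def using sum.reindex_bij_betw[OF bij_un_wo, of "\<lambda>i. A $ i $ i"] by simp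

lemma vec_un_wo_measurable [measurable]: "vec_un_wo \<in> borel_measurable borel"
  by (intro borel_measurable_continuous_onI linear_continuous_on)
    (auto simp: linear_conv_bounded_linear[symmetric] vec_un_wo_def vec_eq_iff intro!: linearI)

lemma lborel_vec_un_wo: "distr lborel borel vec_un_wo = (lborel :: (real^'n) measure)"
proof (rule lborel_eqI[symmetric])
  fix l u :: "real^'n" assume le: "\<And>b. b \<in> Basis \<Longrightarrow> l \<bullet> b \<le> u \<bullet> b"
  have le': "l $ i \<le> u $ i" for i using le[of "axis i 1"] by (simp add: inner_axis axis_in_Basis_iff)
  have pre: "vec_un_wo -` box l u = box (vec_wo l) (vec_wo u)"
  proof -
    have "(\<forall>i. l $ i < y $ mk_wo i \<and> y $ mk_wo i < u $ i) \<longleftrightarrow> (\<forall>i. l $ un_wo i < y $ i \<and> y $ i < u $ un_wo i)" for y :: "real^('n wo)"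
      by (metis un_wo_inverse mk_wo_inverse UNIV_I)
    then show ?thesis by (auto simp: mem_box_cart vec_un_wo_def vec_wo_def)
  qed
  have prodB: "(\<Prod>b\<in>Basis. (v - w) \<bullet> b) = (\<Prod>i\<in>UNIV. (v $ i - w $ i))" for v w :: "real^'k"
  proof -
    have "(Basis :: (real^'k) set) = (\<lambda>i. axis i 1) ` UNIV" by (auto simp: Basis_vec_def)
    then have "(\<Prod>b\<in>Basis. (v - w) \<bullet> b) = (\<Prod>b\<in>range (\<lambda>i. axis i 1). (v - w) \<bullet> b)" by (simp only:)
    also have "\<dots> = (\<Prod>i\<in>UNIV. (v - w) \<bullet> axis i 1)"
      by (rule prod.reindex[unfolded o_def]) (auto simp: inj_on_def axis_eq_axis)
    finally show ?thesis by (simp add: inner_axis)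
  qed
  have "emeasure (distr lborel borel vec_un_wo) (box l u) = emeasure lborel (box (vec_wo l) (vec_wo u))"
    by (subst emeasure_distr) (simp_all add: pre)
  also have "\<dots> = ennreal (\<Prod>b\<in>Basis. (vec_wo u - vec_wo l) \<bullet> b)"
  proof (rule emeasure_lborel_box)
    fix b :: "real^('n wo)" assume "b \<in> Basis"
    then obtain i where "b = axis i 1" by (auto simp: Basis_vec_def)
    then show "vec_wo l \<bullet> b \<le> vec_wo u \<bullet> b" using le' by (simp add: inner_axis vec_wo_def)
  qed
  also have "(\<Prod>b\<in>Basis. (vec_wo u - vec_wo l) \<bullet> b) = (\<Prod>b\<in>Basis. (u - l) \<bullet> b)"
    unfolding prodB vec_wo_def using prod.reindex_bij_betw[OF bij_un_wo, of "\<lambda>i. u $ i - l $ i"] by simp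
  finally show "emeasure (distr lborel borel vec_un_wo) (box l u) = ennreal (\<Prod>b\<in>Basis. (u - l) \<bullet> b)" .
qed simp

text \<open>The preimage of the box is its image under \<open>(1 / r) powm E\<close>, whence the
  negative exponent. The determinant formula for images is applied on the well-ordered copy of the
  index type, to which Lebesgue measure, matrix powers and trace are transported.\<close>

lemma emeasure_powm_box:
  fixes E :: "real^'n^'n" and l u :: "real^'n"
  assumes r: "r > 0"
  shows "emeasure lborel ((*v) (r powm E) -` box l u) = ennreal (r powr (- trace E)) * emeasure lborel (box l u)"
proof -
  let ?T = "(1 / r) powm E"
  have inv: "r powm E *v (?T *v x) = x" "?T *v (r powm E *v x) = x" for x
    using powm_inverse[OF r, of E] by (simp_all add: matrix_vector_mul_assoc)
  have pre: "(*v) (r powm E) -` box l u = (*v) ?T ` box l u"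
    using inv by (auto simp: image_iff) metis
  have mat: "mat_wo ?T = (1 / r) powm (mat_wo E)"
    using r by (simp add: powm_pos mat_wo_exp linear_simps[OF bounded_linear_mat_wo])
  define X where "X = vec_un_wo -` box l u"
  have X: "X = vec_wo ` box l u" unfolding X_def by (auto simp: image_iff) (metis vec_wo_inverse(2))
  have Xb: "X = box (vec_wo l) (vec_wo u)"
  proof -
    have "(\<forall>i. l $ i < y $ mk_wo i \<and> y $ mk_wo i < u $ i) \<longleftrightarrow> (\<forall>i. l $ un_wo i < y $ i \<and> y $ i < u $ un_wo i)" for y :: "real^('n wo)"
      by (metis un_wo_inverse mk_wo_inverse UNIV_I)
    then show ?thesis by (auto simp: X_def mem_box_cart vec_un_wo_def vec_wo_def)
  qed
  have "continuous_on UNIV ((*v) (r powm E))" by (simp add: linear_continuous_on matrix_vector_mul_bounded_linear)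
  then have S: "(*v) (r powm E) -` box l u \<in> sets borel"
    using measurable_sets[OF borel_measurable_continuous_onI, of "(*v) (r powm E)" "box l u"] by simp
  have "vec_un_wo -` ((*v) ?T ` box l u) = (*v) (mat_wo ?T) ` X"
  proof -
    have "(*v) (mat_wo ?T) ` X = vec_wo ` ((*v) ?T ` box l u)"
      unfolding X by (simp add: image_image mat_wo_mult_vec)
    also have "\<dots> = vec_un_wo -` ((*v) ?T ` box l u)"
      by (auto simp: image_iff) (metis vec_wo_inverse(2))
    finally show ?thesis by simp
  qed
  then have 1: "emeasure lborel ((*v) (r powm E) -` box l u) = emeasure lborel ((*v) (mat_wo ?T) ` X)"
    and S': "(*v) (mat_wo ?T) ` X \<in> sets borel"
  proof -
    assume eq: "vec_un_wo -` ((*v) ?T ` box l u) = (*v) (mat_wo ?T) ` X"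
    show "emeasure lborel ((*v) (r powm E) -` box l u) = emeasure lborel ((*v) (mat_wo ?T) ` X)"
      unfolding eq[symmetric] using S unfolding pre
      by (subst lborel_vec_un_wo[symmetric], subst emeasure_distr) simp_all
    show "(*v) (mat_wo ?T) ` X \<in> sets borel"
      unfolding eq[symmetric] by (rule measurable_sets_borel[OF vec_un_wo_measurable]) (use S pre in simp)
  qed
  have lm: "X \<in> lmeasurable" unfolding Xb by simp
  have lin: "linear ((*v) (mat_wo ?T))" by simp
  have lm2: "(*v) (mat_wo ?T) ` X \<in> lmeasurable" by (rule measurable_linear_image[OF lin lm])
  have "emeasure lborel ((*v) (mat_wo ?T) ` X) = ennreal (measure lebesgue ((*v) (mat_wo ?T) ` X))"
  proof -
    have "emeasure lebesgue ((*v) (mat_wo ?T) ` X) = emeasure lborel ((*v) (mat_wo ?T) ` X)"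
      using S' by simp
    then show ?thesis using emeasure_eq_measure2[OF lm2] by simp
  qed
  also have "measure lebesgue ((*v) (mat_wo ?T) ` X) = \<bar>det (mat_wo ?T)\<bar> * measure lebesgue X"
    using measure_linear_image[OF lin lm] by simp
  also have "det (mat_wo ?T) = r powr (- trace E)"
    unfolding mat using r by (simp add: det_powm trace_mat_wo powr_def ln_div)
  finally have "emeasure lborel ((*v) (r powm E) -` box l u) = ennreal (r powr (- trace E)) * ennreal (measure lebesgue X)"
    unfolding 1 by (simp add: ennreal_mult)
  also have "ennreal (measure lebesgue X) = emeasure lborel X"
  proof -
    have "measure lebesgue X = measure lborel X" unfolding Xb by (rule measure_completion) simp
    moreover have "emeasure lborel X \<noteq> \<infinity>" unfolding Xb using emeasure_lborel_box_finite by (simp add: less_top)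
    ultimately show ?thesis by (simp add: emeasure_eq_ennreal_measure)
  qed
  also have "emeasure lborel X = emeasure lborel (box l u)"
    unfolding X_def by (subst (2) lborel_vec_un_wo[symmetric]) (simp add: emeasure_distr)
  finally show ?thesis .
qed

lemma lborel_powm:
  fixes E :: "real^'n^'n"
  assumes r: "r > 0"
  shows "lborel = density (distr lborel borel ((*v) (r powm E))) (\<lambda>_. ennreal (r powr trace E))"
proof (rule lborel_eqI)
  have [measurable]: "(*v) (r powm E) \<in> borel_measurable borel"
    by (intro borel_measurable_continuous_onI linear_continuous_on matrix_vector_mul_bounded_linear)
  fix l u :: "real^'n" assume le: "\<And>b. b \<in> Basis \<Longrightarrow> l \<bullet> b \<le> u \<bullet> b"
  have "emeasure (density (distr lborel borel ((*v) (r powm E))) (\<lambda>_. ennreal (r powr trace E))) (box l u)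
      = ennreal (r powr trace E) * emeasure lborel ((*v) (r powm E) -` box l u)"
    by (subst emeasure_density_const) (simp_all add: emeasure_distr)
  also have "\<dots> = (ennreal (r powr trace E) * ennreal (r powr (- trace E))) * emeasure lborel (box l u)"
    by (simp add: emeasure_powm_box[OF r] mult.assoc)
  also have "ennreal (r powr trace E) * ennreal (r powr (- trace E)) = 1"
    using r by (simp add: ennreal_mult[symmetric] powr_add[symmetric])
  finally show "emeasure (density (distr lborel borel ((*v) (r powm E))) (\<lambda>_. ennreal (r powr trace E))) (box l u)
      = ennreal (\<Prod>b\<in>Basis. (u - l) \<bullet> b)"
    using le by (simp add: emeasure_lborel_box)
qed simp

lemma integral_powm:
  fixes E :: "real^'n^'n" and g :: "real^'n \<Rightarrow> 'b::{banach, second_countable_topology}"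
  assumes r: "r > 0" and [measurable]: "g \<in> borel_measurable borel"
  shows "(\<integral>x. g x \<partial>lborel) = r powr trace E *\<^sub>R (\<integral>x. g (r powm E *v x) \<partial>lborel)"
proof -
  have [measurable]: "(*v) (r powm E) \<in> borel_measurable borel"
    by (intro borel_measurable_continuous_onI linear_continuous_on matrix_vector_mul_bounded_linear)
  show ?thesis
    by (subst lborel_powm[OF r, of E]) (simp add: integral_density integral_distr)
qed

lemma emeasure_powm:
  fixes E :: "real^'n^'n"
  assumes r: "r > 0" and X: "X \<in> sets borel"
  shows "emeasure lborel X = ennreal (r powr trace E) * emeasure lborel {x. r powm E *v x \<in> X}"
proof -
  have [measurable]: "(*v) (r powm E) \<in> borel_measurable borel"
    by (intro borel_measurable_continuous_onI linear_continuous_on matrix_vector_mul_bounded_linear)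
  show ?thesis using X
    by (subst lborel_powm[OF r, of E]) (simp add: emeasure_density_const emeasure_distr vimage_def)
qed

lemma lborel_reflect: "(lborel :: (real^'n) measure) = distr lborel borel (\<lambda>s. t - s)"
  using lborel_affine[of "-1" t] by (simp add: density_1)

lemma linear_vec_borel [measurable]: "(*v) (A :: real^'n^'m) \<in> borel_measurable borel"
  by (intro borel_measurable_continuous_onI linear_continuous_on matrix_vector_mul_bounded_linear)

lemma power_powr_commute: "(x ^ j) powr s = (x powr s) ^ j" for x s :: real
  by (induction j) (simp_all add: powr_mult)

section \<open>Functions homogeneous under the group \<open>c powm E\<close>\<close>

locale homogeneous_field =
  fixes E :: "real^'d^'d" and N :: "real^'d \<Rightarrow> real" and \<phi> :: "real^'d \<Rightarrow> real" and \<beta> :: real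
  assumes E: "min_re_eig E > 0" and polar: "polar_norm E N" and \<phi>_cont: "continuous_on UNIV \<phi>"
    and hom: "homogeneous_fun E \<phi>" and \<beta>: "\<beta> > 0" and adm: "admissible_fun \<beta> E N \<phi>"
begin

abbreviation \<tau> :: "real^'d \<Rightarrow> real" where "\<tau> \<equiv> polar_radius E N"
abbreviation q :: real where "q \<equiv> trace E"

lemma q_pos: "q > 0"
  by (rule trace_pos[OF E])

lemma \<phi>_isCont: "isCont \<phi> x"
  using \<phi>_cont by (simp add: continuous_on_eq_continuous_at)

lemma \<phi>_measurable [measurable]: "\<phi> \<in> borel_measurable borel"
  using \<phi>_cont by (rule borel_measurable_continuous_onI)

lemma \<phi>_nonneg [simp]: "0 \<le> \<phi> x" and \<phi>_pos: "x \<noteq> 0 \<Longrightarrow> 0 < \<phi> x"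
  using adm by (auto simp: admissible_fun_def)

lemma powm_vec_inverse:
  "c > 0 \<Longrightarrow> c powm E *v ((1 / c) powm E *v x) = x" "c > 0 \<Longrightarrow> (1 / c) powm E *v (c powm E *v x) = x"
  by (simp_all add: matrix_vector_mul_assoc powm_inverse)

lemma powm_vec_eq_0_iff: "c > 0 \<Longrightarrow> c powm E *v x = 0 \<longleftrightarrow> x = 0"
  by (metis powm_vec_inverse(2) matrix_vector_mult_0_right)

lemma powm_vec_tendsto_0: "((\<lambda>c. c powm E *v x) \<longlongrightarrow> 0) (at_right 0)"
proof -
  have "((\<lambda>c. c powm E) \<longlongrightarrow> 0) (at_right 0)"
    using powm_tendsto_0[OF E] by (rule tendsto_norm_zero_cancel)
  from bounded_linear.tendsto[OF bounded_linear_mult_vec this, of x] show ?thesis by simp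
qed

text \<open>Homogeneity speaks only of points off the origin. Continuity along
  \<open>c powm E *v x\<close>, which tends to 0 with \<open>c\<close>, gives the value at the
  origin.\<close>

lemma \<phi>_0 [simp]: "\<phi> 0 = 0"
proof -
  obtain x :: "real^'d" where x: "x \<noteq> 0" by (metis axis_eq_0_iff zero_neq_one)
  have "((\<lambda>c. \<phi> (c powm E *v x)) \<longlongrightarrow> \<phi> 0) (at_right 0)"
    by (rule isCont_tendsto_compose[OF \<phi>_isCont powm_vec_tendsto_0])
  moreover have "eventually (\<lambda>c. \<phi> (c powm E *v x) = c * \<phi> x) (at_right 0)"
    by (rule eventually_at_rightI[of 0 1]) (use hom x in \<open>auto simp: homogeneous_fun_def\<close>)
  ultimately have "((\<lambda>c. c * \<phi> x) \<longlongrightarrow> \<phi> 0) (at_right 0)"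
    by (rule Lim_transform_eventually)
  moreover have "((\<lambda>c. c * \<phi> x) \<longlongrightarrow> 0 * \<phi> x) (at_right 0)"
    by (intro tendsto_intros)
  ultimately show ?thesis using tendsto_unique[of "at_right (0::real)"] by fastforce
qed

lemma \<phi>_scale: "c > 0 \<Longrightarrow> \<phi> (c powm E *v x) = c * \<phi> x"
  using hom by (cases "x = 0") (auto simp: homogeneous_fun_def)

lemma \<phi>_eq_0_iff: "\<phi> x = 0 \<longleftrightarrow> x = 0"
  using \<phi>_pos[of x] by (cases "x = 0") auto

text \<open>Existence, uniqueness and continuity of the radius are extracted from the homeomorphism;
  they justify the definite description in \<open>polar_radius\<close>.\<close>

lemma polar_ex:
  obtains g where "continuous_on (UNIV - {0}) (\<lambda>x. fst (g x) :: real)"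
    "\<And>x. x \<noteq> 0 \<Longrightarrow> fst (g x) > 0 \<and> N (snd (g x)) = 1 \<and> x = fst (g x) powm E *v snd (g x)"
    "\<And>s \<theta> s' \<theta>'. s > 0 \<Longrightarrow> s' > 0 \<Longrightarrow> N \<theta> = 1 \<Longrightarrow> N \<theta>' = 1 \<Longrightarrow> s powm E *v \<theta> = s' powm E *v \<theta>' \<Longrightarrow> s = s'"
proof -
  obtain g where g: "homeomorphism ({0<..} \<times> {\<theta>. N \<theta> = 1}) (UNIV - {0}) (\<lambda>(s, \<theta>). (s powm E) *v \<theta>) g"
    using polar by (auto simp: polar_norm_def)
  have "continuous_on (UNIV - {0}) (\<lambda>x. fst (g x))"
    using homeomorphism_cont2[OF g] by (intro continuous_on_fst)
  moreover have "fst (g x) > 0 \<and> N (snd (g x)) = 1 \<and> x = fst (g x) powm E *v snd (g x)" if "x \<noteq> 0" for x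
  proof -
    have "g x \<in> {0<..} \<times> {\<theta>. N \<theta> = 1}" using homeomorphism_image2[OF g] that by blast
    moreover have "(\<lambda>(s, \<theta>). (s powm E) *v \<theta>) (g x) = x" using homeomorphism_apply2[OF g] that by blast
    ultimately show ?thesis by (auto simp: case_prod_beta)
  qed
  moreover have "s = s'" if "s > 0" "s' > 0" "N \<theta> = 1" "N \<theta>' = 1" "s powm E *v \<theta> = s' powm E *v \<theta>'" for s s' \<theta> \<theta>'
    using homeomorphism_apply1[OF g, of "(s, \<theta>)"] homeomorphism_apply1[OF g, of "(s', \<theta>')"] that by auto
  ultimately show ?thesis by (rule that)
qed

lemma \<tau>_eqI:
  assumes "s > 0" "N \<theta> = 1" "x = s powm E *v \<theta>"
  shows "\<tau> x = s"
proof -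
  obtain g where uniq: "\<And>s \<theta> s' \<theta>'. s > 0 \<Longrightarrow> s' > 0 \<Longrightarrow> N \<theta> = 1 \<Longrightarrow> N \<theta>' = 1 \<Longrightarrow> s powm E *v \<theta> = s' powm E *v \<theta>' \<Longrightarrow> s = s'"
    using polar_ex by metis
  have "N 0 = 0" using polar by (simp add: polar_norm_def is_norm_def)
  with assms(2) have "\<theta> \<noteq> 0" by auto
  then have "x \<noteq> 0" using assms powm_vec_eq_0_iff by simp
  then show ?thesis unfolding polar_radius_def
    using assms uniq by (auto intro!: the_equality)
qed

lemma \<tau>_0 [simp]: "\<tau> 0 = 0"
  by (simp add: polar_radius_def)

lemma \<tau>_polar:
  assumes "x \<noteq> 0"
  obtains \<theta> where "\<tau> x > 0" "N \<theta> = 1" "x = \<tau> x powm E *v \<theta>"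
proof -
  obtain g where "fst (g x) > 0 \<and> N (snd (g x)) = 1 \<and> x = fst (g x) powm E *v snd (g x)"
    using polar_ex assms by metis
  with \<tau>_eqI[of "fst (g x)" "snd (g x)" x] show ?thesis by (intro that) auto
qed

lemma \<tau>_nonneg: "0 \<le> \<tau> x"
  by (cases "x = 0") (auto elim: \<tau>_polar)

lemma \<tau>_scale:
  assumes c: "c > 0"
  shows "\<tau> (c powm E *v x) = c * \<tau> x"
proof (cases "x = 0")
  case False
  then obtain \<theta> where \<theta>: "\<tau> x > 0" "N \<theta> = 1" "x = \<tau> x powm E *v \<theta>" by (rule \<tau>_polar)
  have "c powm E *v x = (c * \<tau> x) powm E *v \<theta>"
    by (subst \<theta>(3)) (simp add: powm_mult c \<theta>(1) matrix_vector_mul_assoc)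
  then show ?thesis using c \<theta> by (intro \<tau>_eqI) auto
qed simp

lemma continuous_on_\<tau>: "continuous_on (UNIV - {0}) \<tau>"
proof -
  obtain g where g: "continuous_on (UNIV - {0}) (\<lambda>x. fst (g x) :: real)"
    "\<And>x. x \<noteq> 0 \<Longrightarrow> fst (g x) > 0 \<and> N (snd (g x)) = 1 \<and> x = fst (g x) powm E *v snd (g x)"
    using polar_ex by metis
  have "fst (g x) = \<tau> x" if "x \<noteq> 0" for x using g(2)[OF that] \<tau>_eqI by metis
  then show ?thesis using g(1) by (subst continuous_on_cong[of _ "UNIV - {0}" _ "\<lambda>x. fst (g x)"]) auto
qed

text \<open>Here the Euclidean sphere replaces that of \<open>N\<close>: its compactness is
  immediate, and the existence of the form, without uniqueness, suffices for the estimates below.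
  The intermediate value theorem is applied to the norm of
  \<open>(1 / s) powm E *v x\<close>.\<close>

lemma unit_sphere_form:
  assumes "x \<noteq> 0"
  obtains s \<theta> where "s > 0" "norm \<theta> = 1" "x = s powm E *v \<theta>"
proof -
  define h where "h s = norm ((1 / s) powm E *v x)" for s
  have lim: "((\<lambda>s. norm (s powm E)) \<longlongrightarrow> 0) (at_right 0)" by (rule powm_tendsto_0[OF E])
  have ev: "eventually (\<lambda>s::real. 0 < s \<and> s \<le> 1) (at_right 0)"
    by (rule eventually_at_rightI[of 0 1]) auto
  have "eventually (\<lambda>s. norm (s powm E) < 1 / norm x) (at_right 0)"
    using lim assms by (intro order_tendstoD) auto
  from eventually_conj[OF this ev] obtain s1 where s1: "s1 > 0" "s1 \<le> 1" "norm (s1 powm E) < 1 / norm x"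
    by (auto dest!: eventually_happens)
  have "eventually (\<lambda>s. norm (s powm E) < norm x) (at_right 0)"
    using lim assms by (intro order_tendstoD) auto
  from eventually_conj[OF this ev] obtain s2 where s2: "s2 > 0" "s2 \<le> 1" "norm (s2 powm E) < norm x"
    by (auto dest!: eventually_happens)
  have "h (1 / s1) \<le> norm (s1 powm E) * norm x" unfolding h_def by (simp add: norm_matrix_vector_mult)
  also have "\<dots> \<le> 1" using s1 assms by (simp add: field_simps)
  finally have h1: "h (1 / s1) \<le> 1" .
  have "norm x \<le> norm (s2 powm E) * h s2"
    unfolding h_def using norm_matrix_vector_mult[of "s2 powm E" "(1 / s2) powm E *v x"] s2(1) by (simp add: powm_vec_inverse)
  then have h2: "1 \<le> h s2"
  proof (rule contrapos_pp)
    assume "\<not> 1 \<le> h s2"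
    then have "norm (s2 powm E) * h s2 \<le> norm (s2 powm E) * 1" by (intro mult_left_mono) auto
    then show "\<not> norm x \<le> norm (s2 powm E) * h s2" using s2(3) by linarith
  qed
  have cont: "continuous_on {s2..1 / s1} h"
    unfolding h_def
  proof (intro continuous_at_imp_continuous_on ballI)
    fix s assume "s \<in> {s2..1 / s1}"
    then have "s > 0" using s2 by simp
    have "isCont (\<lambda>s. (1 / s) powm E) s"
      using \<open>s > 0\<close> by (intro isCont_o2[where f="\<lambda>s. 1 / s" and g="\<lambda>s. s powm E"] isCont_powm isCont_divide continuous_const continuous_ident) simp_all
    then show "isCont (\<lambda>s. norm ((1 / s) powm E *v x)) s"
      by (intro continuous_norm) (rule bounded_linear.isCont[OF bounded_linear_mult_vec])
  qed
  have "1 \<le> 1 / s1" using s1 by simp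
  then have "s2 \<le> 1 / s1" using s2(2) by linarith
  then obtain s where s: "s2 \<le> s" "h s = 1" using IVT2'[of h "1 / s1" 1 s2] h1 h2 cont by blast
  then show ?thesis
    using that[of s "(1 / s) powm E *v x"] s2 by (simp add: h_def powm_vec_inverse)
qed

lemma sphere_bounds:
  obtains c where "c > 0" "\<And>\<theta>. norm \<theta> = 1 \<Longrightarrow> c \<le> \<phi> \<theta>"
proof -
  have "\<exists>x\<in>sphere 0 1. \<forall>y\<in>sphere (0::real^'d) 1. \<phi> x \<le> \<phi> y"
    by (intro continuous_attains_inf continuous_on_subset[OF \<phi>_cont]) (auto simp: sphere_eq_empty)
  then obtain x :: "real^'d" where x: "norm x = 1" "\<And>y. norm y = 1 \<Longrightarrow> \<phi> x \<le> \<phi> y" by auto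
  then show ?thesis using that[of "\<phi> x"] \<phi>_pos[of x] by force
qed

text \<open>Both functions are homogeneous of degree 1, so they need only be compared on the compact
  Euclidean sphere.\<close>

lemma \<tau>_le_\<phi>: obtains C where "C > 0" "\<And>x. \<tau> x \<le> C * \<phi> x"
proof -
  obtain c where c: "c > 0" "\<And>\<theta>. norm \<theta> = 1 \<Longrightarrow> c \<le> \<phi> \<theta>" using sphere_bounds by metis
  have "bounded (\<tau> ` sphere 0 1)"
    by (intro compact_imp_bounded compact_continuous_image continuous_on_subset[OF continuous_on_\<tau>]) auto
  then obtain K where "K > 0" "\<forall>y\<in>\<tau> ` sphere 0 1. norm y \<le> K" unfolding bounded_pos by blast
  then have K: "\<tau> \<theta> \<le> K" if "norm \<theta> = 1" for \<theta> using that by (auto simp: abs_le_iff)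
  have "\<tau> x \<le> K / c * \<phi> x" for x
  proof (cases "x = 0")
    case False
    then obtain s \<theta> where s: "s > 0" "norm \<theta> = 1" "x = s powm E *v \<theta>" by (rule unit_sphere_form)
    have "\<tau> \<theta> * c \<le> K * \<phi> \<theta>" using K[OF s(2)] c(2)[OF s(2)] c(1) \<open>K > 0\<close> by (intro mult_mono) auto
    then have "s * \<tau> \<theta> \<le> s * (K / c * \<phi> \<theta>)" using c(1) s(1) by (intro mult_left_mono) (auto simp: field_simps)
    then show ?thesis using s by (simp add: \<tau>_scale \<phi>_scale mult_ac)
  qed simp
  with \<open>K > 0\<close> c(1) show ?thesis using that[of "K / c"] by simp
qed

lemma bounded_sublevel: "bounded {x. \<phi> x \<le> R}"
proof -
  obtain c where c: "c > 0" "\<And>\<theta>. norm \<theta> = 1 \<Longrightarrow> c \<le> \<phi> \<theta>" using sphere_bounds by metis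
  obtain C1 where C1: "C1 > 0" "\<And>s. 0 < s \<and> s \<le> 1 \<Longrightarrow> norm (s powm E) \<le> C1 * s powr 0"
    using powm_growth_le_1[of 0 E] E by auto
  obtain C2 where C2: "C2 > 0" "\<And>s. s \<ge> 1 \<Longrightarrow> norm (s powm E) \<le> C2 * s powr (max_re_eig E + 1)"
    using powm_growth_ge_1[of E "max_re_eig E + 1"] by auto
  define L where "L = max_re_eig E + 1"
  have L: "L > 0" using E min_re_eig_le_max[of E] by (simp add: L_def)
  have "norm x \<le> C1 + C2 * (R / c) powr L" if "\<phi> x \<le> R" for x
  proof (cases "x = 0")
    case True
    then show ?thesis using C1 C2 by simp
  next
    case False
    then obtain s \<theta> where s: "s > 0" "norm \<theta> = 1" "x = s powm E *v \<theta>" by (rule unit_sphere_form)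
    have "s * c \<le> s * \<phi> \<theta>" using s c(2)[OF s(2)] by (intro mult_left_mono) auto
    moreover have "s * \<phi> \<theta> \<le> R" using that s by (simp add: \<phi>_scale)
    ultimately have "s * c \<le> R" by linarith
    then have sR: "s \<le> R / c" using c(1) by (simp add: pos_le_divide_eq)
    have "norm x \<le> norm (s powm E)" using norm_matrix_vector_mult[of "s powm E" \<theta>] s by simp
    also have "\<dots> \<le> C1 + C2 * (R / c) powr L"
    proof (cases "s \<le> 1")
      case True
      then have "norm (s powm E) \<le> C1" using C1(2)[of s] s by simp
      then show ?thesis using C2(1) by (simp add: add_increasing2)
    next
      case False
      then have "norm (s powm E) \<le> C2 * s powr L" using C2(2)[of s] by (simp add: L_def)
      also have "\<dots> \<le> C2 * (R / c) powr L" using C2 sR s L by (intro mult_left_mono powr_mono2) auto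
      finally show ?thesis using C1(1) by simp
    qed
    finally show ?thesis .
  qed
  then show ?thesis unfolding bounded_iff by blast
qed

text \<open>Admissibility is formulated on Euclidean annuli. Scaling moves any point other than 0 to
  the level \<open>\<phi> = 1\<close>, and this level lies in one such annulus.\<close>

lemma unit_level_norms:
  obtains a b where "0 < a" "a < b" "\<And>z. \<phi> z = 1 \<Longrightarrow> a \<le> norm z \<and> norm z \<le> b"
proof -
  obtain b where b: "\<And>z. \<phi> z \<le> 1 \<Longrightarrow> norm z \<le> b" using bounded_sublevel[of 1] unfolding bounded_iff by auto
  have "eventually (\<lambda>z. \<phi> z < 1) (nhds 0)"
    using \<phi>_isCont[of 0] unfolding isCont_def tendsto_at_iff_tendsto_nhds by (rule order_tendstoD(2)) simp
  then obtain a where a: "a > 0" "\<And>z. norm z < a \<Longrightarrow> \<phi> z < 1"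
    unfolding eventually_nhds_metric by (auto simp: dist_norm)
  \<comment> \<open>Halving \<open>a\<close> and taking the maximum guarantee the strict inequality
    between the two radii.\<close>
  show ?thesis
  proof (rule that[of "a / 2" "max b a"])
    show "0 < a / 2" "a / 2 < max b a" using a(1) by auto
    fix z assume "\<phi> z = 1"
    then show "a / 2 \<le> norm z \<and> norm z \<le> max b a" using b[of z] a(2)[of z] a(1) by (cases "norm z < a") auto
  qed
qed

section \<open>Integrability of powers of \<open>\<phi>\<close> over dyadic shells\<close>

lemma emeasure_shell:
  assumes "c > 0"
  shows "emeasure lborel {x. c < \<phi> x \<and> \<phi> x \<le> 2 * c} = ennreal (c powr q) * emeasure lborel {x. 1 < \<phi> x \<and> \<phi> x \<le> 2}"
proof -
  have "emeasure lborel {x. c < \<phi> x \<and> \<phi> x \<le> 2 * c}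
      = ennreal (c powr q) * emeasure lborel {x. c powm E *v x \<in> {x. c < \<phi> x \<and> \<phi> x \<le> 2 * c}}"
    by (rule emeasure_powm[OF assms]) measurable
  also have "{x. c powm E *v x \<in> {x. c < \<phi> x \<and> \<phi> x \<le> 2 * c}} = {x. 1 < \<phi> x \<and> \<phi> x \<le> 2}"
    using assms by (auto simp: \<phi>_scale)
  finally show ?thesis .
qed

text \<open>A shell at height \<open>c\<close> has measure proportional to \<open>c powr q\<close>,
  and \<open>\<phi> powr p\<close> is comparable to \<open>c powr p\<close> on it, so the integral
  is bounded by the series in the hypothesis. The heights are left open to serve both at the origin
  and at infinity; overlaps between shells only enlarge the upper bound.\<close>

lemma integrable_shells:
  fixes c :: "nat \<Rightarrow> real"
  assumes c: "\<And>j. c j > 0" and sm: "summable (\<lambda>j. c j powr (p + q))" and [measurable]: "X \<in> sets borel"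
    and cover: "\<And>x. x \<in> X \<Longrightarrow> \<phi> x \<noteq> 0 \<Longrightarrow> \<exists>j. c j < \<phi> x \<and> \<phi> x \<le> 2 * c j"
  shows "integrable lborel (\<lambda>x. indicator X x * \<phi> x powr p)"
proof (rule integrableI_bounded)
  \<comment> \<open>Covers both signs of \<open>p\<close>: for \<open>p \<ge> 0\<close> the value at
    the upper edge of the shell is used, at the cost of \<open>2 powr p\<close>, and for
    \<open>p < 0\<close> the value at the lower edge.\<close>
  define K where "K = max 1 (2 powr p)"
  define W where "W j = {x. c j < \<phi> x \<and> \<phi> x \<le> 2 * c j}" for j
  have [measurable]: "W j \<in> sets borel" for j unfolding W_def by measurable
  define V where "V = measure lborel {x. 1 < \<phi> x \<and> \<phi> x \<le> 2}"
  have "bounded {x. 1 < \<phi> x \<and> \<phi> x \<le> 2}" by (rule bounded_subset[OF bounded_sublevel[of 2]]) auto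
  then have V: "emeasure lborel {x. 1 < \<phi> x \<and> \<phi> x \<le> 2} = ennreal V"
    unfolding V_def using emeasure_bounded_finite by (intro emeasure_eq_ennreal_measure) (auto simp: less_top)
  have bnd: "ennreal (norm (indicator X x * \<phi> x powr p)) \<le> (\<Sum>j. ennreal (K * c j powr p) * indicator (W j) x)" for x
  proof (cases "x \<in> X \<and> \<phi> x \<noteq> 0")
    case True
    then obtain j where j: "c j < \<phi> x" "\<phi> x \<le> 2 * c j" using cover by blast
    have "\<phi> x powr p \<le> K * c j powr p"
    proof (cases "p \<ge> 0")
      case True
      then have "\<phi> x powr p \<le> (2 * c j) powr p" using j by (intro powr_mono2) auto
      also have "\<dots> = 2 powr p * c j powr p" using c[of j] by (simp add: powr_mult)
      also have "\<dots> \<le> K * c j powr p" by (intro mult_right_mono) (auto simp: K_def)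
      finally show ?thesis .
    next
      case False
      then have "\<phi> x powr p \<le> c j powr p" using j c[of j] by (intro powr_mono2') auto
      also have "\<dots> \<le> K * c j powr p" using mult_right_mono[of 1 K "c j powr p"] by (simp add: K_def)
      finally show ?thesis .
    qed
    then have "ennreal (norm (indicator X x * \<phi> x powr p)) \<le> ennreal (K * c j powr p) * indicator (W j) x"
      using True j by (auto simp: W_def intro!: ennreal_leI)
    also have "\<dots> \<le> (\<Sum>j. ennreal (K * c j powr p) * indicator (W j) x)"
    proof -
      have "f j \<le> (\<Sum>j. f j)" for f :: "nat \<Rightarrow> ennreal" using sum_le_suminf[of f "{j}"] by simp
      then show ?thesis .
    qed
    finally show ?thesis .
  qed auto
  have "(\<integral>\<^sup>+x. ennreal (norm (indicator X x * \<phi> x powr p)) \<partial>lborel) \<le> (\<integral>\<^sup>+x. (\<Sum>j. ennreal (K * c j powr p) * indicator (W j) x) \<partial>lborel)"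
    by (intro nn_integral_mono bnd)
  also have "\<dots> = (\<Sum>j. \<integral>\<^sup>+x. ennreal (K * c j powr p) * indicator (W j) x \<partial>lborel)"
    by (rule nn_integral_suminf) measurable
  also have "\<dots> = (\<Sum>j. ennreal (K * V * c j powr (p + q)))"
  proof (rule suminf_cong)
    fix j
    have "(\<integral>\<^sup>+x. ennreal (K * c j powr p) * indicator (W j) x \<partial>lborel) = ennreal (K * c j powr p) * (ennreal (c j powr q) * ennreal V)"
      unfolding V[symmetric] using emeasure_shell[OF c[of j]] by (subst nn_integral_cmult_indicator) (auto simp: W_def)
    also have "\<dots> = ennreal (K * c j powr p * (c j powr q * V))"
      by (simp add: ennreal_mult' K_def V_def)
    also have "K * c j powr p * (c j powr q * V) = K * V * c j powr (p + q)"
      by (simp add: powr_add mult_ac)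
    finally show "(\<integral>\<^sup>+x. ennreal (K * c j powr p) * indicator (W j) x \<partial>lborel) = ennreal (K * V * c j powr (p + q))" .
  qed
  also have "\<dots> = ennreal (\<Sum>j. K * V * c j powr (p + q))"
    by (rule suminf_ennreal2) (auto simp: K_def V_def intro!: summable_mult sm)
  also have "\<dots> < \<infinity>" by simp
  finally show "(\<integral>\<^sup>+x. ennreal (norm (indicator X x * \<phi> x powr p)) \<partial>lborel) < \<infinity>" .
qed measurable

lemma integrable_power_inside:
  assumes "- q < p" "R > 0"
  shows "integrable lborel (\<lambda>x. indicator {x. \<phi> x \<le> R} x * \<phi> x powr p)"
proof (rule integrable_shells[where c="\<lambda>j. R * (1/2) ^ Suc j"])
  show "summable (\<lambda>j. (R * (1/2) ^ Suc j) powr (p + q))"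
  proof -
    have "(R * (1/2) ^ Suc j) powr (p + q) = (R / 2) powr (p + q) * ((1/2) powr (p + q)) ^ j" for j
    proof -
      have "R * (1/2) ^ Suc j = (R / 2) * (1/2) ^ j" by simp
      then show ?thesis using assms(2) by (simp only: powr_mult power_powr_commute)
    qed
    moreover have "(1/2::real) powr (p + q) < 1" using assms(1) by (simp add: powr_def ln_div)
    ultimately show ?thesis by (auto intro!: summable_mult summable_geometric)
  qed
  fix x assume x: "x \<in> {x. \<phi> x \<le> R}" "\<phi> x \<noteq> 0"
  then have pos: "\<phi> x > 0" by (simp add: order_less_le)
  have "\<exists>j. R * (1/2) ^ Suc j < \<phi> x"
  proof -
    obtain n where "(1/2) ^ n < \<phi> x / R" using real_arch_pow_inv[of "\<phi> x / R" "1/2"] pos assms(2) by auto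
    then have "R * (1/2) ^ n < \<phi> x" using assms(2) by (simp add: field_simps)
    moreover have "R * (1/2) ^ Suc n \<le> R * (1/2) ^ n" using assms(2) by simp
    ultimately show ?thesis by (intro exI[of _ n]) linarith
  qed
  then have L: "R * (1/2) ^ Suc (LEAST j. R * (1/2) ^ Suc j < \<phi> x) < \<phi> x" by (rule LeastI_ex)
  \<comment> \<open>The first shell whose lower edge lies below \<open>\<phi> x\<close>. Minimality
    puts \<open>\<phi> x\<close> below the upper edge; for \<open>j = 0\<close> the upper edge is
    \<open>R\<close> itself.\<close>
  define j where "j = (LEAST j. R * (1/2) ^ Suc j < \<phi> x)"
  have "\<phi> x \<le> 2 * (R * (1/2) ^ Suc j)"
  proof (cases j)
    case 0
    then show ?thesis using x by simp
  next
    case (Suc i)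
    then have "\<not> R * (1/2) ^ Suc i < \<phi> x" using not_less_Least[of i "\<lambda>j. R * (1/2) ^ Suc j < \<phi> x"] by (simp add: j_def)
    then show ?thesis using Suc by simp
  qed
  with L show "\<exists>j. R * (1/2) ^ Suc j < \<phi> x \<and> \<phi> x \<le> 2 * (R * (1/2) ^ Suc j)" unfolding j_def by blast
qed (use assms in auto)

lemma integrable_power_outside:
  assumes "p < - q" "R > 0"
  shows "integrable lborel (\<lambda>x. indicator {x. R < \<phi> x} x * \<phi> x powr p)"
proof (rule integrable_shells[where c="\<lambda>j. R * 2 ^ j"])
  show "summable (\<lambda>j. (R * 2 ^ j) powr (p + q))"
  proof -
    have "(R * 2 ^ j) powr (p + q) = R powr (p + q) * (2 powr (p + q)) ^ j" for j
      using assms(2) by (simp only: powr_mult power_powr_commute)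
    moreover have "(2::real) powr (p + q) < 1" using assms(1) powr_less_mono[of "p + q" 0 2] by simp
    ultimately show ?thesis by (auto intro!: summable_mult summable_geometric)
  qed
  fix x assume x: "x \<in> {x. R < \<phi> x}" "\<phi> x \<noteq> 0"
  have "\<exists>j. \<phi> x \<le> 2 * (R * 2 ^ j)"
  proof -
    obtain n where "\<phi> x / R < 2 ^ n" using real_arch_pow[of 2 "\<phi> x / R"] by auto
    then have "\<phi> x < R * 2 ^ n" using assms(2) by (simp add: field_simps)
    moreover have "R * 2 ^ n \<le> 2 * (R * 2 ^ n)" using assms(2) by simp
    ultimately show ?thesis by (intro exI[of _ n]) linarith
  qed
  then have L: "\<phi> x \<le> 2 * (R * 2 ^ (LEAST j. \<phi> x \<le> 2 * (R * 2 ^ j)))" by (rule LeastI_ex)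
  define j where "j = (LEAST j. \<phi> x \<le> 2 * (R * 2 ^ j))"
  have "R * 2 ^ j < \<phi> x"
  proof (cases j)
    case 0
    then show ?thesis using x by simp
  next
    case (Suc i)
    then have "\<not> \<phi> x \<le> 2 * (R * 2 ^ i)" using not_less_Least[of i "\<lambda>j. \<phi> x \<le> 2 * (R * 2 ^ j)"] by (simp add: j_def)
    then show ?thesis using Suc by simp
  qed
  with L show "\<exists>j. R * 2 ^ j < \<phi> x \<and> \<phi> x \<le> 2 * (R * 2 ^ j)" unfolding j_def by blast
qed (use assms in auto)

end

section \<open>Local estimates for matrix powers\<close>

lemma powm_lipschitz_at_1:
  fixes A :: "real^'n^'n"
  shows "\<exists>C>0. \<forall>y. 1/2 \<le> y \<and> y \<le> 3/2 \<longrightarrow> norm (y powm A - mat 1) \<le> C * \<bar>y - 1\<bar>"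
proof -
  let ?v = "\<lambda>y. (1 / y) *\<^sub>R (y powm A ** A)"
  have "continuous_on {1/2..3/2} ?v"
    by (intro continuous_on_scaleR bounded_linear.continuous_on[OF bounded_linear_matrix_mult_left]
        continuous_on_subset[OF continuous_on_powm] continuous_intros) auto
  then have "bounded (?v ` {1/2..3/2})" by (intro compact_imp_bounded compact_continuous_image) auto
  then obtain C where C: "C > 0" "\<forall>w\<in>?v ` {1/2..3/2}. norm w \<le> C" unfolding bounded_pos by blast
  have "norm (y powm A - 1 powm A) \<le> C * norm (y - 1)" if "y \<in> {1/2..3/2}" for y
  proof (rule differentiable_bound[where S="{1/2..3/2}" and f'="\<lambda>y h. h *\<^sub>R ?v y"])
    fix x :: real assume x: "x \<in> {1/2..3/2}"
    then show "((\<lambda>y. y powm A) has_derivative (\<lambda>h. h *\<^sub>R ?v x)) (at x within {1/2..3/2})"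
      using powm_has_vector_derivative[of x A] has_vector_derivative_at_within
      unfolding has_vector_derivative_def by (simp add: has_derivative_at_withinI)
    show "onorm (\<lambda>h. h *\<^sub>R ?v x) \<le> C"
    proof (rule onorm_le)
      fix h :: real
      have "norm (?v x) \<le> C" using C(2) x by blast
      from mult_left_mono[OF this abs_ge_zero[of h]] show "norm (h *\<^sub>R ?v x) \<le> C * norm h"
        by (simp only: norm_scaleR mult.commute real_norm_def)
    qed
  qed (use that in auto)
  then show ?thesis using C(1) by (auto simp: real_norm_def)
qed

text \<open>Compactness extends the bound near 0 to bounded intervals. The case
  \<open>y \<le> 0\<close>, where the power is 0 by convention, is included because
  \<open>\<phi>\<close> vanishes at the singularity of the kernel.\<close>

lemma powm_growth_bounded_interval:
  fixes A :: "real^'n^'n"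
  assumes "\<alpha> < min_re_eig A"
  shows "\<exists>C>0. \<forall>y. y \<le> R \<longrightarrow> norm (y powm A) \<le> C * y powr \<alpha>"
proof -
  obtain C1 where C1: "C1 > 0" "\<And>s. 0 < s \<and> s \<le> 1 \<Longrightarrow> norm (s powm A) \<le> C1 * s powr \<alpha>"
    using powm_growth_le_1[OF assms] by auto
  let ?g = "\<lambda>y. norm (y powm A) * y powr (- \<alpha>)"
  have "continuous_on {1..R} ?g"
    by (intro continuous_intros continuous_on_subset[OF continuous_on_powm]) auto
  then have "bounded (?g ` {1..R})" by (intro compact_imp_bounded compact_continuous_image) auto
  then obtain C2 where C2: "C2 > 0" "\<forall>w\<in>?g ` {1..R}. norm w \<le> C2" unfolding bounded_pos by blast
  have "norm (y powm A) \<le> max C1 C2 * y powr \<alpha>" if "y \<le> R" for y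
  proof -
    consider "y \<le> 0" | "0 < y" "y \<le> 1" | "1 < y" by linarith
    then show ?thesis
    proof cases
      case 1
      then show ?thesis using C1(1) by (simp add: max.coboundedI1)
    next
      case 2
      then have "norm (y powm A) \<le> C1 * y powr \<alpha>" using C1(2)[of y] by simp
      also have "\<dots> \<le> max C1 C2 * y powr \<alpha>" by (intro mult_right_mono) auto
      finally show ?thesis .
    next
      case 3
      then have "?g y \<le> C2" using C2(2) that by (auto simp: abs_le_iff)
      then have "norm (y powm A) \<le> C2 * y powr \<alpha>" using 3 by (simp add: powr_minus field_simps)
      also have "C2 * y powr \<alpha> \<le> max C1 C2 * y powr \<alpha>" by (intro mult_right_mono) auto
      finally show ?thesis .
    qed
  qed
  then show ?thesis using C1(1) by (intro exI[of _ "max C1 C2"]) auto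
qed


section \<open>The kernel\<close>

lemma integral_reflect:
  fixes g :: "real^'n \<Rightarrow> 'b::{banach, second_countable_topology}"
  assumes [measurable]: "g \<in> borel_measurable borel"
  shows "(\<integral>s. g (t - s) \<partial>lborel) = (\<integral>s. g s \<partial>lborel)"
proof -
  have "(\<integral>s. g s \<partial>lborel) = (\<integral>s. g s \<partial>distr lborel borel (\<lambda>s. t - s))"
    using lborel_reflect[of t] by simp
  also have "\<dots> = (\<integral>s. g (t - s) \<partial>lborel)" by (rule integral_distr) measurable
  finally show ?thesis by simp
qed

lemma integral_translate:
  fixes g :: "real^'n \<Rightarrow> 'b::{banach, second_countable_topology}"
  assumes [measurable]: "g \<in> borel_measurable borel"
  shows "(\<integral>s. g (s + t) \<partial>lborel) = (\<integral>s. g s \<partial>lborel)"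
  using integral_reflect[of "\<lambda>s. g (t - s)" 0] integral_reflect[of g t] by (simp add: add.commute)

lemma integrable_reflect:
  fixes g :: "real^'n \<Rightarrow> 'b::{banach, second_countable_topology}"
  assumes "integrable lborel g"
  shows "integrable lborel (\<lambda>s. g (t - s))"
proof -
  have "integrable (distr lborel borel (\<lambda>s. t - s)) g" using assms lborel_reflect[of t] by simp
  then show ?thesis by (rule integrable_distr[rotated]) measurable
qed

text \<open>Scheffe's argument: a dominating function that moves by translation is as good as a fixed one.\<close>

lemma moving_dominated_convergence:
  fixes g :: "nat \<Rightarrow> real^'n \<Rightarrow> complex" and F F0 :: "real^'n \<Rightarrow> real"
  assumes F: "integrable lborel F" "\<And>x. 0 \<le> F x" "\<And>x. x \<noteq> 0 \<Longrightarrow> isCont F x"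
    and F0: "integrable lborel F0" "\<And>x. 0 \<le> F0 x"
    and [measurable]: "\<And>n. g n \<in> borel_measurable borel" and h: "h \<longlonglongrightarrow> 0"
    and le: "\<And>n s. norm (g n s) \<le> F (h n - s) + F0 s" and lim: "AE s in lborel. (\<lambda>n. g n s) \<longlonglongrightarrow> 0"
  shows "(\<lambda>n. \<integral>s. g n s \<partial>lborel) \<longlonglongrightarrow> 0"
proof -
  have [measurable]: "F \<in> borel_measurable borel" "F0 \<in> borel_measurable borel"
    using F(1) F0(1) by auto
  have iF: "integrable lborel (\<lambda>s. F (t - s))" for t by (rule integrable_reflect[OF F(1)])
  have iF': "integrable lborel (\<lambda>s. F (- s))" using iF[of 0] by simp
  have ig: "integrable lborel (g n)" for n
    by (rule Bochner_Integration.integrable_bound[OF Bochner_Integration.integrable_add[OF iF[of "h n"] F0(1)]])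
      (use le F F0 in \<open>auto simp: add_nonneg_nonneg intro!: AE_I2\<close>)
  define m where "m n s = min (norm (g n s)) (F (- s) + F0 s)" for n s
  have "(\<lambda>n. \<integral>s. m n s \<partial>lborel) \<longlonglongrightarrow> (\<integral>s. 0 \<partial>(lborel :: (real^'n) measure))"
  proof (rule integral_dominated_convergence[where w="\<lambda>s. F (- s) + F0 s"])
    show "AE s in lborel. (\<lambda>n. m n s) \<longlonglongrightarrow> 0"
      using lim
    proof eventually_elim
      case (elim s)
      have "(\<lambda>n. min (norm (g n s)) (F (- s) + F0 s)) \<longlonglongrightarrow> min 0 (F (- s) + F0 s)"
        using tendsto_norm_zero[OF elim] by (intro tendsto_min tendsto_const)
      then show ?case using F(2)[of "-s"] F0(2)[of s] by (simp add: m_def min_def)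
    qed
    show "AE s in lborel. norm (m n s) \<le> F (- s) + F0 s" for n
      using F(2) F0(2) by (intro AE_I2) (auto simp: m_def min_def abs_if)
  qed (auto simp: m_def[abs_def] intro!: Bochner_Integration.integrable_add iF' F0)
  then have m0: "(\<lambda>n. \<integral>s. m n s \<partial>lborel) \<longlonglongrightarrow> 0" by simp
  define d where "d n s = max 0 (F (- s) - F (h n - s))" for n s
  have "(\<lambda>n. \<integral>s. d n s \<partial>lborel) \<longlonglongrightarrow> (\<integral>s. 0 \<partial>(lborel :: (real^'n) measure))"
  proof (rule integral_dominated_convergence[where w="\<lambda>s. F (- s)"])
    have "AE s in lborel. s \<noteq> (0 :: real^'n)" by (rule AE_lborel_singleton)
    then show "AE s in lborel. (\<lambda>n. d n s) \<longlonglongrightarrow> 0"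
    proof eventually_elim
      case (elim s)
      have "(\<lambda>n. h n - s) \<longlonglongrightarrow> 0 - s" by (intro tendsto_intros h)
      then have "(\<lambda>n. F (h n - s)) \<longlonglongrightarrow> F (- s)"
        using F(3)[of "- s"] elim by (intro isCont_tendsto_compose[of "-s" F]) auto
      then have "(\<lambda>n. max 0 (F (- s) - F (h n - s))) \<longlonglongrightarrow> max 0 (F (- s) - F (- s))"
        by (intro tendsto_max tendsto_diff tendsto_const)
      then show ?case by (simp add: d_def)
    qed
    show "AE s in lborel. norm (d n s) \<le> F (- s)" for n
      using F(2) by (intro AE_I2) (auto simp: d_def max_def abs_if)
  qed (auto simp: d_def[abs_def] intro!: iF')
  then have d0: "(\<lambda>n. \<integral>s. d n s \<partial>lborel) \<longlonglongrightarrow> 0" by simp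
  have im: "integrable lborel (m n)" for n
    unfolding m_def[abs_def] by (intro integrable_min integrable_norm ig Bochner_Integration.integrable_add iF' F0)
  have id: "integrable lborel (d n)" for n
    unfolding d_def[abs_def] by (intro integrable_max Bochner_Integration.integrable_diff iF iF') simp
  have bound: "norm (\<integral>s. g n s \<partial>lborel) \<le> (\<integral>s. m n s \<partial>lborel) + (\<integral>s. d n s \<partial>lborel)" for n
  proof -
    have "norm (\<integral>s. g n s \<partial>lborel) \<le> (\<integral>s. norm (g n s) \<partial>lborel)" by (rule integral_norm_bound)
    also have "\<dots> \<le> (\<integral>s. m n s + (d n s + (F (h n - s) - F (- s))) \<partial>lborel)"
    proof (rule integral_mono)
      show "integrable lborel (\<lambda>s. m n s + (d n s + (F (h n - s) - F (- s))))"
        by (intro Bochner_Integration.integrable_add Bochner_Integration.integrable_diff im id iF iF')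
      show "norm (g n s) \<le> m n s + (d n s + (F (h n - s) - F (- s)))" for s
        using le[of n s] by (auto simp: m_def d_def min_def max_def)
    qed (intro integrable_norm ig)
    also have "\<dots> = (\<integral>s. m n s \<partial>lborel) + ((\<integral>s. d n s \<partial>lborel) + ((\<integral>s. F (h n - s) \<partial>lborel) - (\<integral>s. F (- s) \<partial>lborel)))"
      using im id iF iF' by simp
    also have "(\<integral>s. F (h n - s) \<partial>lborel) = (\<integral>s. F (- s) \<partial>lborel)"
      using integral_reflect[of F "h n"] integral_reflect[of F 0] by simp
    finally show ?thesis by simp
  qed
  show ?thesis
  proof (rule Lim_null_comparison)
    show "eventually (\<lambda>n. norm (\<integral>s. g n s \<partial>lborel) \<le> (\<integral>s. m n s \<partial>lborel) + (\<integral>s. d n s \<partial>lborel)) sequentially"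
      using bound by simp
    show "(\<lambda>n. (\<integral>s. m n s \<partial>lborel) + (\<integral>s. d n s \<partial>lborel)) \<longlonglongrightarrow> 0"
      using tendsto_add[OF m0 d0] by simp
  qed
qed

lemma add_powr_le:
  fixes x y p :: real
  assumes "0 \<le> x" "0 \<le> y" "0 < p"
  shows "(x + y) powr p \<le> 2 powr p * (x powr p + y powr p)"
proof -
  have "(x + y) powr p \<le> (2 * max x y) powr p" using assms by (intro powr_mono2) auto
  also have "\<dots> = 2 powr p * max x y powr p" using assms by (simp add: powr_mult)
  also have "\<dots> \<le> 2 powr p * (x powr p + y powr p)" by (intro mult_left_mono) (auto simp: max_def)
  finally show ?thesis .
qed

text \<open>The numbers \<open>\<alpha>\<close> and \<open>\<gamma>\<close> control
  \<open>y powm A\<close> for small and for large \<open>y\<close>. By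
  \<open>\<gamma> < \<beta>\<close> the exponent \<open>\<gamma> - \<beta>\<close>, which governs
  the kernel at infinity, is negative.\<close>

locale fractional_kernel = homogeneous_field E N \<phi> \<beta>
  for E :: "real^'d^'d" and N :: "real^'d \<Rightarrow> real" and \<phi> :: "real^'d \<Rightarrow> real" and \<beta> :: real +
  fixes A :: "real^'m^'m" and \<alpha> \<gamma> :: real
  assumes \<alpha>: "\<alpha> < min_re_eig A" "\<alpha> < 0" and \<gamma>: "max_re_eig A < \<gamma>" "\<gamma> < \<beta>"
begin

definition frac_kernel :: "real^'d \<Rightarrow> real^'d \<Rightarrow> real^'m^'m" where
  "frac_kernel t s = \<phi> (t - s) powm A - \<phi> (- s) powm A"

lemma frac_kernel_measurable [measurable]: "frac_kernel t \<in> borel_measurable borel"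
  unfolding frac_kernel_def[abs_def] by measurable

text \<open>A continuous cut-off is used instead of an indicator, so that the majorant is continuous away from 0.\<close>

definition cutoff :: "real \<Rightarrow> real^'d \<Rightarrow> real" where
  "cutoff R x = max 0 (min 1 (2 - \<phi> x / R))"

lemma cutoff_bounds: "0 \<le> cutoff R x" "cutoff R x \<le> 1" and cutoff_eq_1: "R > 0 \<Longrightarrow> \<phi> x \<le> R \<Longrightarrow> cutoff R x = 1"
  and cutoff_eq_0: "R > 0 \<Longrightarrow> 2 * R < \<phi> x \<Longrightarrow> cutoff R x = 0"
  by (auto simp: cutoff_def max_def min_def field_simps)

text \<open>Up to a constant this dominates the \<open>p\<close>-th power of the norm of
  \<open>\<phi> x powm A\<close> wherever \<open>\<phi> x \<le> R\<close>. Its counterpart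
  \<open>far\<close> dominates the \<open>p\<close>-th power of the increments of
  \<open>\<phi> powm A\<close> beyond that level.\<close>

definition near :: "real \<Rightarrow> real \<Rightarrow> real^'d \<Rightarrow> real" where
  "near R p x = cutoff R x * \<phi> x powr (\<alpha> * p)"

definition far :: "real \<Rightarrow> real \<Rightarrow> real^'d \<Rightarrow> real" where
  "far R p x = indicator {x. R < \<phi> x} x * \<phi> x powr ((\<gamma> - \<beta>) * p)"

lemma near_nonneg: "0 \<le> near R p x" and far_nonneg: "0 \<le> far R p x"
  by (simp_all add: near_def far_def cutoff_bounds)

lemma near_isCont:
  assumes "x \<noteq> 0" "R > 0"
  shows "isCont (near R p) x"
  unfolding near_def[abs_def] cutoff_def
  using assms \<phi>_pos[OF assms(1)]
  by (intro continuous_intros \<phi>_isCont) (auto simp: \<phi>_eq_0_iff)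

lemma near_measurable [measurable]: "near R p \<in> borel_measurable borel"
  unfolding near_def[abs_def] cutoff_def by measurable

lemma integrable_near:
  assumes "R > 0" "- q < \<alpha> * p"
  shows "integrable lborel (near R p)"
proof (rule Bochner_Integration.integrable_bound[OF integrable_power_inside[OF assms(2), of "2 * R"]])
  show "AE x in lborel. norm (near R p x) \<le> norm (indicator {x. \<phi> x \<le> 2 * R} x * \<phi> x powr (\<alpha> * p))"
  proof (rule AE_I2)
    fix x
    show "norm (near R p x) \<le> norm (indicator {x. \<phi> x \<le> 2 * R} x * \<phi> x powr (\<alpha> * p))"
      using cutoff_bounds[of R x] cutoff_eq_0[OF assms(1), of x] mult_right_mono[of "cutoff R x" 1 "\<phi> x powr (\<alpha> * p)"]
      by (auto simp: near_def abs_mult split: split_indicator)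
  qed
qed (use assms in auto)

lemma integrable_far: "R > 0 \<Longrightarrow> (\<gamma> - \<beta>) * p < - q \<Longrightarrow> integrable lborel (far R p)"
  unfolding far_def[abs_def] by (rule integrable_power_outside)

text \<open>Scaling by \<open>1 / \<phi> x\<close> brings \<open>x\<close> to the level
  \<open>\<phi> = 1\<close> and shrinks \<open>h\<close> to polar radius at most
  \<open>T / \<phi> x\<close>. Admissibility and the Lipschitz bound for powers at 1 then gain the
  factor \<open>\<phi> x powr (- \<beta>)\<close> over the size
  \<open>\<phi> x powr \<gamma>\<close> of the power itself.\<close>

lemma frac_kernel_far_bound:
  assumes "T > 0"
  shows "\<exists>C R. C > 0 \<and> R > 0 \<and> (\<forall>h x. \<tau> h \<le> T \<longrightarrow> R \<le> \<phi> x \<longrightarrow>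
    norm (\<phi> (h + x) powm A - \<phi> x powm A) \<le> C * \<phi> x powr (\<gamma> - \<beta>))"
proof -
  obtain a b where ab: "0 < a" "a < b" "\<And>z. \<phi> z = 1 \<Longrightarrow> a \<le> norm z \<and> norm z \<le> b"
    by (rule unit_level_norms) blast
  obtain C1 where C1: "C1 > 0" "\<And>z x. a \<le> norm z \<Longrightarrow> norm z \<le> b \<Longrightarrow> \<tau> x \<le> 1 \<Longrightarrow> \<bar>\<phi> (x + z) - \<phi> z\<bar> \<le> C1 * \<tau> x powr \<beta>"
    using adm[unfolded admissible_fun_def, THEN conjunct2, THEN conjunct2, rule_format, of a b] ab(1,2) by auto
  obtain C2 where C2: "C2 > 0" "\<And>s. s \<ge> 1 \<Longrightarrow> norm (s powm A) \<le> C2 * s powr \<gamma>"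
    using powm_growth_ge_1[OF \<gamma>(1)] by auto
  obtain C3 where C3: "C3 > 0" "\<And>y. 1/2 \<le> y \<Longrightarrow> y \<le> 3/2 \<Longrightarrow> norm (y powm A - mat 1) \<le> C3 * \<bar>y - 1\<bar>"
    using powm_lipschitz_at_1[of A] by auto
  \<comment> \<open>The summand 1 ensures \<open>\<rho> \<ge> 1\<close>, the summand
    \<open>T\<close> ensures that the rescaled increment has polar radius at most 1, and the last
    one brings \<open>y\<close> into the interval from 1/2 to 3/2.\<close>
  define R where "R = 1 + T + T * (2 * C1) powr (1 / \<beta>)"
  have R: "1 \<le> R" "T \<le> R" "T * (2 * C1) powr (1 / \<beta>) \<le> R"
    using assms by (auto simp: R_def intro!: add_nonneg_nonneg mult_nonneg_nonneg)
  define C where "C = C2 * (C3 * (C1 * T powr \<beta>))"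
  have "norm (\<phi> (h + x) powm A - \<phi> x powm A) \<le> C * \<phi> x powr (\<gamma> - \<beta>)" if hx: "\<tau> h \<le> T" "R \<le> \<phi> x" for h x
  proof -
    define \<rho> where "\<rho> = \<phi> x"
    have \<rho>: "\<rho> \<ge> R" "\<rho> \<ge> 1" "\<rho> > 0" using hx R by (auto simp: \<rho>_def)
    define z where "z = (1 / \<rho>) powm E *v x"
    define w where "w = (1 / \<rho>) powm E *v h"
    have z1: "\<phi> z = 1" using \<rho> by (simp add: z_def \<phi>_scale \<rho>_def[symmetric])
    have tw: "\<tau> w = \<tau> h / \<rho>" using \<rho> by (simp add: w_def \<tau>_scale)
    have tw1: "\<tau> w \<le> T / \<rho>" unfolding tw using hx(1) \<rho> by (intro divide_right_mono) auto
    have "T / \<rho> \<le> 1" using \<rho> R by (simp add: field_simps)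
    with tw1 have tw2: "\<tau> w \<le> 1" by linarith
    define y where "y = \<phi> (w + z)"
    have "\<bar>y - 1\<bar> \<le> C1 * \<tau> w powr \<beta>" using C1(2)[of z w] ab(3)[OF z1] tw2 z1 by (simp add: y_def)
    also have "\<dots> \<le> C1 * (T / \<rho>) powr \<beta>"
      using C1(1) tw1 \<tau>_nonneg \<beta> by (intro mult_left_mono powr_mono2) auto
    finally have y1: "\<bar>y - 1\<bar> \<le> C1 * (T / \<rho>) powr \<beta>" .
    have "(T / \<rho>) powr \<beta> \<le> 1 / (2 * C1)"
    proof -
      have "T / \<rho> \<le> 1 / ((2 * C1) powr (1 / \<beta>))"
        using R(3) \<rho> C1(1) by (simp add: field_simps)
      then have "(T / \<rho>) powr \<beta> \<le> (1 / ((2 * C1) powr (1 / \<beta>))) powr \<beta>"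
        using assms \<rho> \<beta> by (intro powr_mono2) auto
      also have "\<dots> = 1 / (2 * C1)" using \<beta> C1(1) by (simp add: powr_divide powr_powr)
      finally show ?thesis .
    qed
    then have "C1 * (T / \<rho>) powr \<beta> \<le> 1 / 2" using C1(1) by (simp add: field_simps)
    with y1 have y2: "1/2 \<le> y" "y \<le> 3/2" by (auto simp: abs_le_iff)
    have hxw: "h + x = \<rho> powm E *v (w + z)"
      using \<rho> by (simp add: w_def z_def matrix_vector_right_distrib powm_vec_inverse)
    have "\<phi> (h + x) = \<rho> * y" unfolding hxw y_def using \<rho> by (simp add: \<phi>_scale)
    then have "\<phi> (h + x) powm A - \<phi> x powm A = \<rho> powm A ** (y powm A - mat 1)"
      using \<rho> y2 by (simp add: powm_mult \<rho>_def[symmetric] linear_simps[OF bounded_linear_matrix_mult_right])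
    then have "norm (\<phi> (h + x) powm A - \<phi> x powm A) \<le> norm (\<rho> powm A) * norm (y powm A - mat 1)"
      by (simp add: norm_matrix_matrix_mult)
    also have "\<dots> \<le> (C2 * \<rho> powr \<gamma>) * (C3 * (C1 * (T / \<rho>) powr \<beta>))"
    proof (intro mult_mono)
      show "norm (\<rho> powm A) \<le> C2 * \<rho> powr \<gamma>" using C2(2) \<rho> by simp
      have "norm (y powm A - mat 1) \<le> C3 * \<bar>y - 1\<bar>" using C3(2) y2 by simp
      also have "\<dots> \<le> C3 * (C1 * (T / \<rho>) powr \<beta>)" using C3(1) y1 by (intro mult_left_mono) auto
      finally show "norm (y powm A - mat 1) \<le> C3 * (C1 * (T / \<rho>) powr \<beta>)" .
    qed (use C2 in auto)
    also have "\<dots> = C * \<rho> powr (\<gamma> - \<beta>)"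
      using \<rho> assms by (simp add: C_def powr_divide powr_diff)
    finally show ?thesis by (simp add: \<rho>_def)
  qed
  moreover have "C > 0" using C1 C2 C3 assms by (simp add: C_def)
  ultimately show ?thesis using R(1) by (intro exI[of _ C] exI[of _ R]) auto
qed

text \<open>For \<open>\<phi> (- s) \<le> R\<close> both arguments of \<open>\<phi>\<close> stay in
  a bounded set and the two powers are estimated separately; cancellation between them is exploited
  only beyond. The constants are uniform for bounded \<open>t\<close>, as continuity in
  \<open>t\<close> requires.\<close>

lemma frac_kernel_powr_bound:
  assumes T: "T > 0" and p: "p > 0"
  shows "\<exists>C R R'. C > 0 \<and> R > 0 \<and> R' > 0 \<and> (\<forall>t s. norm t \<le> T \<longrightarrow> \<tau> t \<le> T \<longrightarrow>
    norm (frac_kernel t s) powr p \<le> C * (near R' p (t - s) + near R' p (- s) + far R p (- s)))"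
proof -
  obtain C1 R where C1: "C1 > 0" "R > 0"
    "\<And>h x. \<tau> h \<le> T \<Longrightarrow> R \<le> \<phi> x \<Longrightarrow> norm (\<phi> (h + x) powm A - \<phi> x powm A) \<le> C1 * \<phi> x powr (\<gamma> - \<beta>)"
    using frac_kernel_far_bound[OF T] by blast
  obtain B where B: "\<And>x. \<phi> x \<le> R \<Longrightarrow> norm x \<le> B"
    using bounded_sublevel[of R] unfolding bounded_iff by auto
  have "bounded (\<phi> ` cball 0 (B + T))"
    by (intro compact_imp_bounded compact_continuous_image continuous_on_subset[OF \<phi>_cont]) auto
  then obtain R0 where R0: "R0 > 0" "\<forall>y\<in>\<phi> ` cball 0 (B + T). norm y \<le> R0" unfolding bounded_pos by blast
  define R' where "R' = max R R0"
  have R': "R' > 0" "R \<le> R'" "R0 \<le> R'" using C1(2) by (auto simp: R'_def)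
  obtain C2 where C2: "C2 > 0" "\<And>y. y \<le> R' \<Longrightarrow> norm (y powm A) \<le> C2 * y powr \<alpha>"
    using powm_growth_bounded_interval[OF \<alpha>(1), of R'] by auto
  define C where "C = 2 powr p * C2 powr p + C1 powr p"
  have C: "2 powr p * C2 powr p \<le> C" "C1 powr p \<le> C" "C > 0" using C1(1) by (auto simp: C_def add_nonneg_pos)
  have nb: "norm (\<phi> x powm A) powr p \<le> C2 powr p * near R' p x" if "\<phi> x \<le> R'" for x
  proof -
    have "norm (\<phi> x powm A) powr p \<le> (C2 * \<phi> x powr \<alpha>) powr p"
      using C2(2)[OF that] p by (intro powr_mono2) auto
    also have "\<dots> = C2 powr p * \<phi> x powr (\<alpha> * p)" using C2(1) by (simp add: powr_mult powr_powr)
    also have "\<dots> = C2 powr p * near R' p x" using cutoff_eq_1[OF R'(1) that] by (simp add: near_def)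
    finally show ?thesis .
  qed
  have "norm (frac_kernel t s) powr p \<le> C * (near R' p (t - s) + near R' p (- s) + far R p (- s))"
    if t: "norm t \<le> T" "\<tau> t \<le> T" for t s
  proof (cases "\<phi> (- s) \<le> R")
    case True
    have "norm (t - s) \<le> B + T" using B[OF True] t(1) norm_triangle_ineq4[of t s] by simp
    then have "\<phi> (t - s) \<le> R0" using R0(2) by (auto simp: abs_le_iff)
    then have le: "\<phi> (t - s) \<le> R'" "\<phi> (- s) \<le> R'" using R' True by auto
    have "norm (frac_kernel t s) powr p \<le> (norm (\<phi> (t - s) powm A) + norm (\<phi> (- s) powm A)) powr p"
      unfolding frac_kernel_def using p by (intro powr_mono2 norm_triangle_ineq4) auto
    also have "\<dots> \<le> 2 powr p * (norm (\<phi> (t - s) powm A) powr p + norm (\<phi> (- s) powm A) powr p)"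
      using p by (intro add_powr_le) auto
    also have "\<dots> \<le> 2 powr p * (C2 powr p * near R' p (t - s) + C2 powr p * near R' p (- s))"
      by (intro mult_left_mono add_mono nb le) auto
    also have "\<dots> = (2 powr p * C2 powr p) * (near R' p (t - s) + near R' p (- s))"
      by (simp add: algebra_simps)
    also have "\<dots> \<le> C * (near R' p (t - s) + near R' p (- s) + far R p (- s))"
      using C near_nonneg far_nonneg by (intro mult_mono) (auto simp: add_nonneg_nonneg)
    finally show ?thesis .
  next
    case False
    have "norm (frac_kernel t s) \<le> C1 * \<phi> (- s) powr (\<gamma> - \<beta>)"
      using C1(3)[OF t(2), of "- s"] False by (simp add: frac_kernel_def)
    then have "norm (frac_kernel t s) powr p \<le> (C1 * \<phi> (- s) powr (\<gamma> - \<beta>)) powr p"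
      using p by (intro powr_mono2) auto
    also have "\<dots> = C1 powr p * far R p (- s)" using C1(1) False by (simp add: powr_mult powr_powr far_def)
    also have "\<dots> \<le> C * (near R' p (t - s) + near R' p (- s) + far R p (- s))"
      using C near_nonneg far_nonneg by (intro mult_mono) (auto simp: add_nonneg_nonneg)
    finally show ?thesis .
  qed
  then show ?thesis using C(3) C1(2) R'(1) by blast
qed

lemma integrable_kernel_powr:
  assumes p: "p > 0" "- q < \<alpha> * p" "(\<gamma> - \<beta>) * p < - q"
  shows "integrable lborel (\<lambda>s. norm (frac_kernel t s) powr p)"
proof -
  define T where "T = max 1 (max (norm t) (\<tau> t))"
  have T: "T > 0" "norm t \<le> T" "\<tau> t \<le> T" by (auto simp: T_def)
  obtain C R R' where C: "C > 0" "R > 0" "R' > 0" "\<And>t s. norm t \<le> T \<Longrightarrow> \<tau> t \<le> T \<Longrightarrow>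
    norm (frac_kernel t s) powr p \<le> C * (near R' p (t - s) + near R' p (- s) + far R p (- s))"
    using frac_kernel_powr_bound[OF T(1) p(1)] by blast
  have 1: "integrable lborel (\<lambda>s. near R' p (t - s))" for t by (rule integrable_reflect[OF integrable_near[OF C(3) p(2)]])
  have 2: "integrable lborel (\<lambda>s. far R p (0 - s))" by (rule integrable_reflect[OF integrable_far[OF C(2) p(3)]])
  have "integrable lborel (\<lambda>s. C * (near R' p (t - s) + near R' p (0 - s) + far R p (0 - s)))"
    by (intro integrable_mult_right Bochner_Integration.integrable_add 1 2)
  then show ?thesis
  proof (rule Bochner_Integration.integrable_bound)
    show "AE s in lborel. norm (norm (frac_kernel t s) powr p) \<le> norm (C * (near R' p (t - s) + near R' p (0 - s) + far R p (0 - s)))"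
    proof (rule AE_I2)
      fix s
      show "norm (norm (frac_kernel t s) powr p) \<le> norm (C * (near R' p (t - s) + near R' p (0 - s) + far R p (0 - s)))"
        using C(4)[OF T(2,3), of s] by simp
    qed
  qed measurable
qed

lemma frac_kernel_tendsto_0:
  assumes h: "h \<longlonglongrightarrow> 0" and s: "s \<noteq> 0"
  shows "(\<lambda>n. frac_kernel (h n) s) \<longlonglongrightarrow> 0"
proof -
  have "isCont (\<lambda>x. \<phi> x powm A) (- s)"
    using \<phi>_pos[of "-s"] s by (intro isCont_o2[OF \<phi>_isCont isCont_powm]) simp
  moreover have "(\<lambda>n. h n - s) \<longlonglongrightarrow> - s" using tendsto_diff[OF h tendsto_const, of s] by simp
  ultimately have "(\<lambda>n. \<phi> (h n - s) powm A) \<longlonglongrightarrow> \<phi> (- s) powm A" by (rule isCont_tendsto_compose)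
  from tendsto_diff[OF this tendsto_const[of "\<phi> (- s) powm A"]] show ?thesis by (simp add: frac_kernel_def)
qed

text \<open>The singularity at \<open>s = h n\<close> moves with \<open>n\<close>. The majorant is
  therefore split into a part \<open>F\<close> that moves along with it and a fixed part
  \<open>F0\<close>.\<close>

lemma integral_kernel_tendsto_0:
  fixes G :: "real^'m^'m \<Rightarrow> complex"
  assumes G: "continuous_on UNIV G" "G 0 = 0" "\<And>T. cmod (G T) \<le> K * (norm T powr a + norm T powr b)" and K: "K \<ge> 0"
    and a: "a > 0" "- q < \<alpha> * a" "(\<gamma> - \<beta>) * a < - q" and b: "b > 0" "- q < \<alpha> * b" "(\<gamma> - \<beta>) * b < - q"
    and h: "h \<longlonglongrightarrow> 0"
  shows "(\<lambda>n. \<integral>s. G (frac_kernel (h n) s) \<partial>lborel) \<longlonglongrightarrow> 0"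
proof -
  \<comment> \<open>Continuity of \<open>\<tau>\<close> has been obtained only off the origin.
    Comparison with \<open>\<phi>\<close>, which is continuous at the origin, makes
    \<open>\<tau> (h n)\<close> small.\<close>
  obtain C0 where C0: "C0 > 0" "\<And>x. \<tau> x \<le> C0 * \<phi> x" using \<tau>_le_\<phi> by metis
  have "(\<lambda>n. C0 * \<phi> (h n)) \<longlonglongrightarrow> C0 * \<phi> 0"
    by (intro tendsto_intros isCont_tendsto_compose[OF \<phi>_isCont h])
  then have ev1: "eventually (\<lambda>n. C0 * \<phi> (h n) < 1) sequentially" by (intro order_tendstoD) auto
  have ev2: "eventually (\<lambda>n. norm (h n) < 1) sequentially" using tendsto_norm_zero[OF h] by (intro order_tendstoD) auto
  from eventually_conj[OF ev1 ev2] obtain M where M: "\<And>n. n \<ge> M \<Longrightarrow> C0 * \<phi> (h n) < 1 \<and> norm (h n) < 1"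
    unfolding eventually_sequentially by blast
  obtain Ca Ra Ra' where ca: "Ca > 0" "Ra > 0" "Ra' > 0" "\<And>t s. norm t \<le> 1 \<Longrightarrow> \<tau> t \<le> 1 \<Longrightarrow>
    norm (frac_kernel t s) powr a \<le> Ca * (near Ra' a (t - s) + near Ra' a (- s) + far Ra a (- s))"
    using frac_kernel_powr_bound[OF zero_less_one a(1)] by blast
  obtain Cb Rb Rb' where cb: "Cb > 0" "Rb > 0" "Rb' > 0" "\<And>t s. norm t \<le> 1 \<Longrightarrow> \<tau> t \<le> 1 \<Longrightarrow>
    norm (frac_kernel t s) powr b \<le> Cb * (near Rb' b (t - s) + near Rb' b (- s) + far Rb b (- s))"
    using frac_kernel_powr_bound[OF zero_less_one b(1)] by blast
  define F where "F x = K * (Ca * near Ra' a x + Cb * near Rb' b x)" for x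
  define F0 where "F0 s = K * (Ca * (near Ra' a (0 - s) + far Ra a (0 - s)) + Cb * (near Rb' b (0 - s) + far Rb b (0 - s)))" for s
  have [measurable]: "G \<in> borel_measurable borel" using G(1) by (rule borel_measurable_continuous_onI)
  have "(\<lambda>n. \<integral>s. G (frac_kernel (h (n + M)) s) \<partial>lborel) \<longlonglongrightarrow> 0"
  proof (rule moving_dominated_convergence[where F=F and ?F0.0=F0 and h="\<lambda>n. h (n + M)"])
    show "integrable lborel F"
      unfolding F_def by (intro integrable_mult_right Bochner_Integration.integrable_add integrable_near ca cb a b)
    show "0 \<le> F x" for x unfolding F_def using K ca(1) cb(1) near_nonneg by (intro mult_nonneg_nonneg add_nonneg_nonneg) auto
    show "isCont F x" if "x \<noteq> 0" for x
      unfolding F_def[abs_def] by (intro continuous_intros near_isCont that ca cb)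
    show "integrable lborel F0"
      unfolding F0_def
      by (intro integrable_mult_right Bochner_Integration.integrable_add integrable_reflect integrable_near integrable_far ca cb a b)
    show "0 \<le> F0 x" for x unfolding F0_def using K ca(1) cb(1) near_nonneg far_nonneg by (intro mult_nonneg_nonneg add_nonneg_nonneg) auto
    show "(\<lambda>n. h (n + M)) \<longlonglongrightarrow> 0" using h by (rule LIMSEQ_ignore_initial_segment)
    show "cmod (G (frac_kernel (h (n + M)) s)) \<le> F (h (n + M) - s) + F0 s" for n s
    proof -
      let ?t = "h (n + M)"
      have t: "norm ?t \<le> 1" "\<tau> ?t \<le> 1" using M[of "n + M"] C0(2)[of ?t] by auto
      have "cmod (G (frac_kernel ?t s)) \<le> K * (norm (frac_kernel ?t s) powr a + norm (frac_kernel ?t s) powr b)" by (rule G(3))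
      also have "\<dots> \<le> K * (Ca * (near Ra' a (?t - s) + near Ra' a (- s) + far Ra a (- s))
          + Cb * (near Rb' b (?t - s) + near Rb' b (- s) + far Rb b (- s)))"
        by (intro mult_left_mono add_mono ca(4) cb(4) t K)
      also have "\<dots> = F (?t - s) + F0 s" by (simp add: F_def F0_def algebra_simps)
      finally show ?thesis .
    qed
    have "AE s in lborel. s \<noteq> (0 :: real^'d)" by (rule AE_lborel_singleton)
    then show "AE s in lborel. (\<lambda>n. G (frac_kernel (h (n + M)) s)) \<longlonglongrightarrow> 0"
    proof eventually_elim
      case (elim s)
      have "(\<lambda>n. frac_kernel (h (n + M)) s) \<longlonglongrightarrow> 0"
        by (rule frac_kernel_tendsto_0[OF LIMSEQ_ignore_initial_segment[OF h] elim])
      then have "(\<lambda>n. G (frac_kernel (h (n + M)) s)) \<longlonglongrightarrow> G 0"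
        using G(1) by (intro isCont_tendsto_compose[of 0 G]) (auto simp: continuous_on_eq_continuous_at)
      then show ?case by (simp add: G(2))
    qed
  qed measurable
  then show ?thesis by (rule LIMSEQ_offset)
qed

section \<open>Scaling, commutation and injectivity of the kernel\<close>

lemma frac_kernel_scale:
  assumes "r > 0"
  shows "frac_kernel (r powm E *v t) (r powm E *v s) = r powm A ** frac_kernel t s"
proof -
  have "\<phi> (r powm E *v x) powm A = r powm A ** \<phi> x powm A" for x
    using assms \<phi>_nonneg[of x] by (cases "\<phi> x = 0")
      (auto simp: \<phi>_scale powm_mult order_less_le linear_simps(3)[OF bounded_linear_matrix_mult_right])
  from this[of "t - s"] this[of "- s"] show ?thesis
    by (simp add: frac_kernel_def linear_simps[OF bounded_linear_matrix_mult_right]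
        linear_simps[OF matrix_vector_mul_bounded_linear])
qed

lemma frac_kernel_commute: "A ** C = C ** A \<Longrightarrow> frac_kernel t s ** C = C ** frac_kernel t s"
  by (simp add: frac_kernel_def powm_commute linear_simps[OF bounded_linear_matrix_mult_left] linear_simps[OF bounded_linear_matrix_mult_right])

lemma frac_kernel_diff: "frac_kernel t s - frac_kernel t' s = frac_kernel (t - t') (s - t')"
  by (simp add: frac_kernel_def)

text \<open>By continuity the kernel annihilates \<open>u\<close> for every \<open>s\<close> other
  than 0 and \<open>t\<close>. Hence \<open>u\<close> is fixed by \<open>y powm transpose A\<close>
  for every ratio \<open>y\<close> of the two values of \<open>\<phi>\<close> that occur. These
  ratios fill an interval, and differentiating in \<open>y\<close> leaves
  \<open>transpose A *v u = 0\<close>.\<close>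

lemma frac_kernel_transpose_injective:
  assumes t: "t \<noteq> 0" and inv: "invertible A" and ae: "AE s in lborel. transpose (frac_kernel t s) *v u = 0"
  shows "u = 0"
proof -
  have cont: "isCont (\<lambda>s. transpose (frac_kernel t s) *v u) s" if "s \<noteq> 0" "s \<noteq> t" for s
  proof -
    have pos: "\<phi> (t - s) > 0" "\<phi> (- s) > 0" using \<phi>_pos[of "t - s"] \<phi>_pos[of "- s"] that by auto
    have "isCont (\<lambda>s. t - s) s" "isCont (\<lambda>s. - s) s" by (intro continuous_intros)+
    from isCont_o2[OF this(1) \<phi>_isCont] isCont_o2[OF this(2) \<phi>_isCont]
    have "isCont (\<lambda>s. \<phi> (t - s)) s" "isCont (\<lambda>s. \<phi> (- s)) s" .
    from isCont_o2[OF this(1) isCont_powm[OF pos(1)]] isCont_o2[OF this(2) isCont_powm[OF pos(2)]]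
    have "isCont (\<lambda>s. \<phi> (t - s) powm A) s" "isCont (\<lambda>s. \<phi> (- s) powm A) s" .
    then have "isCont (\<lambda>s. \<phi> (t - s) powm A - \<phi> (- s) powm A) s" by (rule continuous_diff)
    then show ?thesis unfolding frac_kernel_def
      by (rule bounded_linear.isCont[OF bounded_linear_transpose_mult])
  qed
  have all: "transpose (frac_kernel t s) *v u = 0" if s: "s \<noteq> 0" "s \<noteq> t" for s
  proof (rule ccontr)
    assume ne: "transpose (frac_kernel t s) *v u \<noteq> 0"
    have "eventually (\<lambda>s. transpose (frac_kernel t s) *v u \<noteq> 0) (nhds s)"
      using tendsto_at_iff_tendsto_nhds[THEN iffD1, OF cont[OF s, unfolded isCont_def]] ne
      by (rule tendsto_imp_eventually_ne)
    then obtain e where e: "e > 0" "\<And>y. dist y s < e \<Longrightarrow> transpose (frac_kernel t y) *v u \<noteq> 0"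
      unfolding eventually_nhds_metric by blast
    have "AE y in lborel. y \<notin> ball s e"
      using ae by eventually_elim (use e in \<open>auto simp: dist_commute\<close>)
    then have "emeasure lborel (ball s e) = 0"
      by (subst (asm) AE_iff_measurable[of "ball s e"]) auto
    then show False using content_ball_pos[OF e(1), of s] by (simp add: measure_def)
  qed
  have eq: "\<phi> (t - s) powm transpose A *v u = \<phi> (- s) powm transpose A *v u" if "s \<noteq> 0" "s \<noteq> t" for s
    using all[OF that] by (simp add: frac_kernel_def linear_simps[OF bounded_linear_transpose] transpose_powm matrix_vector_mult_diff_rdistrib)
  \<comment> \<open>At \<open>s = t - x c\<close> the arguments of \<open>\<phi>\<close> are
    \<open>x c\<close> and \<open>x c - t\<close>, and \<open>y c\<close> is the ratio of the values
    there. The numerator is \<open>c * \<phi> t\<close>, so the ratio tends to 0 with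
    \<open>c\<close>.\<close>
  define x where "x c = c powm E *v t" for c
  define y where "y c = c * \<phi> t / \<phi> (x c - t)" for c
  have x0: "(x \<longlongrightarrow> 0) (at_right 0)" unfolding x_def by (rule powm_vec_tendsto_0)
  have "eventually (\<lambda>c. x c \<noteq> t) (at_right 0)" using x0 by (rule tendsto_imp_eventually_ne) (use t in auto)
  then obtain c0 where c0: "c0 > 0" "\<And>c. 0 < c \<Longrightarrow> c < c0 \<Longrightarrow> x c \<noteq> t"
    unfolding eventually_at_right_field by auto
  have fixed: "y c powm transpose A *v u = u" and ypos: "y c > 0" if c: "0 < c" "c < c0" for c
  proof -
    have s: "t - x c \<noteq> 0" "t - x c \<noteq> t" using c0(2)[OF c] c t by (auto simp: x_def powm_vec_eq_0_iff)
    have pos: "\<phi> (x c - t) > 0" using s by (intro \<phi>_pos) auto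
    show "y c > 0" using c pos \<phi>_pos[OF t] by (simp add: y_def)
    have "\<phi> (x c) powm transpose A *v u = \<phi> (x c - t) powm transpose A *v u" using eq[OF s] by simp
    moreover have "\<phi> (x c) = \<phi> (x c - t) * y c" using c pos by (simp add: y_def x_def \<phi>_scale)
    ultimately have "\<phi> (x c - t) powm transpose A *v (y c powm transpose A *v u) = \<phi> (x c - t) powm transpose A *v u"
      using pos \<open>y c > 0\<close> by (simp add: powm_mult matrix_vector_mul_assoc)
    then have "(1 / \<phi> (x c - t)) powm transpose A *v (\<phi> (x c - t) powm transpose A *v (y c powm transpose A *v u))
        = (1 / \<phi> (x c - t)) powm transpose A *v (\<phi> (x c - t) powm transpose A *v u)" by simp
    then show "y c powm transpose A *v u = u"
      using pos by (simp add: matrix_vector_mul_assoc[of "(1 / \<phi> (x c - t)) powm transpose A"] powm_inverse)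
  qed
  have cy: "continuous_on {0<..<c0} y"
  proof (intro continuous_at_imp_continuous_on ballI)
    fix c assume c: "c \<in> {0<..<c0}"
    have "isCont x c" unfolding x_def[abs_def]
      by (rule bounded_linear.isCont[OF bounded_linear_mult_vec isCont_powm]) (use c in simp)
    then have "isCont (\<lambda>c. x c - t) c" by (intro continuous_diff continuous_const)
    from isCont_o2[OF this \<phi>_isCont] have "isCont (\<lambda>c. \<phi> (x c - t)) c" .
    moreover have "\<phi> (x c - t) \<noteq> 0" using c0(2) c by (simp add: \<phi>_eq_0_iff)
    ultimately show "isCont y c" unfolding y_def[abs_def] by (intro continuous_intros)
  qed
  have ylim: "(y \<longlongrightarrow> 0) (at_right 0)"
  proof -
    have "((\<lambda>c. \<phi> (x c - t)) \<longlongrightarrow> \<phi> (0 - t)) (at_right 0)"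
      by (intro isCont_tendsto_compose[OF \<phi>_isCont] tendsto_intros x0)
    then have "((\<lambda>c. c * \<phi> t / \<phi> (x c - t)) \<longlongrightarrow> 0 * \<phi> t / \<phi> (0 - t)) (at_right 0)"
      using t by (intro tendsto_intros) (auto simp: \<phi>_eq_0_iff)
    then show ?thesis by (simp add: y_def[abs_def])
  qed
  define y1 where "y1 = y (c0 / 2)"
  have y1: "y1 > 0" using ypos[of "c0 / 2"] c0(1) by (simp add: y1_def)
  have interval: "r powm transpose A *v u = u" if r: "0 < r" "r < y1" for r
  proof -
    have "eventually (\<lambda>c. y c < r) (at_right 0)" using ylim r(1) by (rule order_tendstoD)
    then obtain c1 where c1: "c1 > 0" "\<And>c. 0 < c \<Longrightarrow> c < c1 \<Longrightarrow> y c < r" unfolding eventually_at_right_field by auto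
    define c2 where "c2 = min (c1 / 2) (c0 / 2)"
    have c2: "0 < c2" "c2 \<le> c0 / 2" "y c2 < r" using c1 c0(1) by (auto simp: c2_def intro!: c1(2))
    have "\<exists>c. c2 \<le> c \<and> c \<le> c0 / 2 \<and> y c = r"
      using c2 r c0(1) by (intro IVT') (auto simp: y1_def intro!: continuous_on_subset[OF cy])
    then obtain c where "c2 \<le> c" "c \<le> c0 / 2" "y c = r" by blast
    then show ?thesis using fixed[of c] c2 c0(1) by auto
  qed
  define r where "r = y1 / 2"
  have r: "0 < r" "r < y1" using y1 by (auto simp: r_def)
  have "((\<lambda>r. r powm transpose A *v u) has_vector_derivative ((1 / r) *\<^sub>R (r powm transpose A ** transpose A)) *v u) (at r)"
    by (rule bounded_linear.has_vector_derivative[OF bounded_linear_mult_vec powm_has_vector_derivative[OF r(1)]])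
  moreover have "((\<lambda>r. r powm transpose A *v u) has_vector_derivative 0) (at r)"
    by (rule has_vector_derivative_transform_within_open[where f="\<lambda>_. u" and S="{0<..<y1}"])
      (use r interval in auto)
  ultimately have "((1 / r) *\<^sub>R (r powm transpose A ** transpose A)) *v u = 0"
    by (rule vector_derivative_unique_at)
  then have "r powm transpose A *v (transpose A *v u) = 0"
    using r(1) by (simp add: scaleR_matrix_vector_assoc[symmetric] matrix_vector_mul_assoc)
  then have "(1 / r) powm transpose A *v (r powm transpose A *v (transpose A *v u)) = 0" by simp
  then have "transpose A *v u = 0"
    using r(1) by (simp add: matrix_vector_mul_assoc[of "(1 / r) powm transpose A"] powm_inverse)
  moreover have "invertible (transpose A)" using inv by (simp add: transpose_invertible)
  then obtain B where "B ** transpose A = mat 1" unfolding invertible_def by blast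
  ultimately show "u = 0" by (metis matrix_vector_mul_assoc matrix_vector_mul_lid matrix_vector_mult_0_right)
qed

end


section \<open>The moving average field\<close>

lemma measure_eqI_char_fun:
  fixes \<mu> \<nu> :: "'a::euclidean_space measure"
  assumes "prob_space \<mu>" "prob_space \<nu>" "sets \<mu> = sets borel" "sets \<nu> = sets borel"
    and ch: "\<And>u. char_fun \<mu> u = char_fun \<nu> u"
  shows "\<mu> = \<nu>"
proof -
  have "distr \<mu> borel (\<lambda>x. x) = distr \<nu> borel (\<lambda>x. x)"
    by (rule distr_eqI_char) (use assms in \<open>auto simp: char_fun_def measurable_ident_sets\<close>)
  moreover have "distr \<mu> borel (\<lambda>x. x) = distr \<mu> \<mu> (\<lambda>x. x)" by (rule distr_cong) (simp_all add: assms(3))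
  moreover have "distr \<nu> borel (\<lambda>x. x) = distr \<nu> \<nu> (\<lambda>x. x)" by (rule distr_cong) (simp_all add: assms(4))
  ultimately show ?thesis by simp
qed

lemma iid_sum_law_prob:
  fixes \<nu> :: "'a::euclidean_space measure"
  assumes "prob_space \<nu>" "sets \<nu> = sets borel"
  shows "prob_space (iid_sum_law n \<nu>)" "sets (iid_sum_law n \<nu>) = sets borel"
proof -
  interpret nu: prob_space \<nu> by fact
  interpret PP: prob_space "Pi\<^sub>M {..<n} (\<lambda>_::nat. \<nu>)" by (rule prob_space_PiM) (rule assms(1))
  have "(\<lambda>x. x k) \<in> measurable (Pi\<^sub>M {..<n} (\<lambda>_. \<nu>)) borel" if "k \<in> {..<n}" for k
    using measurable_component_singleton[OF that, of "\<lambda>_. \<nu>"] assms(2) by (simp cong: measurable_cong_sets)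
  then have "(\<lambda>x. \<Sum>k<n. x k) \<in> measurable (Pi\<^sub>M {..<n} (\<lambda>_. \<nu>)) borel" by (intro borel_measurable_sum) simp
  then show "prob_space (iid_sum_law n \<nu>)" unfolding iid_sum_law_def by (rule PP.prob_space_distr)
qed (simp add: iid_sum_law_def)

context random_measure_bounded
begin

text \<open>This function of \<open>u\<close> is the exponent of a linear combination of integrals;
  its continuity is what identifies it with the log-characteristic function.\<close>

lemma continuous_joint_exponent:
  fixes J :: "'j set" and f :: "'j \<Rightarrow> 's \<Rightarrow> real^'m^'m" and c :: "'j \<Rightarrow> real"
  assumes J: "finite J" and f: "\<And>j. j \<in> J \<Longrightarrow> good (f j)"
  shows "continuous_on UNIV (\<lambda>u. \<integral>s. \<psi> (\<Sum>j\<in>J. transpose (f j s) *v (c j *\<^sub>R u)) \<partial>\<Theta>)"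
proof -
  have "isCont (\<lambda>u. \<integral>s. \<psi> (\<Sum>j\<in>J. transpose (f j s) *v (c j *\<^sub>R u)) \<partial>\<Theta>) u" for u
    unfolding continuous_at_sequentially o_def
  proof (intro allI impI)
    fix v :: "nat \<Rightarrow> real^'m" assume v: "v \<longlonglongrightarrow> u"
    then have "bounded (range v)" by (rule convergent_imp_bounded)
    then obtain L where L: "L > 0" "\<And>n. norm (v n) \<le> L" unfolding bounded_pos by auto
    \<comment> \<open>Only the norm of \<open>e j\<close> matters, which is the absolute value of
      \<open>c j\<close>; any unit vector would do in place of the axis. The bound \<open>L\<close>
      on the convergent sequence becomes the constant of the envelope.\<close>
    obtain i :: 'm where True by simp
    define e :: "'j \<Rightarrow> real^'m" where "e j = c j *\<^sub>R axis i 1" for j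
    have meas: "f j \<in> borel_measurable \<Theta>" if "j \<in> J" for j using f[OF that] by (simp add: good_def)
    show "(\<lambda>n. \<integral>s. \<psi> (\<Sum>j\<in>J. transpose (f j s) *v (c j *\<^sub>R v n)) \<partial>\<Theta>)
        \<longlonglongrightarrow> (\<integral>s. \<psi> (\<Sum>j\<in>J. transpose (f j s) *v (c j *\<^sub>R u)) \<partial>\<Theta>)"
    proof (rule integral_dominated_convergence[where w="\<lambda>s. K * (envelope L f e J s powr a + envelope L f e J s powr b)"])
      show "integrable \<Theta> (\<lambda>s. K * (envelope L f e J s powr a + envelope L f e J s powr b))"
        by (rule integrable_envelope[OF J f]) (use L(1) in auto)
      show "AE s in \<Theta>. (\<lambda>n. \<psi> (\<Sum>j\<in>J. transpose (f j s) *v (c j *\<^sub>R v n))) \<longlonglongrightarrow> \<psi> (\<Sum>j\<in>J. transpose (f j s) *v (c j *\<^sub>R u))"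
      proof (rule AE_I2)
        fix s
        have "(\<lambda>n. \<Sum>j\<in>J. transpose (f j s) *v (c j *\<^sub>R v n)) \<longlonglongrightarrow> (\<Sum>j\<in>J. transpose (f j s) *v (c j *\<^sub>R u))"
          by (intro tendsto_sum bounded_linear.tendsto[OF matrix_vector_mul_bounded_linear] tendsto_scaleR tendsto_const v)
        then show "(\<lambda>n. \<psi> (\<Sum>j\<in>J. transpose (f j s) *v (c j *\<^sub>R v n))) \<longlonglongrightarrow> \<psi> (\<Sum>j\<in>J. transpose (f j s) *v (c j *\<^sub>R u))"
          using \<psi>_cont by (intro isCont_tendsto_compose[of _ \<psi>]) (auto simp: continuous_on_eq_continuous_at)
      qed
      show "AE s in \<Theta>. norm (\<psi> (\<Sum>j\<in>J. transpose (f j s) *v (c j *\<^sub>R v n))) \<le> K * (envelope L f e J s powr a + envelope L f e J s powr b)" for n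
      proof (rule AE_I2)
        fix s
        have le: "envelope 1 f (\<lambda>j. c j *\<^sub>R v n) J s \<le> envelope L f e J s"
          unfolding envelope_def e_def
        proof (rule sum_mono)
          fix j
          have "(norm (f j s) * \<bar>c j\<bar>) * norm (v n) \<le> (norm (f j s) * \<bar>c j\<bar>) * L"
            using L(2) by (intro mult_left_mono) auto
          then show "1 * norm (f j s) * norm (c j *\<^sub>R v n) \<le> L * norm (f j s) * norm (c j *\<^sub>R axis i (1::real) :: real^'m)"
            by (simp add: mult_ac)
        qed
        have "0 \<le> envelope 1 f (\<lambda>j. c j *\<^sub>R v n) J s" unfolding envelope_def by (intro sum_nonneg) auto
        then have "K * (envelope 1 f (\<lambda>j. c j *\<^sub>R v n) J s powr a + envelope 1 f (\<lambda>j. c j *\<^sub>R v n) J s powr b)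
            \<le> K * (envelope L f e J s powr a + envelope L f e J s powr b)"
          using le ab K by (intro mult_left_mono add_mono powr_mono2) auto
        moreover have "cmod (\<psi> (\<Sum>j\<in>J. transpose (f j s) *v (c j *\<^sub>R v n)))
            \<le> K * (envelope 1 f (\<lambda>j. c j *\<^sub>R v n) J s powr a + envelope 1 f (\<lambda>j. c j *\<^sub>R v n) J s powr b)"
          by (rule \<psi>_le_envelope) simp
        ultimately show "norm (\<psi> (\<Sum>j\<in>J. transpose (f j s) *v (c j *\<^sub>R v n))) \<le> K * (envelope L f e J s powr a + envelope L f e J s powr b)"
          by linarith
      qed
    qed (rule measurable_\<psi>_sum; erule meas)+
  qed
  then show ?thesis by (simp add: continuous_on_eq_continuous_at)
qed

end

text \<open>The field is any measurable version of the integrals, so equality holds only almost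
  surely for each \<open>t\<close>. Of the four inequalities on \<open>a\<close> and
  \<open>b\<close>, those with \<open>\<alpha>\<close> give integrability of the powers of the
  kernel near its singularities, those with \<open>\<gamma> - \<beta>\<close> at infinity.\<close>

locale moving_average_field = fractional_kernel E N \<phi> \<beta> "D - trace E *\<^sub>R B" \<alpha> \<gamma>
    + full_strictly_operator_stable \<mu> B + random_measure_bounded P lborel M "log_char \<mu>" K a b
  for E :: "real^'d^'d" and N \<phi> \<beta> and B D :: "real^'m^'m" and \<alpha> \<gamma> and \<mu> :: "(real^'m) measure"
    and P :: "'w measure" and M :: "(real^'d) set \<Rightarrow> 'w \<Rightarrow> real^'m" and K a b +
  fixes X :: "real^'d \<Rightarrow> 'w \<Rightarrow> real^'m"
  assumes X_measurable [measurable]: "\<And>t. X t \<in> borel_measurable P"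
    and X_integral: "\<And>t. AE \<omega> in P. X t \<omega> = stoch_integral P lborel M (frac_kernel t) \<omega>"
    and a_exponents: "- trace E < \<alpha> * a" "(\<gamma> - \<beta>) * a < - trace E"
    and b_exponents: "- trace E < \<alpha> * b" "(\<gamma> - \<beta>) * b < - trace E"
begin

lemma prob_P: "prob_space P"
  by (rule prob_space_axioms)

lemma good_kernel: "good (frac_kernel t)"
  unfolding good_def by (auto intro!: integrable_kernel_powr ab a_exponents b_exponents)

lemma X_joint_char:
  assumes J: "finite J"
  shows "(\<integral>\<omega>. iexp (\<Sum>j\<in>J. X (t j) \<omega> \<bullet> u j) \<partial>P) = exp (\<integral>s. \<psi> (\<Sum>j\<in>J. transpose (frac_kernel (t j) s) *v u j) \<partial>lborel)"
proof -
  let ?Y = "\<lambda>j. stoch_integral P lborel M (frac_kernel (t j))"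
  have Y: "has_stoch_integral P lborel M (frac_kernel (t j)) (?Y j)" for j
    by (rule good_has_stoch_integral[OF good_kernel])
  have [measurable]: "?Y j \<in> borel_measurable P" for j using Y[of j] by (simp add: has_stoch_integral_def)
  have "AE \<omega> in P. \<forall>j\<in>J. X (t j) \<omega> = ?Y j \<omega>"
    using J X_integral by (simp add: AE_finite_all)
  then have "(\<integral>\<omega>. iexp (\<Sum>j\<in>J. X (t j) \<omega> \<bullet> u j) \<partial>P) = (\<integral>\<omega>. iexp (\<Sum>j\<in>J. ?Y j \<omega> \<bullet> u j) \<partial>P)"
    by (intro integral_cong_AE) (measurable, auto elim!: eventually_mono)
  also have "\<dots> = exp (\<integral>s. \<psi> (\<Sum>j\<in>J. transpose (frac_kernel (t j) s) *v u j) \<partial>lborel)"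
    by (rule has_stoch_integral_joint_char[OF J good_kernel Y])
  finally show ?thesis .
qed

lemma integrand_measurable [measurable]:
  "(\<lambda>s. \<psi> (\<Sum>j\<in>J. transpose (frac_kernel (t j) s) *v u j)) \<in> borel_measurable borel"
  using measurable_\<psi>_sum[of J "\<lambda>j. frac_kernel (t j)" u] by simp

text \<open>An increment is a pair of values tested with \<open>u\<close> and \<open>- u\<close>,
  here through a Boolean index. The difference of two kernels is again a kernel, translated, so the
  formula has the same shape as that for the values.\<close>

lemma X_diff_joint_char:
  assumes J: "finite J"
  shows "(\<integral>\<omega>. iexp (\<Sum>j\<in>J. (X (t j) \<omega> - X (r j) \<omega>) \<bullet> u j) \<partial>P)
    = exp (\<integral>s. \<psi> (\<Sum>j\<in>J. transpose (frac_kernel (t j - r j) (s - r j)) *v u j) \<partial>lborel)"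
proof -
  let ?J = "J \<times> (UNIV :: bool set)"
  define t' where "t' p = (if snd p then t (fst p) else r (fst p))" for p
  define u' where "u' p = (if snd p then u (fst p) else - u (fst p))" for p
  have sumJ: "(\<Sum>p\<in>?J. g p) = (\<Sum>j\<in>J. g (j, True) + g (j, False))" for g :: "_ \<Rightarrow> 'z::comm_monoid_add"
    using sum.cartesian_product[of "\<lambda>j b. g (j, b)" UNIV J] by (simp add: UNIV_bool add.commute split_beta)
  have "(\<Sum>p\<in>?J. X (t' p) \<omega> \<bullet> u' p) = (\<Sum>j\<in>J. (X (t j) \<omega> - X (r j) \<omega>) \<bullet> u j)" for \<omega>
    unfolding sumJ by (simp add: t'_def u'_def inner_diff_left)
  moreover have "(\<Sum>p\<in>?J. transpose (frac_kernel (t' p) s) *v u' p) = (\<Sum>j\<in>J. transpose (frac_kernel (t j - r j) (s - r j)) *v u j)" for s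
    unfolding sumJ frac_kernel_diff[symmetric]
    by (simp add: t'_def u'_def linear_simps[OF bounded_linear_transpose] matrix_vector_mult_diff_rdistrib
        linear_simps(4)[OF matrix_vector_mul_bounded_linear])
  ultimately show ?thesis using X_joint_char[of ?J t' u'] J by simp
qed

lemma X_stationary_increments: "stationary_increments P X"
  unfolding stationary_increments_def fdd_eq_def
proof (intro allI impI)
  fix h and J :: "(real^'d) set" assume J: "finite J"
  show "distr P (Pi\<^sub>M J (\<lambda>_. borel)) (\<lambda>\<omega>. \<lambda>t\<in>J. X (t + h) \<omega> - X h \<omega>) =
     distr P (Pi\<^sub>M J (\<lambda>_. borel)) (\<lambda>\<omega>. \<lambda>t\<in>J. X t \<omega> - X 0 \<omega>)"
  proof (rule fdd_eqI_char[OF prob_P prob_P J])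
    fix u :: "real^'d \<Rightarrow> real^'m"
    have "(\<integral>s. \<psi> (\<Sum>t\<in>J. transpose (frac_kernel t (s + (- h))) *v u t) \<partial>lborel) = (\<integral>s. \<psi> (\<Sum>t\<in>J. transpose (frac_kernel t s) *v u t) \<partial>lborel)"
      by (rule integral_translate) measurable
    then show "(\<integral>\<omega>. iexp (\<Sum>t\<in>J. (X (t + h) \<omega> - X h \<omega>) \<bullet> u t) \<partial>P) = (\<integral>\<omega>. iexp (\<Sum>t\<in>J. (X t \<omega> - X 0 \<omega>) \<bullet> u t) \<partial>P)"
      unfolding X_diff_joint_char[OF J] by simp
  qed measurable
qed

text \<open>Translation replaces the increment from \<open>t\<close> to \<open>T n\<close> by the
  kernel at \<open>T n - t\<close>, so that only the behaviour of the kernel at the origin is in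
  question.\<close>

lemma X_stochastically_continuous: "stochastically_continuous P X"
  unfolding stochastically_continuous_def
proof (intro allI impI)
  fix t and T :: "nat \<Rightarrow> real^'d" assume T: "T \<longlonglongrightarrow> t"
  have "conv_in_prob P (\<lambda>n \<omega>. X (T n) \<omega> - X t \<omega>) (\<lambda>_. 0)"
  proof (rule conv_in_prob_0_if_char)
    fix u :: "real^'m"
    define G where "G S = \<psi> (transpose S *v u)" for S :: "real^'m^'m"
    have Gc: "continuous_on UNIV G"
      unfolding G_def
      by (rule continuous_on_compose2[OF \<psi>_cont linear_continuous_on[OF bounded_linear_transpose_mult]]) auto
    have [measurable]: "G \<in> borel_measurable borel" using Gc by (rule borel_measurable_continuous_onI)
    define L where "L = norm u powr a + norm u powr b"
    have G_le: "cmod (G S) \<le> (K * L) * (norm S powr a + norm S powr b)" for S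
    proof -
      have le: "norm (transpose S *v u) \<le> norm S * norm u"
        using norm_matrix_vector_mult[of "transpose S" u] by (simp add: norm_transpose)
      have "norm (transpose S *v u) powr p \<le> norm S powr p * norm u powr p" if "p > 0" for p
        using powr_mono2[OF less_imp_le[OF that] _ le] by (simp add: powr_mult)
      from add_mono[OF this[OF ab(1)] this[OF ab(2)]]
      have "norm (transpose S *v u) powr a + norm (transpose S *v u) powr b \<le> norm S powr a * norm u powr a + norm S powr b * norm u powr b" .
      also have "\<dots> \<le> L * (norm S powr a + norm S powr b)"
        unfolding L_def by (simp add: algebra_simps)
      finally have "K * (norm (transpose S *v u) powr a + norm (transpose S *v u) powr b) \<le> K * (L * (norm S powr a + norm S powr b))"
        using K by (rule mult_left_mono)
      with \<psi>_le[of "transpose S *v u"] show ?thesis by (simp add: G_def mult.assoc)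
    qed
    have eq: "(\<integral>\<omega>. iexp ((X (T n) \<omega> - X t \<omega>) \<bullet> u) \<partial>P) = exp (\<integral>s. G (frac_kernel (T n - t) s) \<partial>lborel)" for n
    proof -
      have "(\<integral>\<omega>. iexp ((X (T n) \<omega> - X t \<omega>) \<bullet> u) \<partial>P) = exp (\<integral>s. G (frac_kernel (T n - t) (s + (- t))) \<partial>lborel)"
        using X_diff_joint_char[of "{()}" "\<lambda>_. T n" "\<lambda>_. t" "\<lambda>_. u"] by (simp add: G_def)
      also have "(\<integral>s. G (frac_kernel (T n - t) (s + (- t))) \<partial>lborel) = (\<integral>s. G (frac_kernel (T n - t) s) \<partial>lborel)"
        by (rule integral_translate) measurable
      finally show ?thesis .
    qed
    have "(\<lambda>n. T n - t) \<longlonglongrightarrow> 0" using tendsto_diff[OF T tendsto_const[of t]] by simp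
    then have "(\<lambda>n. \<integral>s. G (frac_kernel (T n - t) s) \<partial>lborel) \<longlonglongrightarrow> 0"
      by (intro integral_kernel_tendsto_0[where a=a and b=b, OF Gc _ G_le] ab a_exponents b_exponents)
        (use K in \<open>auto simp: G_def L_def linear_simps[OF bounded_linear_transpose]\<close>)
    from tendsto_exp[OF this] show "(\<lambda>n. \<integral>\<omega>. iexp ((X (T n) \<omega> - X t \<omega>) \<bullet> u) \<partial>P) \<longlonglongrightarrow> 1"
      unfolding eq by simp
  qed measurable
  then show "conv_in_prob P (\<lambda>n. X (T n)) (X t)"
    by (simp add: conv_in_prob_def dist_norm)
qed

text \<open>On a hyperplane the characteristic function has modulus 1, so the integral of
  \<open>- Re \<psi>\<close> along the kernel vanishes. The integrand is nonnegative and hence zero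
  almost everywhere, which by \<open>Re_\<psi>_neg\<close> means that the transposed kernel
  annihilates \<open>u\<close>.\<close>

lemma X_full:
  assumes inv: "invertible (D - trace E *\<^sub>R B)"
  shows "full_field P X"
  unfolding full_field_def full_distribution_def
proof (intro allI impI notI)
  fix t :: "real^'d" and u c assume t: "t \<noteq> 0" and u: "u \<noteq> 0" and "AE x in distr P borel (X t). u \<bullet> x = c"
  then have ae: "AE \<omega> in P. u \<bullet> X t \<omega> = c" by (subst (asm) AE_distr_iff) auto
  have "(\<integral>\<omega>. iexp (X t \<omega> \<bullet> u) \<partial>P) = (\<integral>\<omega>. iexp c \<partial>P)"
    by (rule integral_cong_AE) (use ae in \<open>auto simp: inner_commute elim!: eventually_mono\<close>)
  also have "\<dots> = iexp c" by (simp add: prob_space)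
  finally have "exp (\<integral>s. \<psi> (transpose (frac_kernel t s) *v u) \<partial>lborel) = iexp c"
    using X_joint_char[of "{()}" "\<lambda>_. t" "\<lambda>_. u"] by simp
  then have "exp (Re (\<integral>s. \<psi> (transpose (frac_kernel t s) *v u) \<partial>lborel)) = 1"
    by (metis norm_exp_eq_Re norm_exp_i_times)
  moreover have int: "integrable lborel (\<lambda>s. \<psi> (transpose (frac_kernel t s) *v u))"
    using integrable_\<psi>[of "{()}" "\<lambda>_. frac_kernel t" "\<lambda>_. u"] good_kernel by simp
  ultimately have "(\<integral>s. - Re (\<psi> (transpose (frac_kernel t s) *v u)) \<partial>lborel) = 0"
    using integral_Re[OF int] by simp
  moreover have "integrable lborel (\<lambda>s. - Re (\<psi> (transpose (frac_kernel t s) *v u)))"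
    using int by (intro Bochner_Integration.integrable_minus integrable_Re)
  ultimately have "AE s in lborel. - Re (\<psi> (transpose (frac_kernel t s) *v u)) = 0"
    using Re_\<psi>_le_0 by (subst (asm) integral_nonneg_eq_0_iff_AE) auto
  then have "AE s in lborel. transpose (frac_kernel t s) *v u = 0"
    by eventually_elim (use Re_\<psi>_neg in force)
  with frac_kernel_transpose_injective[OF t inv] u show False by blast
qed

section \<open>Self-similarity and stability for commuting \<open>D\<close> and
  \<open>B\<close>\<close>

context
  assumes commute: "D ** B = B ** D"
begin

lemma commute_A: "(D - trace E *\<^sub>R B) ** B = B ** (D - trace E *\<^sub>R B)"
  using commute by (simp add: linear_simps[OF bounded_linear_matrix_mult_left] linear_simps[OF bounded_linear_matrix_mult_right])

lemma transpose_kernel_powm: "transpose (frac_kernel t s) *v (r powm transpose B *v u) = r powm transpose B *v (transpose (frac_kernel t s) *v u)"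
proof -
  have "r powm B ** frac_kernel t s = frac_kernel t s ** r powm B"
    by (rule powm_commute[OF frac_kernel_commute[OF commute_A, symmetric]])
  then have "transpose (r powm B ** frac_kernel t s) = transpose (frac_kernel t s ** r powm B)" by simp
  then show ?thesis by (simp add: matrix_transpose_mul matrix_vector_mul_assoc transpose_powm)
qed

text \<open>Commutation lets a scaling of the test vectors pass through the kernel into
  \<open>\<psi>\<close>. Both the exponent \<open>B\<close> and strict stability rest on this
  identity.\<close>

lemma joint_exponent_scale:
  assumes "r > 0"
  shows "(\<integral>s. \<psi> (\<Sum>j\<in>J. transpose (frac_kernel (t j) s) *v (r powm transpose B *v u j)) \<partial>lborel)
    = of_real r * (\<integral>s. \<psi> (\<Sum>j\<in>J. transpose (frac_kernel (t j) s) *v u j) \<partial>lborel)"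
proof -
  have "\<psi> (\<Sum>j\<in>J. transpose (frac_kernel (t j) s) *v (r powm transpose B *v u j)) = of_real r * \<psi> (\<Sum>j\<in>J. transpose (frac_kernel (t j) s) *v u j)" for s
    unfolding transpose_kernel_powm \<psi>_scale[OF assms, symmetric]
    by (simp add: linear_sum[OF matrix_vector_mul_linear])
  then show ?thesis by simp
qed

text \<open>By commutation \<open>r powm D\<close> splits into \<open>r powm ?A\<close>, which the
  kernel produces under the substitution, and \<open>r powm ?G\<close>, which inside
  \<open>\<psi>\<close> amounts to the factor \<open>r powr trace E\<close>, the Jacobian of the
  substitution.\<close>

lemma X_operator_self_similar: "operator_self_similar P E D X"
  unfolding operator_self_similar_def fdd_eq_def
proof (intro allI impI)
  fix r :: real and J :: "(real^'d) set" assume r: "r > 0" and J: "finite J"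
  let ?A = "D - trace E *\<^sub>R B" and ?G = "trace E *\<^sub>R B"
  show "distr P (Pi\<^sub>M J (\<lambda>_. borel)) (\<lambda>\<omega>. \<lambda>t\<in>J. X (r powm E *v t) \<omega>) =
     distr P (Pi\<^sub>M J (\<lambda>_. borel)) (\<lambda>\<omega>. \<lambda>t\<in>J. r powm D *v X t \<omega>)"
  proof (rule fdd_eqI_char[OF prob_P prob_P J])
    fix u :: "real^'d \<Rightarrow> real^'m"
    have AG: "?A ** ?G = ?G ** ?A" using commute_A by (simp add: matrix_scalar_ac scalar_matrix_assoc[symmetric])
    have D: "r powm D = r powm ?A ** r powm ?G" using powm_add[OF r AG] by simp
    have kG: "frac_kernel t s ** r powm ?G = r powm ?G ** frac_kernel t s" for t s
      by (rule powm_commute[OF frac_kernel_commute[OF AG, symmetric], symmetric])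
    have point: "of_real (r powr trace E) * \<psi> (\<Sum>t\<in>J. transpose (frac_kernel (r powm E *v t) (r powm E *v s)) *v u t)
        = \<psi> (\<Sum>t\<in>J. transpose (frac_kernel t s) *v (transpose (r powm D) *v u t))" for s
    proof -
      have "r powm transpose ?G *v (transpose (frac_kernel (r powm E *v t) (r powm E *v s)) *v u t)
          = transpose (frac_kernel t s) *v (transpose (r powm D) *v u t)" for t
      proof -
        have "(r powm ?A ** frac_kernel t s) ** r powm ?G = r powm D ** frac_kernel t s"
          unfolding D matrix_mul_assoc[symmetric] kG ..
        then have "transpose ((r powm ?A ** frac_kernel t s) ** r powm ?G) *v u t = transpose (r powm D ** frac_kernel t s) *v u t"
          by simp
        then show ?thesis
          unfolding frac_kernel_scale[OF r] matrix_transpose_mul[of _ "r powm ?G"] matrix_transpose_mul[of "r powm D"]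
          by (simp only: transpose_powm matrix_vector_mul_assoc)
      qed
      then show ?thesis
        unfolding scale_q[OF r, symmetric] by (simp add: linear_sum[OF matrix_vector_mul_linear])
    qed
    have "(\<integral>\<omega>. iexp (\<Sum>t\<in>J. X (r powm E *v t) \<omega> \<bullet> u t) \<partial>P)
        = exp (\<integral>s. \<psi> (\<Sum>t\<in>J. transpose (frac_kernel (r powm E *v t) s) *v u t) \<partial>lborel)"
      by (rule X_joint_char[OF J])
    also have "(\<integral>s. \<psi> (\<Sum>t\<in>J. transpose (frac_kernel (r powm E *v t) s) *v u t) \<partial>lborel)
        = r powr trace E *\<^sub>R (\<integral>s. \<psi> (\<Sum>t\<in>J. transpose (frac_kernel (r powm E *v t) (r powm E *v s)) *v u t) \<partial>lborel)"
      by (rule integral_powm[OF r]) measurable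
    also have "\<dots> = (\<integral>s. of_real (r powr trace E) * \<psi> (\<Sum>t\<in>J. transpose (frac_kernel (r powm E *v t) (r powm E *v s)) *v u t) \<partial>lborel)"
      by (simp add: scaleR_conv_of_real)
    also have "\<dots> = (\<integral>s. \<psi> (\<Sum>t\<in>J. transpose (frac_kernel t s) *v (transpose (r powm D) *v u t)) \<partial>lborel)"
      unfolding point ..
    also have "exp \<dots> = (\<integral>\<omega>. iexp (\<Sum>t\<in>J. X t \<omega> \<bullet> (transpose (r powm D) *v u t)) \<partial>P)"
      by (rule X_joint_char[OF J, symmetric])
    finally show "(\<integral>\<omega>. iexp (\<Sum>t\<in>J. X (r powm E *v t) \<omega> \<bullet> u t) \<partial>P) = (\<integral>\<omega>. iexp (\<Sum>t\<in>J. (r powm D *v X t \<omega>) \<bullet> u t) \<partial>P)"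
      by (simp only: inner_matrix_vector)
  qed (auto intro: measurable_compose[OF X_measurable linear_vec_borel])
qed

text \<open>Infinite divisibility belongs to the notion of exponent and is exhibited directly: the
  \<open>n\<close>-th convolution root is the law of \<open>(1 / n) powm B *v L\<close>. The shift
  vectors can be taken to be 0.\<close>

lemma X_field_exponent: "field_exponent P X B"
  unfolding field_exponent_def
proof (intro allI)
  fix k and c :: "nat \<Rightarrow> real" and t :: "nat \<Rightarrow> real^'d"
  define L where "L \<omega> = (\<Sum>j<k. c j *\<^sub>R X (t j) \<omega>)" for \<omega>
  have Lm [measurable]: "L \<in> borel_measurable P" unfolding L_def[abs_def] by measurable
  define \<Psi> where "\<Psi> u = (\<integral>s. \<psi> (\<Sum>j<k. transpose (frac_kernel (t j) s) *v (c j *\<^sub>R u)) \<partial>lborel)" for u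
  let ?\<nu> = "distr P borel L"
  have ch: "(\<integral>\<omega>. iexp (L \<omega> \<bullet> u) \<partial>P) = exp (\<Psi> u)" for u
    using X_joint_char[of "{..<k}" t "\<lambda>j. c j *\<^sub>R u"] by (simp add: L_def \<Psi>_def inner_sum_left)
  have chf: "char_fun ?\<nu> u = exp (\<Psi> u)" for u
    unfolding char_fun_def ch[symmetric] by (rule integral_distr) measurable
  have scale: "\<Psi> (r powm transpose B *v u) = of_real r * \<Psi> u" if "r > 0" for r u
    unfolding \<Psi>_def using joint_exponent_scale[OF that, where J="{..<k}" and t=t and u="\<lambda>j. c j *\<^sub>R u"]
    by (simp add: matrix_vector_mult_scaleR)
  have lc: "log_char ?\<nu> = \<Psi>"
  proof (rule log_char_eqI[OF _ _ chf])
    show "continuous_on UNIV \<Psi>" unfolding \<Psi>_def by (rule continuous_joint_exponent) (auto intro: good_kernel)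
    show "\<Psi> 0 = 0" by (simp add: \<Psi>_def)
  qed
  have pr: "prob_space ?\<nu>" by (rule prob_space_distr) measurable
  have "infinitely_divisible ?\<nu>"
    unfolding infinitely_divisible_def
  proof (intro allI impI)
    fix n :: nat assume n: "n > 0"
    let ?R = "(1 / real n) powm B"
    let ?\<nu>' = "distr P borel (\<lambda>\<omega>. ?R *v L \<omega>)"
    have m': "(\<lambda>\<omega>. ?R *v L \<omega>) \<in> borel_measurable P" by (rule measurable_compose[OF Lm linear_vec_borel])
    have pr': "prob_space ?\<nu>'" by (rule prob_space_distr[OF m'])
    have "char_fun ?\<nu>' u = exp (\<Psi> u / of_nat n)" for u
    proof -
      have "char_fun ?\<nu>' u = (\<integral>\<omega>. iexp ((?R *v L \<omega>) \<bullet> u) \<partial>P)"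
        unfolding char_fun_def by (rule integral_distr[OF m']) measurable
      also have "\<dots> = exp (\<Psi> ((1 / real n) powm transpose B *v u))"
        unfolding inner_matrix_vector ch transpose_powm ..
      finally show ?thesis using scale[of "1 / real n" u] n by simp
    qed
    then have "char_fun (iid_sum_law n ?\<nu>') u = char_fun ?\<nu> u" for u
      using n by (simp add: char_fun_iid_sum[OF pr'] chf exp_of_nat_mult[symmetric])
    then have "iid_sum_law n ?\<nu>' = ?\<nu>"
      by (intro measure_eqI_char_fun iid_sum_law_prob pr pr') auto
    then show "\<exists>\<nu>. prob_space \<nu> \<and> sets \<nu> = sets borel \<and> iid_sum_law n \<nu> = ?\<nu>"
      using pr' by (intro exI[of _ ?\<nu>']) auto
  qed
  then have "operator_stable_exp ?\<nu> B"
    unfolding operator_stable_exp_def lc using pr scale by (auto intro!: exI[of _ "\<lambda>_. 0"])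
  then show "operator_stable_exp (distr P borel (\<lambda>\<omega>. \<Sum>j<k. c j *\<^sub>R X (t j) \<omega>)) B"
    by (simp add: L_def[abs_def])
qed

text \<open>The sum of \<open>m\<close> copies of a finite-dimensional distribution is normalised by
  the block-diagonal matrix whose blocks all equal \<open>(1 / m) powm B\<close>, one for each time
  point.\<close>

lemma X_strictly_operator_stable: "strictly_operator_stable_field P X"
  unfolding strictly_operator_stable_field_def
proof (intro allI impI)
  fix n :: nat and t :: "nat \<Rightarrow> real^'d" assume n: "0 < n"
  let ?I = "{..<n} \<times> (UNIV :: 'm set)"
  let ?B = "Pi\<^sub>M ?I (\<lambda>_. borel :: real measure)"
  define V where "V \<omega> = (\<lambda>p\<in>?I. X (t (fst p)) \<omega> $ snd p)" for \<omega>
  have "(\<lambda>x :: real^'m. x $ i) \<in> borel_measurable borel" for i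
    by (intro borel_measurable_continuous_onI continuous_intros)
  then have V [measurable]: "V \<in> measurable P ?B"
    unfolding V_def[abs_def] by (intro measurable_restrict measurable_compose[OF X_measurable])
  define \<nu> where "\<nu> = distr P ?B V"
  have pr: "prob_space \<nu>" unfolding \<nu>_def by (rule prob_space_distr) measurable
  have sets_\<nu> [measurable_cong]: "sets \<nu> = sets ?B" by (simp add: \<nu>_def)
  have sumI: "(\<Sum>p\<in>?I. g p) = (\<Sum>j<n. \<Sum>i\<in>UNIV. g (j, i))" for g :: "_ \<Rightarrow> 'z::comm_monoid_add"
    using sum.cartesian_product[of "\<lambda>j i. g (j, i)" UNIV "{..<n}"] by (simp add: split_beta)
  define blk :: "(nat \<times> 'm \<Rightarrow> real) \<Rightarrow> nat \<Rightarrow> real^'m" where "blk w j = (\<chi> i. w (j, i))" for w j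
  define \<Psi> where "\<Psi> w = (\<integral>s. \<psi> (\<Sum>j<n. transpose (frac_kernel (t j) s) *v blk w j) \<partial>lborel)" for w
  have ch: "(\<integral>x. iexp (\<Sum>p\<in>?I. w p * x p) \<partial>\<nu>) = exp (\<Psi> w)" for w
  proof -
    have "(\<integral>x. iexp (\<Sum>p\<in>?I. w p * x p) \<partial>\<nu>) = (\<integral>\<omega>. iexp (\<Sum>p\<in>?I. w p * V \<omega> p) \<partial>P)"
      unfolding \<nu>_def by (rule integral_distr) measurable
    also have "\<dots> = (\<integral>\<omega>. iexp (\<Sum>j<n. X (t j) \<omega> \<bullet> blk w j) \<partial>P)"
      unfolding sumI by (simp add: V_def blk_def inner_vec_def mult.commute)
    finally show ?thesis unfolding \<Psi>_def using X_joint_char[of "{..<n}" t "blk w"] by simp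
  qed
  show "strictly_operator_stable_on ?I (distr P ?B (\<lambda>\<omega>. \<lambda>p\<in>?I. X (t (fst p)) \<omega> $ snd p))"
    unfolding V_def[symmetric] \<nu>_def[symmetric] strictly_operator_stable_on_def
  proof (intro conjI pr sets_\<nu> allI impI)
    fix m :: nat assume m: "0 < m"
    \<comment> \<open>The block-diagonal matrix with every block equal to \<open>R\<close>; the
      first component of an index names the block.\<close>
    define Bl where "Bl R p p' = (if fst p = fst p' then R $ snd p $ snd p' else 0)" for R :: "real^'m^'m" and p p' :: "nat \<times> 'm"
    have mv: "mat_vec_on ?I (Bl R) x = (\<lambda>p\<in>?I. (R *v blk x (fst p)) $ snd p)" for R x
    proof -
      have "(\<Sum>p'\<in>?I. Bl R p p' * x p') = (R *v blk x (fst p)) $ snd p" if "p \<in> ?I" for p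
      proof -
        have "(\<Sum>p'\<in>?I. Bl R p p' * x p') = (\<Sum>j<n. if j = fst p then (\<Sum>i\<in>UNIV. R $ snd p $ i * x (j, i)) else 0)"
          unfolding sumI by (intro sum.cong refl) (auto simp: Bl_def)
        also have "\<dots> = (R *v blk x (fst p)) $ snd p"
          using that by (auto simp: blk_def matrix_vector_mult_def)
        finally show ?thesis .
      qed
      then show ?thesis unfolding mat_vec_on_def by (auto simp: restrict_def fun_eq_iff)
    qed
    have blk_mv: "blk (mat_vec_on ?I (Bl R) x) j = R *v blk x j" if "j < n" for R x j
      using that by (simp add: mv vec_eq_iff) (simp add: blk_def)
    \<comment> \<open>Membership in the extensional function space is what makes the identity hold
      outside the index set as well.\<close>
    have inv: "mat_vec_on ?I (Bl R) (mat_vec_on ?I (Bl R') x) = x"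
      if "R ** R' = mat 1" and x: "x \<in> ?I \<rightarrow>\<^sub>E UNIV" for R R' x
    proof
      fix p
      show "mat_vec_on ?I (Bl R) (mat_vec_on ?I (Bl R') x) p = x p"
      proof (cases "p \<in> ?I")
        case True
        then have "fst p < n" by auto
        have "mat_vec_on ?I (Bl R) (mat_vec_on ?I (Bl R') x) p = (R *v (R' *v blk x (fst p))) $ snd p"
          using True unfolding mv[of R] by (simp add: blk_mv[OF \<open>fst p < n\<close>])
        also have "\<dots> = x p" unfolding matrix_vector_mul_assoc that(1) matrix_vector_mul_lid blk_def by simp
        finally show ?thesis .
      next
        case False
        then show ?thesis unfolding PiE_arb[OF x False] by (simp only: mat_vec_on_def restrict_apply if_False)
      qed
    qed
    have ext: "mat_vec_on ?I (Bl R) x \<in> ?I \<rightarrow>\<^sub>E UNIV" for R x by (auto simp: mat_vec_on_def)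
    let ?R = "(1 / real m) powm B" and ?R' = "real m powm B"
    have RR: "?R ** ?R' = mat 1" "?R' ** ?R = mat 1"
      using powm_inverse[of "real m" B] powm_inverse[of "1 / real m" B] m by simp_all
    have invertible: "invertible_on ?I (Bl ?R)"
      unfolding invertible_on_def
      using inv[OF RR(1)] inv[OF RR(2)] ext
      by (intro bij_betw_byWitness[where f'="mat_vec_on ?I (Bl ?R')"] ballI image_subsetI)
    let ?P = "Pi\<^sub>M {..<m} (\<lambda>_. \<nu>)"
    let ?S = "\<lambda>x. mat_vec_on ?I (Bl ?R) (\<lambda>i. \<Sum>k<m. x k i)"
    interpret nu: prob_space \<nu> by (rule pr)
    interpret PP: prob_space ?P by (rule prob_space_PiM) (rule pr)
    interpret pp: product_prob_space "\<lambda>_::nat. \<nu>" "{..<m}" by unfold_locales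
    have comp: "(\<lambda>x. x k i) \<in> borel_measurable ?P" if "k \<in> {..<m}" "i \<in> ?I" for k i
    proof -
      have "(\<lambda>x. x k) \<in> measurable ?P ?B"
        using measurable_component_singleton[OF that(1), of "\<lambda>_. \<nu>"] sets_\<nu> by (simp cong: measurable_cong_sets)
      from measurable_compose[OF this measurable_component_singleton[OF that(2)]] show ?thesis .
    qed
    have S: "?S \<in> measurable ?P ?B"
      unfolding mat_vec_on_def
      by (intro measurable_restrict borel_measurable_sum borel_measurable_times borel_measurable_const comp)
    have "distr ?P ?B ?S = \<nu>"
    proof (rule PiM_measure_eqI_char)
      show "prob_space (distr ?P ?B ?S)" by (rule PP.prob_space_distr[OF S])
      fix u :: "nat \<times> 'm \<Rightarrow> real"
      define w where "w = mat_vec_on ?I (Bl (transpose ?R)) u"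
      have adj: "(\<Sum>p\<in>?I. u p * mat_vec_on ?I (Bl ?R) x p) = (\<Sum>p\<in>?I. w p * x p)" for x
      proof -
        have "(\<Sum>p\<in>?I. u p * mat_vec_on ?I (Bl ?R) x p) = (\<Sum>p\<in>?I. \<Sum>p'\<in>?I. u p * (Bl ?R p p' * x p'))"
          by (intro sum.cong refl) (simp add: mat_vec_on_def sum_distrib_left)
        also have "\<dots> = (\<Sum>p'\<in>?I. \<Sum>p\<in>?I. u p * (Bl ?R p p' * x p'))" by (rule sum.swap)
        also have "\<dots> = (\<Sum>p'\<in>?I. w p' * x p')"
          unfolding w_def mat_vec_on_def
        proof (intro sum.cong refl)
          fix p' assume p': "p' \<in> ?I"
          have "Bl (transpose ?R) p' p = Bl ?R p p'" for p
            by (simp add: Bl_def transpose_def)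
          then show "(\<Sum>p\<in>?I. u p * (Bl ?R p p' * x p')) = (\<lambda>i\<in>?I. \<Sum>j\<in>?I. Bl (transpose ?R) i j * u j) p' * x p'"
            using p' by (simp only: restrict_apply if_True sum_distrib_right) (simp only: mult_ac)
        qed
        finally show ?thesis .
      qed
      have "(\<integral>x. iexp (\<Sum>p\<in>?I. u p * x p) \<partial>distr ?P ?B ?S) = (\<integral>x. iexp (\<Sum>p\<in>?I. u p * ?S x p) \<partial>?P)"
        by (rule integral_distr[OF S]) measurable
      also have "\<dots> = (\<integral>x. (\<Prod>k<m. iexp (\<Sum>p\<in>?I. w p * x k p)) \<partial>?P)"
      proof (intro Bochner_Integration.integral_cong refl)
        fix x :: "nat \<Rightarrow> nat \<times> 'm \<Rightarrow> real"
        have "(\<Sum>p\<in>?I. u p * ?S x p) = (\<Sum>k<m. \<Sum>p\<in>?I. w p * x k p)"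
          unfolding adj sum_distrib_left by (rule sum.swap)
        then show "iexp (\<Sum>p\<in>?I. u p * ?S x p) = (\<Prod>k<m. iexp (\<Sum>p\<in>?I. w p * x k p))"
          by (simp only: of_real_sum sum_distrib_left exp_sum[OF finite_lessThan])
      qed
      also have "\<dots> = (\<Prod>k<m. \<integral>x. iexp (\<Sum>p\<in>?I. w p * x p) \<partial>\<nu>)"
      proof (rule pp.product_integral_prod)
        show "integrable \<nu> (\<lambda>x. iexp (\<Sum>p\<in>?I. w p * x p))"
        proof (rule nu.integrable_const_bound[where B=1])
          have "(\<lambda>x. \<Sum>p\<in>?I. w p * x p) \<in> borel_measurable \<nu>" by measurable
          then show "(\<lambda>x. iexp (\<Sum>p\<in>?I. w p * x p)) \<in> borel_measurable \<nu>" by measurable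
        qed simp
      qed simp
      also have "\<dots> = exp (\<Psi> w) ^ m" by (simp only: ch) simp
      also have "\<Psi> w = (\<integral>s. \<psi> (\<Sum>j<n. transpose (frac_kernel (t j) s) *v ((1 / real m) powm transpose B *v blk u j)) \<partial>lborel)"
        unfolding \<Psi>_def w_def by (simp add: blk_mv transpose_powm)
      also have "\<dots> = of_real (1 / real m) * \<Psi> u"
        unfolding \<Psi>_def by (rule joint_exponent_scale) (use m in simp)
      also have "exp \<dots> ^ m = exp (\<Psi> u)" using m by (simp add: exp_of_nat_mult[symmetric])
      finally show "(\<integral>x. iexp (\<Sum>p\<in>?I. u p * x p) \<partial>distr ?P ?B ?S) = (\<integral>x. iexp (\<Sum>p\<in>?I. u p * x p) \<partial>\<nu>)"
        by (simp only: ch)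
    qed (use pr sets_\<nu> in auto)
    with invertible show "\<exists>A. invertible_on ?I A \<and> distr ?P ?B (\<lambda>x. mat_vec_on ?I A (\<lambda>i. \<Sum>k<m. x k i)) = \<nu>"
      by blast
  qed
qed

end

end

theorem proposition4p3:
  fixes \<mu> :: "(real^'m) measure"
    and P :: "'w measure"
    and M :: "(real^'d) set \<Rightarrow> 'w \<Rightarrow> real^'m"
    and B D :: "real^'m^'m"
    and E :: "real^'d^'d"
    and N :: "real^'d \<Rightarrow> real"
    and \<phi> :: "real^'d \<Rightarrow> real"
    and \<beta> q :: real
    and X :: "real^'d \<Rightarrow> 'w \<Rightarrow> real^'m"
  assumes "full_distribution \<mu>"
    and "strictly_operator_stable_exp \<mu> B"
    and "indep_scattered_random_measure P \<mu> lborel M"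
    and "D \<in> Q_mat"
    and "E \<in> Q_mat"
    and "q = trace E"
    and "polar_norm E N"
    and "continuous_on UNIV \<phi>"
    and "homogeneous_fun E \<phi>"
    and "\<beta> > 0"
    and "admissible_fun \<beta> E N \<phi>"
    and "min_re_eig (D - q *\<^sub>R B) + min_re_eig (q *\<^sub>R B) > 0"
    and "max_re_eig (D - q *\<^sub>R B) + max_re_eig (q *\<^sub>R B) < \<beta>"
    and "\<And>t. X t \<in> borel_measurable P"
    and "\<And>t. AE \<omega> in P. X t \<omega> =
           stoch_integral P lborel M
             (\<lambda>s. \<phi> (t - s) powm (D - q *\<^sub>R B) - \<phi> (- s) powm (D - q *\<^sub>R B)) \<omega>"
  shows "(D ** B = B ** D \<longrightarrow>
            operator_self_similar P E D X \<and>
            strictly_operator_stable_field P X \<and> field_exponent P X B) \<and>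
         (stochastically_continuous P X \<and> stationary_increments P X) \<and>
         (invertible (D - q *\<^sub>R B) \<longrightarrow> full_field P X)"
proof -
  interpret st: full_strictly_operator_stable \<mu> B
    by unfold_locales (use assms in auto)
  interpret hf: homogeneous_field E N \<phi> \<beta>
    by unfold_locales (use assms in \<open>auto simp: Q_mat_def\<close>)
  have q: "q > 0" using hf.q_pos assms(6) by simp
  define G where "G = q *\<^sub>R B"
  define A where "A = D - q *\<^sub>R B"
  have G0: "min_re_eig G > 0" unfolding G_def by (rule st.min_re_eig_pos[OF q])
  have lo: "min_re_eig A + min_re_eig G > 0" and hi: "max_re_eig A + max_re_eig G < \<beta>"
    using assms(12,13) by (simp_all add: A_def G_def)
  \<comment> \<open>The midpoint between \<open>max 0 (- min_re_eig A)\<close> and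
    \<open>min_re_eig G\<close>; by \<open>G0\<close> and \<open>lo\<close> the first number is the
    smaller one.\<close>
  define \<omega>1 where "\<omega>1 = (max 0 (- min_re_eig A) + min_re_eig G) / 2"
  have \<omega>1: "0 < \<omega>1" "\<omega>1 < min_re_eig G" "- min_re_eig A < \<omega>1" using G0 lo by (auto simp: \<omega>1_def)
  \<comment> \<open>The midpoint between \<open>- \<omega>1\<close> and
    \<open>min (min_re_eig A) 0\<close>. The inequality \<open>- \<omega>1 < \<alpha>\<close> is
    integrability at the singularities for the power \<open>q / \<omega>1\<close>.\<close>
  define \<alpha> where "\<alpha> = (min (min_re_eig A) 0 - \<omega>1) / 2"
  have \<alpha>: "- \<omega>1 < \<alpha>" "\<alpha> < min_re_eig A" "\<alpha> < 0" using \<omega>1 by (auto simp: \<alpha>_def min_def)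
  \<comment> \<open>The slack in the second spectral hypothesis. One third of it goes to
    \<open>\<omega>2\<close>, one third to \<open>\<gamma>\<close>, and the last third keeps
    \<open>\<gamma> + \<omega>2 < \<beta>\<close> strict.\<close>
  define d where "d = \<beta> - max_re_eig A - max_re_eig G"
  define \<omega>2 where "\<omega>2 = max_re_eig G + d / 3"
  define \<gamma> where "\<gamma> = max_re_eig A + d / 3"
  have d: "d > 0" using hi by (simp add: d_def)
  have \<omega>2: "max_re_eig G < \<omega>2" "\<omega>1 < \<omega>2" using d \<omega>1 min_re_eig_le_max[of G] by (auto simp: \<omega>2_def)
  have \<gamma>: "max_re_eig A < \<gamma>" "\<gamma> - \<beta> < - \<omega>2" using d d_def unfolding \<gamma>_def \<omega>2_def by linarith+
  obtain K where K: "K > 0" "\<And>v. cmod (log_char \<mu> v) \<le> K * (norm v powr (q / \<omega>2) + norm v powr (q / \<omega>1))"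
    using scaling_power_bound[of "log_char \<mu>" q \<omega>1 G \<omega>2] st.\<psi>_props(1,2) q \<omega>1 \<omega>2 st.scale_q
    unfolding G_def by blast
  \<comment> \<open>The first inequality is tightest at \<open>\<omega>1\<close> and the second at
    \<open>\<omega>2\<close>, so each of the two powers \<open>q / \<omega>1\<close> and
    \<open>q / \<omega>2\<close> satisfies both.\<close>
  have exps: "- q < \<alpha> * (q / \<omega>)" "(\<gamma> - \<beta>) * (q / \<omega>) < - q" if "\<omega>1 \<le> \<omega>" "\<omega> \<le> \<omega>2" for \<omega>
  proof -
    have \<omega>: "\<omega> > 0" using that \<omega>1 by simp
    have "- \<omega> < \<alpha>" "\<gamma> - \<beta> < - \<omega>" using that \<alpha> \<gamma> by simp_all
    from mult_strict_right_mono[OF this(1) q] mult_strict_right_mono[OF this(2) q]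
    show "- q < \<alpha> * (q / \<omega>)" "(\<gamma> - \<beta>) * (q / \<omega>) < - q"
      using \<omega> by (simp_all add: pos_less_divide_eq pos_divide_less_eq mult.commute)
  qed
  have isr: "prob_space P" "\<And>A. A \<in> finite_measure_sets lborel \<Longrightarrow> M A \<in> borel_measurable P"
    using assms(3) by (auto simp: indep_scattered_random_measure_def)
  interpret fk: fractional_kernel E N \<phi> \<beta> "D - trace E *\<^sub>R B" \<alpha> \<gamma>
    by unfold_locales (use \<alpha> \<gamma> \<omega>1 \<omega>2 assms(6) in \<open>auto simp: A_def\<close>)
  interpret prob_space P by (rule isr)
  have M_char: "(\<integral>\<omega>. iexp (M C \<omega> \<bullet> u) \<partial>P) = exp (complex_of_real (measure lborel C) * log_char \<mu> u)"
    if C: "C \<in> finite_measure_sets lborel" for C u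
  proof -
    have "char_fun (distr P borel (M C)) u = exp (complex_of_real (measure lborel C) * log_char \<mu> u)"
      using assms(3) C by (simp add: indep_scattered_random_measure_def)
    moreover have "char_fun (distr P borel (M C)) u = (\<integral>\<omega>. iexp (M C \<omega> \<bullet> u) \<partial>P)"
      unfolding char_fun_def by (rule integral_distr[OF isr(2)[OF C]]) measurable
    ultimately show ?thesis by simp
  qed
  interpret rm: random_measure_bounded P lborel M "log_char \<mu>" K "q / \<omega>2" "q / \<omega>1"
  proof unfold_locales
    fix C :: "nat \<Rightarrow> (real^'d) set" assume C: "range C \<subseteq> finite_measure_sets lborel" "disjoint_family C"
    show "indep_vars (\<lambda>_. borel) (\<lambda>n. M (C n)) UNIV"
      using assms(3) C by (simp add: indep_scattered_random_measure_def)
    show "AE \<omega> in P. (\<lambda>n. M (C n) \<omega>) sums M (\<Union>n. C n) \<omega>" if "(\<Union>n. C n) \<in> finite_measure_sets lborel"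
      using assms(3) C that by (simp add: indep_scattered_random_measure_def)
  qed (use isr(2) M_char st.\<psi>_props(1,2) q \<omega>1 \<omega>2 K in \<open>auto intro: divide_pos_pos\<close>)
  have kernel_eq: "fk.frac_kernel t = (\<lambda>s. \<phi> (t - s) powm (D - q *\<^sub>R B) - \<phi> (- s) powm (D - q *\<^sub>R B))" for t
    by (simp add: fk.frac_kernel_def[abs_def] assms(6))
  interpret moving_average_field E N \<phi> \<beta> B D \<alpha> \<gamma> \<mu> P M K "q / \<omega>2" "q / \<omega>1" X
    by unfold_locales (use assms(14,15) exps[of \<omega>1] exps[of \<omega>2] \<omega>2 in \<open>auto simp: kernel_eq assms(6)\<close>)
  show ?thesis
    using X_operator_self_similar X_strictly_operator_stable X_field_exponent X_stochastically_continuous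
      X_stationary_increments X_full assms(6) by simp
qed


end
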